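(* Let $r=8$. There exists $\delta>0$ such that if $(\Omega_\tau)_{|\tau|\le1}$ is a normalized, dynamically isospectral $C^1$ one-parameter family of domains in $\mathcal S^r_\delta$, then for every parameterization $\gamma$ of the family, $n_\gamma(\tau,\xi)=0$ for all $(\tau,\xi)\in[-1,1]\times\mathbb T^1$.
   Context: For an integer $r\ge2$, $\mathcal D^r$ denotes the set of strictly convex bounded open planar domains with $C^{r+1}$ boundary oriented counterclockwise. A closed geodesic of $\Omega$ is a closed polygon inscribed in $\partial\Omega$ such that at each vertex the two sides meeting there make equal angles with the tangent line to $\partial\Omega$; its length is its perimeter. $\mathcal L(\Omega)=\mathbb N\cdot\{\text{lengths of closed geodesics}\}\cup\mathbb N\cdot\{|\partial\Omega|\}$. A $C^1$ one-parameter family of domains in $\mathcal M\subset\mathcal D^r$ is $(\Omega_\tau)_{|\tau|\le1}\subset\mathcal M$ with a parameterization $\gamma:[-1,1]\times\mathbb T^1\to\mathbb R^2$, continuously differentiable in $\tau$, with each $\gamma(\tau,\cdot)$ a $C^{r+1}$ diffeomorphism of $\mathbb T^1=\mathbb R/\mathbb Z$ onto $\partial\Omega_\tau$; it is dynamically isospectral if $\mathcal L(\Omega_\tau)$ is independent of $\tau$. $\mathcal S^r$ is the set of domains in $\mathcal D^r$ invariant under some reflection of the plane. A perimeter-$1$ domain with arc-length parameterization $\gamma$ is $\delta$-close to a circle if $\|\gamma-\gamma_{\mathbb D}\|_{C^{r+1}}\le\delta$ with $\gamma_{\mathbb D}$ the arc-length parameterization of a perimeter-$1$ disk tangent to $\partial\Omega$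 at $s=0$; in general a domain is $\delta$-close to a circle if its rescaling to perimeter $1$ is; $\mathcal S^r_\delta$ denotes those domains of $\mathcal S^r$ $\delta$-close to a circle. For $\Omega\in\mathcal S^r$ one fixes a symmetry axis, which meets $\partial\Omega$ in a marked point and an auxiliary point (chosen for $\Omega_0$ and continued by continuity along the family, with $\gamma(\tau,0)$ the marked point). The family is normalized if each marked point is the origin and each auxiliary point lies on the positive horizontal semi-axis. The infinitesimal deformation function is $n_\gamma(\tau,\xi)=\langle\partial_\tau\gamma(\tau,\xi),N_\gamma(\tau,\xi)\rangle$, where $N_\gamma(\tau,\xi)$ is the outward unit normal to $\partial\Omega_\tau$ at $\gamma(\tau,\xi)$. *)

theory Defs
  imports "HOL-Analysis.Analysis"
begin

text \<open>The plane is modelled as the complex numbers; the circle T^1 = R/Z is modelled by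
  1-periodic functions on the reals.\<close>

fun vderiv_iter :: "nat \<Rightarrow> (real \<Rightarrow> complex) \<Rightarrow> real \<Rightarrow> complex" where
  "vderiv_iter 0 f = f"
| "vderiv_iter (Suc n) f = (\<lambda>x. vector_derivative (vderiv_iter n f) (at x))"

definition Ck :: "nat \<Rightarrow> (real \<Rightarrow> complex) \<Rightarrow> bool" where
  "Ck k f \<longleftrightarrow> (\<forall>j<k. \<forall>x. vderiv_iter j f differentiable (at x))
              \<and> continuous_on UNIV (vderiv_iter k f)"

definition boundary_param :: "nat \<Rightarrow> complex set \<Rightarrow> (real \<Rightarrow> complex) \<Rightarrow> bool" where
  "boundary_param k \<Omega> g \<longleftrightarrow> Ck k g \<and> (\<forall>x. g (x + 1) = g x)
      \<and> (\<forall>x. vector_derivative g (at x) \<noteq> 0)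
      \<and> inj_on g {0..<1} \<and> g ` {0..1} = frontier \<Omega>"

definition strictly_convex_set :: "complex set \<Rightarrow> bool" where
  "strictly_convex_set \<Omega> \<longleftrightarrow> convex \<Omega> \<and>
     (\<forall>x\<in>closure \<Omega>. \<forall>y\<in>closure \<Omega>. x \<noteq> y \<longrightarrow> open_segment x y \<subseteq> \<Omega>)"

definition domain_D :: "nat \<Rightarrow> complex set \<Rightarrow> bool" where
  "domain_D r \<Omega> \<longleftrightarrow> open \<Omega> \<and> bounded \<Omega> \<and> strictly_convex_set \<Omega>
      \<and> (\<exists>g. boundary_param (r + 1) \<Omega> g)"

definition boundary_length :: "complex set \<Rightarrow> real" where
  "boundary_length \<Omega> = (SOME L. \<exists>g. boundary_param 1 \<Omega> g \<and>
       L = integral {0..1} (\<lambda>t. norm (vector_derivative g (at t))))"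

text \<open>Closed geodesic (periodic billiard orbit): vertices p i, period q, inscribed in the
  boundary, consecutive vertices distinct, and at every vertex the two sides make equal angles
  with the tangent line (reflection law).\<close>
definition closed_geodesic :: "complex set \<Rightarrow> nat \<Rightarrow> (nat \<Rightarrow> complex) \<Rightarrow> bool" where
  "closed_geodesic \<Omega> q p \<longleftrightarrow> q \<ge> 2 \<and> (\<forall>i. p (i + q) = p i)
     \<and> (\<forall>i. p i \<in> frontier \<Omega>) \<and> (\<forall>i. p (Suc i) \<noteq> p i)
     \<and> (\<exists>g. boundary_param 1 \<Omega> g \<and>
          (\<forall>i. \<exists>\<xi>. g \<xi> = p (Suc i) \<and>
             (let t = vector_derivative g (at \<xi>);
                  u = p i - p (Suc i); w = p (Suc (Suc i)) - p (Suc i)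
              in inner u t * norm w = - (inner w t * norm u))))"

definition geodesic_length :: "nat \<Rightarrow> (nat \<Rightarrow> complex) \<Rightarrow> real" where
  "geodesic_length q p = (\<Sum>i<q. dist (p i) (p (Suc i)))"

definition length_spectrum :: "complex set \<Rightarrow> real set" where
  "length_spectrum \<Omega> =
     {real k * l | k l. k \<ge> 1 \<and> (\<exists>q p. closed_geodesic \<Omega> q p \<and> l = geodesic_length q p)}
     \<union> {real k * boundary_length \<Omega> | k. k \<ge> 1}"

text \<open>Invariance under some reflection of the plane (reflection in the line through a
  with direction a square root of w).\<close>
definition reflection_symmetric :: "complex set \<Rightarrow> bool" where
  "reflection_symmetric \<Omega> \<longleftrightarrow>
     (\<exists>a w. norm w = 1 \<and> (\<lambda>z. a + w * cnj (z - a)) ` \<Omega> = \<Omega>)"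

text \<open>The perimeter-1 circle tangent to the curve g at s = 0, by arc length.\<close>
definition tangent_circle :: "(real \<Rightarrow> complex) \<Rightarrow> real \<Rightarrow> complex" where
  "tangent_circle g s = g 0 + (vector_derivative g (at 0) / (2 * of_real pi * \<i>))
                              * (exp (2 * of_real pi * \<i> * of_real s) - 1)"

text \<open>delta-close to a circle: after rescaling to perimeter 1 (forced by the 1-periodic
  arc-length parameterization), the C^(r+1) norm of g - gamma_D is at most delta.\<close>
definition delta_close :: "nat \<Rightarrow> real \<Rightarrow> complex set \<Rightarrow> bool" where
  "delta_close r \<delta> \<Omega> \<longleftrightarrow> (\<exists>c>0. \<exists>g.
      boundary_param (r + 1) ((\<lambda>z. of_real c * z) ` \<Omega>) g
      \<and> (\<forall>s. norm (vector_derivative g (at s)) = 1)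
      \<and> (\<forall>j\<le>r + 1. \<forall>s. norm (vderiv_iter j (\<lambda>s. g s - tangent_circle g s) s) \<le> \<delta>))"

definition S_delta :: "nat \<Rightarrow> real \<Rightarrow> complex set \<Rightarrow> bool" where
  "S_delta r \<delta> \<Omega> \<longleftrightarrow> domain_D r \<Omega> \<and> reflection_symmetric \<Omega> \<and> delta_close r \<delta> \<Omega>"

definition dtau :: "(real \<Rightarrow> real \<Rightarrow> complex) \<Rightarrow> real \<Rightarrow> real \<Rightarrow> complex" where
  "dtau \<gamma> \<tau> \<xi> = vector_derivative (\<lambda>t. \<gamma> t \<xi>) (at \<tau> within {-1..1})"

definition C1_family :: "nat \<Rightarrow> (real \<Rightarrow> complex set) \<Rightarrow> (real \<Rightarrow> real \<Rightarrow> complex) \<Rightarrow> bool" where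
  "C1_family r \<Omega> \<gamma> \<longleftrightarrow>
     (\<forall>\<tau>\<in>{-1..1}. domain_D r (\<Omega> \<tau>) \<and> boundary_param (r + 1) (\<Omega> \<tau>) (\<gamma> \<tau>))
     \<and> (\<forall>\<tau>\<in>{-1..1}. \<forall>\<xi>. ((\<lambda>t. \<gamma> t \<xi>) has_vector_derivative dtau \<gamma> \<tau> \<xi>) (at \<tau> within {-1..1}))
     \<and> continuous_on ({-1..1} \<times> UNIV) (\<lambda>(\<tau>, \<xi>). dtau \<gamma> \<tau> \<xi>)"

definition dyn_isospectral :: "(real \<Rightarrow> complex set) \<Rightarrow> bool" where
  "dyn_isospectral \<Omega> \<longleftrightarrow> (\<forall>\<tau>\<in>{-1..1}. length_spectrum (\<Omega> \<tau>) = length_spectrum (\<Omega> 0))"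

text \<open>Normalized: symmetry axis is the real axis, marked point gamma(tau,0) is the origin,
  auxiliary point on the positive real semi-axis.\<close>
definition normalized :: "(real \<Rightarrow> complex set) \<Rightarrow> (real \<Rightarrow> real \<Rightarrow> complex) \<Rightarrow> bool" where
  "normalized \<Omega> \<gamma> \<longleftrightarrow> (\<forall>\<tau>\<in>{-1..1}. cnj ` \<Omega> \<tau> = \<Omega> \<tau> \<and> \<gamma> \<tau> 0 = 0
       \<and> (\<exists>x>0. complex_of_real x \<in> frontier (\<Omega> \<tau>)))"

definition outward_normal :: "complex set \<Rightarrow> complex \<Rightarrow> complex" where
  "outward_normal \<Omega> p = (THE N. norm N = 1 \<and> (\<forall>z\<in>\<Omega>. inner (z - p) N < 0))"

definition deformation :: "(real \<Rightarrow> complex set) \<Rightarrow> (real \<Rightarrow> real \<Rightarrow> complex) \<Rightarrow> real \<Rightarrow> real \<Rightarrow> real" where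
  "deformation \<Omega> \<gamma> \<tau> \<xi> = inner (dtau \<gamma> \<tau> \<xi>) (outward_normal (\<Omega> \<tau>) (\<gamma> \<tau> \<xi>))"

end

theory Submission
  imports Defs
begin

text \<open>
  After scaling and reflection the boundary of a domain is a curve \<open>\<Gamma>\<close> parametrised by the angle of
  its normal, with radius of curvature close to 1. For each \<open>q\<close> the longest reflection-symmetric
  inscribed \<open>q\<close>-gon of winding number 1 is a billiard orbit, so its length \<open>L q\<close> lies in the length
  spectrum. A Sard argument shows that the spectrum has measure zero; since \<open>L q\<close> is Lipschitz in \<open>\<tau>\<close>,
  it is constant along an isospectral family, and \<open>q \<longlonglongrightarrow> \<infinity>\<close> gives equal boundary lengths.

  Let \<open>n\<close> be the difference of the support functions of two such domains. Convexity of the length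
  in the vertices bounds \<open>\<Sum>k. 2 * sin (\<phi> k) * n (\<theta> k)\<close> along the maximal \<open>q\<close>-orbit \<open>\<theta>\<close>, with
  reflection angles \<open>\<phi>\<close>, from above for one of the domains and from below for the other. In Lazutkin
  coordinates the orbit is equidistributed up to \<open>O(\<epsilon> / q^3)\<close>, so these sums are, up to small errors,
  Riemann sums of an even function \<open>u\<close> of mean zero, that is, the \<open>q\<close>-th cosine coefficient of \<open>u\<close> plus
  a fraction of \<open>A / q^2\<close>, where \<open>A = sup (j^2 * \<bar>c j\<bar>)\<close>. The functions \<open>u\<close> of the two domains differ
  quadratically in \<open>n\<close>. Hence \<open>A\<close> is at most a fixed fraction of itself and vanishes, the domains
  coincide, and the boundary does not move with \<open>\<tau>\<close>.
\<close>

subsection \<open>Riemann sums and cosine series\<close>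

text \<open>The \<open>q\<close>-th Riemann sum of \<open>u\<close> is \<open>c q\<close> plus the
  aliases \<open>c (2 q)\<close>, \<open>c (3 q)\<close>, ..., which amount to at most
  \<open>pi^2 / 6 - 1 < 3/4\<close> of \<open>A / q^2\<close>; the contraction closes if all other
  errors stay below \<open>1/8\<close> of \<open>A / q^2\<close>. With this decay the series of
  \<open>u\<close> cannot be differentiated termwise, so the displacement of the nodes is handled by
  summation by parts. Sine coefficients would be invisible, hence the symmetry. No orbit has
  \<open>q = 1\<close>; there the common marked point gives the value 0. Each maximal orbit yields
  only one inequality, and for functions belonging to different curves, so their difference must be
  small against \<open>A\<close> itself. It is bounded by products of norms of derivatives of
  \<open>n\<close>, which interpolation turns into sup of \<open>n\<close> times sup of its fifth
  derivative: the first factor is at most \<open>2 A\<close>, the second is small near the circle.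
  Five derivatives of the support function are three of the radius of curvature. In the measure-zero
  argument an orbit is fixed by two angles, so lengths must agree to third order; the trapezoidal
  rule with the slopes at both orbits provides this.\<close>

lemma sin_ge_half:
  fixes t :: real
  assumes "0 \<le> t" "t \<le> pi / 2"
  shows "t / 2 \<le> sin t"
proof -
  have "\<bar>sin t - (\<Sum>m<3. sin_coeff m * t ^ m)\<bar> \<le> inverse (fact 3) * \<bar>t\<bar> ^ 3"
    by (rule Maclaurin_sin_bound)
  moreover have "(\<Sum>m<3. sin_coeff m * t ^ m) = t"
    by (simp add: sin_coeff_def numeral_3_eq_3)
  ultimately have *: "t - t ^ 3 / 6 \<le> sin t"
    using assms by (simp add: fact_numeral abs_if split: if_splits)
  have "t \<le> 1.6" using assms pi_approx by simp
  then have "t * t \<le> 1.6 * 1.6" using assms(1) by (intro mult_mono) auto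
  then have "t * (t * t) \<le> t * 3" using assms(1) by (intro mult_left_mono) auto
  then show ?thesis using * by (simp add: power3_eq_cube)
qed

lemma summable_inverse_square: "summable (\<lambda>j. 1 / (real j)\<^sup>2)"
  using inverse_power_summable[of 2, where 'a = real] by (simp add: inverse_eq_divide)

lemma inverse_square_tail:
  assumes "J \<ge> 1"
  shows "(\<Sum>j. 1 / (real (j + J))\<^sup>2) \<le> 2 / real J"
proof -
  let ?g = "\<lambda>j. - 2 / real (j + J)"
  have lim: "?g \<longlonglongrightarrow> 0"
    using LIMSEQ_ignore_initial_segment[OF tendsto_divide_0[OF tendsto_const filterlim_real_at_infinity_sequentially, of "-2"], of J]
    by (simp add: add.commute)
  have s: "(\<lambda>j. ?g (Suc j) - ?g j) sums (0 - ?g 0)"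
    by (rule telescope_sums[OF lim])
  \<comment> \<open>Telescoping majorant: for \<open>y \<ge> 1\<close> one has
    \<open>1 / y^2 \<le> 2 / (y * (y + 1))\<close>.\<close>
  have le: "1 / (real (j + J))\<^sup>2 \<le> ?g (Suc j) - ?g j" for j
  proof -
    define y where "y = real (j + J)"
    have y: "y \<ge> 1" using assms by (simp add: y_def)
    have "1 / y\<^sup>2 \<le> 2 / (y * (y + 1))"
      using y by (simp add: divide_simps power2_eq_square mult_left_mono)
    also have "\<dots> = 2 / y - 2 / (y + 1)" using y by (simp add: field_simps)
    finally show ?thesis by (simp add: y_def add.commute algebra_simps)
  qed
  have "(\<Sum>j. 1 / (real (j + J))\<^sup>2) \<le> (\<Sum>j. ?g (Suc j) - ?g j)"
    by (rule suminf_le[OF le]) (use s sums_summable summable_ignore_initial_segment[OF summable_inverse_square] in auto)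
  also have "\<dots> = 2 / real J" using s by (simp add: sums_iff)
  finally show ?thesis .
qed

lemma sum_inverse_square_le_2: "(\<Sum>r<n. 1 / (real r)\<^sup>2) \<le> 2"
proof -
  have "(\<Sum>r<n. 1 / (real r)\<^sup>2) \<le> (\<Sum>r<Suc n. 1 / (real r)\<^sup>2)" by simp
  \<comment> \<open>The term at \<open>r = 0\<close> is \<open>1 / 0 = 0\<close>.\<close>
  also have "\<dots> = (\<Sum>r<n. 1 / (real (Suc r))\<^sup>2)"
    by (subst sum.lessThan_Suc_shift) simp
  also have "\<dots> = (\<Sum>r<n. 1 / (real (r + 1))\<^sup>2)" by simp
  also have "\<dots> \<le> (\<Sum>r. 1 / (real (r + 1))\<^sup>2)"
    by (intro sum_le_suminf summable_ignore_initial_segment[OF summable_inverse_square]) auto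
  also have "\<dots> \<le> 2" using inverse_square_tail[of 1] by simp
  finally show ?thesis .
qed

text \<open>A square root in place of the logarithm suffices; it is the origin of the factor
  \<open>sqrt e\<close> in \<open>riemann_row\<close>.\<close>

lemma harmonic_le_sqrt: "(\<Sum>r<n. 1 / real (Suc r)) \<le> 2 * sqrt (real n)"
proof (induction n)
  case (Suc n)
  define y where "y = sqrt (real n + 1)"
  define x where "x = sqrt (real n)"
  have y: "y \<ge> 1" "y\<^sup>2 = real n + 1" by (simp_all add: y_def)
  have x: "0 \<le> x" "x \<le> y" "x\<^sup>2 = real n" by (simp_all add: x_def y_def)
  have e: "(y - x) * (y + x) = 1" using x y by (simp add: algebra_simps power2_eq_square)
  have "1 = (y - x) * (y + x)" using e by simp
  also have "\<dots> \<le> (y - x) * (2 * y)" using x by (intro mult_left_mono) auto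
  finally have "1 \<le> 2 * (y - x) * y" by (simp only: mult_ac)
  also have "\<dots> \<le> 2 * (y - x) * y\<^sup>2" using x y mult_left_mono[of 1 y y] by (intro mult_left_mono) (auto simp: power2_eq_square)
  finally have "1 / y\<^sup>2 \<le> 2 * y - 2 * x" using y by (simp add: field_simps)
  then have "1 / (real n + 1) \<le> 2 * y - 2 * x" using y by simp
  then show ?case using Suc by (simp add: x_def y_def add.commute)
qed simp

lemma sin_partial_sum:
  "2 * sin (y / 2) * (\<Sum>l<k. sin (real l * y)) = cos (y / 2) - cos ((real k - 1 / 2) * y)"
proof (induction k)
  case 0
  have "(0 - 1/2) * y = - (y / 2)" by simp
  then show ?case by (simp only: of_nat_0 cos_minus) simp
next
  case (Suc k)
  have "2 * sin (y / 2) * sin (real k * y) = cos (y / 2 - real k * y) - cos (y / 2 + real k * y)"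
    by (simp add: cos_add cos_diff)
  also have "cos (y / 2 - real k * y) = cos ((real k - 1/2) * y)"
    by (subst cos_minus[symmetric]) (simp add: algebra_simps)
  also have "y / 2 + real k * y = (real (Suc k) - 1/2) * y" by (simp add: algebra_simps)
  finally show ?case using Suc by (simp add: algebra_simps)
qed

lemma cos_partial_sum:
  "2 * sin (y / 2) * (\<Sum>l<k. cos (real l * y)) = sin (y / 2) + sin ((real k - 1 / 2) * y)"
proof (induction k)
  case 0
  have "(0 - 1/2) * y = - (y / 2)" by simp
  then show ?case by (simp only: of_nat_0 sin_minus) simp
next
  case (Suc k)
  have "2 * sin (y / 2) * cos (real k * y) = sin (y / 2 + real k * y) + sin (y / 2 - real k * y)"
    by (simp add: sin_add sin_diff)
  also have "sin (y / 2 - real k * y) = - sin ((real k - 1/2) * y)"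
    by (subst sin_minus[symmetric]) (simp add: algebra_simps)
  also have "y / 2 + real k * y = (real (Suc k) - 1/2) * y" by (simp add: algebra_simps)
  finally show ?case using Suc by (simp add: algebra_simps)
qed

text \<open>The distance from \<open>pi * j / q\<close> to the multiples of \<open>pi\<close> is
  \<open>pi * min r (q - r) / q\<close>, and \<open>sin_ge_half\<close> applies on whichever side of
  \<open>pi / 2\<close> the residue falls. The minimum is replaced by a sum of reciprocals so that
  it can be summed over residue classes.\<close>

lemma inverse_sin_le:
  fixes j q :: nat
  assumes "q \<ge> 1" "\<not> q dvd j"
  defines "r \<equiv> j mod q"
  shows "sin (pi * real j / real q) \<noteq> 0"
    and "1 / \<bar>sin (pi * real j / real q)\<bar> \<le> real q * (1 / real r + 1 / (real q - real r))"
proof -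
  have r: "0 < r" "r < q" using assms by (auto simp: r_def dvd_eq_mod_eq_0)
  have j: "j = (j div q) * q + r" by (simp add: r_def)
  have "pi * real j / real q = pi * real r / real q + real (j div q) * pi"
    by (subst j) (use assms(1) in \<open>simp add: field_simps del: div_mult_mod_eq\<close>)
  then have eq: "\<bar>sin (pi * real j / real q)\<bar> = \<bar>sin (pi * real r / real q)\<bar>"
    by (simp add: sin_add abs_mult)
  define m where "m = min (real r) (real q - real r)"
  have m: "m > 0" using r by (simp add: m_def)
  have key: "m / real q \<le> sin (pi * real r / real q)"
  proof (cases "2 * r \<le> q")
    case True
    have "pi * real r / real q / 2 \<le> sin (pi * real r / real q)"
      using True assms(1) by (intro sin_ge_half) (auto simp: field_simps)
    moreover have "m / real q \<le> pi * real r / real q / 2"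
    proof -
      have "m * 2 \<le> real r * pi" using pi_gt3 r unfolding m_def by (intro mult_mono) auto
      then show ?thesis using assms(1) by (simp add: field_simps)
    qed
    ultimately show ?thesis by simp
  next
    case False
    have "pi * (real q - real r) / real q / 2 \<le> sin (pi * (real q - real r) / real q)"
      using False assms(1) r by (intro sin_ge_half) (auto simp: field_simps)
    moreover have "sin (pi * (real q - real r) / real q) = sin (pi * real r / real q)"
    proof -
      have "pi * (real q - real r) / real q = pi - pi * real r / real q" using assms(1) by (simp add: field_simps)
      then show ?thesis by simp
    qed
    moreover have "m / real q \<le> pi * (real q - real r) / real q / 2"
    proof -
      have "m * 2 \<le> (real q - real r) * pi" using pi_gt3 r unfolding m_def by (intro mult_mono) auto
      then show ?thesis using assms(1) by (simp add: field_simps)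
    qed
    ultimately show ?thesis by simp
  qed
  have pos: "sin (pi * real r / real q) > 0" using less_le_trans[OF divide_pos_pos[OF m] key] assms(1) by simp
  then show "sin (pi * real j / real q) \<noteq> 0" using eq by auto
  have "1 / \<bar>sin (pi * real j / real q)\<bar> = 1 / sin (pi * real r / real q)"
    using eq pos by simp
  also have "\<dots> \<le> 1 / (m / real q)" using key m assms(1) pos by (intro divide_left_mono mult_pos_pos) auto
  also have "\<dots> = real q * (1 / m)" by simp
  also have "1 / m \<le> 1 / real r + 1 / (real q - real r)" using r by (auto simp: m_def min_def)
  finally show "1 / \<bar>sin (pi * real j / real q)\<bar> \<le> real q * (1 / real r + 1 / (real q - real r))"
    by (simp add: mult_left_mono)
qed

text \<open>Summation by parts against the partial sums of the sines, which are bounded by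
  \<open>1 / \<bar>sin (pi * j / q)\<bar>\<close>. The trivial bound is only \<open>e / q\<close>;
  weighted with \<open>1 / j\<close>, as it is later, it would sum to a logarithm. The gained factor
  decays away from the multiples of \<open>q\<close>. At the multiples of \<open>q\<close> the sines
  vanish.\<close>

lemma abel_sin_sum:
  fixes \<alpha> :: "nat \<Rightarrow> real" and q j :: nat
  assumes q: "q \<ge> 1" and a0: "\<alpha> 0 = 0" "\<alpha> q = 0"
    and da: "\<And>k. k < q \<Longrightarrow> \<bar>\<alpha> (Suc k) - \<alpha> k\<bar> \<le> e / real q ^ 3"
    and e: "e \<ge> 0"
  shows "\<bar>\<Sum>k<q. \<alpha> k * sin (2 * pi * real j * (real k / real q))\<bar>
           \<le> e / real q * (1 / real (j mod q) + 1 / (real q - real (j mod q)))"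
proof (cases "q dvd j")
  case True
  then obtain i where i: "j = q * i" by (elim dvdE)
  have "sin (2 * pi * real j * (real k / real q)) = 0" for k
  proof -
    have "2 * pi * real j * (real k / real q) = real (2 * i * k) * pi" using q by (simp add: i)
    then show ?thesis by (metis sin_npi)
  qed
  then show ?thesis using e q by simp
next
  case False
  define y where "y = 2 * pi * real j / real q"
  define E where "E k = (\<Sum>l<k. sin (real l * y))" for k
  define s where "s = \<bar>sin (pi * real j / real q)\<bar>"
  note isl = inverse_sin_le[OF q False]
  have s: "s > 0" using isl(1) by (simp add: s_def)
  have y2: "sin (y / 2) = sin (pi * real j / real q)" by (simp add: y_def)
  have E: "\<bar>E k\<bar> \<le> 1 / s" for k
  proof -
    have "\<bar>2 * sin (y / 2) * E k\<bar> \<le> 2"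
      unfolding E_def sin_partial_sum
      using cos_le_one[of "y/2"] cos_ge_minus_one[of "y/2"] cos_le_one[of "(real k - 1/2) * y"] cos_ge_minus_one[of "(real k - 1/2) * y"]
      by linarith
    then have "s * \<bar>E k\<bar> \<le> 1" by (simp add: abs_mult y2 s_def)
    then show ?thesis using s by (simp add: field_simps)
  qed
  have abel: "(\<Sum>k<n. \<alpha> k * sin (real k * y)) = \<alpha> n * E n - (\<Sum>k<n. E (Suc k) * (\<alpha> (Suc k) - \<alpha> k))" for n
    by (induction n) (auto simp: a0 E_def algebra_simps)
  have "(\<Sum>k<q. \<alpha> k * sin (2 * pi * real j * (real k / real q))) = (\<Sum>k<q. \<alpha> k * sin (real k * y))"
    by (simp add: y_def mult_ac)
  also have "\<dots> = - (\<Sum>k<q. E (Suc k) * (\<alpha> (Suc k) - \<alpha> k))" by (simp add: abel a0)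
  also have "\<bar>\<dots>\<bar> \<le> (\<Sum>k<q. \<bar>E (Suc k) * (\<alpha> (Suc k) - \<alpha> k)\<bar>)" by simp
  also have "\<dots> \<le> (\<Sum>k<q. (1 / s) * (e / real q ^ 3))"
    unfolding abs_mult by (intro sum_mono mult_mono E da) (use s in auto)
  also have "\<dots> = (1 / s) * (e / (real q)\<^sup>2)" using q by (simp add: power2_eq_square power3_eq_cube)
  also have "\<dots> \<le> (real q * (1 / real (j mod q) + 1 / (real q - real (j mod q)))) * (e / (real q)\<^sup>2)"
    using isl(2) e by (intro mult_right_mono) (auto simp: s_def)
  also have "\<dots> = e / real q * (1 / real (j mod q) + 1 / (real q - real (j mod q)))"
    using q by (simp add: power2_eq_square)
  finally show ?thesis .
qed

text \<open>Splitting \<open>j = i * q + r\<close>: for \<open>i \<ge> 1\<close> the factor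
  \<open>1 / j\<close> is at most \<open>1 / (i * q)\<close> and leaves a product of two harmonic
  sums; the block \<open>i = 0\<close>, where \<open>1 / j\<close> is large, is summed separately
  through squares.\<close>

lemma block_sum_bound:
  fixes q I :: nat
  assumes q: "q \<ge> 1" 
  shows "(\<Sum>j<I*q. 1 / real j * (1 / real (j mod q) + 1 / (real q - real (j mod q)))) \<le> 4 + 8 * sqrt (real I / real q)"
proof -
  define g where "g r = 1 / real r + 1 / (real q - real r)" for r
  have gs: "(\<Sum>r<q. g r) \<le> 4 * sqrt (real q)"
  proof -
    have "(\<Sum>r<q. 1 / real r) \<le> (\<Sum>r<Suc q. 1 / real r)" by simp
    also have "\<dots> = (\<Sum>r<q. 1 / real (Suc r))" by (subst sum.lessThan_Suc_shift) simp
    finally have 1: "(\<Sum>r<q. 1 / real r) \<le> 2 * sqrt (real q)" using harmonic_le_sqrt[of q] by simp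
    have "(\<Sum>r<q. 1 / (real q - real r)) = (\<Sum>r<q. 1 / real (Suc r))"
      by (rule sum.reindex_bij_witness[of _ "\<lambda>r. q - Suc r" "\<lambda>r. q - Suc r"]) (auto simp: of_nat_diff)
    then have 2: "(\<Sum>r<q. 1 / (real q - real r)) \<le> 2 * sqrt (real q)" using harmonic_le_sqrt[of q] by simp
    show ?thesis using 1 2 by (simp add: g_def sum.distrib)
  qed
  have g0: "(\<Sum>r<q. 1 / real r * g r) \<le> 4"
  proof -
    \<comment> \<open>From \<open>a * b \<le> (a^2 + b^2) / 2\<close>; the sums of squares are
      bounded independently of \<open>q\<close>.\<close>
    have "1 / real r * g r \<le> 3/2 * (1 / (real r)\<^sup>2) + 1/2 * (1 / (real q - real r)\<^sup>2)" for r
    proof -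
      define a b where "a = 1 / real r" and "b = 1 / (real q - real r)"
      have "a * (a + b) \<le> 3/2 * a\<^sup>2 + 1/2 * b\<^sup>2"
        using sum_squares_ge_zero[of "a - b" 0] by (simp add: algebra_simps power2_eq_square)
      then show ?thesis by (simp add: a_def b_def g_def power_divide)
    qed
    then have "(\<Sum>r<q. 1 / real r * g r) \<le> (\<Sum>r<q. 3/2 * (1 / (real r)\<^sup>2) + 1/2 * (1 / (real q - real r)\<^sup>2))"
      by (intro sum_mono)
    also have "\<dots> = 3/2 * (\<Sum>r<q. 1 / (real r)\<^sup>2) + 1/2 * (\<Sum>r<q. 1 / (real q - real r)\<^sup>2)"
      by (simp add: sum.distrib sum_distrib_left)
    also have "(\<Sum>r<q. 1 / (real q - real r)\<^sup>2) = (\<Sum>r<q. 1 / (real (Suc r))\<^sup>2)"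
      by (rule sum.reindex_bij_witness[of _ "\<lambda>r. q - Suc r" "\<lambda>r. q - Suc r"]) (auto simp: of_nat_diff)
    also have "\<dots> = (\<Sum>r<Suc q. 1 / (real r)\<^sup>2)" by (subst sum.lessThan_Suc_shift) simp
    finally show ?thesis using sum_inverse_square_le_2[of q] sum_inverse_square_le_2[of "Suc q"] by linarith
  qed
  have g_nn: "r < q \<Longrightarrow> g r \<ge> 0" for r by (simp add: g_def)
  have blk: "(\<Sum>j\<in>{i*q..<i*q+q}. 1 / real j * g (j mod q)) = (\<Sum>r<q. 1 / real (i * q + r) * g r)" for i
  proof -
    have "(\<Sum>j\<in>{i*q..<i*q+q}. 1 / real j * g (j mod q)) = (\<Sum>r\<in>{0..<q}. 1 / real (r + i * q) * g ((r + i*q) mod q))"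
      by (subst sum.shift_bounds_nat_ivl[symmetric]) (simp add: add.commute)
    then show ?thesis by (simp add: atLeast0LessThan add.commute)
  qed
  have blk1: "(\<Sum>r<q. 1 / real (Suc i * q + r) * g r) \<le> 4 * sqrt (real q) / real q * (1 / real (Suc i))" for i
  proof -
    have "(\<Sum>r<q. 1 / real (Suc i * q + r) * g r) \<le> (\<Sum>r<q. 1 / real (Suc i * q) * g r)"
      using q g_nn by (intro sum_mono mult_right_mono divide_left_mono) (auto intro!: mult_pos_pos add_pos_nonneg)
    also have "\<dots> = 1 / real (Suc i * q) * (\<Sum>r<q. g r)" by (simp add: sum_distrib_left)
    also have "\<dots> \<le> 1 / real (Suc i * q) * (4 * sqrt (real q))" by (intro mult_left_mono gs) auto
    finally show ?thesis by (simp add: field_simps)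
  qed
  have "(\<Sum>j<I*q. 1 / real j * g (j mod q)) = (\<Sum>i<I. \<Sum>r<q. 1 / real (i * q + r) * g r)"
    unfolding sum.nat_group[symmetric] blk ..
  also have "\<dots> \<le> (\<Sum>i<Suc I. \<Sum>r<q. 1 / real (i * q + r) * g r)"
    by (simp, intro sum_nonneg divide_nonneg_nonneg g_nn) auto
  also have "\<dots> = (\<Sum>r<q. 1 / real r * g r) + (\<Sum>i<I. \<Sum>r<q. 1 / real (Suc i * q + r) * g r)"
    by (subst sum.lessThan_Suc_shift) simp
  also have "\<dots> \<le> 4 + (\<Sum>i<I. 4 * sqrt (real q) / real q * (1 / real (Suc i)))"
    by (intro add_mono g0 sum_mono blk1)
  also have "\<dots> = 4 + 4 * sqrt (real q) / real q * (\<Sum>i<I. 1 / real (Suc i))" by (simp add: sum_distrib_left)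
  also have "\<dots> \<le> 4 + 4 * sqrt (real q) / real q * (2 * sqrt (real I))"
    by (intro add_left_mono mult_left_mono harmonic_le_sqrt) auto
  also have "\<dots> = 4 + 8 * sqrt (real I / real q)"
    using q by (simp add: real_sqrt_divide field_simps)
  finally show ?thesis by (simp add: g_def)
qed

text \<open>Coefficient bounds of the form \<open>A / (real j)\<^sup>2\<close> are read with
  \<open>1 / 0 = 0\<close>, so they contain \<open>c 0 = 0\<close>, that is, mean zero.\<close>

definition cosum :: "(nat \<Rightarrow> real) \<Rightarrow> real \<Rightarrow> real" where
  "cosum c x = (\<Sum>j. c j * cos (2 * pi * real j * x))"

lemma cosum_summable:
  assumes "\<And>j. \<bar>c j\<bar> \<le> A / (real j)\<^sup>2" and "\<And>j. \<bar>d j\<bar> \<le> B"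
  shows "summable (\<lambda>j. c j * d j)"
proof (rule summable_comparison_test')
  show "summable (\<lambda>j. A * B * (1 / (real j)\<^sup>2))" by (intro summable_mult summable_inverse_square)
  show "norm (c j * d j) \<le> A * B * (1 / (real j)\<^sup>2)" if "j \<ge> 0" for j
  proof -
    have "\<bar>c j\<bar> * \<bar>d j\<bar> \<le> A / (real j)\<^sup>2 * B"
      using assms(1)[of j] assms(2)[of j] by (intro mult_mono) linarith+
    then show ?thesis by (simp add: abs_mult mult_ac)
  qed
qed

lemma cosum_sums:
  assumes "\<And>j. \<bar>c j\<bar> \<le> A / (real j)\<^sup>2"
  shows "(\<lambda>j. c j * cos (2 * pi * real j * x)) sums cosum c x"
  unfolding cosum_def by (rule summable_sums, rule cosum_summable[where B = 1]) (use assms in auto)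

text \<open>Below the cutoff \<open>J\<close> the factors \<open>d j\<close> are kept individually,
  above it only their common bound is used.\<close>

lemma abs_suminf_mult_le:
  assumes c: "\<And>j. \<bar>c j\<bar> \<le> A / (real j)\<^sup>2" and d: "\<And>j. \<bar>d j\<bar> \<le> B" and J: "J \<ge> 1"
    and A: "A \<ge> 0"
  shows "\<bar>\<Sum>j. c j * d j\<bar> \<le> (\<Sum>j<J. A / (real j)\<^sup>2 * \<bar>d j\<bar>) + 2 * A * B / real J"
proof -
  have sm: "summable (\<lambda>j. c j * d j)" by (rule cosum_summable[OF c d])
  have B: "B \<ge> 0" using d[of 0] by simp
  have "(\<Sum>j. c j * d j) = (\<Sum>j. c (j + J) * d (j + J)) + (\<Sum>j<J. c j * d j)"
    by (rule suminf_split_initial_segment[OF sm])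
  moreover have "\<bar>\<Sum>j<J. c j * d j\<bar> \<le> (\<Sum>j<J. A / (real j)\<^sup>2 * \<bar>d j\<bar>)"
    by (rule order_trans[OF sum_abs]) (unfold abs_mult, intro sum_mono mult_right_mono c abs_ge_zero)
  moreover have "\<bar>\<Sum>j. c (j + J) * d (j + J)\<bar> \<le> 2 * A * B / real J"
  proof -
    have le: "norm (c (j + J) * d (j + J)) \<le> A * B * (1 / (real (j + J))\<^sup>2)" for j
    proof -
      have "\<bar>c (j + J)\<bar> * \<bar>d (j + J)\<bar> \<le> A / (real (j + J))\<^sup>2 * B"
        using c[of "j + J"] d[of "j + J"] A by (intro mult_mono) auto
      then show ?thesis by (simp add: abs_mult mult_ac)
    qed
    have sm2: "summable (\<lambda>j. A * B * (1 / (real (j + J))\<^sup>2))"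
      by (intro summable_mult summable_ignore_initial_segment[OF summable_inverse_square])
    have "\<bar>\<Sum>j. c (j + J) * d (j + J)\<bar> \<le> (\<Sum>j. A * B * (1 / (real (j + J))\<^sup>2))"
      using norm_suminf_le[OF le sm2] by simp
    also have "\<dots> = A * B * (\<Sum>j. 1 / (real (j + J))\<^sup>2)"
      by (rule suminf_mult[OF summable_ignore_initial_segment[OF summable_inverse_square]])
    also have "\<dots> \<le> A * B * (2 / real J)" using A B by (intro mult_left_mono inverse_square_tail J) auto
    finally show ?thesis by (simp add: mult_ac)
  qed
  ultimately show ?thesis by linarith
qed

lemma cosum_le:
  assumes c: "\<And>j. \<bar>c j\<bar> \<le> A / (real j)\<^sup>2" and A: "A \<ge> 0"
  shows "\<bar>cosum c x\<bar> \<le> 2 * A"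
  using abs_suminf_mult_le[OF c, of "\<lambda>j. cos (2 * pi * real j * x)" 1 1] A
  by (simp add: cosum_def)

lemma cos_taylor1: "\<bar>cos (y + h) - cos y + h * sin y\<bar> \<le> h\<^sup>2" for y h :: real
proof -
  have "\<bar>1 - cos h\<bar> \<le> h\<^sup>2 / 2"
  proof -
    have "1 - cos h = 2 * (sin (h / 2))\<^sup>2" using cos_double_sin[of "h/2"] by simp
    also have "\<dots> \<le> 2 * (h / 2)\<^sup>2" using abs_sin_x_le_abs_x[of "h/2"] by (simp only: abs_le_square_iff)
    finally show ?thesis using cos_le_one[of h] by (simp add: power2_eq_square)
  qed
  moreover have "\<bar>sin h - h\<bar> \<le> h\<^sup>2 / 2"
    using Maclaurin_sin_bound[of h 2] by (simp add: sin_coeff_def numeral_2_eq_2)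
  moreover have "\<bar>- cos y * (1 - cos h)\<bar> \<le> 1 * \<bar>1 - cos h\<bar>" unfolding abs_mult by (intro mult_right_mono) auto
  moreover have "\<bar>sin y * (sin h - h)\<bar> \<le> 1 * \<bar>sin h - h\<bar>" unfolding abs_mult by (intro mult_right_mono) auto
  moreover have "\<bar>cos (y + h) - cos y + h * sin y\<bar> \<le> \<bar>- cos y * (1 - cos h)\<bar> + \<bar>sin y * (sin h - h)\<bar>"
    using abs_triangle_ineq4[of "- cos y * (1 - cos h)" "sin y * (sin h - h)"]
    by (simp add: cos_add algebra_simps)
  ultimately show ?thesis by linarith
qed

text \<open>For each frequency \<open>j\<close> the shift of the nodes acts to first order through
  \<open>abel_sin_sum\<close> and to second order by at most \<open>(2 * pi * j * e / q^2)^2\<close>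
  per term; high frequencies are bounded trivially. The weights \<open>w\<close> cost only
  \<open>e / q^2\<close> times the sup of the series.\<close>

lemma riemann_row:
  fixes q :: nat and x w :: "nat \<Rightarrow> real"
  assumes c: "\<And>j. \<bar>c j\<bar> \<le> A / (real j)\<^sup>2" and q: "q \<ge> 1" and e: "0 < e" "e \<le> 1"
    and x0: "x 0 = 0" "x q = 1"
    and dx: "\<And>k. k < q \<Longrightarrow> \<bar>x (Suc k) - x k - 1 / real q\<bar> \<le> e / real q ^ 3"
    and w: "\<And>k. k < q \<Longrightarrow> \<bar>w k - 1\<bar> \<le> e / (real q)\<^sup>2"
  shows "\<bar>(\<Sum>k<q. w k * cosum c (x k)) / real q - (\<Sum>k<q. cosum c (real k / real q)) / real q\<bar>
           \<le> 200 * sqrt e * A / (real q)\<^sup>2"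
proof -
  have A: "A \<ge> 0" using c[of 1] by simp
  define al where "al k = x k - real k / real q" for k
  have al0: "al 0 = 0" "al q = 0" using x0 q by (auto simp: al_def)
  have dal: "\<bar>al (Suc k) - al k\<bar> \<le> e / real q ^ 3" if "k < q" for k
    using dx[OF that] by (simp add: al_def add_divide_distrib algebra_simps)
  have al_le: "\<bar>al k\<bar> \<le> e / (real q)\<^sup>2" if "k \<le> q" for k
  proof -
    have "\<bar>al k\<bar> \<le> real k * (e / real q ^ 3)" using that
    proof (induction k)
      case (Suc k)
      then show ?case using dal[of k] by (simp add: algebra_simps add_divide_distrib)
    qed (simp add: al0)
    also have "\<dots> \<le> real q * (e / real q ^ 3)" using that e by (intro mult_right_mono) auto
    also have "\<dots> = e / (real q)\<^sup>2" using q by (simp add: power2_eq_square power3_eq_cube)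
    finally show ?thesis .
  qed
  define d where "d j = (\<Sum>k<q. cos (2 * pi * real j * x k) - cos (2 * pi * real j * (real k / real q))) / real q" for j
  define g where "g j = 1 / real (j mod q) + 1 / (real q - real (j mod q))" for j
  have d2: "\<bar>d j\<bar> \<le> 2" for j
  proof -
    have "\<bar>\<Sum>k<q. cos (2 * pi * real j * x k) - cos (2 * pi * real j * (real k / real q))\<bar> \<le> (\<Sum>k<q. 2)"
      by (rule order_trans[OF sum_abs], intro sum_mono)
         (smt (verit) cos_le_one cos_ge_minus_one)
    then show ?thesis using q by (simp add: d_def field_simps)
  qed
  have dj: "\<bar>d j\<bar> \<le> 2 * pi * real j * (e / (real q)\<^sup>2 * g j) + (2 * pi * real j)\<^sup>2 * (e\<^sup>2 / real q ^ 4)" for j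
  proof -
    define W where "W = 2 * pi * real j"
    have W: "W \<ge> 0" by (simp add: W_def)
    let ?y = "\<lambda>k. W * (real k / real q)"
    have eq: "cos (W * x k) - cos (?y k) = - W * (al k * sin (?y k)) + (cos (?y k + W * al k) - cos (?y k) + W * al k * sin (?y k))" for k
      by (simp add: al_def algebra_simps)
    have "(\<Sum>k<q. cos (W * x k) - cos (?y k)) = - W * (\<Sum>k<q. al k * sin (?y k))
            + (\<Sum>k<q. cos (?y k + W * al k) - cos (?y k) + W * al k * sin (?y k))"
      unfolding eq by (simp only: sum.distrib sum_distrib_left)
    moreover have "\<bar>W * (\<Sum>k<q. al k * sin (?y k))\<bar> \<le> W * (e / real q * g j)"
    proof -
      have "\<bar>\<Sum>k<q. al k * sin (?y k)\<bar> \<le> e / real q * g j"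
        using abel_sin_sum[OF q al0 dal, of j] e unfolding g_def W_def by simp
      then show ?thesis unfolding abs_mult using W by (simp only: abs_of_nonneg mult_left_mono)
    qed
    moreover have "\<bar>\<Sum>k<q. cos (?y k + W * al k) - cos (?y k) + W * al k * sin (?y k)\<bar> \<le> (\<Sum>k<q. W\<^sup>2 * (e / (real q)\<^sup>2)\<^sup>2)"
    proof (rule order_trans[OF sum_abs], intro sum_mono)
      fix k assume "k \<in> {..<q}"
      then have "\<bar>al k\<bar>\<^sup>2 \<le> (e / (real q)\<^sup>2)\<^sup>2" by (intro power_mono al_le) auto
      then have "(W * al k)\<^sup>2 \<le> W\<^sup>2 * (e / (real q)\<^sup>2)\<^sup>2" by (simp add: power_mult_distrib mult_left_mono)
      then show "\<bar>cos (?y k + W * al k) - cos (?y k) + W * al k * sin (?y k)\<bar> \<le> W\<^sup>2 * (e / (real q)\<^sup>2)\<^sup>2"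
        using cos_taylor1[of "?y k" "W * al k"] by linarith
    qed
    ultimately have "\<bar>\<Sum>k<q. cos (W * x k) - cos (?y k)\<bar> \<le> W * (e / real q * g j) + real q * (W\<^sup>2 * (e / (real q)\<^sup>2)\<^sup>2)"
      by (simp add: abs_le_iff)
    then have "\<bar>d j\<bar> \<le> (W * (e / real q * g j) + real q * (W\<^sup>2 * (e / (real q)\<^sup>2)\<^sup>2)) / real q"
      unfolding d_def W_def[symmetric] abs_divide by (simp add: divide_right_mono)
    also have "\<dots> = W * (e / (real q)\<^sup>2 * g j) + W\<^sup>2 * (e\<^sup>2 / real q ^ 4)"
      using q by (simp add: field_simps power2_eq_square power4_eq_xxxx)
    finally show ?thesis by (simp add: W_def)
  qed
  \<comment> \<open>The cutoff \<open>J = I * q\<close> is about \<open>q^2 / e\<close>: up to the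
    factor \<open>A\<close>, the second-order terms below it sum to about
    \<open>J * e^2 / q^4\<close> and the tail above it is about \<open>1 / J\<close>, both of order
    \<open>e / q^2\<close>.\<close>
  define I where "I = nat \<lceil>real q / e\<rceil>"
  have qe: "real q / e \<ge> 1" using q e by (simp add: field_simps)
  have I: "real I \<ge> real q / e" "real I \<le> 2 * real q / e" "I \<ge> 1"
    using qe unfolding I_def by linarith+
  define J where "J = I * q"
  have J: "J \<ge> 1" using I q by (simp add: J_def)
  have Jr: "real J \<ge> (real q)\<^sup>2 / e" "real J \<le> 2 * (real q)\<^sup>2 / e"
    using mult_right_mono[OF I(1), of "real q"] mult_right_mono[OF I(2), of "real q"]
    by (simp_all add: J_def power2_eq_square)
  have se: "sqrt e > 0" "sqrt e \<le> 1" "e \<le> sqrt e"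
  proof -
    show p: "sqrt e > 0" "sqrt e \<le> 1" using e by auto
    have "sqrt e * sqrt e \<le> sqrt e * 1" using p by (intro mult_left_mono) auto
    then show "e \<le> sqrt e" using e by simp
  qed
  have blk: "(\<Sum>j<J. 1 / real j * g j) \<le> 16 / sqrt e"
  proof -
    have "sqrt (real I / real q) \<le> sqrt (2 / e)"
      using I(2) q by (intro real_sqrt_le_mono) (simp add: field_simps)
    also have "\<dots> \<le> (3/2) / sqrt e"
    proof -
      have "sqrt 2 \<le> sqrt ((3/2)\<^sup>2)" by (intro real_sqrt_le_mono) (simp add: power2_eq_square)
      then have "sqrt 2 \<le> 3/2" by simp
      then have "sqrt 2 / sqrt e \<le> (3/2) / sqrt e" using se by (intro divide_right_mono) auto
      then show ?thesis by (simp add: real_sqrt_divide)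
    qed
    finally have "4 + 8 * sqrt (real I / real q) \<le> 4 + 12 / sqrt e" by simp
    also have "\<dots> \<le> 16 / sqrt e" using se by (simp add: field_simps)
    finally show ?thesis using block_sum_bound[OF q, of I] by (simp add: J_def g_def)
  qed
  have main: "\<bar>\<Sum>j. c j * d j\<bar> \<le> 190 * sqrt e * A / (real q)\<^sup>2"
  proof -
    have "\<bar>\<Sum>j. c j * d j\<bar> \<le> (\<Sum>j<J. A / (real j)\<^sup>2 * \<bar>d j\<bar>) + 2 * A * 2 / real J"
      by (rule abs_suminf_mult_le[OF c d2 J A])
    also have "(\<Sum>j<J. A / (real j)\<^sup>2 * \<bar>d j\<bar>) \<le> (\<Sum>j<J. (2 * pi * A * e / (real q)\<^sup>2) * (1 / real j * g j) + 4 * pi\<^sup>2 * A * e\<^sup>2 / real q ^ 4)"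
    proof (rule sum_mono)
      fix j
      show "A / (real j)\<^sup>2 * \<bar>d j\<bar> \<le> (2 * pi * A * e / (real q)\<^sup>2) * (1 / real j * g j) + 4 * pi\<^sup>2 * A * e\<^sup>2 / real q ^ 4"
      proof (cases "j = 0")
        case True then show ?thesis using A by simp
      next
        case False
        have "A / (real j)\<^sup>2 * \<bar>d j\<bar> \<le> A / (real j)\<^sup>2 * (2 * pi * real j * (e / (real q)\<^sup>2 * g j) + (2 * pi * real j)\<^sup>2 * (e\<^sup>2 / real q ^ 4))"
          using A by (intro mult_left_mono dj) auto
        also have "\<dots> = (2 * pi * A * e / (real q)\<^sup>2) * (1 / real j * g j) + 4 * pi\<^sup>2 * A * e\<^sup>2 / real q ^ 4"
          using False q by (simp add: field_simps power2_eq_square)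
        finally show ?thesis .
      qed
    qed
    also have "\<dots> = (2 * pi * A * e / (real q)\<^sup>2) * (\<Sum>j<J. 1 / real j * g j) + real J * (4 * pi\<^sup>2 * A * e\<^sup>2 / real q ^ 4)"
      by (simp add: sum.distrib sum_distrib_left)
    also have "(2 * pi * A * e / (real q)\<^sup>2) * (\<Sum>j<J. 1 / real j * g j) \<le> (2 * pi * A * e / (real q)\<^sup>2) * (16 / sqrt e)"
      using A e by (intro mult_left_mono blk) auto
    also have "\<dots> = (32 * pi) * (sqrt e * A / (real q)\<^sup>2)"
      proof -
      have "e / sqrt e = sqrt e" using e by (simp add: real_div_sqrt)
      moreover have "(2 * pi * A * e / (real q)\<^sup>2) * (16 / sqrt e) = (32 * pi) * ((e / sqrt e) * A / (real q)\<^sup>2)" by (simp add: mult_ac)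
      ultimately show ?thesis by simp
    qed
    also have "\<dots> \<le> 102 * (sqrt e * A / (real q)\<^sup>2)"
      using pi_approx A se by (intro mult_right_mono) auto
    also have "real J * (4 * pi\<^sup>2 * A * e\<^sup>2 / real q ^ 4) \<le> 2 * (real q)\<^sup>2 / e * (4 * pi\<^sup>2 * A * e\<^sup>2 / real q ^ 4)"
      using A by (intro mult_right_mono Jr) auto
    also have "\<dots> = (8 * pi\<^sup>2) * (e * A / (real q)\<^sup>2)"
      using e q by (simp add: field_simps power2_eq_square power4_eq_xxxx)
    also have "\<dots> \<le> 80 * (sqrt e * A / (real q)\<^sup>2)"
    proof (intro mult_mono divide_right_mono mult_right_mono)
      have "pi * pi \<le> 3.15 * 3.15" using pi_approx by (intro mult_mono) auto
      then show "8 * pi\<^sup>2 \<le> 80" by (simp add: power2_eq_square)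
    qed (use A e se in auto)
    also have "2 * A * 2 / real J \<le> 2 * A * 2 / ((real q)\<^sup>2 / e)"
      using A e q J by (intro divide_left_mono Jr) (auto intro!: mult_pos_pos)
    also have "\<dots> = 4 * (e * A / (real q)\<^sup>2)" by simp
    also have "\<dots> \<le> 4 * (sqrt e * A / (real q)\<^sup>2)"
      using A e se by (intro mult_left_mono divide_right_mono mult_right_mono) auto
    finally have "\<bar>\<Sum>j. c j * d j\<bar> \<le> 186 * (sqrt e * A / (real q)\<^sup>2)" by (simp add: mult_ac)
    also have "\<dots> \<le> 190 * (sqrt e * A / (real q)\<^sup>2)" using A se by (intro mult_right_mono) auto
    finally show ?thesis by simp
  qed
  have diff: "(\<Sum>k<q. cosum c (x k)) / real q - (\<Sum>k<q. cosum c (real k / real q)) / real q = (\<Sum>j. c j * d j)"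
  proof -
    have "(\<lambda>j. (\<Sum>k<q. c j * cos (2 * pi * real j * x k) - c j * cos (2 * pi * real j * (real k / real q))) / real q) sums
          ((\<Sum>k<q. cosum c (x k) - cosum c (real k / real q)) / real q)"
      by (intro sums_divide sums_sum sums_diff cosum_sums[OF c])
    moreover have "(\<Sum>k<q. c j * cos (2 * pi * real j * x k) - c j * cos (2 * pi * real j * (real k / real q))) / real q = c j * d j" for j
      by (simp add: d_def sum_distrib_left right_diff_distrib)
    ultimately show ?thesis by (simp add: sums_iff sum_subtractf diff_divide_distrib)
  qed
  have wt: "\<bar>(\<Sum>k<q. w k * cosum c (x k)) / real q - (\<Sum>k<q. cosum c (x k)) / real q\<bar> \<le> 2 * (sqrt e * A / (real q)\<^sup>2)"
  proof -
    have "\<bar>(\<Sum>k<q. w k * cosum c (x k)) - (\<Sum>k<q. cosum c (x k))\<bar> = \<bar>\<Sum>k<q. (w k - 1) * cosum c (x k)\<bar>"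
      by (simp add: sum_subtractf algebra_simps)
    also have "\<dots> \<le> (\<Sum>k<q. e / (real q)\<^sup>2 * (2 * A))"
      by (rule order_trans[OF sum_abs], unfold abs_mult, intro sum_mono mult_mono w cosum_le c A) (use e in auto)
    also have "\<dots> \<le> (\<Sum>k<q. sqrt e / (real q)\<^sup>2 * (2 * A))"
      using se A by (intro sum_mono mult_right_mono divide_right_mono) auto
    also have "\<dots> = real q * (2 * (sqrt e * A / (real q)\<^sup>2))" by simp
    finally have "\<bar>(\<Sum>k<q. w k * cosum c (x k)) - (\<Sum>k<q. cosum c (x k))\<bar> \<le> real q * (2 * (sqrt e * A / (real q)\<^sup>2))" .
    then have "\<bar>(\<Sum>k<q. w k * cosum c (x k)) - (\<Sum>k<q. cosum c (x k))\<bar> / real q \<le> 2 * (sqrt e * A / (real q)\<^sup>2)"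
      using q by (simp add: pos_divide_le_eq mult.commute)
    then show ?thesis by (simp add: diff_divide_distrib[symmetric])
  qed
  have "0 \<le> sqrt e * A / (real q)\<^sup>2" using A se by simp
  moreover have "190 * sqrt e * A / (real q)\<^sup>2 = 190 * (sqrt e * A / (real q)\<^sup>2)"
      "200 * sqrt e * A / (real q)\<^sup>2 = 200 * (sqrt e * A / (real q)\<^sup>2)" by simp_all
  ultimately show ?thesis using main diff wt by linarith
qed

lemma cos_sum_roots:
  fixes q j :: nat
  assumes q: "q \<ge> 1"
  shows "(\<Sum>k<q. cos (2 * pi * real j * (real k / real q))) = (if q dvd j then real q else 0)"
proof (cases "q dvd j")
  case True
  then obtain i where i: "j = q * i" by (elim dvdE)
  have "cos (2 * pi * real j * (real k / real q)) = 1" for k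
  proof -
    have "2 * pi * real j * (real k / real q) = 2 * pi * real (i * k)" using q by (simp add: i)
    then show ?thesis by (metis cos_2npi mult.assoc mult.commute)
  qed
  then show ?thesis using True by simp
next
  case False
  define y where "y = 2 * pi * real j / real q"
  have s: "sin (y / 2) \<noteq> 0" using inverse_sin_le(1)[OF q False] by (simp add: y_def)
  have "sin ((real q - 1/2) * y) = sin (real j * (2 * pi) - y / 2)" using q by (intro arg_cong[of _ _ sin]) (simp add: y_def field_simps)
  also have "\<dots> = - sin (y / 2)" using sin_2npi[of j] cos_2npi[of j] by (simp add: sin_diff mult_ac)
  finally have "2 * sin (y / 2) * (\<Sum>k<q. cos (real k * y)) = 0" by (simp add: cos_partial_sum)
  then show ?thesis using s False by (simp add: y_def mult_ac)
qed

text \<open>Aliasing: averaging over the \<open>q\<close>-th roots of unity keeps exactly the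
  frequencies divisible by \<open>q\<close>, so the sum is \<open>c q + c (2 * q) + ...\<close>; the
  remainder is at most \<open>A / q^2\<close> times
  \<open>1/4 + 1/9 + ... = pi^2 / 6 - 1\<close>.\<close>

lemma riemann_sum_cosum:
  fixes q :: nat
  assumes c: "\<And>j. \<bar>c j\<bar> \<le> A / (real j)\<^sup>2" and q: "q \<ge> 1"
  shows "\<bar>(\<Sum>k<q. cosum c (real k / real q)) / real q - c q\<bar> \<le> 3 / 4 * A / (real q)\<^sup>2"
proof -
  have A: "A \<ge> 0" using c[of 1] by simp
  define R where "R = (\<Sum>k<q. cosum c (real k / real q)) / real q"
  have c0: "c 0 = 0" using c[of 0] by simp
  have "(\<lambda>j. (\<Sum>k<q. c j * cos (2 * pi * real j * (real k / real q))) / real q) sums R"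
    unfolding R_def by (intro sums_divide sums_sum cosum_sums[OF c])
  moreover have "(\<Sum>k<q. c j * cos (2 * pi * real j * (real k / real q))) / real q = (if q dvd j then c j else 0)" for j
    unfolding sum_distrib_left[symmetric] cos_sum_roots[OF q] using q by simp
  ultimately have s1: "(\<lambda>j. if q dvd j then c j else 0) sums R" by simp
  have "strict_mono (\<lambda>i. q * i)" using q by (auto simp: strict_mono_def)
  then have "(\<lambda>i. if q dvd q * i then c (q * i) else 0) sums R"
    by (subst sums_mono_reindex) (auto intro!: s1)
  then have "(\<lambda>i. c (q * i)) sums R" by simp
  then have "(\<lambda>i. c (q * (i + 2))) sums (R - c q)"
    using sums_iff_shift[of "\<lambda>i. c (q * i)" 2 "R - c q"] by (simp add: numeral_2_eq_2 c0)
  then have R: "R - c q = (\<Sum>i. c (q * (i + 2)))" by (simp add: sums_iff)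
  have sq: "(\<lambda>n. 1 / (real (n + 2))\<^sup>2) sums (pi\<^sup>2 / 6 - 1)"
    using sums_iff_shift[of "\<lambda>n. 1 / (real n + 1)\<^sup>2" 1 "pi\<^sup>2 / 6 - 1"] inverse_squares_sums
    by (simp add: add_ac)
  have "\<bar>R - c q\<bar> \<le> (\<Sum>i. A / (real q)\<^sup>2 * (1 / (real (i + 2))\<^sup>2))"
    unfolding R real_norm_def[symmetric]
  proof (rule norm_suminf_le)
    show "summable (\<lambda>i. A / (real q)\<^sup>2 * (1 / (real (i + 2))\<^sup>2))"
      by (rule summable_mult[OF sums_summable[OF sq]])
    show "norm (c (q * (i + 2))) \<le> A / (real q)\<^sup>2 * (1 / (real (i + 2))\<^sup>2)" for i
      using c[of "q * (i + 2)"] by (simp only: real_norm_def of_nat_mult power_mult_distrib) simp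
  qed
  also have "\<dots> = A / (real q)\<^sup>2 * (pi\<^sup>2 / 6 - 1)"
    using sums_mult[OF sq] unfolding sums_iff by blast
  also have "\<dots> \<le> A / (real q)\<^sup>2 * (3/4)"
  proof (intro mult_left_mono)
    have "pi * pi \<le> 3.15 * 3.15" using pi_approx by (intro mult_mono) auto
    then show "pi\<^sup>2 / 6 - 1 \<le> 3/4" by (simp add: power2_eq_square)
  qed (use A in auto)
  finally show ?thesis by (simp add: R_def mult_ac)
qed

lemma cosum_uniform_limit:
  assumes c: "\<And>j. \<bar>c j\<bar> \<le> A / (real j)\<^sup>2"
  shows "uniform_limit S (\<lambda>n x. \<Sum>j<n. c j * cos (2 * pi * real j * x)) (cosum c) sequentially"
  unfolding cosum_def[abs_def]
proof (rule Weierstrass_m_test)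
  show "summable (\<lambda>j. A * (1 / (real j)\<^sup>2))" by (intro summable_mult summable_inverse_square)
  fix j x
  have "\<bar>c j\<bar> * \<bar>cos (2 * pi * real j * x)\<bar> \<le> A / (real j)\<^sup>2 * 1"
    using c[of j] by (intro mult_mono) auto
  then show "norm (c j * cos (2 * pi * real j * x)) \<le> A * (1 / (real j)\<^sup>2)" by (simp add: abs_mult)
qed

lemma cosum_continuous:
  assumes c: "\<And>j. \<bar>c j\<bar> \<le> A / (real j)\<^sup>2"
  shows "continuous_on S (cosum c)"
  by (rule uniform_limit_theorem[OF _ cosum_uniform_limit[OF c]]) (auto intro!: always_eventually continuous_intros)

lemma cosum_periodic: "cosum c (x + 1) = cosum c x"
proof -
  have "cos (2 * pi * real j * (x + 1)) = cos (2 * pi * real j * x)" for j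
    using sin_2npi[of j] cos_2npi[of j] by (simp add: ring_distribs cos_add mult_ac)
  then show ?thesis by (simp add: cosum_def)
qed

lemma cosum_even: "cosum c (- x) = cosum c x"
  by (simp add: cosum_def)

section \<open>Uniqueness and decay of cosine coefficients\<close>

lemma integral_cos_int:
  fixes k :: int
  assumes "k \<noteq> 0"
  shows "((\<lambda>x. cos (2 * pi * of_int k * x)) has_integral 0) {0..1::real}"
proof -
  define W where "W = 2 * pi * real_of_int k"
  have W: "W \<noteq> 0" using assms by (simp add: W_def)
  have "((\<lambda>x. cos (W * x)) has_integral (sin (W * 1) / W - sin (W * 0) / W)) {0..1}"
    by (rule fundamental_theorem_of_calculus)
       (use W in \<open>auto intro!: derivative_eq_intros simp flip: has_real_derivative_iff_has_vector_derivative\<close>)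
  moreover have "sin W = 0" unfolding W_def by (metis sin_int_2pin)
  ultimately show ?thesis by (simp add: W_def)
qed

lemma integral_cos_cos:
  fixes j k :: nat
  assumes "k \<noteq> 0 "
  shows "((\<lambda>x. cos (2 * pi * real j * x) * cos (2 * pi * real k * x)) has_integral (if j = k then 1/2 else 0)) {0..1::real}"
proof -
  have eq: "cos (2 * pi * real j * x) * cos (2 * pi * real k * x) =
    1/2 * cos (2 * pi * of_int (int j - int k) * x) + 1/2 * cos (2 * pi * of_int (int j + int k) * x)" for x :: real
    by (simp add: cos_times_cos algebra_simps)
  have "((\<lambda>x. cos (2 * pi * of_int (int j + int k) * x)) has_integral 0) {0..1::real}"
    by (rule integral_cos_int) (use assms in auto)
  moreover have "((\<lambda>x. cos (2 * pi * of_int (int j - int k) * x)) has_integral (if j = k then 1 else 0)) {0..1::real}"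
  proof (cases "j = k")
    case True
    then show ?thesis using has_integral_const_real[of "1::real" 0 1] by simp
  next
    case False
    then show ?thesis using integral_cos_int[of "int j - int k"] by simp
  qed
  ultimately have "((\<lambda>x. 1/2 * cos (2 * pi * of_int (int j - int k) * x) + 1/2 * cos (2 * pi * of_int (int j + int k) * x))
      has_integral (1/2 * (if j = k then 1 else 0) + 1/2 * 0)) {0..1::real}"
    by (intro has_integral_add has_integral_mult_right)
  then show ?thesis unfolding eq by (simp split: if_splits)
qed

lemma integral_cosum_cos:
  fixes k :: nat
  assumes c: "\<And>j. \<bar>c j\<bar> \<le> A / (real j)\<^sup>2"
  shows "((\<lambda>x. cosum c x * cos (2 * pi * real k * x)) has_integral (c k / 2)) {0..1}"
proof -
  let ?f = "\<lambda>n x. (\<Sum>j<n. c j * cos (2 * pi * real j * x)) * cos (2 * pi * real k * x)"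
  have u: "uniform_limit {0..1} ?f (\<lambda>x. cosum c x * cos (2 * pi * real k * x)) sequentially"
  proof (rule uniform_lim_mult[OF cosum_uniform_limit[OF c] uniform_limit_const])
    show "bounded ((\<lambda>x. cosum c x) ` {0..1})"
      by (intro compact_imp_bounded compact_continuous_image cosum_continuous[OF c]) auto
    show "bounded ((\<lambda>x. cos (2 * pi * real k * x)) ` {0..1})"
      by (intro compact_imp_bounded compact_continuous_image continuous_intros) auto
  qed
  obtain I J where I: "\<And>n. (?f n has_integral I n) {0..1}"
    and J: "((\<lambda>x. cosum c x * cos (2 * pi * real k * x)) has_integral J) {0..1}" "I \<longlonglongrightarrow> J"
    by (rule uniform_limit_integral[OF u]) (auto intro!: continuous_intros)
  have c0: "c 0 = 0" using c[of 0] by simp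
  have "I n = c k / 2" if "n > k" for n
  proof -
    have *: "((\<lambda>x. c j * (cos (2 * pi * real j * x) * cos (2 * pi * real k * x))) has_integral (if j = k then c k / 2 else 0)) {0..1::real}" for j
    proof (cases "k = 0")
      case False
      show ?thesis using has_integral_mult_right[OF integral_cos_cos[OF False, of j], of "c j"]
        by (simp split: if_splits)
    next
      case True
      show ?thesis
      proof (cases "j = 0")
        case False
        then have "((\<lambda>x. cos (2 * pi * of_int (int j) * x)) has_integral 0) {0..1::real}"
          by (intro integral_cos_int) auto
        from has_integral_mult_right[OF this, of "c j"] show ?thesis using True False by simp
      qed (use True c0 in simp)
    qed
    have "(?f n has_integral (\<Sum>j<n. if j = k then c k / 2 else 0)) {0..1}"
      unfolding sum_distrib_right mult.assoc[of "c _"] by (intro has_integral_sum * ) simp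
    then have "(?f n has_integral (c k / 2)) {0..1}" using that by simp
    with I show ?thesis by (rule has_integral_unique)
  qed
  then have "I \<longlonglongrightarrow> c k / 2"
    by (intro tendsto_eventually eventually_sequentiallyI[of "Suc k"]) auto
  with J(2) have "J = c k / 2" by (rule LIMSEQ_unique)
  with J(1) show ?thesis by simp
qed

text \<open>Vanishing cosine coefficients give vanishing integrals against every power of
  \<open>cos (2 * pi * x)\<close>, by the product formula. An even periodic function is a continuous
  function of \<open>cos (2 * pi * x)\<close>, so Stone-Weierstrass approximates it by polynomials
  in the cosine, and the integral of \<open>e^2\<close> is arbitrarily small.\<close>

lemma even_periodic_zero_of_coeffs:
  fixes e :: "real \<Rightarrow> real"
  assumes cont: "continuous_on UNIV e" and per: "\<And>x. e (x + 1) = e x" and even: "\<And>x. e (- x) = e x"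
    and z: "\<And>k::nat. ((\<lambda>x. e x * cos (2 * pi * real k * x)) has_integral 0) {0..1}"
  shows "e x = 0"
proof -
  have cS: "continuous_on S e" for S using cont continuous_on_subset by blast
  \<comment> \<open>The induction shifts the frequency by plus or minus one, hence integer
    frequencies; negative ones reduce to \<open>z\<close> since the cosine is even.\<close>
  have pw: "((\<lambda>x. e x * (cos (2 * pi * of_int k * x) * cos (2 * pi * x) ^ n)) has_integral 0) {0..1}" for n and k :: int
  proof (induction n arbitrary: k)
    case 0
    have "cos (2 * pi * of_int k * x) = cos (2 * pi * real (nat \<bar>k\<bar>) * x)" for x
      by (cases "k \<ge> 0") auto
    then show ?case using z[of "nat \<bar>k\<bar>"] by simp
  next
    case (Suc n)
    have "e x * (cos (2 * pi * of_int k * x) * cos (2 * pi * x) ^ Suc n) =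
       1/2 * (e x * (cos (2 * pi * of_int (k - 1) * x) * cos (2 * pi * x) ^ n))
     + 1/2 * (e x * (cos (2 * pi * of_int (k + 1) * x) * cos (2 * pi * x) ^ n))" for x
    proof -
      have "cos (2 * pi * of_int k * x) * cos (2 * pi * x) = 1/2 * cos (2 * pi * of_int (k - 1) * x) + 1/2 * cos (2 * pi * of_int (k + 1) * x)"
        by (simp add: cos_add cos_diff ring_distribs)
      then have "cos (2 * pi * of_int k * x) * cos (2 * pi * x) ^ Suc n = (1/2 * cos (2 * pi * of_int (k - 1) * x) + 1/2 * cos (2 * pi * of_int (k + 1) * x)) * cos (2 * pi * x) ^ n"
        by (metis (no_types, lifting) mult.assoc power_Suc)
      then show ?thesis by (simp only: ring_distribs mult_ac)
    qed
    moreover have "((\<lambda>x. 1/2 * (e x * (cos (2 * pi * of_int (k - 1) * x) * cos (2 * pi * x) ^ n))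
     + 1/2 * (e x * (cos (2 * pi * of_int (k + 1) * x) * cos (2 * pi * x) ^ n))) has_integral (1/2 * 0 + 1/2 * 0)) {0..1}"
      by (intro has_integral_add has_integral_mult_right Suc.IH)
    ultimately show ?case by simp
  qed
  have poly: "((\<lambda>x. e x * p (cos (2 * pi * x))) has_integral 0) {0..1}" if rp: "real_polynomial_function p" for p :: "real \<Rightarrow> real"
  proof -
    obtain a n where p: "p = (\<lambda>x. \<Sum>i\<le>n. a i * x ^ i)"
      using rp unfolding real_polynomial_function_iff_sum by blast
    have "((\<lambda>x. e x * (a i * cos (2 * pi * x) ^ i)) has_integral 0) {0..1}" for i
      using has_integral_mult_right[OF pw[of 0 i], of "a i"] by (simp add: mult_ac)
    then have "((\<lambda>x. \<Sum>i\<le>n. e x * (a i * cos (2 * pi * x) ^ i)) has_integral (\<Sum>i\<le>n. 0)) {0..1}"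
      by (intro has_integral_sum) auto
    then show ?thesis by (simp add: p sum_distrib_left)
  qed
  have "bounded (e ` {0..1})" by (intro compact_imp_bounded compact_continuous_image cS) auto
  then obtain B where B: "B > 0" "\<And>x. x \<in> {0..1} \<Longrightarrow> \<bar>e x\<bar> \<le> B"
    by (auto simp: bounded_pos)
  have int: "(\<lambda>x. (e x)\<^sup>2) integrable_on {0..1}"
    by (intro integrable_continuous_real continuous_intros cS)
  have small: "integral {0..1} (\<lambda>x. (e x)\<^sup>2) \<le> B * h" if h: "h > 0" for h
  proof -
    have c1: "continuous_on {-1..1} (\<lambda>y. e (arccos y / (2 * pi)))"
      by (rule continuous_on_compose2[OF cont]) (auto intro!: continuous_intros)
    obtain p where p: "real_polynomial_function p" "\<And>y. y \<in> {-1..1} \<Longrightarrow> \<bar>e (arccos y / (2 * pi)) - p y\<bar> < h"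
      by (rule Stone_Weierstrass_real_polynomial_function[OF _ c1 h]) auto
    have near: "\<bar>e x - p (cos (2 * pi * x))\<bar> \<le> h" if x: "x \<in> {0..1}" for x
    proof -
      have half: "\<bar>e x - p (cos (2 * pi * x))\<bar> \<le> h" if "0 \<le> x" "x \<le> 1/2" for x
      proof -
        have "2 * pi * x \<le> 2 * pi * (1/2)" using that by (intro mult_left_mono) auto
        then have "arccos (cos (2 * pi * x)) = 2 * pi * x" using that by (intro arccos_cos) auto
        then show ?thesis using p(2)[of "cos (2 * pi * x)"] by simp
      qed
      show ?thesis
      proof (cases "x \<le> 1/2")
        case True then show ?thesis using half[of x] x by auto
      next
        case False
        \<comment> \<open>\<open>arccos\<close> inverts the cosine only on half a period; the other
          half is reached by reflection at \<open>1/2\<close>.\<close>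
        have 1: "e (1 - x) = e x" using per[of "- x"] even[of x] by (simp add: add.commute)
        have 2: "cos (2 * pi * (1 - x)) = cos (2 * pi * x)"
          by (simp add: right_diff_distrib cos_diff)
        show ?thesis using half[of "1 - x"] False x unfolding 1 2 by auto
      qed
    qed
    have pc: "continuous_on {0..1} (\<lambda>x. p (cos (2 * pi * x)))"
    proof (rule continuous_on_compose2[of UNIV p])
      show "continuous_on UNIV p" using p(1)
        by (auto simp: real_polynomial_function_eq intro!: continuous_on_polymonial_function)
    qed (auto intro!: continuous_intros)
    have i2: "((\<lambda>x. (e x)\<^sup>2 - e x * p (cos (2 * pi * x))) has_integral (integral {0..1} (\<lambda>x. (e x)\<^sup>2) - 0)) {0..1}"
      by (intro has_integral_diff integrable_integral int poly p)
    have "integral {0..1} (\<lambda>x. (e x)\<^sup>2) - 0 \<le> B * h * (1 - 0)"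
    proof (rule has_integral_le[OF i2])
      show "((\<lambda>x. B * h) has_integral (B * h * (1 - 0))) {0..1::real}"
        using has_integral_const_real[of "B * h" 0 1] by simp
      fix x :: real assume x: "x \<in> {0..1}"
      have "(e x)\<^sup>2 - e x * p (cos (2 * pi * x)) = e x * (e x - p (cos (2 * pi * x)))"
        by (simp add: algebra_simps power2_eq_square)
      also have "\<dots> \<le> \<bar>e x\<bar> * \<bar>e x - p (cos (2 * pi * x))\<bar>" by (metis abs_ge_self abs_mult)
      also have "\<dots> \<le> B * h" using B x by (intro mult_mono near) auto
      finally show "(e x)\<^sup>2 - e x * p (cos (2 * pi * x)) \<le> B * h" .
    qed
    then show ?thesis by simp
  qed
  have "integral {0..1} (\<lambda>x. (e x)\<^sup>2) \<le> 0"
  proof (rule field_le_epsilon)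
    fix h :: real assume "h > 0"
    then show "integral {0..1} (\<lambda>x. (e x)\<^sup>2) \<le> 0 + h" using small[of "h / B"] B by simp
  qed
  moreover have "integral {0..1} (\<lambda>x. (e x)\<^sup>2) \<ge> 0" by (rule integral_nonneg[OF int]) auto
  ultimately have i0: "((\<lambda>x. (e x)\<^sup>2) has_integral 0) (cbox 0 1)"
    using integrable_integral[OF int] by simp
  have z01: "e y = 0" if "y \<in> {0..1}" for y
  proof -
    have "(e y)\<^sup>2 = 0"
      by (rule has_integral_0_cbox_imp_0[OF _ _ i0]) (use that in \<open>auto intro!: continuous_intros cS\<close>)
    then show ?thesis by simp
  qed
  have "e (y + real n) = e y" for y n
  proof (induction n)
    case (Suc n)
    then show ?case using per[of "y + real n"] by (simp add: add_ac)
  qed simp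
  then have shift: "e (\<bar>x\<bar> - real n) = e \<bar>x\<bar>" for n by (metis diff_add_cancel)
  have "e \<bar>x\<bar> = e (frac \<bar>x\<bar>)"
    using shift[of "nat \<lfloor>\<bar>x\<bar>\<rfloor>"] by (simp add: frac_def)
  also have "\<dots> = 0" by (rule z01) (auto simp: frac_lt_1 less_imp_le)
  finally show ?thesis using even[of x] by (cases "x \<ge> 0") auto
qed

text \<open>At \<open>j = 0\<close> this is twice the mean; it is used for functions of mean
  zero.\<close>

definition cos_coeff_of :: "(real \<Rightarrow> real) \<Rightarrow> nat \<Rightarrow> real" where
  "cos_coeff_of f j = 2 * integral {0..1} (\<lambda>x. f x * cos (2 * pi * real j * x))"

lemma cos_coeff_of_bound:
  assumes d1: "\<And>x. (f has_real_derivative f' x) (at x)" and d2: "\<And>x. (f' has_real_derivative f'' x) (at x)"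
    and cont: "continuous_on UNIV f''" and per: "\<And>x. f (x + 1) = f x"
    and i0: "integral {0..1} f = 0" and M: "\<And>x. \<bar>f'' x\<bar> \<le> M"
  shows "\<bar>cos_coeff_of f j\<bar> \<le> M / (real j)\<^sup>2"
proof (cases "j = 0")
  case True
  then show ?thesis using i0 by (simp add: cos_coeff_of_def)
next
  case False
  define W where "W = 2 * pi * real j"
  have W: "W > 0" using False by (simp add: W_def)
  have per': "f' 1 = f' 0"
  proof -
    have "((\<lambda>x. f (x + 1)) has_real_derivative f' 1) (at 0)"
      using DERIV_shift[of f "f' 1" 0 1] d1[of 1] by simp
    then have "(f has_real_derivative f' 1) (at 0)" by (simp add: per)
    then show ?thesis using d1[of 0] DERIV_unique by blast
  qed
  have cf: "continuous_on {0..1} f" using d1 by (meson DERIV_continuous_on has_field_derivative_at_within)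
  have cf'': "continuous_on {0..1} f''" using cont continuous_on_subset by blast
  \<comment> \<open>\<open>?F\<close> packs two integrations by parts into one antiderivative: the
    mixed terms cancel, and its boundary values agree by periodicity.\<close>
  let ?F = "\<lambda>x. f x * sin (W * x) / W + f' x * cos (W * x) / W\<^sup>2"
  have "((\<lambda>x. f x * cos (W * x) + f'' x * cos (W * x) / W\<^sup>2) has_integral (?F 1 - ?F 0)) {0..1}"
  proof (rule fundamental_theorem_of_calculus)
    fix x :: real
    have "(?F has_real_derivative (f x * cos (W * x) + f'' x * cos (W * x) / W\<^sup>2)) (at x)"
      by (rule derivative_eq_intros d1 d2 refl | use W in \<open>simp add: field_simps power2_eq_square\<close>)+
    then show "(?F has_vector_derivative (f x * cos (W * x) + f'' x * cos (W * x) / W\<^sup>2)) (at x within {0..1})"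
      by (simp add: has_real_derivative_iff_has_vector_derivative has_vector_derivative_at_within)
  qed simp
  moreover have "?F 1 - ?F 0 = 0"
    using sin_2npi[of j] cos_2npi[of j] per' by (simp add: W_def mult_ac)
  ultimately have s: "((\<lambda>x. f x * cos (W * x) + f'' x * cos (W * x) / W\<^sup>2) has_integral 0) {0..1}" by simp
  have i2: "((\<lambda>x. f'' x * cos (W * x)) has_integral (integral {0..1} (\<lambda>x. f'' x * cos (W * x)))) {0..1}"
    by (intro integrable_integral integrable_continuous_real continuous_intros cf'')
  have "((\<lambda>x. f x * cos (W * x)) has_integral (0 - integral {0..1} (\<lambda>x. f'' x * cos (W * x)) / W\<^sup>2)) {0..1}"
    using has_integral_diff[OF s has_integral_divide[OF i2, of "W\<^sup>2"]] by simp
  then have eq: "integral {0..1} (\<lambda>x. f x * cos (W * x)) = - integral {0..1} (\<lambda>x. f'' x * cos (W * x)) / W\<^sup>2"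
    by (simp add: integral_unique)
  have "\<bar>integral {0..1} (\<lambda>x. f'' x * cos (W * x))\<bar> \<le> M * (1 - 0)"
    unfolding real_norm_def[symmetric]
  proof (rule integral_bound)
    show "norm (f'' x * cos (W * x)) \<le> M" for x
      using mult_mono[OF M[of x] abs_cos_le_one[of "W * x"]] M[of x] by (simp add: abs_mult)
  qed (auto intro!: continuous_intros cf'')
  then have "\<bar>cos_coeff_of f j\<bar> \<le> 2 * (M / W\<^sup>2)"
    unfolding cos_coeff_of_def W_def[symmetric] eq by (simp add: abs_mult divide_right_mono)
  also have "\<dots> \<le> M / (real j)\<^sup>2"
  proof -
    have "2 \<le> (2 * pi)\<^sup>2" using mult_mono[of 3 pi 3 pi] pi_gt3 by (simp add: power2_eq_square)
    moreover have "M \<ge> 0" using M[of 0] by simp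
    ultimately have "M * 2 \<le> M * (2 * pi)\<^sup>2" by (intro mult_left_mono)
    then show ?thesis using False by (simp add: W_def power_mult_distrib divide_simps)
  qed
  finally show ?thesis .
qed

lemma cosine_series:
  assumes d1: "\<And>x. (f has_real_derivative f' x) (at x)" and d2: "\<And>x. (f' has_real_derivative f'' x) (at x)"
    and cont: "continuous_on UNIV f''" and per: "\<And>x. f (x + 1) = f x" and even: "\<And>x. f (- x) = f x"
    and i0: "integral {0..1} f = 0" and M: "\<And>x. \<bar>f'' x\<bar> \<le> M"
  shows "f x = cosum (cos_coeff_of f) x"
proof -
  note b = cos_coeff_of_bound[OF d1 d2 cont per i0 M]
  have cf: "continuous_on UNIV f" using d1 by (meson DERIV_continuous_on has_field_derivative_at_within)
  have "f x - cosum (cos_coeff_of f) x = 0"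
  proof (rule even_periodic_zero_of_coeffs[where e = "\<lambda>x. f x - cosum (cos_coeff_of f) x"])
    show "continuous_on UNIV (\<lambda>x. f x - cosum (cos_coeff_of f) x)"
      by (intro continuous_intros cf cosum_continuous[OF b])
    fix k :: nat
    have "(\<lambda>x. f x * cos (2 * pi * real k * x)) integrable_on {0..1}"
      by (intro integrable_continuous_real continuous_intros continuous_on_subset[OF cf]) auto
    then have "((\<lambda>x. f x * cos (2 * pi * real k * x)) has_integral (cos_coeff_of f k / 2)) {0..1}"
      by (simp add: cos_coeff_of_def has_integral_integral)
    from has_integral_diff[OF this integral_cosum_cos[OF b, of k]]
    show "((\<lambda>x. (f x - cosum (cos_coeff_of f) x) * cos (2 * pi * real k * x)) has_integral 0) {0..1}"
      by (simp add: algebra_simps)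
  qed (simp_all add: per even cosum_periodic cosum_even)
  then show ?thesis by simp
qed

lemma cos_coeff_of_diff:
  assumes "continuous_on UNIV f" "continuous_on UNIV g"
  shows "cos_coeff_of (\<lambda>x. f x - g x) j = cos_coeff_of f j - cos_coeff_of g j"
proof -
  have "(\<lambda>x. h x * cos (2 * pi * real j * x)) integrable_on {0..1}" if "continuous_on UNIV h" for h :: "real \<Rightarrow> real"
    by (intro integrable_continuous_real continuous_intros continuous_on_subset[OF that]) auto
  then show ?thesis using assms
    by (simp add: cos_coeff_of_def left_diff_distrib integral_diff)
qed

text \<open>\<open>A\<close> is the least constant in the coefficient bound, finite by the a priori
  bound \<open>M\<close>. Since the aliasing error is \<open>3/4\<close> and the rows are at most
  \<open>1/8\<close> of \<open>A / q^2\<close>, the supremum satisfies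
  \<open>A \<le> 7/8 * A\<close>. The row hypothesis is quantified over all admissible constants so
  that it can be used with this one.\<close>

lemma vanishing_of_small_rows:
  assumes c: "\<And>j. \<bar>c j\<bar> \<le> M / (real j)\<^sup>2"
    and rows: "\<And>A q. (\<And>j. \<bar>c j\<bar> \<le> A / (real j)\<^sup>2) \<Longrightarrow> q \<ge> 1 \<Longrightarrow>
       \<bar>(\<Sum>k<q. cosum c (real k / real q)) / real q\<bar> \<le> 1 / 8 * A / (real q)\<^sup>2"
  shows "c j = 0"
proof -
  define S where "S = range (\<lambda>j. (real j)\<^sup>2 * \<bar>c j\<bar>)"
  have c0: "c 0 = 0" using c[of 0] by simp
  have "(real j)\<^sup>2 * \<bar>c j\<bar> \<le> \<bar>M\<bar>" for j
    using c[of j] c0 by (cases "j = 0") (auto simp: field_simps)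
  then have bdd: "bdd_above S" by (auto simp: S_def bdd_above_def)
  define A where "A = Sup S"
  have A: "(real j)\<^sup>2 * \<bar>c j\<bar> \<le> A" for j unfolding A_def by (intro cSup_upper bdd) (auto simp: S_def)
  have cA: "\<bar>c j\<bar> \<le> A / (real j)\<^sup>2" for j using A[of j] c0 by (cases "j = 0") (auto simp: field_simps)
  have A0: "A \<ge> 0" using A[of 0] by simp
  have "A \<le> 7/8 * A"
    unfolding A_def[symmetric]
  proof (subst (1) A_def, rule cSup_least)
    fix y assume "y \<in> S"
    then obtain q where y: "y = (real q)\<^sup>2 * \<bar>c q\<bar>" by (auto simp: S_def)
    show "y \<le> 7/8 * A"
    proof (cases "q = 0")
      case True then show ?thesis using y A0 by simp
    next
      case False
      then have q: "q \<ge> 1" by simp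
      have "\<bar>c q\<bar> \<le> 3 / 4 * A / (real q)\<^sup>2 + 1 / 8 * A / (real q)\<^sup>2"
        using riemann_sum_cosum[OF cA q] rows[OF cA q] by linarith
      also have "\<dots> = 7/8 * A / (real q)\<^sup>2" by (simp add: add_divide_distrib[symmetric])
      finally show ?thesis using False unfolding y by (simp add: field_simps)
    qed
  qed (auto simp: S_def)
  then have "A = 0" using A0 by simp
  then show ?thesis using cA[of j] by simp
qed

subsection \<open>Curves parametrised by the normal angle\<close>

text \<open>Integration of an inequality between derivatives; the expansions below are obtained by
  applying it repeatedly with explicit majorants.\<close>

lemma deriv_abs_bound:
  fixes f g f' g' :: "real \<Rightarrow> real"
  assumes "0 \<le> d" "f 0 = 0" "g 0 = 0"
    and "\<And>t. 0 \<le> t \<Longrightarrow> t \<le> d \<Longrightarrow> (f has_real_derivative f' t) (at t)"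
    and "\<And>t. 0 \<le> t \<Longrightarrow> t \<le> d \<Longrightarrow> (g has_real_derivative g' t) (at t)"
    and "\<And>t. 0 \<le> t \<Longrightarrow> t \<le> d \<Longrightarrow> \<bar>f' t\<bar> \<le> g' t"
  shows "\<bar>f d\<bar> \<le> g d"
proof -
  have "g 0 - f 0 \<le> g d - f d"
  proof (rule DERIV_nonneg_imp_nondecreasing[OF assms(1), of "\<lambda>t. g t - f t"])
    fix t assume t: "0 \<le> t" "t \<le> d"
    have "((\<lambda>t. g t - f t) has_real_derivative (g' t - f' t)) (at t)"
      by (intro DERIV_diff assms t)
    moreover have "0 \<le> g' t - f' t" using assms(6)[OF t] by linarith
    ultimately show "\<exists>y. ((\<lambda>t. g t - f t) has_real_derivative y) (at t) \<and> 0 \<le> y" by blast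
  qed
  moreover have "g 0 + f 0 \<le> g d + f d"
  proof (rule DERIV_nonneg_imp_nondecreasing[OF assms(1), of "\<lambda>t. g t + f t"])
    fix t assume t: "0 \<le> t" "t \<le> d"
    have "((\<lambda>t. g t + f t) has_real_derivative (g' t + f' t)) (at t)"
      by (intro DERIV_add assms t)
    moreover have "0 \<le> g' t + f' t" using assms(6)[OF t] by linarith
    ultimately show "\<exists>y. ((\<lambda>t. g t + f t) has_real_derivative y) (at t) \<and> 0 \<le> y" by blast
  qed
  ultimately show ?thesis using assms by linarith
qed

lemma deriv_bump_nonneg:
  fixes f f' :: "real \<Rightarrow> real"
  assumes d: "\<And>t. (f has_real_derivative f' t) (at t)" and z: "f a = 0" "f c = 0"
    and up: "\<And>t. a \<le> t \<Longrightarrow> t \<le> m \<Longrightarrow> f' t \<ge> 0" and down: "\<And>t. m \<le> t \<Longrightarrow> t \<le> c \<Longrightarrow> f' t \<le> 0"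
    and b: "a \<le> b" "b \<le> c"
  shows "f b \<ge> 0"
proof (cases "b \<le> m")
  case True
  have "f a \<le> f b"
    by (rule DERIV_nonneg_imp_nondecreasing[OF b(1)]) (use d up True in force)
  then show ?thesis using z by simp
next
  case False
  have "f c \<le> f b"
    by (rule DERIV_nonpos_imp_nonincreasing[OF b(2)]) (use d down False in force)
  then show ?thesis using z by simp
qed

lemma inner_cis: "inner (cis a) (cis b) = cos (a - b)"
  by (simp add: inner_complex_def cos_diff)

lemma inner_i_cis: "inner (\<i> * cis a) (cis b) = - sin (a - b)"
  by (simp add: inner_complex_def sin_diff)

lemma inner_of_real_mult: "inner (of_real r * z) w = r * inner z w" for z w :: complex
  by (simp add: inner_complex_def algebra_simps)

lemma cos_lt_one:
  fixes x :: real
  assumes "0 < x" "x < 2 * pi" shows "cos x < 1"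
proof -
  have "sin (x / 2) > 0" using assms by (intro sin_gt_zero) auto
  moreover have "cos x = 1 - 2 * (sin (x / 2))\<^sup>2" using cos_double_sin[of "x/2"] by simp
  ultimately show ?thesis by simp
qed

text \<open>\<open>t\<close> is the angle of the outward normal \<open>cis t\<close>, so the unit
  tangent is \<open>\<i> * cis t\<close>, \<open>\<rho>\<close> is the radius of curvature and
  \<open>s\<close> an arc length; \<open>pers\<close> normalises the perimeter to
  \<open>2 * pi\<close>. The bounds say that the curve is close to the unit circle.\<close>

locale billiard_curve =
  fixes \<rho> \<rho>1 \<rho>2 \<rho>3 :: "real \<Rightarrow> real" and \<Gamma> :: "real \<Rightarrow> complex" and s :: "real \<Rightarrow> real" and \<epsilon> :: real
  assumes eps: "0 < \<epsilon>" "\<epsilon> \<le> 1 / 1000"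
    and d\<rho>: "\<And>t. (\<rho> has_real_derivative \<rho>1 t) (at t)"
    and d\<rho>1: "\<And>t. (\<rho>1 has_real_derivative \<rho>2 t) (at t)"
    and d\<rho>2: "\<And>t. (\<rho>2 has_real_derivative \<rho>3 t) (at t)"
    and b\<rho>: "\<And>t. \<bar>\<rho> t - 1\<bar> \<le> \<epsilon>" and b\<rho>1: "\<And>t. \<bar>\<rho>1 t\<bar> \<le> \<epsilon>"
    and b\<rho>2: "\<And>t. \<bar>\<rho>2 t\<bar> \<le> \<epsilon>" and b\<rho>3: "\<And>t. \<bar>\<rho>3 t\<bar> \<le> \<epsilon>"
    and d\<Gamma>: "\<And>t. (\<Gamma> has_vector_derivative of_real (\<rho> t) * (\<i> * cis t)) (at t)"
    and ds: "\<And>t. (s has_real_derivative \<rho> t) (at t)"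
    and per\<Gamma>: "\<And>t. \<Gamma> (t + 2 * pi) = \<Gamma> t"
    and per\<rho>: "\<And>t. \<rho> (t + 2 * pi) = \<rho> t"
    and pers: "\<And>t. s (t + 2 * pi) = s t + 2 * pi"
begin

lemma rho_pos: "\<rho> t > 0" and rho_bounds: "1 - \<epsilon> \<le> \<rho> t" "\<rho> t \<le> 1 + \<epsilon>" and rho_num: "999/1000 \<le> \<rho> t" "\<rho> t \<le> 1001/1000"
  using b\<rho>[of t] eps by (auto simp: abs_le_iff)

lemma d_inner_Gamma: "((\<lambda>t. inner (\<Gamma> t) w) has_real_derivative \<rho> t * inner (\<i> * cis t) w) (at t)"
proof -
  have "((\<lambda>t. inner (\<Gamma> t) w) has_vector_derivative inner (of_real (\<rho> t) * (\<i> * cis t)) w) (at t)"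
    using bounded_linear.has_vector_derivative[OF bounded_linear_inner_left d\<Gamma>] .
  then show ?thesis by (simp add: has_real_derivative_iff_has_vector_derivative inner_of_real_mult)
qed

text \<open>Distance from \<open>\<Gamma> b\<close> to the tangent line at
  \<open>\<Gamma> a\<close>; for the unit circle it is \<open>1 - cos (b - a)\<close>.\<close>

definition height :: "real \<Rightarrow> real \<Rightarrow> real" where
  "height a b = inner (\<Gamma> a - \<Gamma> b) (cis a)"

lemma d_height: "((\<lambda>b. height a b) has_real_derivative \<rho> b * sin (b - a)) (at b)"
  unfolding height_def inner_diff_left
  by (rule derivative_eq_intros d_inner_Gamma refl)+ (simp add: inner_i_cis)

text \<open>Comparison with circles of radius \<open>1 - \<epsilon>\<close> and
  \<open>1 + \<epsilon>\<close>: the difference vanishes at both ends of a period and its derivative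
  has the sign of \<open>sin (t - a)\<close>, so it first rises and then falls.\<close>

lemma height_bounds_aux:
  assumes "a \<le> b" "b \<le> a + 2 * pi"
  shows "(1 - \<epsilon>) * (1 - cos (b - a)) \<le> height a b" "height a b \<le> (1 + \<epsilon>) * (1 - cos (b - a))"
proof -
  have sgn: "a \<le> t \<Longrightarrow> t \<le> a + pi \<Longrightarrow> sin (t - a) \<ge> 0" "a + pi \<le> t \<Longrightarrow> t \<le> a + 2 * pi \<Longrightarrow> sin (t - a) \<le> 0" for t
  proof -
    show "a \<le> t \<Longrightarrow> t \<le> a + pi \<Longrightarrow> sin (t - a) \<ge> 0" by (intro sin_ge_zero) auto
    show "a + pi \<le> t \<Longrightarrow> t \<le> a + 2 * pi \<Longrightarrow> sin (t - a) \<le> 0"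
      using sin_ge_zero[of "t - a - pi"] by (simp add: sin_diff)
  qed
  have "height a b - (1 - \<epsilon>) * (1 - cos (b - a)) \<ge> 0"
  proof (rule deriv_bump_nonneg[where a = a and c = "a + 2 * pi" and m = "a + pi" and f = "\<lambda>b. height a b - (1 - \<epsilon>) * (1 - cos (b - a))"])
    fix t show "((\<lambda>b. height a b - (1 - \<epsilon>) * (1 - cos (b - a))) has_real_derivative (\<rho> t - (1 - \<epsilon>)) * sin (t - a)) (at t)"
      by (rule derivative_eq_intros d_height refl)+ (simp add: algebra_simps)
    show "a \<le> t \<Longrightarrow> t \<le> a + pi \<Longrightarrow> 0 \<le> (\<rho> t - (1 - \<epsilon>)) * sin (t - a)"
      using rho_bounds[of t] sgn(1)[of t] by simp
    show "a + pi \<le> t \<Longrightarrow> t \<le> a + 2 * pi \<Longrightarrow> (\<rho> t - (1 - \<epsilon>)) * sin (t - a) \<le> 0"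
      using rho_bounds[of t] sgn(2)[of t] by (simp add: mult_nonneg_nonpos)
  qed (use assms per\<Gamma> in \<open>auto simp: height_def\<close>)
  then show "(1 - \<epsilon>) * (1 - cos (b - a)) \<le> height a b" by simp
  have "(1 + \<epsilon>) * (1 - cos (b - a)) - height a b \<ge> 0"
  proof (rule deriv_bump_nonneg[where a = a and c = "a + 2 * pi" and m = "a + pi" and f = "\<lambda>b. (1 + \<epsilon>) * (1 - cos (b - a)) - height a b"])
    fix t show "((\<lambda>b. (1 + \<epsilon>) * (1 - cos (b - a)) - height a b) has_real_derivative ((1 + \<epsilon>) - \<rho> t) * sin (t - a)) (at t)"
      by (rule derivative_eq_intros d_height refl)+ (simp add: algebra_simps)
    show "a \<le> t \<Longrightarrow> t \<le> a + pi \<Longrightarrow> 0 \<le> ((1 + \<epsilon>) - \<rho> t) * sin (t - a)"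
      using rho_bounds[of t] sgn(1)[of t] by simp
    show "a + pi \<le> t \<Longrightarrow> t \<le> a + 2 * pi \<Longrightarrow> ((1 + \<epsilon>) - \<rho> t) * sin (t - a) \<le> 0"
      using rho_bounds[of t] sgn(2)[of t] by (simp add: mult_nonneg_nonpos)
  qed (use assms per\<Gamma> in \<open>auto simp: height_def\<close>)
  then show "height a b \<le> (1 + \<epsilon>) * (1 - cos (b - a))" by simp
qed

lemma Gamma_int: "\<Gamma> (t + 2 * pi * of_int k) = \<Gamma> t"
proof (induction k rule: int_induct[where k = 0])
  case (step1 i)
  have "\<Gamma> (t + 2 * pi * of_int (i + 1)) = \<Gamma> ((t + 2 * pi * of_int i) + 2 * pi)" by (simp add: algebra_simps)
  then show ?case using step1 per\<Gamma> by metis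
next
  case (step2 i)
  have "\<Gamma> (t + 2 * pi * of_int i) = \<Gamma> ((t + 2 * pi * of_int (i - 1)) + 2 * pi)" by (simp add: algebra_simps)
  then show ?case using step2 per\<Gamma> by metis
qed simp

lemma angle_reduce: obtains k :: int where "a \<le> b + 2 * pi * of_int k" "b + 2 * pi * of_int k < a + 2 * pi"
proof
  define x where "x = (a - b) / (2 * pi)"
  have x: "a - b = 2 * pi * x" by (simp add: x_def)
  have k: "x \<le> of_int \<lceil>x\<rceil>" "of_int \<lceil>x\<rceil> < x + 1" by linarith+
  have "2 * pi * x \<le> 2 * pi * of_int \<lceil>x\<rceil>" using k(1) by (intro mult_left_mono) auto
  then show "a \<le> b + 2 * pi * of_int \<lceil>x\<rceil>" using x by linarith
  have "2 * pi * of_int \<lceil>x\<rceil> < 2 * pi * (x + 1)" using k(2) by (intro mult_strict_left_mono) auto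
  also have "\<dots> = 2 * pi * x + 2 * pi" by (simp add: algebra_simps)
  finally show "b + 2 * pi * of_int \<lceil>x\<rceil> < a + 2 * pi" using x by linarith
qed

lemma height_bounds:
  "(1 - \<epsilon>) * (1 - cos (b - a)) \<le> height a b" "height a b \<le> (1 + \<epsilon>) * (1 - cos (b - a))"
proof -
  obtain k where k: "a \<le> b + 2 * pi * of_int k" "b + 2 * pi * of_int k < a + 2 * pi" by (rule angle_reduce)
  have "cos (b + 2 * pi * of_int k - a) = cos (b - a)"
  proof -
    have "b + 2 * pi * of_int k - a = (b - a) + 2 * pi * of_int k" by simp
    then show ?thesis using sin_int_2pin[of k] cos_int_2pin[of k] by (simp only: cos_add)
  qed
  moreover have "height a (b + 2 * pi * of_int k) = height a b" by (simp add: height_def Gamma_int)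
  ultimately show "(1 - \<epsilon>) * (1 - cos (b - a)) \<le> height a b" "height a b \<le> (1 + \<epsilon>) * (1 - cos (b - a))"
    using height_bounds_aux[of a "b + 2 * pi * of_int k"] k by auto
qed

lemma height_nonneg: "height a b \<ge> 0"
  using height_bounds(1)[of b a] eps cos_le_one[of "b - a"]
    mult_nonneg_nonneg[of "1 - \<epsilon>" "1 - cos (b - a)"] by linarith

lemma height_pos:
  assumes "a < b" "b < a + 2 * pi" shows "height a b > 0" "height b a > 0"
proof -
  have c: "cos (b - a) < 1" using assms by (intro cos_lt_one) auto
  have "cos (a - b) = cos (b - a)" by (metis cos_minus minus_diff_eq)
  then have "0 < (1 - \<epsilon>) * (1 - cos (b - a))" "0 < (1 - \<epsilon>) * (1 - cos (a - b))" using c eps by auto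
  then show "height a b > 0" "height b a > 0" using height_bounds(1) less_le_trans by blast+
qed

lemma Gamma_eq_imp: assumes "\<Gamma> a = \<Gamma> b" obtains k :: int where "b = a + 2 * pi * of_int k"
proof -
  obtain k where k: "a \<le> b + 2 * pi * of_int k" "b + 2 * pi * of_int k < a + 2 * pi" by (rule angle_reduce)
  have "height a (b + 2 * pi * of_int k) = 0" using assms by (simp add: height_def Gamma_int)
  then have "\<not> a < b + 2 * pi * of_int k" using height_pos(1) k(2) by fastforce
  then have "b = a + 2 * pi * of_int (- k)" using k by simp
  then show ?thesis by (rule that)
qed

text \<open>The chord between the normal angles \<open>m - d\<close> and \<open>m + d\<close>,
  measured against the tangent direction at \<open>m\<close>. On a circle it is real; its imaginary
  part \<open>SS\<close> measures the skewness caused by varying curvature.\<close>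

definition midchord :: "real \<Rightarrow> real \<Rightarrow> complex" where
  "midchord m d = - \<i> * cis (- m) * (\<Gamma> (m + d) - \<Gamma> (m - d))"

definition CC where "CC m d = Re (midchord m d)"
definition SS where "SS m d = Im (midchord m d)"

lemma d_midchord: "((\<lambda>d. midchord m d) has_vector_derivative (of_real (\<rho> (m + d)) * cis d + of_real (\<rho> (m - d)) * cis (- d))) (at d)"
proof -
  have 1: "((\<lambda>d. \<Gamma> (m + d)) has_vector_derivative of_real (\<rho> (m + d)) * (\<i> * cis (m + d))) (at d)"
    using vector_diff_chain_at[of "\<lambda>d. m + d" 1 d \<Gamma>, OF _ d\<Gamma>[of "m + d"]]
      has_vector_derivative_add[OF has_vector_derivative_const[of m] has_vector_derivative_id, of "at d"]
    by (simp add: o_def)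
  have 2: "((\<lambda>d. \<Gamma> (m - d)) has_vector_derivative - (of_real (\<rho> (m - d)) * (\<i> * cis (m - d)))) (at d)"
    using vector_diff_chain_at[of "\<lambda>d. m - d" "-1" d \<Gamma>, OF _ d\<Gamma>[of "m - d"]]
      has_vector_derivative_diff[OF has_vector_derivative_const[of m] has_vector_derivative_id, of "at d"]
    by (simp add: o_def)
  have "((\<lambda>d. - \<i> * cis (- m) * (\<Gamma> (m + d) - \<Gamma> (m - d))) has_vector_derivative
      - \<i> * cis (- m) * (of_real (\<rho> (m + d)) * (\<i> * cis (m + d)) - - (of_real (\<rho> (m - d)) * (\<i> * cis (m - d))))) (at d)"
    by (intro has_vector_derivative_mult_right has_vector_derivative_diff 1 2)
  also have "- \<i> * cis (- m) * (of_real (\<rho> (m + d)) * (\<i> * cis (m + d)) - - (of_real (\<rho> (m - d)) * (\<i> * cis (m - d))))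
     = of_real (\<rho> (m + d)) * (cis (- m) * cis (m + d)) + of_real (\<rho> (m - d)) * (cis (- m) * cis (m - d))"
    by (simp add: algebra_simps)
  also have "\<dots> = of_real (\<rho> (m + d)) * cis d + of_real (\<rho> (m - d)) * cis (- d)"
    by (simp only: cis_mult) simp
  finally show ?thesis by (simp add: midchord_def[abs_def])
qed

lemma d_CC: "((\<lambda>d. CC m d) has_real_derivative (\<rho> (m + d) + \<rho> (m - d)) * cos d) (at d)"
  using bounded_linear.has_vector_derivative[OF bounded_linear_Re d_midchord[of m d]]
  by (simp add: CC_def[abs_def] has_real_derivative_iff_has_vector_derivative algebra_simps)

lemma d_SS: "((\<lambda>d. SS m d) has_real_derivative (\<rho> (m + d) - \<rho> (m - d)) * sin d) (at d)"
  using bounded_linear.has_vector_derivative[OF bounded_linear_Im d_midchord[of m d]]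
  by (simp add: SS_def[abs_def] has_real_derivative_iff_has_vector_derivative algebra_simps)

lemma CC_0: "CC m 0 = 0" and SS_0: "SS m 0 = 0" and CC_pi: "CC m pi = 0"
proof -
  have "\<Gamma> (m + pi) = \<Gamma> (m - pi)" using per\<Gamma>[of "m - pi"] by (simp add: algebra_simps)
  then show "CC m pi = 0" by (simp add: CC_def midchord_def)
qed (simp_all add: CC_def SS_def midchord_def)

lemma CC_ge: assumes "0 \<le> d" "d \<le> pi" shows "2 * (1 - \<epsilon>) * sin d \<le> CC m d"
proof -
  have "CC m d - 2 * (1 - \<epsilon>) * sin d \<ge> 0"
  proof (rule deriv_bump_nonneg[where a = 0 and c = pi and m = "pi/2" and f = "\<lambda>d. CC m d - 2 * (1 - \<epsilon>) * sin d"])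
    fix t show "((\<lambda>d. CC m d - 2 * (1 - \<epsilon>) * sin d) has_real_derivative (\<rho> (m + t) + \<rho> (m - t) - 2 * (1 - \<epsilon>)) * cos t) (at t)"
      by (rule derivative_eq_intros d_CC refl)+ (simp add: algebra_simps)
    show "0 \<le> t \<Longrightarrow> t \<le> pi/2 \<Longrightarrow> 0 \<le> (\<rho> (m + t) + \<rho> (m - t) - 2 * (1 - \<epsilon>)) * cos t"
      using rho_bounds[of "m + t"] rho_bounds[of "m - t"] cos_ge_zero[of t] by simp
    show "pi/2 \<le> t \<Longrightarrow> t \<le> pi \<Longrightarrow> (\<rho> (m + t) + \<rho> (m - t) - 2 * (1 - \<epsilon>)) * cos t \<le> 0"
      using rho_bounds[of "m + t"] rho_bounds[of "m - t"] cos_ge_zero[of "pi - t"] by (simp add: mult_nonneg_nonpos cos_diff)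
  qed (use assms CC_0 CC_pi in auto)
  then show ?thesis by simp
qed

lemma CC_pos: assumes "0 < d" "d < pi" shows "CC m d > 0"
proof -
  have "sin d > 0" using assms by (intro sin_gt_zero) auto
  then have "0 < 2 * (1 - \<epsilon>) * sin d" using eps by simp
  then show ?thesis using CC_ge[of d m] assms by linarith
qed

definition len :: "real \<Rightarrow> real \<Rightarrow> real" where "len a b = norm (\<Gamma> b - \<Gamma> a)"

text \<open>The normal angle whose tangent direction is that of the chord. Measuring from the mean
  angle with \<open>arctan\<close> gives a branch valid on the whole range
  \<open>0 < b - a < 2 * pi\<close>, because \<open>CC\<close> is positive there.\<close>

definition chang :: "real \<Rightarrow> real \<Rightarrow> real" where
  "chang a b = (a + b) / 2 + arctan (SS ((a + b) / 2) ((b - a) / 2) / CC ((a + b) / 2) ((b - a) / 2))"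

lemma complex_arctan_polar: assumes "Re z > 0" shows "z = of_real (norm z) * cis (arctan (Im z / Re z))"
proof -
  have "z \<noteq> 0" using assms by auto
  then have "z = of_real (norm z) * cis (Arg z)" by (metis rcis_cmod_Arg rcis_def)
  moreover have "Arg z = arctan (Im z / Re z)" using assms by (rule arg_conv_arctan)
  ultimately show ?thesis by simp
qed

text \<open>\<open>chang a b - a\<close> and \<open>b - chang a b\<close> are the angles between the
  chord and the tangents at its ends. Their sines are heights divided by the length, hence positive;
  together with the crude range given by \<open>arctan\<close> this puts both angles between
  \<open>0\<close> and \<open>pi\<close>.\<close>

lemma chord_polar:
  assumes "a < b" "b < a + 2 * pi"
  shows "\<Gamma> b - \<Gamma> a = of_real (len a b) * (\<i> * cis (chang a b))" and "len a b > 0"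
    and "0 < chang a b - a" "chang a b - a < pi" "0 < b - chang a b" "b - chang a b < pi"
    and "len a b * sin (chang a b - a) = height a b" "len a b * sin (b - chang a b) = height b a"
proof -
  define m where "m = (a + b) / 2"
  define d where "d = (b - a) / 2"
  have md: "m + d = b" "m - d = a" by (auto simp: m_def d_def field_simps)
  have d: "0 < d" "d < pi" using assms by (auto simp: d_def)
  define \<sigma> where "\<sigma> = arctan (SS m d / CC m d)"
  have ch: "chang a b = m + \<sigma>" by (simp add: chang_def \<sigma>_def m_def d_def)
  have mc: "midchord m d = of_real (norm (midchord m d)) * cis \<sigma>"
    using complex_arctan_polar[of "midchord m d"] CC_pos[OF d, of m] by (simp add: \<sigma>_def SS_def CC_def)
  have nm: "norm (midchord m d) = len a b" by (simp add: midchord_def len_def md norm_mult)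
  have "\<Gamma> b - \<Gamma> a = \<i> * cis m * midchord m d"
  proof -
    have "\<i> * cis m * midchord m d = (cis m * cis (- m)) * (\<Gamma> b - \<Gamma> a)"
      unfolding midchord_def md by (simp add: algebra_simps)
    then show ?thesis by (simp add: cis_mult)
  qed
  also have "\<dots> = \<i> * cis m * (of_real (len a b) * cis \<sigma>)" using mc nm by simp
  also have "\<dots> = of_real (len a b) * (\<i> * (cis m * cis \<sigma>))" by (simp add: algebra_simps)
  finally show *: "\<Gamma> b - \<Gamma> a = of_real (len a b) * (\<i> * cis (chang a b))" by (simp add: cis_mult ch)
  show lp: "len a b > 0" using CC_pos[OF d, of m] nm by (metis CC_def norm_le_zero_iff not_le_imp_less zero_complex.sel(1) less_irrefl)
  show 1: "len a b * sin (chang a b - a) = height a b"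
  proof -
    have "height a b = - inner (\<Gamma> b - \<Gamma> a) (cis a)" by (simp add: height_def inner_diff_left)
    then show ?thesis by (simp add: * inner_of_real_mult inner_i_cis)
  qed
  show 2: "len a b * sin (b - chang a b) = height b a"
  proof -
    have "height b a = inner (\<Gamma> b - \<Gamma> a) (cis b)" by (simp add: height_def)
    then show ?thesis by (simp add: * inner_of_real_mult inner_i_cis) (metis minus_diff_eq mult_minus_right sin_minus)
  qed
  have s1: "sin (chang a b - a) > 0" using 1 height_pos(1)[OF assms] lp by (metis zero_less_mult_pos)
  have s2: "sin (b - chang a b) > 0" using 2 height_pos(2)[OF assms] lp by (metis zero_less_mult_pos)
  have sg: "- (pi/2) < \<sigma>" "\<sigma> < pi/2" using arctan[of "SS m d / CC m d"] by (auto simp: \<sigma>_def)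
  have e1: "chang a b - a = d + \<sigma>" and e2: "b - chang a b = d - \<sigma>" unfolding ch using md by auto
  have pos: "0 < x \<and> x < pi" if "sin x > 0" "- (pi / 2) < x" "x < 3 * pi / 2" for x
  proof -
    have "\<not> x \<le> 0" using sin_ge_zero[of "- x"] that by auto
    moreover have "\<not> x \<ge> pi" using sin_ge_zero[of "x - pi"] that by (auto simp: sin_diff)
    ultimately show ?thesis by auto
  qed
  show "0 < chang a b - a" "chang a b - a < pi" using pos[OF s1] sg d unfolding e1 by auto
  show "0 < b - chang a b" "b - chang a b < pi" using pos[OF s2] sg d unfolding e2 by auto
qed

lemma d_norm_Gamma:
  assumes "\<Gamma> b \<noteq> p"
  shows "((\<lambda>b. norm (\<Gamma> b - p)) has_real_derivative \<rho> b * inner (\<i> * cis b) (sgn (\<Gamma> b - p))) (at b)"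
proof -
  have "((\<lambda>b. \<Gamma> b - p) has_derivative (\<lambda>h. h *\<^sub>R (of_real (\<rho> b) * (\<i> * cis b)))) (at b)"
    using d\<Gamma>[of b] by (auto simp: has_vector_derivative_def intro!: derivative_eq_intros)
  from has_derivative_compose[OF this has_derivative_norm] assms
  have "((\<lambda>b. norm (\<Gamma> b - p)) has_derivative (\<lambda>h. inner (h *\<^sub>R (of_real (\<rho> b) * (\<i> * cis b))) (sgn (\<Gamma> b - p)))) (at b)" by simp
  then show ?thesis unfolding has_field_derivative_def
    by (rule has_derivative_eq_rhs) (simp add: fun_eq_iff inner_of_real_mult)
qed

lemma sgn_chord: assumes "a < b" "b < a + 2 * pi" shows "sgn (\<Gamma> b - \<Gamma> a) = \<i> * cis (chang a b)"
proof -
  have n: "norm (\<Gamma> b - \<Gamma> a) = len a b" by (simp add: len_def)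
  have "sgn (\<Gamma> b - \<Gamma> a) = (\<Gamma> b - \<Gamma> a) / of_real (len a b)"
    by (simp add: sgn_eq n)
  also have "\<dots> = \<i> * cis (chang a b)" using chord_polar(1,2)[OF assms] by simp
  finally show ?thesis .
qed

lemma d_len_right: assumes "a < b" "b < a + 2 * pi"
  shows "((\<lambda>b. len a b) has_real_derivative \<rho> b * cos (b - chang a b)) (at b)"
proof -
  have "inner (\<i> * cis b) (sgn (\<Gamma> b - \<Gamma> a)) = cos (b - chang a b)"
    unfolding sgn_chord[OF assms] by (simp add: inner_complex_def cos_diff)
  moreover have "\<Gamma> b \<noteq> \<Gamma> a" using chord_polar(2)[OF assms] by (auto simp: len_def)
  ultimately show ?thesis using d_norm_Gamma[of b "\<Gamma> a"] by (simp add: len_def[abs_def])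
qed

lemma d_len_left: assumes "a < b" "b < a + 2 * pi"
  shows "((\<lambda>a. len a b) has_real_derivative - (\<rho> a * cos (chang a b - a))) (at a)"
proof -
  have "sgn (\<Gamma> a - \<Gamma> b) = - (\<i> * cis (chang a b))"
    using sgn_chord[OF assms] sgn_minus[of "\<Gamma> b - \<Gamma> a"] by simp
  then have "inner (\<i> * cis a) (sgn (\<Gamma> a - \<Gamma> b)) = - cos (chang a b - a)"
    by (simp add: inner_complex_def cos_diff)
  moreover have "\<Gamma> a \<noteq> \<Gamma> b" using chord_polar(2)[OF assms] by (auto simp: len_def)
  ultimately show ?thesis using d_norm_Gamma[of a "\<Gamma> b"] by (simp add: len_def[abs_def] norm_minus_commute)
qed

end

section \<open>Finite differences and elementary inequalities\<close>

lemma central_diff1: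
  fixes g g1 :: "real \<Rightarrow> real"
  assumes d: "\<And>x. (g has_real_derivative g1 x) (at x)" and B: "\<And>x. \<bar>g1 x\<bar> \<le> B" and t: "0 \<le> t"
  shows "\<bar>g (m + t) - g (m - t)\<bar> \<le> 2 * B * t"
proof (rule deriv_abs_bound[OF t, where f = "\<lambda>t. g (m + t) - g (m - t)" and g = "\<lambda>t. 2 * B * t"])
  fix t :: real
  show "((\<lambda>t. g (m + t) - g (m - t)) has_real_derivative (g1 (m + t) + g1 (m - t))) (at t)"
    by (rule derivative_eq_intros DERIV_chain2[OF d] refl | simp)+
  show "((\<lambda>t. 2 * B * t) has_real_derivative (2 * B)) (at t)"
    by (rule derivative_eq_intros refl | simp)+
  show "\<bar>g1 (m + t) + g1 (m - t)\<bar> \<le> 2 * B" using B[of "m + t"] B[of "m - t"] by linarith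
qed simp_all

lemma central_diff2:
  fixes g g1 g2 :: "real \<Rightarrow> real"
  assumes d: "\<And>x. (g has_real_derivative g1 x) (at x)" and d1: "\<And>x. (g1 has_real_derivative g2 x) (at x)"
    and B: "\<And>x. \<bar>g2 x\<bar> \<le> B" and t: "0 \<le> t"
  shows "\<bar>g (m + t) + g (m - t) - 2 * g m\<bar> \<le> B * t\<^sup>2"
proof (rule deriv_abs_bound[OF t, where f = "\<lambda>t. g (m + t) + g (m - t) - 2 * g m" and g = "\<lambda>t. B * t\<^sup>2"])
  fix t :: real
  show "((\<lambda>t. g (m + t) + g (m - t) - 2 * g m) has_real_derivative (g1 (m + t) - g1 (m - t))) (at t)"
    by (rule derivative_eq_intros DERIV_chain2[OF d] refl | simp)+
  show "((\<lambda>t. B * t\<^sup>2) has_real_derivative (2 * B * t)) (at t)"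
    by (rule derivative_eq_intros refl | simp)+
  show "\<bar>g1 (m + t) - g1 (m - t)\<bar> \<le> 2 * B * t" if "0 \<le> t" by (rule central_diff1[OF d1 B that])
qed simp_all

lemma central_diff3:
  fixes g g1 g2 g3 :: "real \<Rightarrow> real"
  assumes d: "\<And>x. (g has_real_derivative g1 x) (at x)" and d1: "\<And>x. (g1 has_real_derivative g2 x) (at x)"
    and d2: "\<And>x. (g2 has_real_derivative g3 x) (at x)"
    and B: "\<And>x. \<bar>g3 x\<bar> \<le> B" and t: "0 \<le> t"
  shows "\<bar>g (m + t) - g (m - t) - 2 * t * g1 m\<bar> \<le> B * t ^ 3 / 3"
proof (rule deriv_abs_bound[OF t, where f = "\<lambda>t. g (m + t) - g (m - t) - 2 * t * g1 m" and g = "\<lambda>t. B * t ^ 3 / 3"])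
  fix t :: real
  show "((\<lambda>t. g (m + t) - g (m - t) - 2 * t * g1 m) has_real_derivative (g1 (m + t) + g1 (m - t) - 2 * g1 m)) (at t)"
    by (rule derivative_eq_intros DERIV_chain2[OF d] refl | simp)+
  show "((\<lambda>t. B * t ^ 3 / 3) has_real_derivative (B * t\<^sup>2)) (at t)"
    by (rule derivative_eq_intros refl | simp)+
  show "\<bar>g1 (m + t) + g1 (m - t) - 2 * g1 m\<bar> \<le> B * t\<^sup>2" if "0 \<le> t" by (rule central_diff2[OF d1 d2 B that])
qed simp_all

lemma backward_diff2:
  fixes g g1 g2 :: "real \<Rightarrow> real"
  assumes d: "\<And>x. (g has_real_derivative g1 x) (at x)" and d1: "\<And>x. (g1 has_real_derivative g2 x) (at x)"
    and B: "\<And>x. \<bar>g2 x\<bar> \<le> B" and t: "0 \<le> t"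
  shows "\<bar>g (m - t) - g m + t * g1 m\<bar> \<le> B * t\<^sup>2 / 2"
proof (rule deriv_abs_bound[OF t, where f = "\<lambda>t. g (m - t) - g m + t * g1 m" and g = "\<lambda>t. B * t\<^sup>2 / 2"])
  fix t :: real
  show "((\<lambda>t. g (m - t) - g m + t * g1 m) has_real_derivative (g1 m - g1 (m - t))) (at t)"
    by (rule derivative_eq_intros DERIV_chain2[OF d] refl | simp)+
  show "((\<lambda>t. B * t\<^sup>2 / 2) has_real_derivative (B * t)) (at t)"
    by (rule derivative_eq_intros refl | simp)+
  show "\<bar>g1 m - g1 (m - t)\<bar> \<le> B * t" if "0 \<le> t"
  proof (rule deriv_abs_bound[OF that, where f = "\<lambda>t. g1 m - g1 (m - t)" and g = "\<lambda>t. B * t"])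
    fix t show "((\<lambda>t. g1 m - g1 (m - t)) has_real_derivative g2 (m - t)) (at t)"
      by (rule derivative_eq_intros DERIV_chain2[OF d1] refl | simp)+
    show "((\<lambda>t. B * t) has_real_derivative B) (at t)" by (rule derivative_eq_intros refl | simp)+
  qed (use B in auto)
qed simp_all

lemma sin_minus_x_cos_bound:
  fixes d :: real assumes "0 \<le> d"
  shows "\<bar>sin d - d * cos d\<bar> \<le> d ^ 3 / 3"
proof (rule deriv_abs_bound[OF assms, where f = "\<lambda>d. sin d - d * cos d" and g = "\<lambda>d. d ^ 3 / 3"])
  fix t :: real
  show "((\<lambda>d. sin d - d * cos d) has_real_derivative t * sin t) (at t)"
    by (rule derivative_eq_intros refl | simp)+
  show "((\<lambda>d. d ^ 3 / 3) has_real_derivative t * t) (at t)"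
    by (rule derivative_eq_intros refl | simp add: power2_eq_square)+
  show "0 \<le> t \<Longrightarrow> \<bar>t * sin t\<bar> \<le> t * t"
    using abs_sin_x_le_abs_x[of t] by (simp add: abs_mult mult_left_mono)
qed simp_all

text \<open>Both terms have leading part \<open>d^3\<close>; this cancellation is what leaves an
  error of order \<open>d^4\<close> in the chord direction in \<open>sig_expand\<close>.\<close>

lemma trig_quintic_bound:
  fixes d :: real assumes "0 \<le> d"
  shows "\<bar>3 * (sin d - d * cos d) - d\<^sup>2 * sin d\<bar> \<le> d ^ 5 / 15"
proof (rule deriv_abs_bound[OF assms, where f = "\<lambda>d. 3 * (sin d - d * cos d) - d\<^sup>2 * sin d" and g = "\<lambda>d. d ^ 5 / 15"])
  fix t :: real
  show "((\<lambda>d. 3 * (sin d - d * cos d) - d\<^sup>2 * sin d) has_real_derivative t * (sin t - t * cos t)) (at t)"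
    by (rule derivative_eq_intros refl | simp)+ (simp add: algebra_simps power2_eq_square)
  show "((\<lambda>d. d ^ 5 / 15) has_real_derivative t ^ 4 / 3) (at t)"
    by (rule derivative_eq_intros refl | simp)+
  show "0 \<le> t \<Longrightarrow> \<bar>t * (sin t - t * cos t)\<bar> \<le> t ^ 4 / 3"
    using mult_left_mono[OF sin_minus_x_cos_bound[of t], of t] by (simp add: abs_mult power4_eq_xxxx power3_eq_cube)
qed simp_all

lemma arctan_diff_bound: "\<bar>arctan z - z\<bar> \<le> \<bar>z\<bar> ^ 3 / 3"
proof -
  have *: "\<bar>arctan z - z\<bar> \<le> z ^ 3 / 3" if "0 \<le> z" for z :: real
  proof (rule deriv_abs_bound[OF that, where f = "\<lambda>z. arctan z - z" and g = "\<lambda>z. z ^ 3 / 3"])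
    fix t :: real
    show "((\<lambda>z. arctan z - z) has_real_derivative (inverse (1 + t\<^sup>2) - 1)) (at t)"
      by (rule derivative_eq_intros refl | simp)+
    show "((\<lambda>z. z ^ 3 / 3) has_real_derivative t\<^sup>2) (at t)"
      by (rule derivative_eq_intros refl | simp)+
    have p: "1 + t\<^sup>2 > 0" by (simp add: add_pos_nonneg)
    have "inverse (1 + t\<^sup>2) - 1 = - t\<^sup>2 / (1 + t\<^sup>2)" using p by (simp add: field_simps)
    then show "\<bar>inverse (1 + t\<^sup>2) - 1\<bar> \<le> t\<^sup>2" using p by (simp add: divide_simps) (simp add: algebra_simps)
  qed simp_all
  show ?thesis
  proof (cases "z \<ge> 0")
    case True then show ?thesis using *[of z] by simp
  next
    case False
    then show ?thesis using *[of "- z"] by (simp add: arctan_minus abs_minus_commute)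
  qed
qed

lemma ln_ratio_bound:
  fixes z :: real assumes "\<bar>z\<bar> \<le> 1/2"
  shows "\<bar>ln (1 - z) - ln (1 + z) + 2 * z\<bar> \<le> \<bar>z\<bar> ^ 3"
proof -
  have *: "\<bar>ln (1 - z) - ln (1 + z) + 2 * z\<bar> \<le> z ^ 3" if "0 \<le> z" "z \<le> 1/2" for z :: real
  proof (rule deriv_abs_bound[OF that(1), where f = "\<lambda>z. ln (1 - z) - ln (1 + z) + 2 * z" and g = "\<lambda>z. z ^ 3"])
    fix t :: real assume t: "0 \<le> t" "t \<le> z"
    then have t2: "t \<le> 1/2" using that by simp
    show "((\<lambda>z. ln (1 - z) - ln (1 + z) + 2 * z) has_real_derivative (- 2 * t\<^sup>2 / (1 - t\<^sup>2))) (at t)"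
    proof -
      have tt: "t * t \<le> 1/2 * (1/2)" using t t2 by (intro mult_mono) auto
      have "((\<lambda>z. ln (1 - z) - ln (1 + z) + 2 * z) has_real_derivative ((0 - 1) / (1 - t) - (0 + 1) / (1 + t) + 2)) (at t)"
        using t t2 by (auto intro!: derivative_eq_intros simp: divide_simps)
      moreover have "(0 - 1) / (1 - t) - (0 + 1) / (1 + t) + 2 = - 2 * t\<^sup>2 / (1 - t\<^sup>2)"
      proof -
        have "1 - t\<^sup>2 = (1 - t) * (1 + t)" by (simp add: algebra_simps power2_eq_square)
        then show ?thesis using t t2 by (simp add: divide_simps power2_eq_square, (simp add: algebra_simps)?)
      qed
      ultimately show ?thesis by simp
    qed
    show "((\<lambda>z. z ^ 3) has_real_derivative (3 * t\<^sup>2)) (at t)"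
      by (rule derivative_eq_intros refl | simp)+
    have tt: "t\<^sup>2 \<le> 1/4" using power_mono[OF t2 t(1), of 2] by (simp add: power2_eq_square)
    have "2 * t\<^sup>2 \<le> 3 * t\<^sup>2 * (1 - t\<^sup>2)"
    proof -
      have "t\<^sup>2 * t\<^sup>2 \<le> t\<^sup>2 * (1/4)" using tt by (intro mult_left_mono) auto
      moreover have "0 \<le> t\<^sup>2" by simp
      ultimately show ?thesis unfolding right_diff_distrib by linarith
    qed
    then show "\<bar>- 2 * t\<^sup>2 / (1 - t\<^sup>2)\<bar> \<le> 3 * t\<^sup>2" using tt by (simp add: abs_if divide_simps)
  qed simp_all
  show ?thesis
  proof (cases "z \<ge> 0")
    case True then show ?thesis using *[of z] assms by simp
  next
    case False
    then show ?thesis using *[of "- z"] assms by (simp add: abs_minus_commute algebra_simps)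
  qed
qed

lemma abs_exp_minus_one: fixes y :: real assumes "\<bar>y\<bar> \<le> 1" shows "\<bar>exp y - 1\<bar> \<le> 2 * \<bar>y\<bar>"
proof (cases "y \<ge> 0")
  case True
  have "exp y \<le> 1 + y + y\<^sup>2" using exp_bound[of y] True assms by simp
  moreover have "y\<^sup>2 \<le> y" using True assms by (simp add: power2_eq_square mult_left_le)
  ultimately show ?thesis using True exp_ge_add_one_self[of y] by linarith
next
  case False
  have "exp y \<ge> 1 + y" by (rule exp_ge_add_one_self)
  moreover have "exp y \<le> 1" using False by simp
  ultimately show ?thesis using False by linarith
qed

text \<open>All terms lie within the factors \<open>exp c\<close> and \<open>exp (- c)\<close> of
  \<open>a k\<close>, and so does their average.\<close>

lemma ln_average_bound:
  fixes a :: "nat \<Rightarrow> real"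
  assumes q: "q \<ge> 1" and pos: "\<And>k. k < q \<Longrightarrow> a k > 0" and S: "(\<Sum>k<q. a k) = S"
    and c: "\<And>j k. j < q \<Longrightarrow> k < q \<Longrightarrow> \<bar>ln (a j) - ln (a k)\<bar> \<le> c" and k: "k < q"
  shows "\<bar>ln (a k) - ln (S / real q)\<bar> \<le> c"
proof -
  have Sp: "S > 0" unfolding S[symmetric] using q pos by (intro sum_pos) (auto intro!: exI[of _ 0] simp: lessThan_empty_iff)
  have up: "a j \<le> a k * exp c" if "j < q" for j
  proof -
    have "ln (a j) \<le> ln (a k) + c" using c[OF that k] by linarith
    then have "exp (ln (a j)) \<le> exp (ln (a k) + c)" by (simp only: exp_le_cancel_iff)
    then show ?thesis using pos[OF that] pos[OF k] by (simp add: exp_add)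
  qed
  have lo: "a k * exp (- c) \<le> a j" if "j < q" for j
  proof -
    have "ln (a k) + - c \<le> ln (a j)" using c[OF that k] by linarith
    then have "exp (ln (a k) + - c) \<le> exp (ln (a j))" by (simp only: exp_le_cancel_iff)
    then show ?thesis using pos[OF that] pos[OF k] by (simp only: exp_add exp_ln)
  qed
  have "S \<le> real q * (a k * exp c)" unfolding S[symmetric] using sum_bounded_above[of "{..<q}" a "a k * exp c"] up by simp
  then have "S / real q \<le> a k * exp c" using q by (simp add: field_simps)
  then have "ln (S / real q) \<le> ln (a k * exp c)" using Sp q pos[OF k] by (subst ln_le_cancel_iff) auto
  then have 1: "ln (S / real q) \<le> ln (a k) + c" using pos[OF k] by (simp add: ln_mult)
  have "real q * (a k * exp (- c)) \<le> S" unfolding S[symmetric] using sum_bounded_below[of "{..<q}" "a k * exp (- c)" a] lo by simp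
  then have "a k * exp (- c) \<le> S / real q" using q by (simp add: field_simps)
  then have "ln (a k * exp (- c)) \<le> ln (S / real q)" using Sp q pos[OF k] by (subst ln_le_cancel_iff) auto
  then have 2: "ln (a k) - c \<le> ln (S / real q)" using pos[OF k] by (simp add: ln_mult)
  show ?thesis using 1 2 by linarith
qed

lemma sinc_diff_bound:
  fixes x y :: real assumes "0 < x" "x \<le> y"
  shows "\<bar>sin y / y - sin x / x\<bar> \<le> y / 3 * (y - x)"
proof -
  have "\<bar>(\<lambda>t. sin (x + t) / (x + t) - sin x / x) (y - x)\<bar> \<le> (\<lambda>t. y / 3 * t) (y - x)"
  proof (rule deriv_abs_bound[where f = "\<lambda>t. sin (x + t) / (x + t) - sin x / x" and g = "\<lambda>t. y / 3 * t"])
    fix t assume t: "0 \<le> t" "t \<le> y - x"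
    have p: "x + t > 0" using t assms by simp
    show "((\<lambda>t. sin (x + t) / (x + t) - sin x / x) has_real_derivative (((x + t) * cos (x + t) - sin (x + t)) / (x + t)\<^sup>2)) (at t)"
    proof -
      have "((\<lambda>t. sin (x + t) / (x + t) - sin x / x) has_real_derivative ((cos (x + t) * 1 * (x + t) - sin (x + t) * 1) / ((x + t) * (x + t)) - 0)) (at t)"
        by (intro DERIV_diff DERIV_const DERIV_divide DERIV_chain2[OF DERIV_sin]) (use p in \<open>auto intro!: derivative_eq_intros\<close>)
      then show ?thesis by (simp add: power2_eq_square mult_ac)
    qed
    show "((\<lambda>t. y / 3 * t) has_real_derivative (y / 3)) (at t)" by (rule derivative_eq_intros refl | simp)+
    have "\<bar>(x + t) * cos (x + t) - sin (x + t)\<bar> \<le> (x + t) ^ 3 / 3"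
      using sin_minus_x_cos_bound[of "x + t"] p by (simp add: abs_minus_commute)
    then have "\<bar>((x + t) * cos (x + t) - sin (x + t)) / (x + t)\<^sup>2\<bar> \<le> (x + t) / 3"
      using p by (simp add: abs_divide divide_simps power3_eq_cube power2_eq_square mult_ac)
    also have "\<dots> \<le> y / 3" using t by simp
    finally show "\<bar>((x + t) * cos (x + t) - sin (x + t)) / (x + t)\<^sup>2\<bar> \<le> y / 3" .
  qed (use assms in auto)
  then show ?thesis by simp
qed

lemma ex_antiderivative:
  fixes f :: "real \<Rightarrow> real"
  assumes "continuous_on UNIV f"
  shows "\<exists>F. F 0 = 0 \<and> (\<forall>x. (F has_real_derivative f x) (at x))"
proof -
  have "\<exists>F. \<forall>x. -\<infinity> < ereal x \<longrightarrow> ereal x < \<infinity> \<longrightarrow> (F has_vector_derivative f x) (at x)"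
    by (rule einterval_antiderivative) (use assms in \<open>auto simp: continuous_on_eq_continuous_at\<close>)
  then obtain F where F: "\<And>x. (F has_real_derivative f x) (at x)"
    by (auto simp: has_real_derivative_iff_has_vector_derivative)
  have "((\<lambda>x. F x - F 0) has_real_derivative f x) (at x)" for x
    using DERIV_diff[OF F DERIV_const[of "F 0"]] by simp
  then show ?thesis by (intro exI[of _ "\<lambda>x. F x - F 0"]) auto
qed

section \<open>Deflection of a chord and the adiabatic invariant\<close>

context billiard_curve
begin

text \<open>\<open>pp\<close>, \<open>pp1\<close> and \<open>pp2\<close> are the first three
  derivatives of \<open>ln \<rho>\<close>.\<close>

definition pp where "pp t = \<rho>1 t / \<rho> t"
definition pp1 where "pp1 t = \<rho>2 t / \<rho> t - (pp t)\<^sup>2"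
definition pp2 where "pp2 t = \<rho>3 t / \<rho> t - \<rho>2 t * \<rho>1 t / (\<rho> t)\<^sup>2 - 2 * pp t * pp1 t"

lemma d_ln_rho: "((\<lambda>t. ln (\<rho> t)) has_real_derivative pp t) (at t)"
  using DERIV_chain2[OF DERIV_ln[OF rho_pos] d\<rho>, of t] by (simp add: pp_def field_simps)

lemma d_pp: "(pp has_real_derivative pp1 t) (at t)"
proof -
  have "(pp has_real_derivative (\<rho>2 t * \<rho> t - \<rho>1 t * \<rho>1 t) / (\<rho> t * \<rho> t)) (at t)"
    unfolding pp_def[abs_def] by (intro DERIV_divide d\<rho> d\<rho>1) (use rho_pos[of t] in simp)
  moreover have "(\<rho>2 t * \<rho> t - \<rho>1 t * \<rho>1 t) / (\<rho> t * \<rho> t) = pp1 t"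
    using rho_pos[of t] by (simp add: pp1_def pp_def field_simps power2_eq_square)
  ultimately show ?thesis by simp
qed

lemma d_pp1: "(pp1 has_real_derivative pp2 t) (at t)"
proof -
  have "(pp1 has_real_derivative ((\<rho>3 t * \<rho> t - \<rho>2 t * \<rho>1 t) / (\<rho> t * \<rho> t) - 2 * (pp1 t * pp t))) (at t)"
  proof -
    have "((\<lambda>t. (pp t)\<^sup>2) has_real_derivative (2 * (pp1 t * pp t))) (at t)"
      using DERIV_power[OF d_pp, of 2 t] by simp
    then show ?thesis
      unfolding pp1_def[abs_def] by (intro DERIV_diff DERIV_divide d\<rho> d\<rho>2) (use rho_pos[of t] in \<open>simp_all add: pp1_def\<close>)
  qed
  moreover have "(\<rho>3 t * \<rho> t - \<rho>2 t * \<rho>1 t) / (\<rho> t * \<rho> t) - 2 * (pp1 t * pp t) = pp2 t"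
    using rho_pos[of t] by (simp add: pp2_def field_simps power2_eq_square)
  ultimately show ?thesis by simp
qed

lemma div_rho_bound: assumes "\<bar>x\<bar> \<le> B" shows "\<bar>x / \<rho> t\<bar> \<le> (501/500) * B"
proof -
  have B: "B \<ge> 0" using assms by linarith
  have "\<bar>x / \<rho> t\<bar> = \<bar>x\<bar> / \<rho> t" using rho_pos[of t] by simp
  also have "\<dots> \<le> B / (999/1000)" using assms rho_num[of t] B by (intro frac_le) auto
  also have "\<dots> \<le> (501/500) * B" using B by simp
  finally show ?thesis .
qed

lemma pp_bound: "\<bar>pp t\<bar> \<le> (501/500) * \<epsilon>"
  unfolding pp_def by (rule div_rho_bound[OF b\<rho>1])

lemma pp1_bound: "\<bar>pp1 t\<bar> \<le> (251/250) * \<epsilon>"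
proof -
  have "\<bar>pp t\<bar> * \<bar>pp t\<bar> \<le> ((501/500) * \<epsilon>) * (11/10000)" using pp_bound[of t] eps by (intro mult_mono) auto
  then have "\<bar>(pp t)\<^sup>2\<bar> \<le> (1/500) * \<epsilon>" using eps by (simp add: power2_eq_square abs_mult)
  then show ?thesis using div_rho_bound[OF b\<rho>2, of t t] unfolding pp1_def by linarith
qed

lemma pp2_bound: "\<bar>pp2 t\<bar> \<le> (101/100) * \<epsilon>"
proof -
  have 1: "\<bar>\<rho>3 t / \<rho> t\<bar> \<le> (501/500) * \<epsilon>" by (rule div_rho_bound[OF b\<rho>3])
  have "\<bar>\<rho>2 t / \<rho> t\<bar> * \<bar>pp t\<bar> \<le> ((501/500) * \<epsilon>) * (11/10000)"
    using pp_bound[of t] div_rho_bound[OF b\<rho>2, of t t] eps by (intro mult_mono) auto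
  moreover have "\<bar>\<rho>2 t * \<rho>1 t / (\<rho> t)\<^sup>2\<bar> = \<bar>\<rho>2 t / \<rho> t\<bar> * \<bar>pp t\<bar>" by (simp add: pp_def power2_eq_square abs_mult)
  ultimately have 2: "\<bar>\<rho>2 t * \<rho>1 t / (\<rho> t)\<^sup>2\<bar> \<le> (1/500) * \<epsilon>" using eps by linarith
  have "\<bar>pp t\<bar> * \<bar>pp1 t\<bar> \<le> ((501/500) * \<epsilon>) * (11/10000)" using pp_bound[of t] pp1_bound[of t] eps by (intro mult_mono) auto
  then have 3: "\<bar>2 * pp t * pp1 t\<bar> \<le> (3/1000) * \<epsilon>" using eps by (simp add: abs_mult)
  show ?thesis using 1 2 3 unfolding pp2_def by linarith
qed

text \<open>Deviation of the chord direction from the mean of the two normal angles; the chord makes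
  the angles \<open>d + sig m d\<close> and \<open>d - sig m d\<close> with the tangents at its
  ends.\<close>

definition sig where "sig m d = arctan (SS m d / CC m d)"

lemma CC_ge_lin: assumes "0 < d" "d \<le> pi / 2" shows "(999/1000) * d \<le> CC m d"
proof -
  have "(999/1000) * d \<le> (1 - \<epsilon>) * d" using eps assms by (intro mult_right_mono) auto
  also have "\<dots> \<le> 2 * (1 - \<epsilon>) * sin d"
  proof -
    have "2 * (1 - \<epsilon>) * (d / 2) \<le> 2 * (1 - \<epsilon>) * sin d" using assms eps by (intro mult_left_mono sin_ge_half) auto
    moreover have "2 * (1 - \<epsilon>) * (d / 2) = (1 - \<epsilon>) * d" by simp
    ultimately show ?thesis by linarith
  qed
  also have "\<dots> \<le> CC m d" using assms by (intro CC_ge) auto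
  finally show ?thesis .
qed

lemma SS_bound: assumes "0 \<le> d" shows "\<bar>SS m d\<bar> \<le> 2/3 * \<epsilon> * d ^ 3"
proof (rule deriv_abs_bound[OF assms, where f = "SS m" and g = "\<lambda>d. 2/3 * \<epsilon> * d ^ 3"])
  fix t :: real assume t: "0 \<le> t"
  show "(SS m has_real_derivative (\<rho> (m + t) - \<rho> (m - t)) * sin t) (at t)" by (rule d_SS)
  show "((\<lambda>d. 2/3 * \<epsilon> * d ^ 3) has_real_derivative (2 * \<epsilon> * t) * t) (at t)"
    by (rule derivative_eq_intros refl | simp add: power2_eq_square)+
  show "\<bar>(\<rho> (m + t) - \<rho> (m - t)) * sin t\<bar> \<le> (2 * \<epsilon> * t) * t"
    unfolding abs_mult using central_diff1[OF d\<rho> b\<rho>1 t, of m] abs_sin_x_le_abs_x[of t] t eps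
    by (intro mult_mono) auto
qed (simp_all add: SS_0)

lemma SS_expand: assumes "0 \<le> d" shows "\<bar>SS m d - 2 * \<rho>1 m * (sin d - d * cos d)\<bar> \<le> \<epsilon> * d ^ 5 / 15"
proof (rule deriv_abs_bound[OF assms, where f = "\<lambda>d. SS m d - 2 * \<rho>1 m * (sin d - d * cos d)" and g = "\<lambda>d. \<epsilon> * d ^ 5 / 15"])
  fix t :: real assume t: "0 \<le> t"
  show "((\<lambda>d. SS m d - 2 * \<rho>1 m * (sin d - d * cos d)) has_real_derivative (\<rho> (m + t) - \<rho> (m - t) - 2 * t * \<rho>1 m) * sin t) (at t)"
    by (rule derivative_eq_intros d_SS refl | simp)+ (simp add: algebra_simps)
  show "((\<lambda>d. \<epsilon> * d ^ 5 / 15) has_real_derivative (\<epsilon> * t ^ 3 / 3) * t) (at t)"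
    by (rule derivative_eq_intros refl | simp)+ (simp add: power4_eq_xxxx power3_eq_cube)
  show "\<bar>(\<rho> (m + t) - \<rho> (m - t) - 2 * t * \<rho>1 m) * sin t\<bar> \<le> (\<epsilon> * t ^ 3 / 3) * t"
    unfolding abs_mult using central_diff3[OF d\<rho> d\<rho>1 d\<rho>2 b\<rho>3 t, of m] abs_sin_x_le_abs_x[of t] t eps
    by (intro mult_mono) auto
qed (simp_all add: SS_0)

lemma CC_expand: assumes "0 \<le> d" shows "\<bar>CC m d - 2 * \<rho> m * sin d\<bar> \<le> \<epsilon> * d ^ 3 / 3"
proof (rule deriv_abs_bound[OF assms, where f = "\<lambda>d. CC m d - 2 * \<rho> m * sin d" and g = "\<lambda>d. \<epsilon> * d ^ 3 / 3"])
  fix t :: real assume t: "0 \<le> t"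
  show "((\<lambda>d. CC m d - 2 * \<rho> m * sin d) has_real_derivative (\<rho> (m + t) + \<rho> (m - t) - 2 * \<rho> m) * cos t) (at t)"
    by (rule derivative_eq_intros d_CC refl | simp)+ (simp add: algebra_simps)
  show "((\<lambda>d. \<epsilon> * d ^ 3 / 3) has_real_derivative (\<epsilon> * t\<^sup>2) * 1) (at t)"
    by (rule derivative_eq_intros refl | simp)+
  show "\<bar>(\<rho> (m + t) + \<rho> (m - t) - 2 * \<rho> m) * cos t\<bar> \<le> (\<epsilon> * t\<^sup>2) * 1"
    unfolding abs_mult using central_diff2[OF d\<rho> d\<rho>1 b\<rho>2 t, of m] t eps
    by (intro mult_mono) auto
qed (simp_all add: CC_0)

lemma SC_bound: assumes d: "0 < d" "d \<le> pi / 2" shows "\<bar>SS m d / CC m d\<bar> \<le> (7/10) * \<epsilon> * d\<^sup>2"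
proof -
  have C: "CC m d > 0" "(999/1000) * d \<le> CC m d" using CC_ge_lin[OF d, of m] d by auto
  have "\<bar>SS m d / CC m d\<bar> = \<bar>SS m d\<bar> / CC m d" using C by simp
  also have "\<dots> \<le> (2/3 * \<epsilon> * d ^ 3) / ((999/1000) * d)"
    using SS_bound[of d m] d C eps by (intro frac_le) auto
  also have "\<dots> = (2/3 / (999/1000)) * (\<epsilon> * d\<^sup>2)" using d by (simp add: power3_eq_cube power2_eq_square)
  also have "\<dots> \<le> (7/10) * (\<epsilon> * d\<^sup>2)" using eps by (intro mult_right_mono) auto
  finally show ?thesis by simp
qed

lemma sig_bound: assumes d: "0 < d" "d \<le> pi / 2" shows "\<bar>sig m d\<bar> \<le> (7/10) * \<epsilon> * d\<^sup>2"
  using SC_bound[OF assms, of m] abs_arctan_le[of "SS m d / CC m d"] unfolding sig_def by linarith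

lemma sig_expand: assumes d: "0 < d" "d \<le> pi / 2" shows "\<bar>sig m d - pp m / 3 * d\<^sup>2\<bar> \<le> (1/5) * \<epsilon> * d ^ 4"
proof -
  have C: "CC m d > 0" "(999/1000) * d \<le> CC m d" using CC_ge_lin[OF d, of m] d by auto
  define e1 where "e1 = SS m d - 2 * \<rho>1 m * (sin d - d * cos d)"
  define e2 where "e2 = CC m d - 2 * \<rho> m * sin d"
  define e3 where "e3 = 3 * (sin d - d * cos d) - d\<^sup>2 * sin d"
  have e: "\<bar>e1\<bar> \<le> \<epsilon> * d ^ 5 / 15" "\<bar>e2\<bar> \<le> \<epsilon> * d ^ 3 / 3" "\<bar>e3\<bar> \<le> d ^ 5 / 15"
    using SS_expand[of d m] CC_expand[of d m] trig_quintic_bound[of d] d by (auto simp: e1_def e2_def e3_def)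
  have r: "\<bar>\<rho> m\<bar> \<le> (1001/1000)" using rho_num[of m] by (auto simp: abs_le_iff)
  \<comment> \<open>The numerator of \<open>SS / CC - pp * d^2 / 3\<close>, up to a factor. When the
    leading parts of \<open>SS\<close> and \<open>CC\<close> are inserted only the combination
    \<open>e3\<close> survives, which is of fifth order.\<close>
  have num: "3 * \<rho> m * SS m d - \<rho>1 m * d\<^sup>2 * CC m d = 3 * (\<rho> m * e1) - \<rho>1 m * d\<^sup>2 * e2 + 2 * \<rho> m * \<rho>1 m * e3"
    by (simp add: e1_def e2_def e3_def algebra_simps)
  define E where "E = \<epsilon> * d ^ 5"
  have Ep: "E \<ge> 0" using eps d by (simp add: E_def)
  have 1: "\<bar>\<rho> m * e1\<bar> \<le> (1001/1000) * (E / 15)" unfolding abs_mult E_def by (intro mult_mono r e) auto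
  have 2: "\<bar>\<rho>1 m * d\<^sup>2 * e2\<bar> \<le> (1/1000) * (E / 3)"
  proof -
    have "\<bar>\<rho>1 m\<bar> * (d\<^sup>2 * \<bar>e2\<bar>) \<le> (1/1000) * (d\<^sup>2 * (\<epsilon> * d ^ 3 / 3))"
      using b\<rho>1[of m] eps e(2) by (intro mult_mono) auto
    also have "\<dots> = (1/1000) * (E / 3)" by (simp add: E_def eval_nat_numeral)
    finally show ?thesis by (simp add: abs_mult mult_ac)
  qed
  have 3: "\<bar>2 * \<rho> m * \<rho>1 m * e3\<bar> \<le> 2 * ((1001/1000) * (E / 15))"
  proof -
    have "\<bar>\<rho> m\<bar> * (\<bar>\<rho>1 m\<bar> * \<bar>e3\<bar>) \<le> (1001/1000) * (\<epsilon> * (d ^ 5 / 15))"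
      using b\<rho>1[of m] eps e(3) r by (intro mult_mono) auto
    then show ?thesis by (simp add: abs_mult E_def mult_ac)
  qed
  have N: "\<bar>3 * \<rho> m * SS m d - \<rho>1 m * d\<^sup>2 * CC m d\<bar> \<le> (17/50) * E"
    unfolding num using 1 2 3 Ep by linarith
  have "SS m d / CC m d - pp m / 3 * d\<^sup>2 = (3 * \<rho> m * SS m d - \<rho>1 m * d\<^sup>2 * CC m d) / (3 * \<rho> m * CC m d)"
    using C rho_pos[of m] by (simp add: pp_def field_simps)
  moreover have "\<bar>(3 * \<rho> m * SS m d - \<rho>1 m * d\<^sup>2 * CC m d) / (3 * \<rho> m * CC m d)\<bar> \<le> ((17/50) * E) / ((29/10) * d)"
  proof -
    have "(29/10) * d \<le> 3 * (999/1000) * ((999/1000) * d)" using d by simp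
    also have "\<dots> \<le> 3 * \<rho> m * CC m d" using rho_num[of m] C d by (intro mult_mono) auto
    finally have "(29/10) * d \<le> 3 * \<rho> m * CC m d" .
    then show ?thesis unfolding abs_divide using N d Ep by (intro frac_le) auto
  qed
  moreover have "((17/50) * E) / ((29/10) * d) \<le> (3/25) * \<epsilon> * d ^ 4"
  proof -
    have "((17/50) * E) / ((29/10) * d) = ((17/50) / (29/10)) * (\<epsilon> * d ^ 4)" using d by (simp add: E_def eval_nat_numeral)
    also have "\<dots> \<le> (3/25) * (\<epsilon> * d ^ 4)" using eps by (intro mult_right_mono) auto
    finally show ?thesis by simp
  qed
  ultimately have A: "\<bar>SS m d / CC m d - pp m / 3 * d\<^sup>2\<bar> \<le> (3/25) * \<epsilon> * d ^ 4" by simp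
  have "\<bar>sig m d - SS m d / CC m d\<bar> \<le> \<bar>SS m d / CC m d\<bar> ^ 3 / 3" unfolding sig_def by (rule arctan_diff_bound)
  also have "\<dots> \<le> ((7/10) * \<epsilon> * d\<^sup>2) ^ 3 / 3" by (intro divide_right_mono power_mono SC_bound[OF d]) auto
  also have "\<dots> = ((7/10) ^ 3 / 3 * \<epsilon>\<^sup>2 * d\<^sup>2) * (\<epsilon> * d ^ 4)" by (simp add: power_mult_distrib eval_nat_numeral)
  also have "\<dots> \<le> (1/100) * (\<epsilon> * d ^ 4)"
  proof (intro mult_right_mono)
    have "d \<le> 2" using d pi_less_4 by simp
    then have "d\<^sup>2 \<le> 2\<^sup>2" using d by (intro power_mono) auto
    moreover have "\<epsilon>\<^sup>2 \<le> (1/1000)\<^sup>2" using eps by (intro power_mono) auto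
    ultimately have "\<epsilon>\<^sup>2 * d\<^sup>2 \<le> (1/1000)\<^sup>2 * 2\<^sup>2" by (intro mult_mono) auto
    then show "(7/10) ^ 3 / 3 * \<epsilon>\<^sup>2 * d\<^sup>2 \<le> (1/100)" by (simp add: power2_eq_square power3_eq_cube)
  qed (use eps in auto)
  finally have "\<bar>sig m d - SS m d / CC m d\<bar> \<le> (1/100) * \<epsilon> * d ^ 4" by simp
  moreover have "0 \<le> \<epsilon> * d ^ 4" using eps by simp
  ultimately show ?thesis using A by linarith
qed

lemma step_bounds:
  fixes m d :: real
  assumes d: "0 < d" "d \<le> pi / 2"
  defines "z \<equiv> sig m d / d"
  shows "\<bar>z\<bar> \<le> (7/10) * \<epsilon> * d" "\<bar>z\<bar> \<le> 1 / 500" "\<bar>z - pp m / 3 * d\<bar> \<le> (1/5) * \<epsilon> * d ^ 3"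
proof -
  have "\<bar>z\<bar> = \<bar>sig m d\<bar> / d" using d by (simp add: z_def)
  also have "\<dots> \<le> (7/10) * \<epsilon> * d\<^sup>2 / d" using d by (intro divide_right_mono sig_bound) auto
  finally show 1: "\<bar>z\<bar> \<le> (7/10) * \<epsilon> * d" using d by (simp add: power2_eq_square)
  have "d \<le> 2" using d pi_less_4 by simp
  then have "(7/10) * \<epsilon> * d \<le> (7/10) * (1/1000) * 2" using eps d by (intro mult_mono) auto
  then show "\<bar>z\<bar> \<le> 1 / 500" using 1 by simp
  have "z - pp m / 3 * d = (sig m d - pp m / 3 * d\<^sup>2) / d" using d by (simp add: z_def field_simps power2_eq_square)
  then have "\<bar>z - pp m / 3 * d\<bar> = \<bar>sig m d - pp m / 3 * d\<^sup>2\<bar> / d" using d by simp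
  also have "\<dots> \<le> ((1/5) * \<epsilon> * d ^ 4) / d" using d by (intro divide_right_mono sig_expand) auto
  also have "\<dots> = (1/5) * \<epsilon> * d ^ 3" using d by (simp add: eval_nat_numeral)
  finally show "\<bar>z - pp m / 3 * d\<bar> \<le> (1/5) * \<epsilon> * d ^ 3" .
qed

lemma ln_split: fixes d z :: real assumes "0 < d" "\<bar>z\<bar> \<le> 1/500" shows "ln (d * (1 + z)) = ln d + ln (1 + z)" "ln (d * (1 - z)) = ln d + ln (1 - z)"
  using assms by (auto intro!: ln_mult_pos simp: abs_le_iff)

text \<open>The reflection angle times the cube root of the radius of curvature is nearly invariant:
  along a chord the logarithm of the angle drops by about \<open>2 * sig m d / d\<close>, that is
  \<open>2/3 * d * pp m\<close>, and a third of the change of \<open>ln \<rho>\<close> is the same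
  amount. Both are odd in \<open>d\<close>, so the error is cubic and not quadratic. The first bound
  is the crude version; the third compares with the value at the midpoint.\<close>

lemma adiabatic_step:
  assumes d: "0 < d" "d \<le> pi / 2"
  shows "\<bar>ln (d - sig m d) - ln (d + sig m d)\<bar> \<le> 3 * \<epsilon> * d"
    and "\<bar>(ln (d - sig m d) + ln (\<rho> (m + d)) / 3) - (ln (d + sig m d) + ln (\<rho> (m - d)) / 3)\<bar> \<le> 3 * \<epsilon> * d ^ 3"
    and "\<bar>(ln (d + sig m d) + ln (\<rho> (m - d)) / 3) - (ln d + ln (\<rho> m) / 3)\<bar> \<le> 3 * \<epsilon> * d\<^sup>2"
proof -
  define z where "z = sig m d / d"
  note zb = step_bounds[OF d, of m, folded z_def]
  have sd: "sig m d = d * z" using d by (simp add: z_def)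
  have L: "ln (d + sig m d) = ln d + ln (1 + z)" "ln (d - sig m d) = ln d + ln (1 - z)"
    using ln_split[OF d(1) zb(2)] by (simp_all add: sd algebra_simps)
  have d2: "d \<le> 2" using d pi_less_4 by simp
  define D2 D3 where "D2 = \<epsilon> * d\<^sup>2" and "D3 = \<epsilon> * d ^ 3"
  have Dp: "D2 \<ge> 0" "D3 \<ge> 0" using eps d by (auto simp: D2_def D3_def)
  have D32: "D3 \<le> 2 * D2"
    using mult_right_mono[OF d2, of "\<epsilon> * d\<^sup>2"] eps by (simp add: D2_def D3_def power3_eq_cube power2_eq_square mult_ac)
  have z3: "\<bar>z\<bar> ^ 3 \<le> (1/100) * D3"
  proof -
    have "\<bar>z\<bar> ^ 3 \<le> ((7/10) * \<epsilon> * d) ^ 3" by (intro power_mono zb) auto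
    also have "\<dots> = ((7/10) ^ 3 * \<epsilon>\<^sup>2) * D3" by (simp add: D3_def power_mult_distrib eval_nat_numeral)
    also have "\<dots> \<le> (1/100) * D3"
    proof (intro mult_right_mono Dp)
      have "\<epsilon>\<^sup>2 \<le> (1/1000)\<^sup>2" using eps by (intro power_mono) auto
      then show "(7/10) ^ 3 * \<epsilon>\<^sup>2 \<le> (1/100)" by (simp add: power2_eq_square power3_eq_cube)
    qed
    finally show ?thesis .
  qed
  have lr: "\<bar>ln (1 - z) - ln (1 + z) + 2 * z\<bar> \<le> \<bar>z\<bar> ^ 3" by (rule ln_ratio_bound) (use zb in simp)
  have z32: "\<bar>z\<bar> ^ 3 \<le> (1/10) * \<bar>z\<bar>"
  proof -
    have "\<bar>z\<bar>\<^sup>2 \<le> (1/500)\<^sup>2" by (intro power_mono zb) auto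
    then have "\<bar>z\<bar>\<^sup>2 * \<bar>z\<bar> \<le> (1/10) * \<bar>z\<bar>" by (intro mult_right_mono) (auto simp: power2_eq_square)
    then show ?thesis by (simp add: power3_eq_cube power2_eq_square)
  qed
  have "0 \<le> \<epsilon> * d" using eps d by simp
  then show "\<bar>ln (d - sig m d) - ln (d + sig m d)\<bar> \<le> 3 * \<epsilon> * d"
    unfolding L using lr z32 zb(1) by linarith
  define P where "P = d * pp m"
  have z3b: "\<bar>z - P / 3\<bar> \<le> (1/5) * D3" using zb(3) by (simp add: D3_def P_def mult_ac)
  have lr3: "\<bar>ln (1 - z) - ln (1 + z) + 2 * z\<bar> \<le> (1/100) * D3" using lr z3 by linarith
  have c3: "\<bar>ln (\<rho> (m + d)) - ln (\<rho> (m - d)) - 2 * P\<bar> \<le> (101/100) * D3 / 3"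
    using central_diff3[OF d_ln_rho d_pp d_pp1 pp2_bound, of d m] d by (simp add: D3_def P_def mult.assoc)
  have "\<bar>(ln (d - sig m d) + ln (\<rho> (m + d)) / 3) - (ln (d + sig m d) + ln (\<rho> (m - d)) / 3)\<bar> \<le> 3 * D3"
    unfolding L using lr3 z3b c3 Dp by linarith
  then show "\<bar>(ln (d - sig m d) + ln (\<rho> (m + d)) / 3) - (ln (d + sig m d) + ln (\<rho> (m - d)) / 3)\<bar> \<le> 3 * \<epsilon> * d ^ 3"
    by (simp add: D3_def)
  have l1: "\<bar>ln (1 + z) - z\<bar> \<le> 2 * z\<^sup>2" by (rule abs_ln_one_plus_x_minus_x_bound) (use zb in simp)
  have "\<bar>z\<bar>\<^sup>2 \<le> ((7/10) * \<epsilon> * d)\<^sup>2" by (intro power_mono zb) auto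
  also have "\<dots> = ((7/10)\<^sup>2 * \<epsilon>) * D2" by (simp add: D2_def power_mult_distrib eval_nat_numeral)
  also have "\<dots> \<le> (1/100) * D2" using Dp eps by (intro mult_right_mono) (auto simp: power2_eq_square)
  finally have z2: "z\<^sup>2 \<le> (1/100) * D2" by simp
  have b2: "\<bar>ln (\<rho> (m - d)) - ln (\<rho> m) + P\<bar> \<le> (251/250) * D2 / 2"
    using backward_diff2[OF d_ln_rho d_pp pp1_bound, of d m] d by (simp add: D2_def P_def mult.assoc)
  have "\<bar>(ln (d + sig m d) + ln (\<rho> (m - d)) / 3) - (ln d + ln (\<rho> m) / 3)\<bar> \<le> 3 * D2"
    unfolding L using l1 z2 z3b b2 D32 Dp by linarith
  then show "\<bar>(ln (d + sig m d) + ln (\<rho> (m - d)) / 3) - (ln d + ln (\<rho> m) / 3)\<bar> \<le> 3 * \<epsilon> * d\<^sup>2"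
    by (simp add: D2_def)
qed

end

subsection \<open>Lazutkin coordinates and orbits of rotation number 1/q\<close>

context billiard_curve
begin

text \<open>The cube root of \<open>\<rho>\<close>, written so that \<open>d_ln_rho\<close>
  differentiates it. Lazutkin's density is \<open>\<rho>\<close> to the power \<open>-2/3\<close> in
  arc length, which is the power \<open>1/3\<close> in the normal angle since
  \<open>s' = \<rho>\<close>.\<close>

definition cr where "cr t = exp (ln (\<rho> t) / 3)"

lemma d_cr: "(cr has_real_derivative (cr t * (pp t / 3))) (at t)"
  unfolding cr_def[abs_def] using DERIV_chain2[OF DERIV_exp DERIV_cdivide[OF d_ln_rho, of 3]] by simp

lemma cr_pos: "cr t > 0" by (simp add: cr_def)

lemma cr_cube: "cr t ^ 3 = \<rho> t"
  using exp_of_nat_mult[of 3 "ln (\<rho> t) / 3"] rho_pos[of t] by (simp add: cr_def)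

lemma cr_bounds: "99/100 \<le> cr t" "cr t \<le> 101/100"
proof -
  show "cr t \<le> 101/100"
  proof (rule ccontr)
    assume "\<not> ?thesis"
    then have "(101/100) ^ 3 \<le> cr t ^ 3" by (intro power_mono) auto
    then have "(101/100) ^ 3 \<le> \<rho> t" unfolding cr_cube .
    then show False using rho_num[of t] by (simp add: power3_eq_cube)
  qed
  show "99/100 \<le> cr t"
  proof (rule ccontr)
    assume "\<not> ?thesis"
    then have "cr t ^ 3 \<le> (99/100) ^ 3" using cr_pos[of t] by (intro power_mono) auto
    then have "\<rho> t \<le> (99/100) ^ 3" unfolding cr_cube .
    then show False using rho_num[of t] by (simp add: power3_eq_cube)
  qed
qed

definition lz where "lz = (SOME F. F 0 = 0 \<and> (\<forall>x. (F has_real_derivative cr x) (at x)))"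

lemma lz: "lz 0 = 0" "(lz has_real_derivative cr x) (at x)"
proof -
  have "continuous_on UNIV cr" by (intro continuous_at_imp_continuous_on ballI DERIV_isCont[OF d_cr])
  from someI_ex[OF ex_antiderivative[OF this]] show "lz 0 = 0" "(lz has_real_derivative cr x) (at x)"
    unfolding lz_def by auto
qed

definition KK where "KK = lz (2 * pi)"

lemma KK_bounds: "99/100 * (2 * pi) \<le> KK" "KK \<le> 101/100 * (2 * pi)" "KK > 0"
proof -
  have "lz (2 * pi) - 99/100 * (2 * pi) \<ge> lz 0 - 99/100 * 0"
    by (rule DERIV_nonneg_imp_nondecreasing[where f = "\<lambda>t. lz t - 99/100 * t"])
       (use cr_bounds in \<open>auto intro!: derivative_eq_intros lz exI[of _ "cr _ - 99/100"]\<close>)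
  then show 1: "99/100 * (2 * pi) \<le> KK" by (simp add: KK_def lz)
  have "101/100 * (2 * pi) - lz (2 * pi) \<ge> 101/100 * 0 - lz 0"
    by (rule DERIV_nonneg_imp_nondecreasing[where f = "\<lambda>t. 101/100 * t - lz t"])
       (use cr_bounds in \<open>auto intro!: derivative_eq_intros lz exI[of _ "101/100 - cr _"]\<close>)
  then show "KK \<le> 101/100 * (2 * pi)" by (simp add: KK_def lz)
  show "KK > 0" by (rule less_le_trans[OF _ 1]) simp
qed

lemma KK_num: "6 \<le> KK" "KK \<le> 7"
  using KK_bounds pi_gt3 pi_approx by auto

definition XX where "XX t = lz t / KK"

lemma XX_0: "XX 0 = 0" and XX_2pi: "XX (2 * pi) = 1"
  using KK_bounds(3) by (simp_all add: XX_def lz KK_def)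

lemma d_XX: "(XX has_real_derivative cr t / KK) (at t)"
  unfolding XX_def[abs_def] by (intro DERIV_cdivide lz)

lemma per_cr: "cr (t + 2 * pi) = cr t" by (simp add: cr_def per\<rho>)

lemma XX_per: "XX (t + 2 * pi) = XX t + 1"
proof -
  have "((\<lambda>t. XX (t + 2 * pi) - XX t) has_real_derivative 0) (at x)" for x
  proof -
    have "((\<lambda>t. t + 2 * pi) has_real_derivative 1) (at x)" by (auto intro!: derivative_eq_intros)
    from DERIV_diff[OF DERIV_chain2[OF d_XX this] d_XX[of x]] show ?thesis by (simp add: per_cr)
  qed
  then have "XX (t + 2 * pi) - XX t = XX (0 + 2 * pi) - XX 0"
    by (intro DERIV_isconst_all allI) auto
  then show ?thesis by (simp add: XX_0 XX_2pi)
qed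

text \<open>The increment of the Lazutkin coordinate along a chord is \<open>2 / KK\<close> times
  the adiabatic invariant at the midpoint, up to a relative error from the second derivative of the
  density. Equal invariants therefore mean equal steps.\<close>

lemma XX_step:
  assumes d: "0 < d" "d \<le> pi / 2"
  shows "XX (m + d) - XX (m - d) > 0"
    and "\<bar>ln (XX (m + d) - XX (m - d)) - (ln (2 / KK) + ln d + ln (\<rho> m) / 3)\<bar> \<le> 2 * \<epsilon> * d\<^sup>2"
proof -
  define R where "R t = cr t / KK" for t
  have d1: "(R has_real_derivative (R t * (pp t / 3))) (at t)" for t
    unfolding R_def[abs_def] using DERIV_cdivide[OF d_cr, of KK t] by (simp add: mult_ac)
  have d2: "((\<lambda>t. R t * (pp t / 3)) has_real_derivative (R t * ((pp t)\<^sup>2 / 9 + pp1 t / 3))) (at t)" for t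
    using DERIV_mult[OF d1 DERIV_cdivide[OF d_pp, of 3], of t] by (simp add: algebra_simps power2_eq_square)
  have dX: "(XX has_real_derivative R t) (at t)" for t unfolding R_def by (rule d_XX)
  have Rm: "R t \<le> 11/10 * R m" for t
  proof -
    have "cr t \<le> 11/10 * cr m" using cr_bounds[of t] cr_bounds[of m] by linarith
    then have "cr t / KK \<le> 11/10 * cr m / KK" using KK_bounds(3) by (intro divide_right_mono) auto
    then show ?thesis by (simp add: R_def)
  qed
  have Rp: "R t > 0" for t using cr_pos KK_bounds(3) by (simp add: R_def)
  have B: "\<bar>R t * ((pp t)\<^sup>2 / 9 + pp1 t / 3)\<bar> \<le> 1/2 * \<epsilon> * R m" for t
  proof -
    have "\<bar>pp t\<bar> * \<bar>pp t\<bar> \<le> ((501/500) * \<epsilon>) * (11/10000)" using pp_bound[of t] eps by (intro mult_mono) auto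
    then have "\<bar>(pp t)\<^sup>2\<bar> \<le> (1/500) * \<epsilon>" using eps by (simp add: power2_eq_square abs_mult)
    then have "\<bar>(pp t)\<^sup>2 / 9 + pp1 t / 3\<bar> \<le> 2/5 * \<epsilon>" using pp1_bound[of t] by linarith
    then have "R t * \<bar>(pp t)\<^sup>2 / 9 + pp1 t / 3\<bar> \<le> (11/10 * R m) * (2/5 * \<epsilon>)"
      using Rm[of t] Rp[of t] Rp[of m] by (intro mult_mono) auto
    also have "\<dots> \<le> 1/2 * \<epsilon> * R m" using Rp[of m] eps by simp
    finally show ?thesis using Rp[of t] by (simp add: abs_mult)
  qed
  define W where "W = 2 * d * R m"
  have W: "W > 0" using Rp d by (simp add: W_def)
  have "\<bar>XX (m + d) - XX (m - d) - W\<bar> \<le> (1/2 * \<epsilon> * R m) * d ^ 3 / 3"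
    using central_diff3[OF dX d1 d2 B, of d m] d by (simp add: W_def)
  also have "\<dots> = (\<epsilon> * d\<^sup>2 / 12) * W" by (simp add: W_def eval_nat_numeral)
  finally have b: "\<bar>XX (m + d) - XX (m - d) - W\<bar> \<le> (\<epsilon> * d\<^sup>2 / 12) * W" .
  define e where "e = (XX (m + d) - XX (m - d) - W) / W"
  have X: "XX (m + d) - XX (m - d) = W * (1 + e)" using W by (simp add: e_def field_simps)
  have e: "\<bar>e\<bar> \<le> \<epsilon> * d\<^sup>2 / 12" unfolding e_def abs_divide using b W by (simp add: field_simps)
  have d2: "d \<le> 2" using d pi_less_4 by simp
  have "\<epsilon> * d\<^sup>2 \<le> (1/1000) * 2\<^sup>2" using eps d2 d by (intro mult_mono power_mono) auto
  then have e1: "\<bar>e\<bar> \<le> 1/100" using e by simp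
  show "XX (m + d) - XX (m - d) > 0" unfolding X using W e1 by (intro mult_pos_pos) (auto simp: abs_le_iff)
  have "ln (XX (m + d) - XX (m - d)) = ln W + ln (1 + e)"
    unfolding X using W e1 by (intro ln_mult_pos) (auto simp: abs_le_iff)
  moreover have "ln W = ln (2 / KK) + ln d + ln (\<rho> m) / 3"
  proof -
    have "W = (2 / KK) * (d * cr m)" by (simp add: W_def R_def)
    moreover have "ln ((2 / KK) * (d * cr m)) = ln (2 / KK) + ln (d * cr m)" using KK_bounds(3) d cr_pos[of m] by (intro ln_mult_pos) auto
    moreover have "ln (d * cr m) = ln d + ln (cr m)" using d cr_pos[of m] by (intro ln_mult_pos) auto
    ultimately have "ln W = ln (2 / KK) + (ln d + ln (cr m))" by simp
    then show ?thesis by (simp add: cr_def)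
  qed
  moreover have "\<bar>ln (1 + e)\<bar> \<le> 2 * \<epsilon> * d\<^sup>2"
  proof -
    have "\<bar>ln (1 + e) - e\<bar> \<le> 2 * e\<^sup>2" by (rule abs_ln_one_plus_x_minus_x_bound) (use e1 in simp)
    moreover have "\<bar>e\<bar> * \<bar>e\<bar> \<le> 1/100 * \<bar>e\<bar>" by (intro mult_right_mono e1) auto
    then have "e\<^sup>2 \<le> 1/100 * \<bar>e\<bar>" by (simp add: power2_eq_square flip: abs_mult)
    moreover have "0 \<le> \<epsilon> * d\<^sup>2" using eps by simp
    ultimately show ?thesis using e by linarith
  qed
  ultimately show "\<bar>ln (XX (m + d) - XX (m - d)) - (ln (2 / KK) + ln d + ln (\<rho> m) / 3)\<bar> \<le> 2 * \<epsilon> * d\<^sup>2" by simp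
qed

text \<open>A billiard orbit of rotation number \<open>1/q\<close>: \<open>\<theta> k\<close> are the normal angles at the vertices and
  \<open>\<phi> k\<close> the angles of reflection there.\<close>

definition orbit :: "nat \<Rightarrow> (nat \<Rightarrow> real) \<Rightarrow> (nat \<Rightarrow> real) \<Rightarrow> bool" where
  "orbit q \<theta> \<phi> \<longleftrightarrow> q \<ge> 2 \<and> \<theta> 0 = 0 \<and> \<theta> q = 2 * pi \<and> \<phi> q = \<phi> 0 \<and>
     (\<forall>k<q. \<theta> k < \<theta> (Suc k) \<and> \<theta> (Suc k) < \<theta> k + 2 * pi \<and>
        chang (\<theta> k) (\<theta> (Suc k)) - \<theta> k = \<phi> k \<and> \<theta> (Suc k) - chang (\<theta> k) (\<theta> (Suc k)) = \<phi> (Suc k))"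

text \<open>A bootstrap. The half gaps sum to \<open>pi\<close>, so the crude step bound makes all
  reflection angles comparable, hence close to \<open>pi / q\<close>; then the cubic errors of
  \<open>q\<close> steps add up to only a multiple of \<open>\<epsilon> / q^2\<close>. The steps of
  \<open>XX\<close> are thus equal up to that relative error, and they sum to 1. The divisor
  \<open>real q * sin (pi / real q) / pi\<close> in the second bound is the value of the numerator
  for the circle.\<close>

lemma orbit_estimates:
  assumes o: "orbit q \<theta> \<phi>" and k: "k < q"
  shows "\<bar>XX (\<theta> (Suc k)) - XX (\<theta> k) - 1 / real q\<bar> \<le> 1000 * \<epsilon> / real q ^ 3"
    and "\<bar>2 * real q * sin (\<phi> k) * (cr (\<theta> k) / KK) / (real q * sin (pi / real q) / pi) - 1\<bar> \<le> 1000 * \<epsilon> / (real q)\<^sup>2"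
    and "0 < sin (\<phi> k)"
proof -
  have q: "q \<ge> 2" and \<theta>0: "\<theta> 0 = 0" "\<theta> q = 2 * pi" and \<phi>q: "\<phi> q = \<phi> 0" using o by (auto simp: orbit_def)
  have gap: "\<theta> k < \<theta> (Suc k)" "\<theta> (Suc k) < \<theta> k + 2 * pi" if "k < q" for k using o that by (auto simp: orbit_def)
  have ang: "chang (\<theta> k) (\<theta> (Suc k)) - \<theta> k = \<phi> k" "\<theta> (Suc k) - chang (\<theta> k) (\<theta> (Suc k)) = \<phi> (Suc k)" if "k < q" for k
    using o that by (auto simp: orbit_def)
  define d m where "d k = (\<theta> (Suc k) - \<theta> k) / 2" and "m k = (\<theta> k + \<theta> (Suc k)) / 2" for k
  have md: "m k + d k = \<theta> (Suc k)" "m k - d k = \<theta> k" for k by (auto simp: d_def m_def field_simps)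
  have \<phi>p: "\<phi> k > 0" "\<phi> k < pi" if "k < q" for k using chord_polar(3,4)[OF gap[OF that]] ang[OF that] by auto
  have \<phi>p': "\<phi> k > 0" if "k \<le> q" for k using \<phi>p(1) that \<phi>q q by (cases "k = q") auto
  have ch: "chang (\<theta> k) (\<theta> (Suc k)) = m k + sig (m k) (d k)" for k by (simp add: chang_def sig_def m_def d_def)
  have \<phi>1: "\<phi> k = d k + sig (m k) (d k)" "\<phi> (Suc k) = d k - sig (m k) (d k)" if "k < q" for k
    using ang[OF that] md[of k] unfolding ch by linarith+
  have dd: "2 * d k = \<phi> k + \<phi> (Suc k)" if "k < q" for k using \<phi>1[OF that] by simp
  have dpos: "d k > 0" if "k < q" for k using gap(1)[OF that] by (simp add: d_def)
  have sumd: "(\<Sum>k<q. d k) = pi"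
  proof -
    have "(\<Sum>k<q. d k) = (\<Sum>k<q. \<theta> (Suc k) - \<theta> k) / 2" by (simp add: d_def sum_divide_distrib)
    also have "(\<Sum>k<q. \<theta> (Suc k) - \<theta> k) = \<theta> q - \<theta> 0" by (rule sum_lessThan_telescope)
    finally show ?thesis by (simp add: \<theta>0)
  qed
  have sumphi: "(\<Sum>k<q. \<phi> k) = pi"
  proof -
    have "(\<Sum>k<q. 2 * d k) = (\<Sum>k<q. \<phi> k) + (\<Sum>k<q. \<phi> (Suc k))" using dd by (simp add: sum.distrib)
    moreover have "(\<Sum>k<q. \<phi> (Suc k)) = (\<Sum>k<q. \<phi> k)"
    proof -
      have "(\<Sum>k<q. \<phi> (Suc k) - \<phi> k) = \<phi> q - \<phi> 0" by (rule sum_lessThan_telescope)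
      then show ?thesis using \<phi>q by (simp add: sum_subtractf)
    qed
    ultimately show ?thesis using sumd by (simp add: sum_distrib_left[symmetric])
  qed
  have dle: "d k \<le> pi / 2" if "k < q" for k
  proof -
    \<comment> \<open>Two different reflection angles together are at most the sum of all, which is
      \<open>pi\<close>; since \<open>q \<ge> 2\<close> the two ends of a side are different
      vertices.\<close>
    have two: "\<phi> i + \<phi> j \<le> pi" if "i < q" "j < q" "i \<noteq> j" for i j
    proof -
      have "sum \<phi> {i, j} \<le> sum \<phi> {..<q}" using that \<phi>p(1) by (intro sum_mono2) (auto intro: less_imp_le)
      then show ?thesis using that sumphi by simp
    qed
    have "\<phi> k + \<phi> (Suc k) \<le> pi"
    proof (cases "Suc k = q")
      case True then show ?thesis using two[of k 0] \<phi>q q that by auto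
    next
      case False then show ?thesis using two[of k "Suc k"] that by auto
    qed
    then show ?thesis using dd[OF that] by simp
  qed
  have seqb: "\<bar>f j - f i\<bar> \<le> (\<Sum>k<q. c k)" if st: "\<And>k. k < q \<Longrightarrow> \<bar>f (Suc k) - f k\<bar> \<le> c k" and i: "i < q" "j < q" for f c :: "nat \<Rightarrow> real" and i j
  proof -
    have cn: "c k \<ge> 0" if "k < q" for k using st[OF that] by linarith
    have *: "\<bar>f j - f i\<bar> \<le> (\<Sum>k\<in>{i..<j}. c k)" if "i \<le> j" "j < q" for i j
    proof -
      have "f j - f i = (\<Sum>k\<in>{i..<j}. f (Suc k) - f k)" using sum_Suc_diff'[OF that(1), of f] by simp
      then have "\<bar>f j - f i\<bar> \<le> (\<Sum>k\<in>{i..<j}. \<bar>f (Suc k) - f k\<bar>)" by simp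
      also have "\<dots> \<le> (\<Sum>k\<in>{i..<j}. c k)" using that by (intro sum_mono st) auto
      finally show ?thesis .
    qed
    have **: "(\<Sum>k\<in>{i..<j}. c k) \<le> (\<Sum>k<q. c k)" if "j < q" for i j using that cn by (intro sum_mono2) auto
    show ?thesis using *[of i j] *[of j i] **[of i j] **[of j i] i by (cases "i \<le> j") (auto simp: abs_minus_commute)
  qed
  \<comment> \<open>First pass, with the crude bound of order \<open>\<epsilon> * d\<close>.\<close>
  have lnphi: "\<bar>ln (\<phi> j) - ln (\<phi> i)\<bar> \<le> 10 * \<epsilon>" if "i < q" "j < q" for i j
  proof -
    have "\<bar>ln (\<phi> j) - ln (\<phi> i)\<bar> \<le> (\<Sum>k<q. 3 * \<epsilon> * d k)"
      using adiabatic_step(1)[OF dpos dle] \<phi>1 that by (intro seqb) auto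
    also have "\<dots> = 3 * pi * \<epsilon>" using sumd by (simp add: sum_distrib_left[symmetric])
    also have "\<dots> \<le> 10 * \<epsilon>" using pi_approx eps by (intro mult_right_mono) auto
    finally show ?thesis .
  qed
  have lnphi2: "\<bar>ln (\<phi> k) - ln (pi / real q)\<bar> \<le> 10 * \<epsilon>" if "k < q" for k
    by (rule ln_average_bound[OF _ _ sumphi _ that]) (use q \<phi>p lnphi in auto)
  have pq: "pi / real q > 0" using q by simp
  have phib: "\<bar>\<phi> k - pi / real q\<bar> \<le> pi / real q * (20 * \<epsilon>)" if "k < q" for k
  proof -
    define y where "y = ln (\<phi> k) - ln (pi / real q)"
    have y: "\<bar>y\<bar> \<le> 10 * \<epsilon>" using lnphi2[OF that] by (simp add: y_def)
    have "exp y = \<phi> k / (pi / real q)" unfolding y_def exp_diff using \<phi>p(1)[OF that] pq by (simp only: exp_ln)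
    then have "\<phi> k = pi / real q * exp y" using pq q by (simp add: field_simps)
    then have "\<phi> k - pi / real q = pi / real q * (exp y - 1)" by (simp only: right_diff_distrib mult_1_right)
    moreover have "\<bar>exp y - 1\<bar> \<le> 20 * \<epsilon>" using abs_exp_minus_one[of y] y eps by linarith
    ultimately show ?thesis using pq by (simp only: abs_mult abs_of_pos) (intro mult_left_mono; simp)
  qed
  have phile: "\<phi> k \<le> 33/10 / real q" if "k < q" for k
  proof -
    have "pi / real q * (20 * \<epsilon>) \<le> pi / real q * (20 * (1/1000))" using eps pq by (intro mult_left_mono) auto
    then have "\<phi> k \<le> pi / real q * (51/50)" using phib[OF that] unfolding abs_le_iff by (simp add: algebra_simps)
    also have "\<dots> \<le> 33/10 / real q"
    proof -
      have "pi * (51/50) \<le> 33/10" using pi_approx by simp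
      then show ?thesis using q by (simp add: field_simps)
    qed
    finally show ?thesis .
  qed
  have dq: "d k \<le> 33/10 / real q" if "k < q" for k
  proof (cases "Suc k = q")
    case True
    then show ?thesis using dd[OF that] phile[OF that] phile[of 0] \<phi>q q by auto
  next
    case False
    then show ?thesis using dd[OF that] phile[OF that] phile[of "Suc k"] that by auto
  qed
  have d2: "\<epsilon> * (d k)\<^sup>2 \<le> 11 * \<epsilon> / (real q)\<^sup>2" and d3: "\<epsilon> * (d k) ^ 3 \<le> 36 * \<epsilon> / real q ^ 3" if "k < q" for k
  proof -
    have "(d k)\<^sup>2 \<le> (33/10 / real q)\<^sup>2" using dq[OF that] dpos[OF that] by (intro power_mono) auto
    also have "\<dots> \<le> 11 / (real q)\<^sup>2" unfolding power_divide by (intro divide_right_mono) (auto simp: power2_eq_square)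
    finally show "\<epsilon> * (d k)\<^sup>2 \<le> 11 * \<epsilon> / (real q)\<^sup>2" using mult_left_mono[of "(d k)\<^sup>2" "11 / (real q)\<^sup>2" \<epsilon>] eps by (simp add: mult_ac)
    have "(d k) ^ 3 \<le> (33/10 / real q) ^ 3" using dq[OF that] dpos[OF that] by (intro power_mono) auto
    also have "\<dots> \<le> 36 / real q ^ 3" unfolding power_divide by (intro divide_right_mono) (auto simp: power3_eq_cube)
    finally show "\<epsilon> * (d k) ^ 3 \<le> 36 * \<epsilon> / real q ^ 3" using mult_left_mono[of "(d k) ^ 3" "36 / real q ^ 3" \<epsilon>] eps by (simp add: mult_ac)
  qed
  define Q where "Q = \<epsilon> / (real q)\<^sup>2"
  have Q: "Q \<ge> 0" using eps by (simp add: Q_def)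
  have Q1: "Q \<le> 1/4000"
  proof -
    have "2\<^sup>2 \<le> (real q)\<^sup>2" using q by (intro power_mono) auto
    then have "Q \<le> (1/1000) / 2\<^sup>2" unfolding Q_def using eps by (intro frac_le) auto
    then show ?thesis by simp
  qed
  \<comment> \<open>Second pass with the cubic bound, now that \<open>d k\<close> is known to be of
    order \<open>1 / q\<close>.\<close>
  define G where "G k = ln (\<phi> k) + ln (\<rho> (\<theta> k)) / 3" for k
  have Gd: "\<bar>G j - G i\<bar> \<le> 110 * Q" if "i < q" "j < q" for i j
  proof -
    have "\<bar>G j - G i\<bar> \<le> (\<Sum>k<q. 108 * \<epsilon> / real q ^ 3)"
    proof (rule seqb[OF _ that])
      fix k assume k: "k < q"
      have "\<bar>G (Suc k) - G k\<bar> \<le> 3 * \<epsilon> * (d k) ^ 3"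
        using adiabatic_step(2)[OF dpos[OF k] dle[OF k], of "m k"] unfolding G_def \<phi>1[OF k] md .
      then show "\<bar>G (Suc k) - G k\<bar> \<le> 108 * \<epsilon> / real q ^ 3" using d3[OF k] by simp
    qed
    also have "\<dots> = 108 * Q" using q by (simp add: Q_def power2_eq_square power3_eq_cube)
    finally show ?thesis using Q by simp
  qed
  define D where "D k = XX (\<theta> (Suc k)) - XX (\<theta> k)" for k
  have Dp: "D k > 0" if "k < q" for k
    using XX_step(1)[OF dpos[OF that] dle[OF that], of "m k"] unfolding D_def md .
  have DG: "\<bar>ln (D k) - (ln (2 / KK) + G k)\<bar> \<le> 55 * Q" if "k < q" for k
  proof -
    have 1: "\<bar>ln (D k) - (ln (2 / KK) + ln (d k) + ln (\<rho> (m k)) / 3)\<bar> \<le> 2 * \<epsilon> * (d k)\<^sup>2"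
      using XX_step(2)[OF dpos[OF that] dle[OF that], of "m k"] unfolding D_def md .
    have 2: "\<bar>G k - (ln (d k) + ln (\<rho> (m k)) / 3)\<bar> \<le> 3 * \<epsilon> * (d k)\<^sup>2"
      using adiabatic_step(3)[OF dpos[OF that] dle[OF that], of "m k"] unfolding G_def \<phi>1(1)[OF that] md .
    have 3: "\<epsilon> * (d k)\<^sup>2 \<le> 11 * Q" using d2[OF that] by (simp add: Q_def)
    show ?thesis using 1 2 3 by linarith
  qed
  have sumD: "(\<Sum>k<q. D k) = 1"
  proof -
    have "(\<Sum>k<q. D k) = XX (\<theta> q) - XX (\<theta> 0)" unfolding D_def by (rule sum_lessThan_telescope)
    then show ?thesis by (simp add: \<theta>0 XX_0 XX_2pi)
  qed
  have lnD: "\<bar>ln (D k) - ln (1 / real q)\<bar> \<le> 220 * Q" if "k < q" for k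
  proof (rule ln_average_bound[OF _ _ sumD _ that])
    fix i j assume "i < q" "j < q"
    then show "\<bar>ln (D i) - ln (D j)\<bar> \<le> 220 * Q" using DG[of i] DG[of j] Gd[of i j] by linarith
  qed (use q Dp in auto)
  show "\<bar>XX (\<theta> (Suc k)) - XX (\<theta> k) - 1 / real q\<bar> \<le> 1000 * \<epsilon> / real q ^ 3"
  proof -
    define y where "y = ln (D k) - ln (1 / real q)"
    have y: "\<bar>y\<bar> \<le> 220 * Q" using lnD[OF k] by (simp add: y_def)
    have "exp y = D k / (1 / real q)" unfolding y_def exp_diff using Dp[OF k] q by (simp only: exp_ln) simp
    then have "D k - 1 / real q = 1 / real q * (exp y - 1)" using q by (simp add: field_simps)
    moreover have "\<bar>exp y - 1\<bar> \<le> 440 * Q" using abs_exp_minus_one[of y] y Q1 by linarith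
    ultimately have "\<bar>D k - 1 / real q\<bar> \<le> 1 / real q * (440 * Q)"
      by (simp only: abs_mult) (intro mult_mono; simp)
    also have "\<dots> \<le> 1 / real q * (1000 * Q)" using Q by (intro mult_left_mono) auto
    also have "\<dots> = 1000 * \<epsilon> / real q ^ 3" using q by (simp add: Q_def power2_eq_square power3_eq_cube)
    finally show ?thesis by (simp add: D_def)
  qed
  show sp: "0 < sin (\<phi> k)" using \<phi>p[OF k] by (intro sin_gt_zero)
  show "\<bar>2 * real q * sin (\<phi> k) * (cr (\<theta> k) / KK) / (real q * sin (pi / real q) / pi) - 1\<bar> \<le> 1000 * \<epsilon> / (real q)\<^sup>2"
  proof -
    define \<alpha> where "\<alpha> = pi / real q"
    \<comment> \<open>\<open>A\<close> is the adiabatic invariant normalised by \<open>q\<close> and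
      \<open>KK\<close>; \<open>B\<close> compares the sinc function at the actual and at the
      average reflection angle.\<close>
    define A where "A = real q * (2 / KK) * \<phi> k * cr (\<theta> k)"
    define B where "B = (sin (\<phi> k) / \<phi> k) / (sin \<alpha> / \<alpha>)"
    have al: "0 < \<alpha>" "\<alpha> \<le> pi / 2" using q pi_gt_zero by (auto simp: \<alpha>_def field_simps)
    have sal: "1/2 \<le> sin \<alpha> / \<alpha>" using sin_ge_half[of \<alpha>] al by (simp add: field_simps)
    have eqAB: "2 * real q * sin (\<phi> k) * (cr (\<theta> k) / KK) / (real q * sin (pi / real q) / pi) = A * B"
    proof -
      have "sin \<alpha> \<noteq> 0" using sal al by auto
      then show ?thesis unfolding A_def B_def \<alpha>_def[symmetric]
        using \<phi>p(1)[OF k] KK_bounds(3) q al by (simp add: field_simps) (simp add: \<alpha>_def field_simps)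
    qed
    have A: "\<bar>A - 1\<bar> \<le> 550 * Q"
    proof -
      define y where "y = ln (2 / KK) + G k + ln (real q)"
      have "ln (1 / real q) = - ln (real q)" using q by (simp add: ln_div)
      then have y: "\<bar>y\<bar> \<le> 275 * Q" using DG[OF k] lnD[OF k] unfolding y_def by linarith
      have "exp y = A"
        unfolding y_def G_def exp_add using \<phi>p(1)[OF k] KK_bounds(3) q by (simp add: A_def cr_def mult_ac)
      then show ?thesis using abs_exp_minus_one[of y] y Q1 by linarith
    qed
    have B: "\<bar>B - 1\<bar> \<le> 160 * Q"
    proof -
      have sd: "\<bar>sin (\<phi> k) / \<phi> k - sin \<alpha> / \<alpha>\<bar> \<le> (33/10 / real q) / 3 * \<bar>\<phi> k - \<alpha>\<bar>"
      proof (cases "\<alpha> \<le> \<phi> k")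
        case True
        have "\<bar>sin (\<phi> k) / \<phi> k - sin \<alpha> / \<alpha>\<bar> \<le> \<phi> k / 3 * (\<phi> k - \<alpha>)" by (rule sinc_diff_bound[OF al(1) True])
        also have "\<dots> \<le> (33/10 / real q) / 3 * (\<phi> k - \<alpha>)" using phile[OF k] True by (intro mult_right_mono divide_right_mono) auto
        finally show ?thesis using True by simp
      next
        case False
        have "\<bar>sin \<alpha> / \<alpha> - sin (\<phi> k) / \<phi> k\<bar> \<le> \<alpha> / 3 * (\<alpha> - \<phi> k)" by (rule sinc_diff_bound) (use \<phi>p(1)[OF k] False in auto)
        also have "\<dots> \<le> (33/10 / real q) / 3 * (\<alpha> - \<phi> k)"
          using False pi_approx q by (intro mult_right_mono divide_right_mono) (auto simp: \<alpha>_def field_simps)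
        finally show ?thesis using False by (simp add: abs_minus_commute)
      qed
      also have "\<dots> \<le> (33/10 / real q) / 3 * (\<alpha> * (20 * \<epsilon>))" using phib[OF k] by (intro mult_left_mono) (auto simp: \<alpha>_def)
      also have "\<dots> = (22 * pi) * Q" using q by (simp add: \<alpha>_def Q_def power2_eq_square)
      also have "\<dots> \<le> 80 * Q" using pi_approx Q by (intro mult_right_mono) auto
      finally have "\<bar>sin (\<phi> k) / \<phi> k - sin \<alpha> / \<alpha>\<bar> \<le> 80 * Q" .
      have "B - 1 = (sin (\<phi> k) / \<phi> k - sin \<alpha> / \<alpha>) / (sin \<alpha> / \<alpha>)"
        using sal by (subst diff_divide_distrib) (auto simp: B_def)
      then have "\<bar>B - 1\<bar> = \<bar>sin (\<phi> k) / \<phi> k - sin \<alpha> / \<alpha>\<bar> / (sin \<alpha> / \<alpha>)"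
        using sal abs_of_pos[of "sin \<alpha> / \<alpha>"] by (simp only: abs_divide[of _ "sin \<alpha> / \<alpha>"])
      also have "\<dots> \<le> (80 * Q) / (1/2)"
        by (rule frac_le) (use sal Q \<open>\<bar>sin (\<phi> k) / \<phi> k - sin \<alpha> / \<alpha>\<bar> \<le> 80 * Q\<close> in auto)
      finally show ?thesis by simp
    qed
    have "A * B - 1 = (A - 1) * (B - 1) + (A - 1) + (B - 1)" by (simp add: algebra_simps)
    moreover have "\<bar>(A - 1) * (B - 1)\<bar> \<le> (550 * Q) * 1" unfolding abs_mult using A B Q1 Q by (intro mult_mono) auto
    moreover have "\<bar>(A - 1) * (B - 1)\<bar> \<le> (1/5) * (160 * Q)" unfolding abs_mult using A B Q1 Q by (intro mult_mono) auto
    ultimately have "\<bar>A * B - 1\<bar> \<le> 1000 * Q" using A B Q by linarith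
    then show ?thesis unfolding eqAB by (simp add: Q_def)
  qed
qed

end

subsection \<open>Symmetric polygons of maximal length\<close>

text \<open>A reflection-symmetric inscribed polygon with \<open>q\<close> sides is given by its first \<open>(q - 1) div 2 + 1\<close>
  normal angles; \<open>full_chain\<close> adds the mirror images.\<close>

definition half_chains :: "nat \<Rightarrow> (nat \<Rightarrow> real) set" where
  "half_chains q = (let m = (q - 1) div 2 in
     {h. h 0 = 0 \<and> (\<forall>k<m. h k \<le> h (Suc k)) \<and> h m \<le> pi \<and> (\<forall>k>m. h k = 0)})"

definition full_chain :: "nat \<Rightarrow> (nat \<Rightarrow> real) \<Rightarrow> nat \<Rightarrow> real" where
  "full_chain q h k = (if 2 * k < q then h k else if 2 * k = q then pi else 2 * pi - h (q - k))"

lemma full_chain_mirror: "k \<le> q \<Longrightarrow> full_chain q h (q - k) = 2 * pi - full_chain q h k"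
  by (auto simp: full_chain_def)

lemma full_chain_0: "h \<in> half_chains q \<Longrightarrow> q \<ge> 1 \<Longrightarrow> full_chain q h 0 = 0" "h \<in> half_chains q \<Longrightarrow> q \<ge> 1 \<Longrightarrow> full_chain q h q = 2 * pi"
  by (auto simp: full_chain_def half_chains_def Let_def)

lemma half_chains_range:
  assumes "h \<in> half_chains q" shows "0 \<le> h k" "h k \<le> pi"
proof -
  define m where "m = (q - 1) div 2"
  have h: "h 0 = 0" "\<And>k. k < m \<Longrightarrow> h k \<le> h (Suc k)" "h m \<le> pi" "\<And>k. k > m \<Longrightarrow> h k = 0"
    using assms by (auto simp: half_chains_def Let_def m_def)
  have 1: "k \<le> m \<Longrightarrow> 0 \<le> h k" for k by (induction k) (use h in \<open>auto intro: order_trans\<close>)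
  have 2: "k \<le> m \<Longrightarrow> h (m - k) \<le> pi" for k
  proof (induction k)
    case (Suc k)
    then show ?case using h(2)[of "m - Suc k"] by (simp add: Suc_diff_Suc)
  qed (use h in simp)
  show "0 \<le> h k" using 1 h(4) by (cases "k \<le> m") auto
  show "h k \<le> pi" using 2[of "m - k"] h(4)[of k] by (cases "k \<le> m") auto
qed

lemma half_chains_nonempty: "(\<lambda>k. 0) \<in> half_chains q"
  by (simp add: half_chains_def Let_def)

text \<open>Fixing the entries beyond the half chain to 0 makes the set a closed part of a product
  of compact intervals, so Tychonoff applies.\<close>

lemma compact_half_chains: "compact (half_chains q)"
proof -
  define m where "m = (q - 1) div 2"
  have c1: "compact (PiE UNIV (\<lambda>i::nat. {0..pi}))"
  proof -
    have "compactin (product_topology (\<lambda>i. euclidean) UNIV) (PiE UNIV (\<lambda>i::nat. {0..pi::real}))"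
      by (subst compactin_PiE) (simp add: compactin_euclidean_iff)
    then show ?thesis by (simp add: euclidean_product_topology)
  qed
  have ct: "continuous_on UNIV (\<lambda>h::nat \<Rightarrow> real. h k)" for k by (rule continuous_on_product_coordinates)
  have "closed {h::nat \<Rightarrow> real. h 0 = 0 \<and> (\<forall>k<m. h k \<le> h (Suc k)) \<and> h m \<le> pi \<and> (\<forall>k>m. h k = 0)}"
  proof -
    have "closed {h::nat \<Rightarrow> real. k < m \<longrightarrow> h k \<le> h (Suc k)}" for k
      by (cases "k < m") (auto intro!: closed_Collect_le ct)
    moreover have "closed {h::nat \<Rightarrow> real. k > m \<longrightarrow> h k = 0}" for k
      by (cases "k > m") (auto intro!: closed_Collect_eq ct continuous_on_const)
    ultimately show ?thesis
      by (intro closed_Collect_conj closed_Collect_all closed_Collect_eq closed_Collect_le ct continuous_on_const)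
  qed
  then have cl: "closed (half_chains q)" by (simp add: half_chains_def Let_def m_def)
  have "half_chains q = PiE UNIV (\<lambda>i. {0..pi}) \<inter> half_chains q"
    using half_chains_range by (auto simp: PiE_def)
  then show ?thesis using compact_Int_closed[OF c1 cl] by simp
qed

lemma sum_lessThan_plus:
  fixes g :: "nat \<Rightarrow> real"
  shows "sum g {..<a + b} = sum g {..<a} + (\<Sum>k<b. g (a + k))"
  by (induction b) auto

text \<open>The axis is the real line; the marked point is \<open>\<Gamma> 0\<close>, and
  \<open>\<Gamma> pi\<close> is the other point on the axis.\<close>

locale sym_curve = billiard_curve +
  assumes sym\<Gamma>: "\<And>t. \<Gamma> (- t) = cnj (\<Gamma> t)" and sym\<rho>: "\<And>t. \<rho> (- t) = \<rho> t" and \<Gamma>0: "\<Gamma> 0 = 0"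
begin

lemma Gamma_mirror: "\<Gamma> (2 * pi - t) = cnj (\<Gamma> t)"
  using per\<Gamma>[of "- t"] sym\<Gamma>[of t] by (simp add: add.commute)

lemma len_mirror: "len (2 * pi - b) (2 * pi - a) = len a b"
  unfolding len_def Gamma_mirror by (metis complex_cnj_diff complex_mod_cnj norm_minus_commute)

lemma chang_mirror: "chang (2 * pi - b) (2 * pi - a) = 2 * pi - chang a b"
proof -
  define m where "m = (a + b) / 2"
  define d where "d = (b - a) / 2"
  have e: "(2 * pi - b + (2 * pi - a)) / 2 = 2 * pi - m" "(2 * pi - a - (2 * pi - b)) / 2 = d"
    by (auto simp: m_def d_def field_simps)
  have "midchord (2 * pi - m) d = cnj (midchord m d)"
  proof -
    have 1: "\<Gamma> (2 * pi - m + d) = cnj (\<Gamma> (m - d))" "\<Gamma> (2 * pi - m - d) = cnj (\<Gamma> (m + d))"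
      using Gamma_mirror[of "m - d"] Gamma_mirror[of "m + d"] by (simp_all add: algebra_simps)
    have 2: "cis (- (2 * pi - m)) = cis m" by (simp add: complex_eq_iff cos_diff sin_diff)
    have 3: "cnj (cis (- m)) = cis m" by (simp add: cis_cnj)
    show ?thesis unfolding midchord_def 1 2 by (simp add: 3 algebra_simps)
  qed
  then have "CC (2 * pi - m) d = CC m d" "SS (2 * pi - m) d = - SS m d" by (simp_all add: CC_def SS_def)
  then show ?thesis unfolding chang_def e m_def[symmetric] d_def[symmetric] by (simp add: arctan_minus)
qed

text \<open>Relative to the normal at the middle point one chord points outward and the other
  inward, so they do not have the same direction.\<close>

lemma strict_triangle:
  assumes "x < y" "y < z" "z < x + 2 * pi"
  shows "len x z < len x y + len y z"
proof -
  define a b where "a = \<Gamma> y - \<Gamma> x" and "b = \<Gamma> z - \<Gamma> y"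
  have h1: "inner a (cis y) > 0" using height_pos(2)[of x y] assms by (simp add: height_def a_def)
  have h2: "inner b (cis y) < 0" using height_pos(1)[of y z] assms by (simp add: height_def b_def inner_diff_left)
  have "norm (a + b) \<noteq> norm a + norm b"
  proof
    assume "norm (a + b) = norm a + norm b"
    then have e: "norm a *\<^sub>R b = norm b *\<^sub>R a" by (simp add: norm_triangle_eq)
    have "norm a * inner b (cis y) = norm b * inner a (cis y)"
      using arg_cong[OF e, of "\<lambda>v. inner v (cis y)"] by simp
    moreover have "norm a > 0" using h1 by auto
    ultimately have "norm b * inner a (cis y) < 0" using h2 by (metis mult_pos_neg)
    then show False using h1 by (metis less_le_not_le mult_nonneg_nonneg norm_ge_zero less_imp_le)
  qed
  moreover have "norm (a + b) \<le> norm a + norm b" by (rule norm_triangle_ineq)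
  ultimately show ?thesis by (simp add: len_def a_def b_def)
qed

lemma len_self: "len a a = 0" by (simp add: len_def)

text \<open>Up to and including \<open>t = pi\<close>, where a norm need not be differentiable, the
  closing side of an odd polygon is the smooth function \<open>2 * Im (\<Gamma> t)\<close>.\<close>

lemma len_pi_mirror: assumes "0 \<le> t" "t \<le> pi" shows "len t (2 * pi - t) = 2 * Im (\<Gamma> t)"
proof -
  have "CC pi (pi - t) = 2 * Im (\<Gamma> t)"
    using Gamma_mirror[of t] by (simp add: CC_def midchord_def algebra_simps)
  moreover have "0 \<le> CC pi (pi - t)"
    using CC_pos[of "pi - t" pi] CC_0 CC_pi assms by (cases "t = pi"; cases "t = 0") auto
  ultimately have "Im (\<Gamma> t) \<ge> 0" by simp
  moreover have "\<Gamma> (2 * pi - t) - \<Gamma> t = of_real (- 2 * Im (\<Gamma> t)) * \<i>"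
    by (simp add: Gamma_mirror complex_eq_iff)
  ultimately show ?thesis by (simp add: len_def norm_mult)
qed

lemma chang_vertical: assumes "0 < t" "t < pi" shows "chang t (2 * pi - t) = pi"
  using chang_mirror[where a = t and b = "2 * pi - t"] by simp

lemma d_Im_Gamma: "((\<lambda>t. Im (\<Gamma> t)) has_real_derivative \<rho> t * cos t) (at t)"
  using bounded_linear.has_vector_derivative[OF bounded_linear_Im d\<Gamma>[of t]]
  by (simp add: has_real_derivative_iff_has_vector_derivative)

definition perim :: "nat \<Rightarrow> (nat \<Rightarrow> real) \<Rightarrow> real" where
  "perim q \<theta> = (\<Sum>k<q. len (\<theta> k) (\<theta> (Suc k)))"

text \<open>For even \<open>q\<close> the polygon has a vertex at \<open>pi\<close> and two
  mirror-image sides end there; for odd \<open>q\<close> a single side crosses the axis and is its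
  own mirror image.\<close>

definition last_side :: "nat \<Rightarrow> real \<Rightarrow> real" where
  "last_side q t = (if even q then 2 * len t pi else len t (2 * pi - t))"

definition half_perim :: "nat \<Rightarrow> (nat \<Rightarrow> real) \<Rightarrow> real" where
  "half_perim q h = (\<Sum>k<(q - 1) div 2. 2 * len (h k) (h (Suc k))) + last_side q (h ((q - 1) div 2))"

lemma perim_full_chain:
  assumes "q \<ge> 2"
  shows "perim q (full_chain q h) = half_perim q h"
proof -
  define e where "e k = len (full_chain q h k) (full_chain q h (Suc k))" for k
  have mir: "e (q - Suc k) = e k" if "k < q" for k
  proof -
    have "Suc (q - Suc k) = q - k" using that by simp
    then show ?thesis using that full_chain_mirror[of k q h] full_chain_mirror[of "Suc k" q h] len_mirror
      by (simp add: e_def)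
  qed
  define m where "m = (q - 1) div 2"
  have el: "e k = len (h k) (h (Suc k))" if "k < m" for k
  proof -
    have "2 * k < q" "2 * Suc k < q" using that by (auto simp: m_def)
    then show ?thesis by (simp add: e_def full_chain_def)
  qed
  show ?thesis
  proof (cases "even q")
    case True
    then have q: "q = Suc m + Suc m" using assms unfolding m_def by presburger
    have em: "e m = len (h m) pi" by (simp add: e_def full_chain_def q)
    have "(\<Sum>k<q. e k) = (\<Sum>k<Suc m. e k) + (\<Sum>k<Suc m. e (Suc m + k))" unfolding q by (rule sum_lessThan_plus) 
    also have "(\<Sum>k<Suc m. e (Suc m + k)) = (\<Sum>k<Suc m. e (Suc m + (Suc m - Suc k)))" by (rule sum.nat_diff_reindex[symmetric])
    also have "\<dots> = (\<Sum>k<Suc m. e k)"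
    proof (intro sum.cong refl)
      fix k assume k: "k \<in> {..<Suc m}"
      then have "Suc m + (Suc m - Suc k) = q - Suc k" by (auto simp: q)
      then show "e (Suc m + (Suc m - Suc k)) = e k" using mir[of k] k q by auto
    qed
    finally have "(\<Sum>k<q. e k) = 2 * (\<Sum>k<Suc m. e k)" by simp
    also have "(\<Sum>k<Suc m. e k) = (\<Sum>k<m. len (h k) (h (Suc k))) + len (h m) pi" by (simp add: em el)
    finally show ?thesis using True by (simp add: perim_def half_perim_def e_def m_def last_side_def sum_distrib_left)
  next
    case False
    then have q: "q = Suc m + m" "m \<ge> 1" using assms unfolding m_def by presburger+
    have em: "e m = len (h m) (2 * pi - h m)" using q(2) by (simp add: e_def full_chain_def q)
    have "(\<Sum>k<q. e k) = (\<Sum>k<Suc m. e k) + (\<Sum>k<m. e (Suc m + k))" unfolding q(1) by (rule sum_lessThan_plus)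
    also have "(\<Sum>k<m. e (Suc m + k)) = (\<Sum>k<m. e (Suc m + (m - Suc k)))" by (rule sum.nat_diff_reindex[symmetric])
    also have "\<dots> = (\<Sum>k<m. e k)"
    proof (intro sum.cong refl)
      fix k assume k: "k \<in> {..<m}"
      then have "Suc m + (m - Suc k) = q - Suc k" by (auto simp: q)
      then show "e (Suc m + (m - Suc k)) = e k" using mir[of k] k q by auto
    qed
    finally have "(\<Sum>k<q. e k) = 2 * (\<Sum>k<m. e k) + e m" by simp
    also have "\<dots> = 2 * (\<Sum>k<m. len (h k) (h (Suc k))) + len (h m) (2 * pi - h m)" by (simp add: em el)
    finally show ?thesis using False by (simp add: perim_def half_perim_def e_def m_def last_side_def sum_distrib_left)
  qed
qed

lemma continuous_Gamma: "continuous_on S \<Gamma>"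
  by (intro continuous_at_imp_continuous_on ballI has_vector_derivative_continuous[OF d\<Gamma>])

lemma ex_max_half_chain:
  obtains h where "h \<in> half_chains q" "\<And>h'. h' \<in> half_chains q \<Longrightarrow> half_perim q h' \<le> half_perim q h"
proof -
  have ct: "continuous_on S (\<lambda>h::nat \<Rightarrow> real. h k)" for k S
    by (rule continuous_on_subset[OF continuous_on_product_coordinates]) auto
  have cl: "continuous_on S (\<lambda>h. len (f h) (g h))" if "continuous_on S f" "continuous_on S g" for f g :: "(nat \<Rightarrow> real) \<Rightarrow> real" and S
    unfolding len_def
    by (intro continuous_intros continuous_on_compose2[OF continuous_Gamma[of UNIV] that(2)] continuous_on_compose2[OF continuous_Gamma[of UNIV] that(1)]) auto
  have "continuous_on (half_chains q) (half_perim q)"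
    unfolding half_perim_def[abs_def] last_side_def
    by (cases "even q") (auto intro!: continuous_intros cl ct)
  from continuous_attains_sup[OF compact_half_chains _ this] half_chains_nonempty that
  show ?thesis by blast
qed

lemma half_perim_update:
  assumes k: "k = Suc i" "k \<le> (q - 1) div 2"
  defines "m \<equiv> (q - 1) div 2"
  shows "half_perim q (h(k := t)) - half_perim q h =
     (2 * len (h i) t + (if k < m then 2 * len t (h (Suc k)) else last_side q t))
   - (2 * len (h i) (h k) + (if k < m then 2 * len (h k) (h (Suc k)) else last_side q (h k)))"
proof -
  define e where "e h j = 2 * len (h j) (h (Suc j))" for h :: "nat \<Rightarrow> real" and j
  let ?h = "h(k := t)"
  have eq: "e ?h j = e h j" if "j \<noteq> i" "j \<noteq> k" for j using that k by (simp add: e_def)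
  have ei: "e ?h i = 2 * len (h i) t" "e h i = 2 * len (h i) (h k)" using k by (auto simp: e_def)
  show ?thesis
  proof (cases "k < m")
    case True
    have split: "(\<Sum>j<m. g j) = (\<Sum>j\<in>{..<m} - {i, k}. g j) + (g i + g k)" for g :: "nat \<Rightarrow> real"
    proof -
      have "{..<m} = ({..<m} - {i, k}) \<union> {i, k}" using True k by auto
      then have "sum g {..<m} = sum g ({..<m} - {i, k}) + sum g {i, k}" by (metis Diff_disjoint Int_commute finite_Diff finite_lessThan finite.emptyI finite.insertI sum.union_disjoint)
      then show ?thesis using k by simp
    qed
    have "(\<Sum>j\<in>{..<m} - {i, k}. e ?h j) = (\<Sum>j\<in>{..<m} - {i, k}. e h j)" by (intro sum.cong refl eq) auto
    moreover have "e ?h k = 2 * len t (h (Suc k))" "e h k = 2 * len (h k) (h (Suc k))" by (auto simp: e_def)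
    ultimately show ?thesis using True unfolding half_perim_def m_def[symmetric] e_def[symmetric] split by (simp add: ei)
  next
    case False
    then have m: "m = Suc i" using k by (simp add: m_def)
    have "(\<Sum>j<i. e ?h j) = (\<Sum>j<i. e h j)" using k by (intro sum.cong refl eq) auto
    moreover have "(\<Sum>j<m. e g j) = (\<Sum>j<i. e g j) + e g i" for g by (simp add: m)
    moreover have "?h m = t" "h m = h k" using k m by auto
    ultimately show ?thesis using False unfolding half_perim_def m_def[symmetric] e_def[symmetric] by (simp only: ei if_False)
  qed
qed

end

context sym_curve
begin

text \<open>A maximiser could lie on the boundary of the compact set, with coinciding vertices.
  Strictness propagates: a positive gap on one side of a vertex forces a positive gap on the other,
  else moving the vertex would lengthen the polygon; and not all gaps vanish, as they sum to
  \<open>pi\<close>. At an interior maximum the derivative vanishes, which says that the cosines of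
  the two angles agree. \<open>U\<close> extends the half chain by \<open>pi\<close>, the upper
  limit of its last entry.\<close>

lemma max_half_chain_critical:
  assumes q: "q \<ge> 2" and h: "h \<in> half_chains q"
    and mx: "\<forall>h' \<in> half_chains q. half_perim q h' \<le> half_perim q h"
  defines "m \<equiv> (q - 1) div 2"
  defines "U \<equiv> (\<lambda>k. if k \<le> m then h k else pi)"
  shows "\<And>k. k \<le> m \<Longrightarrow> U k < U (Suc k)"
    and "\<And>k. 1 \<le> k \<Longrightarrow> k \<le> m \<Longrightarrow>
           h k - chang (h (k - 1)) (h k) = chang (h k) (full_chain q h (Suc k)) - h k"
proof -
  have hc: "h 0 = 0" "\<And>k. k < m \<Longrightarrow> h k \<le> h (Suc k)" "h m \<le> pi" "\<And>k. k > m \<Longrightarrow> h k = 0"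
    using h by (auto simp: half_chains_def Let_def m_def)
  note rng = half_chains_range[OF h]
  have U0: "U 0 = 0" "U (Suc m) = pi" using hc by (auto simp: U_def)
  have Ule: "U k \<le> U (Suc k)" if "k \<le> m" for k
    using that hc by (auto simp: U_def le_less)
  define f where "f k t = 2 * len (h (k - 1)) t + (if k < m then 2 * len t (h (Suc k)) else last_side q t)" for k t
  have fmax: "f k t \<le> f k (h k)" if k: "1 \<le> k" "k \<le> m" and t: "h (k - 1) \<le> t" "t \<le> U (Suc k)" for k t
  proof -
    have "h(k := t) \<in> half_chains q"
      unfolding half_chains_def Let_def m_def[symmetric]
    proof (intro CollectI conjI allI impI)
      show "(h(k := t)) 0 = 0" using k hc by auto
      show "(h(k := t)) m \<le> pi" using k hc t by (auto simp: U_def split: if_splits)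
      show "(h(k := t)) j \<le> (h(k := t)) (Suc j)" if "j < m" for j
        using that k t hc(2)[OF that] by (auto simp: U_def split: if_splits)
      show "(h(k := t)) j = 0" if "j > m" for j using that k hc by auto
    qed
    from mx[rule_format, OF this] have "half_perim q (h(k := t)) - half_perim q h \<le> 0" by simp
    moreover have "half_perim q (h(k := t)) - half_perim q h = f k t - f k (h k)"
      using half_perim_update[of k "k - 1" q h t] k by (simp add: f_def m_def)
    ultimately show ?thesis by simp
  qed
  have fmid: "f k t = 2 * len (U (k - 1)) t + 2 * len t (U (Suc k))" if "1 \<le> k" "k \<le> m" "k < m \<or> even q" for k t
    using that by (auto simp: f_def U_def last_side_def)
  have f_odd: "f m t = 2 * len (h (m - 1)) t + len t (2 * pi - t)" if "odd q" for t
    using that by (simp add: f_def last_side_def)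
  have Uh: "U k = h k" if "k \<le> m" for k using that by (simp add: U_def)
  have Urng: "0 \<le> U k" "U k \<le> pi" for k using rng[of k] by (auto simp: U_def)
  \<comment> \<open>A vertex sits on a neighbour while its two neighbours are distinct: moving it
    strictly between them gains by the triangle inequality.\<close>
  have generic: False if k: "1 \<le> k" "k \<le> m" "k < m \<or> even q" and ne: "U (k - 1) < U (Suc k)"
      and end_pt: "h k = U (k - 1) \<or> h k = U (Suc k)" for k
  proof -
    define t where "t = (U (k - 1) + U (Suc k)) / 2"
    have t: "U (k - 1) < t" "t < U (Suc k)" using ne by (auto simp: t_def)
    have "f k t \<le> f k (h k)" by (rule fmax) (use k t Uh[of "k - 1"] in auto)
    moreover have "f k (h k) = 2 * len (U (k - 1)) (U (Suc k))" unfolding fmid[OF k] using end_pt by (auto simp: len_self)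
    moreover have "len (U (k - 1)) (U (Suc k)) < len (U (k - 1)) t + len t (U (Suc k))"
      by (rule strict_triangle) (use t Urng[of "Suc k"] Urng[of "k - 1"] in auto)
    ultimately show False unfolding fmid[OF k] by simp
  qed
  have claim1: "U k < U (Suc k)" if k: "1 \<le> k" "k \<le> m" and s: "U (k - 1) < U k" for k
  proof (rule ccontr)
    assume "\<not> ?thesis"
    then have z: "U k = U (Suc k)" using Ule[OF k(2)] by simp
    show False
    proof (cases "k < m \<or> even q")
      case True
      then show False using generic[OF k True] s z Uh[OF k(2)] by auto
    next
      case False
      then have km: "k = m" and od: "odd q" using k by auto
      have hm: "h m = pi" using z U0 Uh[of m] km by simp
      have lt: "h (m - 1) < pi" using s hm Uh[of m] Uh[of "m - 1"] km by simp
      have chn: "h (m - 1) < pi" "pi < h (m - 1) + 2 * pi" using lt rng[of "m - 1"] pi_gt_zero by linarith+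
      \<comment> \<open>For odd \<open>q\<close> the closing side has degenerated at
        \<open>pi\<close>. Moving the vertex back opens it at rate \<open>2 * \<rho> pi\<close>,
        while the two copies of the preceding side shrink at a strictly smaller total rate.\<close>
      define F where "F t = 2 * len (h (m - 1)) t + 2 * Im (\<Gamma> t)" for t
      have dF: "(F has_real_derivative (2 * (\<rho> pi * cos (pi - chang (h (m - 1)) pi)) + 2 * (\<rho> pi * cos pi))) (at pi)"
        unfolding F_def[abs_def] by (intro DERIV_add DERIV_cmult d_len_right[OF chn] d_Im_Gamma)
      define c where "c = cos (pi - chang (h (m - 1)) pi)"
      have c1: "c < 1" unfolding c_def
        using chord_polar(5,6)[OF chn] by (intro cos_lt_one) auto
      have "\<rho> pi * c < \<rho> pi * 1" using rho_pos[of pi] c1 by (intro mult_strict_left_mono)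
      then have neg: "2 * (\<rho> pi * cos (pi - chang (h (m - 1)) pi)) + 2 * (\<rho> pi * cos pi) < 0"
        unfolding c_def[symmetric] cos_pi by linarith
      obtain e where e: "e > 0" "\<And>x. 0 < x \<Longrightarrow> x < e \<Longrightarrow> F pi < F (pi - x)"
        using DERIV_neg_dec_left[OF dF neg] by auto
      define x where "x = min (e / 2) ((pi - h (m - 1)) / 2)"
      have x: "0 < x" "x < e" "h (m - 1) < pi - x" using e lt by (auto simp: x_def min_def field_simps)
      have "f m (pi - x) \<le> f m (h m)" by (rule fmax) (use k km x U0 in auto)
      moreover have "f m t = F t" if "0 \<le> t" "t \<le> pi" for t
        unfolding f_odd[OF od] F_def using len_pi_mirror[OF that] by simp
      ultimately have "F (pi - x) \<le> F pi" using x rng[of "m - 1"] hm by (simp add: less_imp_le)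
      then show False using e(2)[of x] x by simp
    qed
  qed
  have claim2: "U (k - 1) < U k" if k: "1 \<le> k" "k \<le> m" and s: "U k < U (Suc k)" for k
  proof (rule ccontr)
    assume "\<not> ?thesis"
    then have z: "U (k - 1) = U k" using Ule[of "k - 1"] k by simp
    show False
    proof (cases "k < m \<or> even q")
      case True
      then show False using generic[OF k True] s z Uh[OF k(2)] by auto
    next
      case False
      then have km: "k = m" and od: "odd q" using k by auto
      define x where "x = h m"
      have hx: "h (m - 1) = x" using z Uh[of m] Uh[of "m - 1"] km by (simp add: x_def)
      have x: "0 \<le> x" "x < pi" using s rng[of m] U0 Uh[of m] km by (auto simp: x_def)
      \<comment> \<open>The side from \<open>x\<close> to \<open>2 * pi - x\<close> is replaced by
        three sides through \<open>t\<close> and \<open>2 * pi - t\<close>. For \<open>x = 0\<close>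
        it has length 0 and the replacement is longer anyway.\<close>
      define t where "t = (x + pi) / 2"
      have t: "x < t" "t < pi" using x by (auto simp: t_def)
      have "f m t \<le> f m (h m)" by (rule fmax) (use k km t U0 hx in auto)
      then have le: "2 * len x t + len t (2 * pi - t) \<le> len x (2 * pi - x)" unfolding f_odd[OF od] hx x_def[symmetric] by (simp add: len_self)
      show False
      proof (cases "x = 0")
        case True
        have "len x (2 * pi - x) = 0" using True per\<Gamma>[of 0] by (simp add: len_def)
        moreover have "len x t > 0" by (rule chord_polar(2)) (use t x in auto)
        moreover have "len t (2 * pi - t) \<ge> 0" by (simp add: len_def)
        ultimately show False using le by simp
      next
        case False
        have "len x (2 * pi - x) < len x t + len t (2 * pi - x)" by (rule strict_triangle) (use t x False in auto)
        also have "len t (2 * pi - x) \<le> len t (2 * pi - t) + len (2 * pi - t) (2 * pi - x)"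
          unfolding len_def using norm_triangle_ineq[of "\<Gamma> (2 * pi - t) - \<Gamma> t" "\<Gamma> (2 * pi - x) - \<Gamma> (2 * pi - t)"] by simp
        also have "len (2 * pi - t) (2 * pi - x) = len x t" by (rule len_mirror)
        finally show False using le by simp
      qed
    qed
  qed
  have strict0: "U 0 < U 1"
  proof (rule ccontr)
    \<comment> \<open>By \<open>claim2\<close> a zero gap forces the next gap to be zero, so all
      vertices would coincide, although \<open>U\<close> runs from 0 to \<open>pi\<close>.\<close>
    assume n: "\<not> ?thesis"
    have "U k = U (Suc k)" if "k \<le> m" for k using that
    proof (induction k)
      case 0 then show ?case using n Ule[of 0] by simp
    next
      case (Suc k)
      then show ?case using claim2[of "Suc k"] Ule[of "Suc k"] by fastforce
    qed
    then have "k \<le> Suc m \<Longrightarrow> U k = U 0" for k by (induction k) auto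
    then show False using U0 by (metis order_refl pi_neq_zero)
  qed
  show strict: "U k < U (Suc k)" if "k \<le> m" for k using that
  proof (induction k)
    case (Suc k)
    then show ?case using claim1[of "Suc k"] by simp
  qed (use strict0 in simp)
  fix k assume k: "1 \<le> k" "k \<le> m"
  define a where "a = h (k - 1)"
  define x where "x = h k"
  have ax: "a < x" using strict[of "k - 1"] k Uh[of k] Uh[of "k - 1"] by (simp add: a_def x_def)
  have xU: "x < U (Suc k)" using strict[of k] k Uh[of k] by (simp add: x_def)
  have rg: "0 \<le> a" "x < pi" using rng[of "k - 1"] xU Urng[of "Suc k"] by (auto simp: a_def)
  have gp: "x < a + 2 * pi" using rg pi_gt_zero by linarith
  define b where "b = full_chain q h (Suc k)"
  have bgap: "x < b" "b < x + 2 * pi" and dr: "((\<lambda>t. if k < m then 2 * len t (h (Suc k)) else last_side q t) has_real_derivative (- 2 * (\<rho> x * cos (chang x b - x)))) (at x)"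
  proof -
    consider "k < m" | "k = m" "even q" | "k = m" "odd q" using k by linarith
    then have "x < b \<and> b < x + 2 * pi \<and> ((\<lambda>t. if k < m then 2 * len t (h (Suc k)) else last_side q t) has_real_derivative (- 2 * (\<rho> x * cos (chang x b - x)))) (at x)"
    proof cases
      case 1
      then have b: "b = h (Suc k)" by (auto simp: b_def full_chain_def m_def)
      have g: "x < b" "b < x + 2 * pi" using xU 1 rng[of "Suc k"] ax rg by (auto simp: b U_def)
      show ?thesis using DERIV_cmult[OF d_len_left[OF g], of 2] g 1 by (simp add: b)
    next
      case 2
      have "2 * Suc k = q" using 2 q unfolding m_def by presburger
      then have b: "b = pi" by (simp add: b_def full_chain_def)
      have g: "x < b" "b < x + 2 * pi" using rg ax by (auto simp: b)
      show ?thesis using DERIV_cmult[OF d_len_left[OF g], of 2] g 2 by (simp add: b last_side_def)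
    next
      case 3
      have "2 * Suc k = Suc q" using 3 q k unfolding m_def by presburger
      then have "\<not> 2 * Suc k < q" "2 * Suc k \<noteq> q" "q - Suc k = k" by arith+
      then have b: "b = 2 * pi - x" unfolding b_def full_chain_def x_def by simp
      have x0: "0 < x" using ax rg by simp
      have g: "x < b" "b < x + 2 * pi" using rg x0 by (auto simp: b)
      \<comment> \<open>The closing side is counted once but both its ends move, so its derivative
        agrees with that of a side counted twice with one fixed end.\<close>
      have "((\<lambda>t. 2 * Im (\<Gamma> t)) has_real_derivative 2 * (\<rho> x * cos x)) (at x)" by (intro DERIV_cmult d_Im_Gamma)
      then have "((\<lambda>t. len t (2 * pi - t)) has_real_derivative 2 * (\<rho> x * cos x)) (at x)"
      proof (rule has_field_derivative_transform_within_open)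
        show "open {0<..<pi}" by simp
        show "x \<in> {0<..<pi}" using x0 rg by simp
      qed (use len_pi_mirror in auto)
      moreover have "- 2 * (\<rho> x * cos (chang x b - x)) = 2 * (\<rho> x * cos x)"
        unfolding b chang_vertical[OF x0 rg(2)] by simp
      ultimately have "((\<lambda>t. len t (2 * pi - t)) has_real_derivative - 2 * (\<rho> x * cos (chang x b - x))) (at x)" by (simp only:)
      moreover have "(\<lambda>t. if k < m then 2 * len t (h (Suc k)) else last_side q t) = (\<lambda>t. len t (2 * pi - t))"
        using 3 by (simp add: last_side_def)
      ultimately show ?thesis using g by (simp only:)
    qed
    then show "x < b" "b < x + 2 * pi" "((\<lambda>t. if k < m then 2 * len t (h (Suc k)) else last_side q t) has_real_derivative (- 2 * (\<rho> x * cos (chang x b - x)))) (at x)" by auto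
  qed
  have df: "(f k has_real_derivative (2 * (\<rho> x * cos (x - chang a x)) + (- 2 * (\<rho> x * cos (chang x b - x))))) (at x)"
    unfolding f_def[abs_def] a_def[symmetric] by (intro DERIV_add DERIV_cmult d_len_right[OF ax gp] dr)
  define e where "e = min (x - a) (U (Suc k) - x)"
  have e: "e > 0" using ax xU by (simp add: e_def)
  have "2 * (\<rho> x * cos (x - chang a x)) + (- 2 * (\<rho> x * cos (chang x b - x))) = 0"
  proof (rule DERIV_local_max[OF df e], intro allI impI)
    fix t assume "\<bar>x - t\<bar> < e"
    then have "a \<le> t" "t \<le> U (Suc k)" by (auto simp: e_def)
    then show "f k t \<le> f k x" unfolding x_def a_def by (intro fmax k)
  qed
  then have "\<rho> x * cos (x - chang a x) = \<rho> x * cos (chang x b - x)" by linarith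
  then have "cos (x - chang a x) = cos (chang x b - x)" using rho_pos[of x] by (metis less_irrefl mult_left_cancel)
  then have "x - chang a x = chang x b - x"
    by (rule cos_inj_pi[rotated 4]) (use chord_polar(5,6)[OF ax gp] chord_polar(3,4)[OF bgap] in linarith)+
  then show "h k - chang (h (k - 1)) (h k) = chang (h k) (full_chain q h (Suc k)) - h k"
    by (simp add: x_def a_def b_def)
qed

text \<open>The equal-angle law holds at the interior vertices of the half chain by criticality, at
  their mirror images by symmetry, and at the vertices on the axis by symmetry alone: there the
  incoming and the outgoing side are mirror images.\<close>

lemma ex_max_orbit:
  assumes q: "q \<ge> 2"
  obtains h \<phi> where "h \<in> half_chains q" "orbit q (full_chain q h) \<phi>"
    "\<And>h'. h' \<in> half_chains q \<Longrightarrow> perim q (full_chain q h') \<le> perim q (full_chain q h)"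
proof -
  obtain h where h: "h \<in> half_chains q" and mx: "\<And>h'. h' \<in> half_chains q \<Longrightarrow> half_perim q h' \<le> half_perim q h"
    using ex_max_half_chain[of q] by blast
  define m where "m = (q - 1) div 2"
  define \<theta> where "\<theta> = full_chain q h"
  have "\<forall>h' \<in> half_chains q. half_perim q h' \<le> half_perim q h" using mx by blast
  note cr = max_half_chain_critical[OF q h this, folded m_def]
  have mir: "\<theta> (q - k) = 2 * pi - \<theta> k" if "k \<le> q" for k using full_chain_mirror[OF that] by (simp add: \<theta>_def)
  have \<theta>h: "\<theta> k = h k" if "k \<le> m" for k
  proof -
    have "2 * k < q" using that q by (auto simp: m_def)
    then show ?thesis by (simp add: \<theta>_def full_chain_def)
  qed
  have hr: "0 \<le> h k" "h k \<le> pi" for k using half_chains_range[OF h] by auto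
  have st: "\<theta> k < \<theta> (Suc k) \<and> \<theta> (Suc k) < \<theta> k + 2 * pi" if "k < q" for k
  proof -
    have low: "\<theta> k < \<theta> (Suc k) \<and> \<theta> (Suc k) < \<theta> k + 2 * pi" if "k \<le> m" for k
    proof (cases "k < m")
      case True
      then show ?thesis using cr(1)[of k] \<theta>h[of k] \<theta>h[of "Suc k"] hr[of k] hr[of "Suc k"] pi_gt_zero by auto
    next
      case False
      then have k: "k = m" using that by simp
      have hm: "h m < pi" using cr(1)[of m] by simp
      show ?thesis
      proof (cases "even q")
        case True
        then have "2 * Suc m = q" using q unfolding m_def by presburger
        then have "\<theta> (Suc m) = pi" by (simp add: \<theta>_def full_chain_def)
        then show ?thesis using hm k \<theta>h[of m] hr[of m] pi_gt_zero by auto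
      next
        case False
        have m1: "m \<ge> 1" using False q unfolding m_def by presburger
        have "2 * m + 1 = q" using False q unfolding m_def by presburger
        then have "Suc m = q - m" "m \<le> q" by auto
        then have "\<theta> (Suc m) = 2 * pi - h m" using mir[of m] \<theta>h[of m] by simp
        moreover have "0 < h m" using cr(1)[of "m - 1"] m1 hr[of "m - 1"] by auto
        ultimately show ?thesis using hm k \<theta>h[of m] pi_gt_zero by auto
      qed
    qed
    show ?thesis
    proof (cases "k \<le> m")
      case False
      define j where "j = q - Suc k"
      have j: "j \<le> m" "Suc j = q - k" "Suc k = q - j" "k = q - Suc j" using False \<open>k < q\<close> by (auto simp: j_def m_def)
      have "\<theta> k = 2 * pi - \<theta> (Suc j)" "\<theta> (Suc k) = 2 * pi - \<theta> j"
        using mir[of "Suc j"] mir[of j] \<open>k < q\<close> unfolding j(4)[symmetric] j(3)[symmetric] by (simp_all add: j_def)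
      then show ?thesis using low[OF j(1)] by auto
    qed (rule low)
  qed
  define inA where "inA j = \<theta> j - chang (\<theta> (j - 1)) (\<theta> j)" for j
  define outA where "outA j = chang (\<theta> j) (\<theta> (Suc j)) - \<theta> j" for j
  have mirA: "inA j = outA (q - j)" if "1 \<le> j" "j \<le> q" for j
  proof -
    have "Suc (q - j) = q - (j - 1)" using that by simp
    then have "\<theta> (q - j) = 2 * pi - \<theta> j" "\<theta> (Suc (q - j)) = 2 * pi - \<theta> (j - 1)" using mir[of j] mir[of "j - 1"] that by auto
    then show ?thesis unfolding inA_def outA_def by (simp only: chang_mirror)
  qed
  have low: "inA j = outA j" if "1 \<le> j" "j \<le> m" for j
    using cr(2)[OF that] \<theta>h[of j] \<theta>h[of "j - 1"] that by (simp add: inA_def outA_def \<theta>_def)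
  have refl: "inA j = outA j" if j: "1 \<le> j" "j < q" for j
  proof -
    consider "j \<le> m" | "q - j \<le> m" "\<not> j \<le> m" | "2 * j = q" using j unfolding m_def by linarith
    then show ?thesis
    proof cases
      case 2
      have "outA j = inA (q - j)" using mirA[of "q - j"] j by simp
      also have "\<dots> = outA (q - j)" using low[of "q - j"] 2 j by simp
      also have "\<dots> = inA j" using mirA[of j] j by simp
      finally show ?thesis by simp
    next
      case 3
      then have "q - j = j" by simp
      then show ?thesis using mirA[of j] j by simp
    qed (use low j in auto)
  qed
  define \<phi> where "\<phi> k = (if k < q then outA k else outA 0)" for k
  have "orbit q \<theta> \<phi>"
    unfolding orbit_def
  proof (intro conjI allI impI)
    show "\<theta> 0 = 0" "\<theta> q = 2 * pi" using full_chain_0[OF h] q by (auto simp: \<theta>_def)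
    show "\<phi> q = \<phi> 0" using q by (simp add: \<phi>_def)
    fix k assume k: "k < q"
    show "\<theta> k < \<theta> (Suc k)" "\<theta> (Suc k) < \<theta> k + 2 * pi" using st[OF k] by auto
    show "chang (\<theta> k) (\<theta> (Suc k)) - \<theta> k = \<phi> k" using k by (simp add: \<phi>_def outA_def)
    have "inA (Suc k) = \<phi> (Suc k)"
      using refl[of "Suc k"] mirA[of "Suc k"] k by (cases "Suc k < q") (auto simp: \<phi>_def)
    then show "\<theta> (Suc k) - chang (\<theta> k) (\<theta> (Suc k)) = \<phi> (Suc k)" by (simp add: inA_def)
  qed (rule q)
  then show ?thesis using that[of h \<phi>] h mx perim_full_chain[OF q] by (simp add: \<theta>_def)
qed

lemma cis_normal_jump: "\<i> * cis (t - p) - \<i> * cis (t + p) = of_real (2 * sin p) * cis t"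
  by (simp add: complex_eq_iff cos_add cos_diff sin_add sin_diff)

text \<open>Each side length is a norm, hence at least its component along the corresponding side of the orbit;
  the equal-angle law turns the sum of these components into a sum over normals.\<close>

lemma orbit_first_variation:
  fixes y :: "nat \<Rightarrow> complex"
  assumes o: "orbit q \<theta> \<phi>" and y: "y q = y 0"
  shows "(\<Sum>k<q. 2 * sin (\<phi> k) * inner (y k) (cis (\<theta> k))) \<le> (\<Sum>k<q. norm (y (Suc k) - y k))"
    and "(\<Sum>k<q. 2 * sin (\<phi> k) * inner (\<Gamma> (\<theta> k)) (cis (\<theta> k))) = perim q \<theta>"
proof -
  have oo: "\<theta> 0 = 0" "\<theta> q = 2 * pi" "\<phi> q = \<phi> 0" and q: "q \<ge> 2" using o by (auto simp: orbit_def)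
  have ok: "\<theta> k < \<theta> (Suc k)" "\<theta> (Suc k) < \<theta> k + 2 * pi" "chang (\<theta> k) (\<theta> (Suc k)) - \<theta> k = \<phi> k"
    "\<theta> (Suc k) - chang (\<theta> k) (\<theta> (Suc k)) = \<phi> (Suc k)" if "k < q" for k using o that by (auto simp: orbit_def)
  define u where "u k = \<i> * cis (chang (\<theta> k) (\<theta> (Suc k)))" for k
  have nu: "norm (u k) = 1" for k by (simp add: u_def norm_mult)
  have u1: "u k = \<i> * cis (\<theta> k + \<phi> k)" "u k = \<i> * cis (\<theta> (Suc k) - \<phi> (Suc k))" if "k < q" for k
  proof -
    have "chang (\<theta> k) (\<theta> (Suc k)) = \<theta> k + \<phi> k" "chang (\<theta> k) (\<theta> (Suc k)) = \<theta> (Suc k) - \<phi> (Suc k)"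
      using ok(3,4)[OF that] by linarith+
    then show "u k = \<i> * cis (\<theta> k + \<phi> k)" "u k = \<i> * cis (\<theta> (Suc k) - \<phi> (Suc k))" by (simp_all add: u_def)
  qed
  \<comment> \<open>The direction of the side arriving at vertex \<open>k\<close>, written so that
    it also makes sense at \<open>k = 0\<close>; summation by parts then turns sides into the jumps
    \<open>v k - u k\<close>, which are normal to the curve.\<close>
  define v where "v k = \<i> * cis (\<theta> k - \<phi> k)" for k
  have vq: "v q = v 0" by (simp add: v_def oo complex_eq_iff cos_diff sin_diff)
  have sm: "(\<Sum>k<q. inner (u k) (y (Suc k) - y k)) = (\<Sum>k<q. 2 * sin (\<phi> k) * inner (y k) (cis (\<theta> k)))"
    if y: "y q = y 0" for y :: "nat \<Rightarrow> complex"
  proof -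
    have "(\<Sum>k<q. inner (u k) (y (Suc k) - y k)) = (\<Sum>k<q. inner (v (Suc k)) (y (Suc k)) - inner (u k) (y k))"
      using u1(2) by (intro sum.cong refl) (auto simp: v_def inner_diff_right)
    also have "\<dots> = (\<Sum>k<q. inner (v (Suc k)) (y (Suc k)) - inner (v k) (y k)) + (\<Sum>k<q. inner (v k) (y k) - inner (u k) (y k))"
      by (simp add: sum.distrib[symmetric])
    also have "(\<Sum>k<q. inner (v (Suc k)) (y (Suc k)) - inner (v k) (y k)) = 0"
      using sum_lessThan_telescope[of "\<lambda>k. inner (v k) (y k)" q] vq y by simp
    also have "(\<Sum>k<q. inner (v k) (y k) - inner (u k) (y k)) = (\<Sum>k<q. 2 * sin (\<phi> k) * inner (y k) (cis (\<theta> k)))"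
    proof (intro sum.cong refl)
      fix k assume "k \<in> {..<q}"
      then have "v k - u k = of_real (2 * sin (\<phi> k)) * cis (\<theta> k)" using u1(1)[of k] cis_normal_jump by (simp add: v_def)
      then have "inner (v k - u k) (y k) = 2 * sin (\<phi> k) * inner (cis (\<theta> k)) (y k)" by (simp only: inner_of_real_mult)
      then show "inner (v k) (y k) - inner (u k) (y k) = 2 * sin (\<phi> k) * inner (y k) (cis (\<theta> k))"
        by (simp add: inner_diff_left inner_commute[of "cis _" "y k"])
    qed
    finally show ?thesis by simp
  qed
  have "(\<Sum>k<q. inner (u k) (y (Suc k) - y k)) \<le> (\<Sum>k<q. norm (y (Suc k) - y k))"
    using norm_cauchy_schwarz[of "u _" "y (Suc _) - y _"] nu by (intro sum_mono) (metis mult_1)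
  then show "(\<Sum>k<q. 2 * sin (\<phi> k) * inner (y k) (cis (\<theta> k))) \<le> (\<Sum>k<q. norm (y (Suc k) - y k))"
    by (simp add: sm[OF y])
  have g: "\<Gamma> (\<theta> q) = \<Gamma> (\<theta> 0)" using oo per\<Gamma>[of 0] by simp
  have "(\<Sum>k<q. inner (u k) (\<Gamma> (\<theta> (Suc k)) - \<Gamma> (\<theta> k))) = perim q \<theta>"
    unfolding perim_def
  proof (intro sum.cong refl)
    fix k assume "k \<in> {..<q}"
    then have "\<Gamma> (\<theta> (Suc k)) - \<Gamma> (\<theta> k) = of_real (len (\<theta> k) (\<theta> (Suc k))) * u k"
      using chord_polar(1)[OF ok(1,2)] by (simp add: u_def)
    moreover have "inner (u k) (of_real r * u k) = r" for r
      using nu[of k] by (metis inner_commute inner_of_real_mult mult.right_neutral norm_eq_1)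
    ultimately show "inner (u k) (\<Gamma> (\<theta> (Suc k)) - \<Gamma> (\<theta> k)) = len (\<theta> k) (\<theta> (Suc k))" by simp
  qed
  then show "(\<Sum>k<q. 2 * sin (\<phi> k) * inner (\<Gamma> (\<theta> k)) (cis (\<theta> k))) = perim q \<theta>"
    using sm[of "\<lambda>k. \<Gamma> (\<theta> k)"] g by simp
qed

end

subsection \<open>Rigidity of the maximal lengths\<close>

text \<open>The growth at rate at least \<open>c\<close> gives injectivity, surjectivity through the
  intermediate value theorem, and the Lipschitz constant of the inverse.\<close>

lemma inverse_diffeo:
  fixes f f' :: "real \<Rightarrow> real"
  assumes d: "\<And>x. (f has_real_derivative f' x) (at x)" and c: "c > 0" "\<And>x. c \<le> f' x"
  shows "\<exists>g. (\<forall>x. g (f x) = x) \<and> (\<forall>y. f (g y) = y) \<and> (\<forall>y. (g has_real_derivative inverse (f' (g y))) (at y))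
           \<and> (\<forall>y z. \<bar>g y - g z\<bar> \<le> \<bar>y - z\<bar> / c)"
proof -
  have grow: "c * (y - x) \<le> f y - f x" if "x \<le> y" for x y
  proof -
    have "f x - c * x \<le> f y - c * y"
    proof (rule DERIV_nonneg_imp_nondecreasing[OF that, where f = "\<lambda>t. f t - c * t"])
      fix t
      have "((\<lambda>t. f t - c * t) has_real_derivative (f' t - c)) (at t)"
        using DERIV_diff[OF d DERIV_cmult_Id[of c]] .
      then show "\<exists>y. ((\<lambda>t. f t - c * t) has_real_derivative y) (at t) \<and> 0 \<le> y" using c(2)[of t] by (intro exI[of _ "f' t - c"]) simp
    qed
    then show ?thesis by (simp add: algebra_simps)
  qed
  have abs_grow: "c * \<bar>y - x\<bar> \<le> \<bar>f y - f x\<bar>" for x y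
    using grow[of x y] grow[of y x] by (cases "x \<le> y") (auto simp: abs_minus_commute abs_if)
  have inj: "inj f"
  proof (rule injI)
    fix x y assume "f x = f y"
    then have "c * \<bar>y - x\<bar> \<le> 0" using abs_grow[of y x] by simp
    then show "x = y" using c(1) by (simp add: mult_le_0_iff)
  qed
  have surj: "\<exists>x. f x = y" for y
  proof -
    define M where "M = \<bar>y - f 0\<bar> / c"
    have M: "M \<ge> 0" "c * M = \<bar>y - f 0\<bar>" using c(1) by (auto simp: M_def)
    have "f (- M) \<le> y" "y \<le> f M" using grow[of "- M" 0] grow[of 0 M] M by auto
    then have "\<exists>x\<ge>- M. x \<le> M \<and> f x = y"
      by (intro IVT) (use M DERIV_isCont[OF d] in auto)
    then show ?thesis by blast
  qed
  define g where "g = inv f"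
  have gf: "g (f x) = x" for x unfolding g_def by (rule inv_f_f[OF inj])
  have fg: "f (g y) = y" for y unfolding g_def using surj[of y] by (auto intro: f_inv_into_f)
  have lip: "\<bar>g y - g z\<bar> \<le> \<bar>y - z\<bar> / c" for y z
    using abs_grow[of "g y" "g z"] c(1) by (simp add: fg field_simps)
  have cont: "isCont g y" for y
    unfolding continuous_at_eps_delta
  proof (intro allI impI)
    fix e :: real assume e: "e > 0"
    show "\<exists>d>0. \<forall>x'. dist x' y < d \<longrightarrow> dist (g x') (g y) < e"
    proof (intro exI[of _ "e * c"] conjI allI impI)
      fix x' assume "dist x' y < e * c"
      then have "\<bar>x' - y\<bar> / c < e" using c(1) by (simp add: dist_real_def field_simps)
      then show "dist (g x') (g y) < e" using lip[of x' y] unfolding dist_real_def by linarith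
    qed (use e c in simp)
  qed
  have "(g has_real_derivative inverse (f' (g y))) (at y)" for y
    by (rule DERIV_inverse_function[where a = "y - 1" and b = "y + 1" and f = f])
       (use d c fg cont in \<open>auto simp: less_le_trans[OF c(1)] intro: less_imp_neq[THEN not_sym]\<close>, metis c(1) c(2) not_le)
  then show ?thesis using gf fg lip by blast
qed

context billiard_curve
begin

definition psi where "psi = (SOME g. (\<forall>x. g (XX x) = x) \<and> (\<forall>y. XX (g y) = y) \<and>
   (\<forall>y. (g has_real_derivative inverse (cr (g y) / KK)) (at y)) \<and> (\<forall>y z. \<bar>g y - g z\<bar> \<le> \<bar>y - z\<bar> / (1/8)))"

lemma psi: "psi (XX x) = x" "XX (psi y) = y" "(psi has_real_derivative KK / cr (psi y)) (at y)"
  "\<bar>psi y - psi z\<bar> \<le> 8 * \<bar>y - z\<bar>"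
proof -
  have "1/8 \<le> cr x / KK" for x
    using cr_bounds[of x] KK_num by (simp add: field_simps)
  from someI_ex[OF inverse_diffeo[OF d_XX _ this]]
  have *: "(\<forall>x. psi (XX x) = x) \<and> (\<forall>y. XX (psi y) = y) \<and>
   (\<forall>y. (psi has_real_derivative inverse (cr (psi y) / KK)) (at y)) \<and> (\<forall>y z. \<bar>psi y - psi z\<bar> \<le> \<bar>y - z\<bar> / (1/8))"
    unfolding psi_def by simp
  then show "psi (XX x) = x" "XX (psi y) = y" by blast+
  have "(psi has_real_derivative inverse (cr (psi y) / KK)) (at y)" using * by blast
  then show "(psi has_real_derivative KK / cr (psi y)) (at y)" by (simp add: field_simps)
  have "\<bar>psi y - psi z\<bar> \<le> \<bar>y - z\<bar> / (1/8)" using * by blast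
  then show "\<bar>psi y - psi z\<bar> \<le> 8 * \<bar>y - z\<bar>" by simp
qed

lemma psi_per: "psi (y + 1) = psi y + 2 * pi"
  using psi(1)[of "psi y + 2 * pi"] by (simp add: XX_per psi(2))

lemma psi_01: "psi 0 = 0" "psi 1 = 2 * pi"
  using psi(1)[of 0] psi(1)[of "2 * pi"] by (simp_all add: XX_0 XX_2pi)

definition bb where "bb t = KK / cr t"

lemma d_psi: "(psi has_real_derivative bb (psi y)) (at y)" unfolding bb_def by (rule psi(3))

lemma d_bb: "(bb has_real_derivative - (bb t * pp t / 3)) (at t)"
proof -
  have "(bb has_real_derivative (0 * cr t - KK * (cr t * (pp t / 3))) / (cr t * cr t)) (at t)"
    unfolding bb_def[abs_def] by (intro DERIV_divide DERIV_const d_cr) (use cr_pos[of t] in simp)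
  moreover have "(0 * cr t - KK * (cr t * (pp t / 3))) / (cr t * cr t) = - (bb t * pp t / 3)"
    using cr_pos[of t] by (simp add: bb_def)
  ultimately show ?thesis by (simp only:)
qed

lemma bb_cube: "bb t ^ 3 = KK ^ 3 / \<rho> t"
  by (simp add: bb_def power_divide cr_cube)

lemma per_bb: "bb (t + 2 * pi) = bb t" by (simp add: bb_def per_cr)

text \<open>The transported deformation \<open>(n / X') \<circ> X\<^sup>-\<^sup>1\<close> and its second derivative.\<close>

definition uu where "uu n x = bb (psi x) * n (psi x)"
definition EE where "EE n n1 n2 t = KK ^ 3 / \<rho> t * (n2 t - pp t * n1 t + (2 * (pp t)\<^sup>2 / 9 - pp1 t / 3) * n t)" for n n1 n2 :: "real \<Rightarrow> real"

lemma d_uu: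
  assumes n: "\<And>t. (n has_real_derivative n1 t) (at t)"
  shows "(uu n has_real_derivative (bb (psi x))\<^sup>2 * (n1 (psi x) - pp (psi x) * n (psi x) / 3)) (at x)"
proof -
  have "((\<lambda>t. bb t * n t) has_real_derivative (- (bb t * pp t / 3) * n t + n1 t * bb t)) (at t)" for t
    by (rule DERIV_mult[OF d_bb n])
  from DERIV_chain2[OF this d_psi, of x]
  show ?thesis unfolding uu_def[abs_def] by (simp add: algebra_simps power2_eq_square)
qed

text \<open>Each chain rule through \<open>psi\<close> adds a factor \<open>bb\<close>; after two of
  them the cube \<open>KK ^ 3 / \<rho>\<close> appears, so no cube roots remain in
  \<open>EE\<close>.\<close>

lemma d2_uu:
  assumes n: "\<And>t. (n has_real_derivative n1 t) (at t)" and n1: "\<And>t. (n1 has_real_derivative n2 t) (at t)"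
  shows "((\<lambda>x. (bb (psi x))\<^sup>2 * (n1 (psi x) - pp (psi x) * n (psi x) / 3)) has_real_derivative EE n n1 n2 (psi x)) (at x)"
proof -
  have b2: "((\<lambda>t. (bb t)\<^sup>2) has_real_derivative (- (2/3) * pp t * (bb t)\<^sup>2)) (at t)" for t
    using DERIV_power[OF d_bb, of 2 t] by (simp add: power2_eq_square algebra_simps)
  have i: "((\<lambda>t. n1 t - pp t * n t / 3) has_real_derivative (n2 t - (pp1 t * n t + n1 t * pp t) / 3)) (at t)" for t
    by (intro DERIV_diff n1 DERIV_cdivide DERIV_mult d_pp n)
  from DERIV_chain2[OF DERIV_mult[OF b2 i] d_psi, of x]
  have "((\<lambda>x. (bb (psi x))\<^sup>2 * (n1 (psi x) - pp (psi x) * n (psi x) / 3)) has_real_derivative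
     ((- (2/3) * pp (psi x) * (bb (psi x))\<^sup>2) * (n1 (psi x) - pp (psi x) * n (psi x) / 3)
      + (n2 (psi x) - (pp1 (psi x) * n (psi x) + n1 (psi x) * pp (psi x)) / 3) * (bb (psi x))\<^sup>2) * bb (psi x)) (at x)" .
  moreover have "((- (2/3) * P * B\<^sup>2) * (N1 - P * N / 3) + (N2 - (P1 * N + N1 * P) / 3) * B\<^sup>2) * B
     = B ^ 3 * (N2 - P * N1 + (2 * P\<^sup>2 / 9 - P1 / 3) * N)" for P B N N1 N2 P1 :: real
    by (simp add: power2_eq_square power3_eq_cube) (simp add: field_simps)
  ultimately show ?thesis by (simp only: EE_def bb_cube[symmetric])
qed

lemma KK_cube: "KK ^ 3 \<le> 343" "KK ^ 3 > 0"
  using power_mono[of KK 7 3] KK_num by auto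

end

context sym_curve
begin

lemma cr_even: "cr (- t) = cr t" by (simp add: cr_def sym\<rho>)

lemma XX_odd: "XX (- t) = - XX t"
proof -
  have "((\<lambda>t. XX (- t) + XX t) has_real_derivative 0) (at x)" for x
  proof -
    have "((\<lambda>t. - t) has_real_derivative -1) (at x)" by (auto intro!: derivative_eq_intros)
    from DERIV_add[OF DERIV_chain2[OF d_XX this] d_XX[of x]] show ?thesis by (simp add: cr_even)
  qed
  then have "XX (- t) + XX t = XX (- 0) + XX 0" by (intro DERIV_isconst_all allI) auto
  then show ?thesis by (simp add: XX_0)
qed

lemma psi_odd: "psi (- x) = - psi x"
  using psi(1)[of "- psi x"] by (simp add: XX_odd psi(2))

lemma uu_even: assumes "\<And>t. n (- t) = n t" shows "uu n (- x) = uu n x"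
  by (simp add: uu_def psi_odd assms bb_def cr_even)

end

section \<open>Interpolation between derivatives\<close>

lemma landau_inequality:
  fixes f f1 f2 :: "real \<Rightarrow> real"
  assumes d: "\<And>x. (f has_real_derivative f1 x) (at x)" and d1: "\<And>x. (f1 has_real_derivative f2 x) (at x)"
    and A: "\<And>x. \<bar>f x\<bar> \<le> A" and C: "\<And>x. \<bar>f2 x\<bar> \<le> C"
  shows "(f1 x)\<^sup>2 \<le> 4 * A * C"
proof -
  have A0: "A \<ge> 0" and C0: "C \<ge> 0" using A[of 0] C[of 0] by auto
  have key: "t * \<bar>f1 x\<bar> \<le> 2 * A + C * t\<^sup>2 / 2" if t: "t \<ge> 0" for t
  proof -
    have "\<bar>f (x - t) - f x + t * f1 x\<bar> \<le> C * t\<^sup>2 / 2" by (rule backward_diff2[OF d d1 C t])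
    then have "\<bar>t * f1 x\<bar> \<le> 2 * A + C * t\<^sup>2 / 2" using A[of "x - t"] A[of x] by linarith
    then show ?thesis using t by (simp add: abs_mult)
  qed
  show ?thesis
  proof (cases "C = 0")
    case True
    have "f1 x = 0"
    proof (rule ccontr)
      assume "f1 x \<noteq> 0"
      then have p: "\<bar>f1 x\<bar> > 0" by simp
      have "(2 * A + 1) / \<bar>f1 x\<bar> * \<bar>f1 x\<bar> \<le> 2 * A" using key[of "(2 * A + 1) / \<bar>f1 x\<bar>"] True A0 by simp
      then show False using p by simp
    qed
    then show ?thesis using A0 C0 by simp
  next
    case False
    then have Cp: "C > 0" using C0 by simp
    \<comment> \<open>The shift in \<open>key\<close> that maximises
      \<open>t * \<bar>f1 x\<bar> - C * t^2 / 2\<close>.\<close>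
    have "\<bar>f1 x\<bar> / C * \<bar>f1 x\<bar> \<le> 2 * A + C * (\<bar>f1 x\<bar> / C)\<^sup>2 / 2" using Cp by (intro key) auto
    then have "(f1 x)\<^sup>2 / C \<le> 2 * A + (f1 x)\<^sup>2 / (2 * C)"
      using Cp by (simp add: power2_eq_square divide_simps flip: abs_mult) 
    then have "(f1 x)\<^sup>2 / (2 * C) \<le> 2 * A" using Cp by (simp add: field_simps)
    then show ?thesis using Cp by (simp add: field_simps)
  qed
qed

text \<open>The hypothesis is log-convexity up to the constant 4, so products of two norms with
  constant index sum grow outward: from (2,3) to (1,4) to (0,5). \<open>canc\<close> divides by a
  factor that may be zero.\<close>

lemma interpolation_products:
  fixes a :: "nat \<Rightarrow> real"
  assumes nn: "\<And>i. a i \<ge> 0" and L: "\<And>i. i \<le> 3 \<Longrightarrow> (a (Suc i))\<^sup>2 \<le> 4 * a i * a (Suc (Suc i))"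
  shows "a 2 * a 3 \<le> 4096 * (a 0 * a 5)"
proof -
  have L1: "a 1 * a 1 \<le> 4 * (a 0 * a 2)" "a 2 * a 2 \<le> 4 * (a 1 * a 3)" "a 3 * a 3 \<le> 4 * (a 2 * a 4)" "a 4 * a 4 \<le> 4 * (a 3 * a 5)"
    using L[of 0] L[of 1] L[of 2] L[of 3] by (simp_all add: power2_eq_square eval_nat_numeral mult_ac)
  have canc: "x \<le> K * y" if "x * x \<le> K * (x * y)" "x \<ge> 0" "y \<ge> 0" "K \<ge> 0" for x y K :: real
  proof (cases "x = 0")
    case False
    then have "x > 0" using that by simp
    moreover have "x * x \<le> x * (K * y)" using that by (simp add: mult_ac)
    ultimately show ?thesis by simp
  qed (use that in simp)
  have "(a 2 * a 3) * (a 2 * a 3) = (a 2 * a 2) * (a 3 * a 3)" by simp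
  also have "\<dots> \<le> (4 * (a 1 * a 3)) * (4 * (a 2 * a 4))" by (rule mult_mono) (use nn L1 in auto)
  finally have "(a 2 * a 3) * (a 2 * a 3) \<le> 16 * ((a 2 * a 3) * (a 1 * a 4))" by (simp add: mult_ac)
  then have 1: "a 2 * a 3 \<le> 16 * (a 1 * a 4)" by (rule canc) (use nn in auto)
  have "(a 1 * a 4) * (a 1 * a 4) = (a 1 * a 1) * (a 4 * a 4)" by simp
  also have "\<dots> \<le> (4 * (a 0 * a 2)) * (4 * (a 3 * a 5))" by (rule mult_mono) (use nn L1 in auto)
  also have "\<dots> = 16 * ((a 2 * a 3) * (a 0 * a 5))" by simp
  also have "\<dots> \<le> 16 * ((16 * (a 1 * a 4)) * (a 0 * a 5))" using nn 1 by (intro mult_left_mono mult_right_mono) auto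
  finally have "(a 1 * a 4) * (a 1 * a 4) \<le> 256 * ((a 1 * a 4) * (a 0 * a 5))" by (simp add: mult_ac)
  then have "a 1 * a 4 \<le> 256 * (a 0 * a 5)" by (rule canc) (use nn in auto)
  then show ?thesis using 1 by simp
qed

lemma lipschitz_of_deriv:
  fixes f f' :: "real \<Rightarrow> real"
  assumes "\<And>x. (f has_real_derivative f' x) (at x)" "\<And>x. \<bar>f' x\<bar> \<le> C"
  shows "\<bar>f x - f y\<bar> \<le> C * \<bar>x - y\<bar>"
  using field_differentiable_bound[of UNIV f f' C x y] assms
  by (auto simp: has_field_derivative_at_within)

section \<open>Comparison of two curves\<close>

locale two_curves = A: sym_curve \<rho> \<rho>1 \<rho>2 \<rho>3 \<Gamma> s \<epsilon> + B: sym_curve \<sigma> \<sigma>1 \<sigma>2 \<sigma>3 \<Delta> w \<epsilon>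
  for \<rho> \<rho>1 \<rho>2 \<rho>3 :: "real \<Rightarrow> real" and \<Gamma> :: "real \<Rightarrow> complex" and s :: "real \<Rightarrow> real"
    and \<sigma> \<sigma>1 \<sigma>2 \<sigma>3 :: "real \<Rightarrow> real" and \<Delta> :: "real \<Rightarrow> complex" and w :: "real \<Rightarrow> real" and \<epsilon> :: real
begin

text \<open>The difference \<open>N 0\<close> of the support functions and its derivatives.\<close>

definition N :: "nat \<Rightarrow> real \<Rightarrow> real" where
  "N i t = (let d = inner (\<Delta> t - \<Gamma> t) (cis t); d1 = inner (\<Delta> t - \<Gamma> t) (\<i> * cis t) in
     if i = 0 then d else if i = 1 then d1 else if i = 2 then \<sigma> t - \<rho> t - d
     else if i = 3 then \<sigma>1 t - \<rho>1 t - d1 else if i = 4 then \<sigma>2 t - \<rho>2 t - (\<sigma> t - \<rho> t - d)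
     else \<sigma>3 t - \<rho>3 t - (\<sigma>1 t - \<rho>1 t - d1))"

lemma N_rec: "N 2 t = \<sigma> t - \<rho> t - N 0 t" "N 3 t = \<sigma>1 t - \<rho>1 t - N 1 t"
  "N 4 t = \<sigma>2 t - \<rho>2 t - N 2 t" "N 5 t = \<sigma>3 t - \<rho>3 t - N 3 t"
  by (simp_all add: N_def Let_def)

lemma d_diff: "((\<lambda>t. \<Delta> t - \<Gamma> t) has_vector_derivative of_real (\<sigma> t - \<rho> t) * (\<i> * cis t)) (at t)"
  using has_vector_derivative_diff[OF B.d\<Gamma> A.d\<Gamma>, of t] by (simp add: left_diff_distrib)

lemma d_cis: "(cis has_vector_derivative \<i> * cis t) (at t)"
  unfolding cis_conv_exp[abs_def]
  by (rule has_vector_derivative_eq_rhs, rule has_vector_derivative_real_field[where f = "\<lambda>z. exp (\<i> * z)"])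
     (auto intro!: derivative_eq_intros)

lemma d_N0: "(N 0 has_real_derivative N 1 t) (at t)"
proof -
  have "((\<lambda>t. inner (\<Delta> t - \<Gamma> t) (cis t)) has_vector_derivative
      (inner (\<Delta> t - \<Gamma> t) (\<i> * cis t) + inner (of_real (\<sigma> t - \<rho> t) * (\<i> * cis t)) (cis t))) (at t)"
    by (rule bounded_bilinear.has_vector_derivative[OF bounded_bilinear_inner d_diff d_cis])
  then show ?thesis
    by (simp add: N_def[abs_def] Let_def has_real_derivative_iff_has_vector_derivative inner_of_real_mult inner_i_cis del: of_real_diff)
qed

lemma d_N1: "(N 1 has_real_derivative N 2 t) (at t)"
proof -
  have d: "((\<lambda>t. \<i> * cis t) has_vector_derivative \<i> * (\<i> * cis t)) (at t)"
    by (intro has_vector_derivative_mult_right d_cis)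
  have "((\<lambda>t. inner (\<Delta> t - \<Gamma> t) (\<i> * cis t)) has_vector_derivative
      (inner (\<Delta> t - \<Gamma> t) (\<i> * (\<i> * cis t)) + inner (of_real (\<sigma> t - \<rho> t) * (\<i> * cis t)) (\<i> * cis t))) (at t)"
    by (rule bounded_bilinear.has_vector_derivative[OF bounded_bilinear_inner d_diff d])
  moreover have "inner (\<Delta> t - \<Gamma> t) (\<i> * (\<i> * cis t)) = - inner (\<Delta> t - \<Gamma> t) (cis t)"
    by (simp add: inner_complex_def)
  moreover have "inner (\<i> * cis t) (\<i> * cis t) = 1" by (simp add: inner_complex_def flip: power2_eq_square)
  ultimately show ?thesis
    by (simp add: N_def[abs_def] Let_def has_real_derivative_iff_has_vector_derivative inner_of_real_mult del: of_real_diff)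
qed

lemma d_N: assumes "i \<le> 4" shows "(N i has_real_derivative N (Suc i) t) (at t)"
proof -
  have e: "N 2 = (\<lambda>t. \<sigma> t - \<rho> t - N 0 t)" "N 3 = (\<lambda>t. \<sigma>1 t - \<rho>1 t - N 1 t)" "N 4 = (\<lambda>t. \<sigma>2 t - \<rho>2 t - N 2 t)"
    using N_rec by auto
  have d2: "(N 2 has_real_derivative N 3 t) (at t)"
    by (subst e(1), subst N_rec(2)) (intro DERIV_diff A.d\<rho> B.d\<rho> d_N0)
  have d3: "(N 3 has_real_derivative N 4 t) (at t)"
    by (subst e(2), subst N_rec(3)) (intro DERIV_diff A.d\<rho>1 B.d\<rho>1 d_N1)
  have d4: "(N 4 has_real_derivative N 5 t) (at t)"
    by (subst e(3), subst N_rec(4)) (intro DERIV_diff A.d\<rho>2 B.d\<rho>2 d2)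
  have "i = 0 \<or> i = 1 \<or> i = 2 \<or> i = 3 \<or> i = 4" using assms by auto
  then show ?thesis using d_N0 d_N1 d2 d3 d4 by (elim disjE) (simp_all add: eval_nat_numeral)
qed

lemma diff_bound: "norm (\<Delta> t - \<Gamma> t) \<le> 13 * \<epsilon>"
proof -
  obtain k where k: "0 \<le> t + 2 * pi * of_int k" "t + 2 * pi * of_int k < 0 + 2 * pi" by (rule A.angle_reduce)
  define x where "x = t + 2 * pi * of_int k"
  have x: "0 \<le> x" "x \<le> 6.5" using k pi_approx by (auto simp: x_def)
  have "norm ((\<Delta> x - \<Gamma> x) - (\<Delta> 0 - \<Gamma> 0)) \<le> (2 * \<epsilon>) * norm (x - 0)"
  proof (rule differentiable_bound[of UNIV _ "\<lambda>t h. h *\<^sub>R (of_real (\<sigma> t - \<rho> t) * (\<i> * cis t))"])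
    fix t :: real
    show "((\<lambda>t. \<Delta> t - \<Gamma> t) has_derivative (\<lambda>h. h *\<^sub>R (of_real (\<sigma> t - \<rho> t) * (\<i> * cis t)))) (at t within UNIV)"
      using d_diff[of t] by (simp add: has_vector_derivative_def)
    have "\<bar>\<sigma> t - \<rho> t\<bar> \<le> 2 * \<epsilon>" using A.b\<rho>[of t] B.b\<rho>[of t] by linarith
    then show "onorm (\<lambda>h. h *\<^sub>R (complex_of_real (\<sigma> t - \<rho> t) * (\<i> * cis t))) \<le> 2 * \<epsilon>"
      by (intro onorm_le) (auto simp: norm_mult mult_left_mono mult.commute simp del: of_real_diff)
  qed auto
  also have "\<dots> \<le> (2 * \<epsilon>) * 6.5" using x A.eps by (intro mult_left_mono) auto
  finally show ?thesis by (simp add: A.\<Gamma>0 B.\<Gamma>0 x_def A.Gamma_int B.Gamma_int)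
qed

lemma N_bound: assumes "i \<le> 5" shows "\<bar>N i t\<bar> \<le> 17 * \<epsilon>"
proof -
  have 0: "\<bar>N 0 t\<bar> \<le> 13 * \<epsilon>"
    using Cauchy_Schwarz_ineq2[of "\<Delta> t - \<Gamma> t" "cis t"] diff_bound[of t] by (simp add: N_def Let_def)
  have 1: "\<bar>N 1 t\<bar> \<le> 13 * \<epsilon>"
    using Cauchy_Schwarz_ineq2[of "\<Delta> t - \<Gamma> t" "\<i> * cis t"] diff_bound[of t] by (simp add: N_def Let_def norm_mult)
  have 2: "\<bar>N 2 t\<bar> \<le> 15 * \<epsilon>" unfolding N_rec using 0 A.b\<rho>[of t] B.b\<rho>[of t] by linarith
  have 3: "\<bar>N 3 t\<bar> \<le> 15 * \<epsilon>" unfolding N_rec using 1 A.b\<rho>1[of t] B.b\<rho>1[of t] by linarith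
  have 4: "\<bar>N 4 t\<bar> \<le> 17 * \<epsilon>" using N_rec(3)[of t] 2 A.b\<rho>2[of t] B.b\<rho>2[of t] by linarith
  have 5: "\<bar>N 5 t\<bar> \<le> 17 * \<epsilon>" using N_rec(4)[of t] 3 A.b\<rho>3[of t] B.b\<rho>3[of t] by linarith
  have "i = 0 \<or> i = 1 \<or> i = 2 \<or> i = 3 \<or> i = 4 \<or> i = 5" using assms by auto
  then show ?thesis using 0 1 2 3 4 5 A.eps by (elim disjE) auto
qed

lemma N_per0: "N 0 (t + 2 * pi) = N 0 t" "N 1 (t + 2 * pi) = N 1 t"
  by (simp_all add: N_def Let_def A.per\<Gamma> B.per\<Gamma> complex_eq_iff inner_complex_def)

lemma N_per: assumes "i \<le> 4" shows "N i (t + 2 * pi) = N i t"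
  using assms
proof (induction i arbitrary: t)
  case 0 show ?case by (rule N_per0)
next
  case (Suc i)
  have "((\<lambda>t. t + 2 * pi) has_real_derivative 1) (at t)" by (auto intro!: derivative_eq_intros)
  from DERIV_chain2[OF d_N this, of i] Suc have "(N i has_real_derivative N (Suc i) (t + 2 * pi)) (at t)" by simp
  then show ?case using d_N[of i t] Suc DERIV_unique by force
qed

definition aa :: "nat \<Rightarrow> real" where "aa i = (SUP t. \<bar>N i t\<bar>)"

lemma N_le: assumes "i \<le> 5" shows "\<bar>N i t\<bar> \<le> aa i"
  unfolding aa_def by (rule cSUP_upper) (use N_bound[OF assms] in \<open>auto simp: bdd_above_def\<close>)

lemma aa_nonneg: "i \<le> 5 \<Longrightarrow> aa i \<ge> 0" using N_le[of i 0] by linarith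

lemma aa_least: "(\<And>t. \<bar>N i t\<bar> \<le> c) \<Longrightarrow> aa i \<le> c"
  unfolding aa_def by (rule cSUP_least) auto

text \<open>Each \<open>N i\<close> is the derivative of a periodic function, so it vanishes
  somewhere in every period (Rolle) and is bounded by the period times the next norm. For
  \<open>i = 0\<close> the primitive \<open>w - s - N 1\<close> is periodic because both perimeters
  are \<open>2 * pi\<close>.\<close>

lemma aa_step: assumes "i \<le> 4" shows "aa i \<le> 7 * aa (Suc i)"
proof (rule aa_least)
  fix t
  define P where "P = (if i = 0 then (\<lambda>t. w t - s t - N 1 t) else N (i - 1))"
  have dP: "(P has_real_derivative N i x) (at x)" for x
  proof (cases "i = 0")
    case True
    have "((\<lambda>t. w t - s t - N 1 t) has_real_derivative (\<sigma> x - \<rho> x - N 2 x)) (at x)"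
      by (intro DERIV_diff A.ds B.ds d_N1)
    then show ?thesis using True by (simp add: P_def N_rec)
  next
    case False
    then show ?thesis using d_N[of "i - 1" x] assms by (simp add: P_def)
  qed
  have pP: "P (x + 2 * pi) = P x" for x
    using N_per[of "i - 1" x] N_per0 assms by (auto simp: P_def A.pers B.pers)
  have "\<exists>z. t < z \<and> z < t + 2 * pi \<and> DERIV P z :> 0"
    by (rule Rolle) (use pP dP DERIV_isCont[OF dP] in \<open>auto intro!: continuous_at_imp_continuous_on simp: real_differentiable_def\<close>)
  then obtain z where z: "t < z" "z < t + 2 * pi" "N i z = 0" using dP DERIV_unique by blast
  have "\<bar>N i t - N i z\<bar> \<le> aa (Suc i) * \<bar>t - z\<bar>"
    by (rule lipschitz_of_deriv[OF d_N[OF assms] N_le]) (use assms in simp)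
  also have "\<dots> \<le> aa (Suc i) * 7" using z pi_approx aa_nonneg[of "Suc i"] assms by (intro mult_left_mono) auto
  finally show "\<bar>N i t\<bar> \<le> 7 * aa (Suc i)" using z by simp
qed

lemma aa_landau: assumes "i \<le> 3" shows "(aa (Suc i))\<^sup>2 \<le> 4 * aa i * aa (Suc (Suc i))"
proof -
  have p: "0 \<le> 4 * aa i * aa (Suc (Suc i))" using aa_nonneg[of i] aa_nonneg[of "Suc (Suc i)"] assms by simp
  have "aa (Suc i) \<le> sqrt (4 * aa i * aa (Suc (Suc i)))"
  proof (rule aa_least)
    fix t
    have "(N (Suc i) t)\<^sup>2 \<le> 4 * aa i * aa (Suc (Suc i))"
      by (rule landau_inequality[OF d_N d_N N_le N_le]) (use assms in auto)
    then show "\<bar>N (Suc i) t\<bar> \<le> sqrt (4 * aa i * aa (Suc (Suc i)))" by (rule real_le_rsqrt[OF _, simplified power2_abs, of "\<bar>N (Suc i) t\<bar>" , simplified])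
  qed
  then have "(aa (Suc i))\<^sup>2 \<le> (sqrt (4 * aa i * aa (Suc (Suc i))))\<^sup>2" using aa_nonneg[of "Suc i"] assms by (intro power_mono) auto
  then show ?thesis using p by simp
qed

text \<open>The quadratic terms of the comparison below are all reduced to
  \<open>aa 0 * aa 5\<close>, where the first factor is controlled linearly by the cosine
  coefficients and the second is small.\<close>

lemma aa_products:
  "aa 2 * aa 3 \<le> 4096 * (aa 0 * aa 5)" "aa 2 * aa 2 \<le> 7 * (aa 2 * aa 3)" "aa 1 * aa 3 \<le> 7 * (aa 2 * aa 3)" "aa 0 * aa 4 \<le> 7 * (aa 0 * aa 5)"
proof -
  define a where "a i = (if i \<le> 5 then aa i else 0)" for i
  have "a 2 * a 3 \<le> 4096 * (a 0 * a 5)"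
    by (rule interpolation_products) (use aa_nonneg aa_landau in \<open>auto simp: a_def\<close>)
  then show "aa 2 * aa 3 \<le> 4096 * (aa 0 * aa 5)" by (simp add: a_def)
  have n: "aa 2 \<ge> 0" "aa 3 \<ge> 0" "aa 0 \<ge> 0" using aa_nonneg by auto
  have st: "aa 2 \<le> 7 * aa 3" "aa 1 \<le> 7 * aa 2" "aa 4 \<le> 7 * aa 5"
    using aa_step[of 2] aa_step[of 1] aa_step[of 4] by (simp_all add: eval_nat_numeral)
  show "aa 2 * aa 2 \<le> 7 * (aa 2 * aa 3)" using mult_left_mono[OF st(1) n(1)] by simp
  show "aa 1 * aa 3 \<le> 7 * (aa 2 * aa 3)" using mult_right_mono[OF st(2) n(2)] by simp
  show "aa 0 * aa 4 \<le> 7 * (aa 0 * aa 5)" using mult_left_mono[OF st(3) n(3)] by simp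
qed

lemma steps: "aa 0 \<le> 7 * aa 1" "aa 1 \<le> 7 * aa 2" "aa 2 \<le> 7 * aa 3" "aa 3 \<le> 7 * aa 4"
  using aa_step[of 0] aa_step[of 1] aa_step[of 2] aa_step[of 3] by (simp_all add: eval_nat_numeral)

lemma nonnegs: "aa 0 \<ge> 0" "aa 1 \<ge> 0" "aa 2 \<ge> 0" "aa 3 \<ge> 0" "aa 4 \<ge> 0" "aa 5 \<ge> 0"
  using aa_nonneg by auto

lemma diffs: "\<bar>\<sigma> t - \<rho> t\<bar> \<le> 50 * aa 2" "\<bar>\<sigma>1 t - \<rho>1 t\<bar> \<le> 50 * aa 3" "\<bar>\<sigma>2 t - \<rho>2 t\<bar> \<le> 50 * aa 4"
  using N_rec[of t] N_le[of 0 t] N_le[of 1 t] N_le[of 2 t] N_le[of 3 t] N_le[of 4 t] steps by (auto simp: abs_le_iff)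

lemma cr_diff: "\<bar>B.cr t - A.cr t\<bar> \<le> 20 * aa 2"
proof -
  define x y where "x = B.cr t" and "y = A.cr t"
  have b: "99/100 \<le> x" "99/100 \<le> y" using A.cr_bounds[of t] B.cr_bounds[of t] by (auto simp: x_def y_def)
  have "x * x \<ge> 99/100 * (99/100)" "x * y \<ge> 99/100 * (99/100)" "y * y \<ge> 99/100 * (99/100)" by (intro mult_mono; use b in auto)+
  then have "5/2 \<le> x * x + x * y + y * y" by simp
  then have "\<bar>x - y\<bar> * (5/2) \<le> \<bar>x - y\<bar> * (x * x + x * y + y * y)" by (intro mult_left_mono) auto
  also have "\<dots> = \<bar>(x - y) * (x * x + x * y + y * y)\<bar>" using \<open>5/2 \<le> _\<close> by (simp add: abs_mult)
  also have "(x - y) * (x * x + x * y + y * y) = x ^ 3 - y ^ 3" by (simp add: algebra_simps power3_eq_cube)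
  also have "\<dots> = \<sigma> t - \<rho> t" by (simp add: x_def y_def A.cr_cube B.cr_cube)
  finally show ?thesis using diffs(1)[of t] by (simp add: x_def y_def)
qed

lemma lz_diff: assumes "0 \<le> t" "t \<le> 2 * pi" shows "\<bar>B.lz t - A.lz t\<bar> \<le> 130 * aa 2"
proof -
  have "\<bar>(B.lz t - A.lz t) - (B.lz 0 - A.lz 0)\<bar> \<le> (20 * aa 2) * \<bar>t - 0\<bar>"
    by (rule lipschitz_of_deriv[where f = "\<lambda>t. B.lz t - A.lz t"]) (rule DERIV_diff[OF B.lz(2) A.lz(2)], rule cr_diff)
  also have "\<dots> \<le> (20 * aa 2) * (13/2)" using assms pi_approx nonnegs by (intro mult_left_mono) auto
  finally show ?thesis by (simp add: A.lz B.lz)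
qed

lemma KK_diff: "\<bar>B.KK - A.KK\<bar> \<le> 130 * aa 2"
  unfolding A.KK_def B.KK_def by (rule lz_diff) auto

lemma XX_diff: "\<bar>B.XX t - A.XX t\<bar> \<le> 45 * aa 2"
proof -
  have base: "\<bar>B.XX t - A.XX t\<bar> \<le> 45 * aa 2" if t: "0 \<le> t" "t \<le> 2 * pi" for t
  proof -
    have "A.XX 0 \<le> A.XX t" "A.XX t \<le> A.XX (2 * pi)"
      by (rule DERIV_nonneg_imp_nondecreasing; use t A.d_XX A.cr_pos A.KK_bounds(3) in \<open>auto intro!: exI conjI simp: less_imp_le\<close>)+
    then have X: "\<bar>A.XX t\<bar> \<le> 1" by (simp add: A.XX_0 A.XX_2pi)
    have "B.XX t - A.XX t = ((B.lz t - A.lz t) - A.XX t * (B.KK - A.KK)) / B.KK"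
      using A.KK_bounds(3) B.KK_bounds(3) by (simp add: A.XX_def B.XX_def field_simps)
    moreover have "\<bar>A.XX t * (B.KK - A.KK)\<bar> \<le> 1 * (130 * aa 2)" unfolding abs_mult by (intro mult_mono X KK_diff) auto
    then have "\<bar>(B.lz t - A.lz t) - A.XX t * (B.KK - A.KK)\<bar> \<le> 260 * aa 2" using lz_diff[OF t] by linarith
    then have "\<bar>(B.lz t - A.lz t) - A.XX t * (B.KK - A.KK)\<bar> / B.KK \<le> 260 * aa 2 / 6"
      using B.KK_num nonnegs by (intro frac_le) auto
    moreover have "\<bar>((B.lz t - A.lz t) - A.XX t * (B.KK - A.KK)) / B.KK\<bar> = \<bar>(B.lz t - A.lz t) - A.XX t * (B.KK - A.KK)\<bar> / B.KK"
      using B.KK_bounds(3) by (simp add: abs_divide)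
    ultimately show ?thesis using nonnegs by linarith
  qed
  have per: "B.XX (t + 2 * pi * of_int k) - A.XX (t + 2 * pi * of_int k) = B.XX t - A.XX t" for k :: int
  proof (induction k rule: int_induct[where k = 0])
    case (step1 i)
    have "t + 2 * pi * of_int (i + 1) = (t + 2 * pi * of_int i) + 2 * pi" by (simp add: algebra_simps)
    then show ?case using step1 by (simp only: A.XX_per B.XX_per)
  next
    case (step2 i)
    have "t + 2 * pi * of_int i = (t + 2 * pi * of_int (i - 1)) + 2 * pi" by (simp add: algebra_simps)
    then show ?case using step2 by (simp only: A.XX_per B.XX_per)
  qed simp
  obtain k where k: "0 \<le> t + 2 * pi * of_int k" "t + 2 * pi * of_int k < 0 + 2 * pi" by (rule A.angle_reduce)
  show ?thesis using base[of "t + 2 * pi * of_int k"] per[of k] k by simp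
qed

text \<open>With \<open>t = B.psi x\<close> one has \<open>t = A.psi (A.XX t)\<close> and
  \<open>x = B.XX t\<close>, so the Lipschitz bound of \<open>A.psi\<close> transfers
  \<open>XX_diff\<close> to the inverses.\<close>

lemma psi_diff: "\<bar>B.psi x - A.psi x\<bar> \<le> 360 * aa 2"
proof -
  define t where "t = B.psi x"
  have "\<bar>A.psi (A.XX t) - A.psi x\<bar> \<le> 8 * \<bar>A.XX t - x\<bar>" by (rule A.psi(4))
  also have "x = B.XX t" by (simp add: t_def B.psi(2))
  finally have "\<bar>t - A.psi (B.XX t)\<bar> \<le> 8 * \<bar>A.XX t - B.XX t\<bar>" by (simp add: A.psi(1))
  then show ?thesis using XX_diff[of t] by (simp add: t_def B.psi(2) abs_minus_commute)
qed

end

section \<open>Second derivatives of the transported deformations\<close>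

context two_curves
begin

abbreviation "EA \<equiv> A.EE (N 0) (N 1) (N 2)"
abbreviation "EB \<equiv> B.EE (N 0) (N 1) (N 2)"

definition QA where "QA t = N 2 t - A.pp t * N 1 t + (2 * (A.pp t)\<^sup>2 / 9 - A.pp1 t / 3) * N 0 t"
definition QB where "QB t = N 2 t - B.pp t * N 1 t + (2 * (B.pp t)\<^sup>2 / 9 - B.pp1 t / 3) * N 0 t"

lemma E_eq: "EA t = A.KK ^ 3 / \<rho> t * QA t" "EB t = B.KK ^ 3 / \<sigma> t * QB t"
  by (simp_all add: A.EE_def B.EE_def QA_def QB_def)

lemma small: "\<bar>A.pp t\<bar> \<le> 1/100" "\<bar>A.pp1 t\<bar> \<le> 1/100" "\<bar>A.pp2 t\<bar> \<le> 1/100" "\<bar>B.pp t\<bar> \<le> 1/100" "\<bar>B.pp1 t\<bar> \<le> 1/100"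
  using A.pp_bound[of t] A.pp1_bound[of t] A.pp2_bound[of t] B.pp_bound[of t] B.pp1_bound[of t] A.eps by auto

lemma abs_mult_le: "\<bar>x\<bar> \<le> a \<Longrightarrow> \<bar>y\<bar> \<le> b \<Longrightarrow> \<bar>x * y\<bar> \<le> a * b" for x y a b :: real
  unfolding abs_mult by (intro mult_mono) auto

lemma pp_sq_small: "\<bar>A.pp t\<bar> \<le> 1/100 \<Longrightarrow> \<bar>(A.pp t)\<^sup>2\<bar> \<le> 1/100"
  using abs_mult_le[of "A.pp t" "1/100" "A.pp t" "1/100"] by (simp add: power2_eq_square)

lemma QA_bound: "\<bar>QA t\<bar> \<le> 3 * aa 2"
proof -
  have 1: "\<bar>A.pp t * N 1 t\<bar> \<le> 1/100 * aa 1" by (intro abs_mult_le small N_le) auto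
  have "\<bar>2 * (A.pp t)\<^sup>2 / 9 - A.pp1 t / 3\<bar> \<le> 1/100" using small(2)[of t] pp_sq_small[OF small(1)[of t]] by linarith
  then have 2: "\<bar>(2 * (A.pp t)\<^sup>2 / 9 - A.pp1 t / 3) * N 0 t\<bar> \<le> 1/100 * aa 0" by (intro abs_mult_le N_le) auto
  show ?thesis unfolding QA_def using 1 2 N_le[of 2 t] steps nonnegs by linarith
qed

lemma pp_diff: "\<bar>B.pp t - A.pp t\<bar> \<le> 60 * aa 3"
proof -
  have "B.pp t - A.pp t = ((\<sigma>1 t - \<rho>1 t) - A.pp t * (\<sigma> t - \<rho> t)) / \<sigma> t"
    using A.rho_pos[of t] B.rho_pos[of t] by (simp add: A.pp_def B.pp_def field_simps)
  moreover have "\<bar>A.pp t * (\<sigma> t - \<rho> t)\<bar> \<le> 1/100 * (50 * aa 2)" by (intro abs_mult_le small diffs)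
  then have "\<bar>(\<sigma>1 t - \<rho>1 t) - A.pp t * (\<sigma> t - \<rho> t)\<bar> \<le> 54 * aa 3" using diffs(2)[of t] steps by linarith
  then have "\<bar>((\<sigma>1 t - \<rho>1 t) - A.pp t * (\<sigma> t - \<rho> t)) / \<sigma> t\<bar> \<le> 60 * aa 3"
    by (rule order_trans[OF B.div_rho_bound]) (use nonnegs in simp)
  ultimately show ?thesis by simp
qed

lemma pp1_diff: "\<bar>B.pp1 t - A.pp1 t\<bar> \<le> 80 * aa 4"
proof -
  have "B.pp1 t - A.pp1 t = ((\<sigma>2 t - \<rho>2 t) - \<rho>2 t / \<rho> t * (\<sigma> t - \<rho> t)) / \<sigma> t - (B.pp t - A.pp t) * (B.pp t + A.pp t)"
    using A.rho_pos[of t] B.rho_pos[of t] by (simp add: A.pp1_def B.pp1_def field_simps power2_eq_square)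
  moreover have "\<bar>\<rho>2 t / \<rho> t\<bar> \<le> 1/100" using A.div_rho_bound[OF A.b\<rho>2, of t t] A.eps by auto
  then have "\<bar>\<rho>2 t / \<rho> t * (\<sigma> t - \<rho> t)\<bar> \<le> 1/100 * (50 * aa 2)" by (intro abs_mult_le diffs)
  then have "\<bar>(\<sigma>2 t - \<rho>2 t) - \<rho>2 t / \<rho> t * (\<sigma> t - \<rho> t)\<bar> \<le> 75 * aa 4" using diffs(3)[of t] steps by linarith
  then have "\<bar>((\<sigma>2 t - \<rho>2 t) - \<rho>2 t / \<rho> t * (\<sigma> t - \<rho> t)) / \<sigma> t\<bar> \<le> 76 * aa 4"
    by (rule order_trans[OF B.div_rho_bound]) (use nonnegs in simp)
  moreover have "\<bar>B.pp t + A.pp t\<bar> \<le> 1/400" using A.pp_bound[of t] B.pp_bound[of t] A.eps by linarith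
  then have "\<bar>(B.pp t - A.pp t) * (B.pp t + A.pp t)\<bar> \<le> (60 * aa 3) * (1/400)" by (intro abs_mult_le pp_diff)
  ultimately show ?thesis using steps nonnegs by linarith
qed

text \<open>The coefficient of \<open>N 2\<close> is 1 for both curves and drops out; every
  remaining term is a difference of the curves times \<open>N 0\<close> or \<open>N 1\<close>, hence
  quadratic.\<close>

lemma Q_diff: "\<bar>QB t - QA t\<bar> \<le> 70 * (aa 1 * aa 3) + 30 * (aa 0 * aa 4)"
proof -
  have "QB t - QA t = - (B.pp t - A.pp t) * N 1 t + (2/9 * ((B.pp t - A.pp t) * (B.pp t + A.pp t)) - (B.pp1 t - A.pp1 t) / 3) * N 0 t"
    by (simp add: QA_def QB_def power2_eq_square algebra_simps diff_divide_distrib)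
  moreover have "\<bar>- (B.pp t - A.pp t) * N 1 t\<bar> \<le> (60 * aa 3) * aa 1"
    by (intro abs_mult_le N_le) (use pp_diff[of t] in auto)
  moreover have "\<bar>(2/9 * ((B.pp t - A.pp t) * (B.pp t + A.pp t)) - (B.pp1 t - A.pp1 t) / 3) * N 0 t\<bar> \<le> (30 * aa 4) * aa 0"
  proof (intro abs_mult_le N_le)
    have "\<bar>B.pp t + A.pp t\<bar> \<le> 1/400" using A.pp_bound[of t] B.pp_bound[of t] A.eps by linarith
    then have "\<bar>(B.pp t - A.pp t) * (B.pp t + A.pp t)\<bar> \<le> (60 * aa 3) * (1/400)" by (intro abs_mult_le pp_diff)
    moreover have "\<bar>2/9 * X - Y / 3\<bar> \<le> 30 * aa 4" if "\<bar>X\<bar> \<le> (60 * aa 3) * (1/400)" "\<bar>Y\<bar> \<le> 80 * aa 4" for X Y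
      using that steps nonnegs by linarith
    ultimately show "\<bar>2/9 * ((B.pp t - A.pp t) * (B.pp t + A.pp t)) - (B.pp1 t - A.pp1 t) / 3\<bar> \<le> 30 * aa 4"
      using pp1_diff[of t] by blast
  qed simp
  moreover have "(60 * aa 3) * aa 1 \<le> 70 * (aa 1 * aa 3)" "(30 * aa 4) * aa 0 = 30 * (aa 0 * aa 4)" using nonnegs by auto
  ultimately show ?thesis by linarith
qed

lemma coef_diff: "\<bar>B.KK ^ 3 / \<sigma> t - A.KK ^ 3 / \<rho> t\<bar> \<le> 40000 * aa 2"
proof -
  define x y where "x = B.KK" and "y = A.KK"
  have b: "0 \<le> x" "x \<le> 7" "0 \<le> y" "y \<le> 7" using A.KK_num B.KK_num by (auto simp: x_def y_def)
  have "x * x \<le> 7 * 7" "x * y \<le> 7 * 7" "y * y \<le> 7 * 7" by (rule mult_mono; use b in auto)+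
  then have "\<bar>x * x + x * y + y * y\<bar> \<le> 147" using b by simp
  then have "\<bar>(x - y) * (x * x + x * y + y * y)\<bar> \<le> (130 * aa 2) * 147" using KK_diff by (intro abs_mult_le) (auto simp: x_def y_def)
  moreover have "x ^ 3 - y ^ 3 = (x - y) * (x * x + x * y + y * y)" by (simp add: algebra_simps power3_eq_cube)
  ultimately have k: "\<bar>B.KK ^ 3 - A.KK ^ 3\<bar> \<le> 19110 * aa 2" by (simp add: x_def y_def)
  have r: "\<bar>A.KK ^ 3 / \<rho> t\<bar> \<le> 344" by (rule order_trans[OF A.div_rho_bound[of _ 343]]) (use A.KK_cube in auto)
  have "\<bar>A.KK ^ 3 / \<rho> t * (\<sigma> t - \<rho> t)\<bar> \<le> 344 * (50 * aa 2)" by (intro abs_mult_le r diffs)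
  then have n: "\<bar>(B.KK ^ 3 - A.KK ^ 3) - A.KK ^ 3 / \<rho> t * (\<sigma> t - \<rho> t)\<bar> \<le> 36400 * aa 2" using k nonnegs by linarith
  have "B.KK ^ 3 / \<sigma> t - A.KK ^ 3 / \<rho> t = ((B.KK ^ 3 - A.KK ^ 3) - A.KK ^ 3 / \<rho> t * (\<sigma> t - \<rho> t)) / \<sigma> t"
    using A.rho_pos[of t] B.rho_pos[of t] by (simp add: field_simps)
  then show ?thesis using order_trans[OF B.div_rho_bound[OF n, of t], of "40000 * aa 2"] nonnegs by simp
qed

lemma E_diff: "\<bar>EB t - EA t\<bar> \<le> 120000 * (aa 2 * aa 2) + 344 * (70 * (aa 1 * aa 3) + 30 * (aa 0 * aa 4))"
proof -
  have "EB t - EA t = (B.KK ^ 3 / \<sigma> t - A.KK ^ 3 / \<rho> t) * QA t + B.KK ^ 3 / \<sigma> t * (QB t - QA t)"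
    unfolding E_eq by (simp add: algebra_simps)
  moreover have "\<bar>(B.KK ^ 3 / \<sigma> t - A.KK ^ 3 / \<rho> t) * QA t\<bar> \<le> (40000 * aa 2) * (3 * aa 2)" by (intro abs_mult_le coef_diff QA_bound)
  moreover have "\<bar>B.KK ^ 3 / \<sigma> t\<bar> \<le> 344" by (rule order_trans[OF B.div_rho_bound[of _ 343]]) (use B.KK_cube in auto)
  then have "\<bar>B.KK ^ 3 / \<sigma> t * (QB t - QA t)\<bar> \<le> 344 * (70 * (aa 1 * aa 3) + 30 * (aa 0 * aa 4))" by (intro abs_mult_le Q_diff)
  ultimately show ?thesis by linarith
qed

text \<open>Needed to move the evaluation point from \<open>A.psi x\<close> to
  \<open>B.psi x\<close>, which then costs a multiple of \<open>aa 2 * aa 3\<close>.\<close>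

lemma d_EA: "\<exists>e. (EA has_real_derivative e) (at t) \<and> \<bar>e\<bar> \<le> 3000 * aa 3"
proof -
  define c where "c t = A.KK ^ 3 / \<rho> t" for t
  have dc: "(c has_real_derivative (- c t * A.pp t)) (at t)" for t
  proof -
    have "(c has_real_derivative ((0 * \<rho> t - A.KK ^ 3 * \<rho>1 t) / (\<rho> t * \<rho> t))) (at t)"
      unfolding c_def[abs_def] by (intro DERIV_divide DERIV_const A.d\<rho>) (use A.rho_pos[of t] in simp)
    moreover have "(0 * \<rho> t - A.KK ^ 3 * \<rho>1 t) / (\<rho> t * \<rho> t) = - c t * A.pp t" by (simp add: c_def A.pp_def)
    ultimately show ?thesis by (simp only:)
  qed
  define q' where "q' = N 3 t - (A.pp1 t * N 1 t + N 2 t * A.pp t) + ((4 * A.pp t * A.pp1 t / 9 - A.pp2 t / 3) * N 0 t + N 1 t * (2 * (A.pp t)\<^sup>2 / 9 - A.pp1 t / 3))"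
  have dq: "(QA has_real_derivative q') (at t)"
  proof -
    have "((\<lambda>t. (A.pp t)\<^sup>2) has_real_derivative (2 * (A.pp1 t * A.pp t))) (at t)"
      using DERIV_power[OF A.d_pp, of 2 t] by simp
    from DERIV_cdivide[OF DERIV_cmult[OF this, of 2], of 9]
    have "((\<lambda>t. 2 * (A.pp t)\<^sup>2 / 9) has_real_derivative (4 * A.pp t * A.pp1 t / 9)) (at t)" by (simp add: mult_ac)
    note sqd = this
    have N2: "(N 2 has_real_derivative N 3 t) (at t)" using d_N[of 2 t] by (simp add: eval_nat_numeral)
    show ?thesis unfolding QA_def[abs_def] q'_def
      by (rule DERIV_add[OF DERIV_diff[OF N2 DERIV_mult[OF A.d_pp d_N1]] DERIV_mult[OF DERIV_diff[OF sqd DERIV_cdivide[OF A.d_pp1]] d_N0]])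
  qed
  have sq: "\<bar>(A.pp t)\<^sup>2\<bar> \<le> 1/100" by (rule pp_sq_small[OF small(1)])
  have "\<bar>A.pp t * A.pp1 t\<bar> \<le> 1/100 * (1/100)" by (intro abs_mult_le small)
  then have co1: "\<bar>4 * A.pp t * A.pp1 t / 9 - A.pp2 t / 3\<bar> \<le> 1/100" using small(3)[of t] by linarith
  have co2: "\<bar>2 * (A.pp t)\<^sup>2 / 9 - A.pp1 t / 3\<bar> \<le> 1/100" using small(2)[of t] sq by linarith
  have b1: "\<bar>A.pp1 t * N 1 t\<bar> \<le> 1/100 * aa 1" "\<bar>N 2 t * A.pp t\<bar> \<le> aa 2 * (1/100)" by (intro abs_mult_le small N_le; simp)+
  have b2: "\<bar>(4 * A.pp t * A.pp1 t / 9 - A.pp2 t / 3) * N 0 t\<bar> \<le> 1/100 * aa 0" "\<bar>N 1 t * (2 * (A.pp t)\<^sup>2 / 9 - A.pp1 t / 3)\<bar> \<le> aa 1 * (1/100)"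
    by (intro abs_mult_le co1 co2 N_le; simp)+
  have b3: "\<bar>N 3 t\<bar> \<le> aa 3" by (rule N_le) simp
  have st: "aa 0 \<le> 343 * aa 3" "aa 1 \<le> 49 * aa 3" "aa 2 \<le> 7 * aa 3" using steps by linarith+
  have triv: "\<bar>x - (y + z) + (u + v)\<bar> \<le> \<bar>x\<bar> + \<bar>y\<bar> + \<bar>z\<bar> + \<bar>u\<bar> + \<bar>v\<bar>" for x y z u v :: real by linarith
  have q': "\<bar>q'\<bar> \<le> 6 * aa 3"
    unfolding q'_def by (rule order_trans[OF triv]) (use b1 b2 b3 st nonnegs in linarith)
  have c: "\<bar>c t\<bar> \<le> 344" unfolding c_def by (rule order_trans[OF A.div_rho_bound[of _ 343]]) (use A.KK_cube in auto)
  have "\<bar>- c t * A.pp t\<bar> \<le> 344 * (1/500)" using c A.pp_bound[of t] A.eps by (intro abs_mult_le) (auto simp: abs_le_iff)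
  then have 1: "\<bar>(- c t * A.pp t) * QA t\<bar> \<le> (344 * (1/500)) * (3 * aa 2)" by (rule abs_mult_le[OF _ QA_bound])
  have 2: "\<bar>q' * c t\<bar> \<le> (6 * aa 3) * 344" by (intro abs_mult_le q' c)
  have dE: "((\<lambda>t. c t * QA t) has_real_derivative ((- c t * A.pp t) * QA t + q' * c t)) (at t)"
    by (rule DERIV_mult[OF dc dq])
  have EAeq: "EA = (\<lambda>t. c t * QA t)" using E_eq(1) by (auto simp: c_def)
  have fin: "\<bar>(- c t * A.pp t) * QA t + q' * c t\<bar> \<le> 3000 * aa 3" using 1 2 st nonnegs by linarith
  show ?thesis unfolding EAeq using dE fin by (intro exI conjI)
qed

text \<open>Two causes, both quadratic in the deformation: the evaluation points differ by a
  multiple of \<open>aa 2\<close>, and the coefficients in \<open>EE\<close> differ.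
  \<open>aa_products\<close> brings all terms to the form \<open>aa 0 * aa 5\<close>; the constant
  is a generous bound for the sum.\<close>

lemma second_deriv_diff: "\<bar>EB (B.psi x) - EA (A.psi x)\<bar> \<le> 10 ^ 11 * (aa 0 * aa 5)"
proof -
  define e where "e t = (SOME e. (EA has_real_derivative e) (at t) \<and> \<bar>e\<bar> \<le> 3000 * aa 3)" for t
  have e: "(EA has_real_derivative e t) (at t)" "\<bar>e t\<bar> \<le> 3000 * aa 3" for t
    using someI_ex[OF d_EA[of t]] by (auto simp: e_def)
  have "\<bar>EA (B.psi x) - EA (A.psi x)\<bar> \<le> (3000 * aa 3) * \<bar>B.psi x - A.psi x\<bar>" by (rule lipschitz_of_deriv[OF e])
  also have "\<dots> \<le> (3000 * aa 3) * (360 * aa 2)" using nonnegs by (intro mult_left_mono psi_diff) auto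
  finally have 1: "\<bar>EA (B.psi x) - EA (A.psi x)\<bar> \<le> 1080000 * (aa 2 * aa 3)" by (simp add: mult_ac)
  have "0 \<le> aa 0 * aa 5" using nonnegs by simp
  then show ?thesis using 1 E_diff[of "B.psi x"] aa_products by (simp add: abs_le_iff)
qed

end

section \<open>Cosine coefficients of both functions and the squeeze\<close>

context two_curves
begin

abbreviation "uA \<equiv> A.uu (N 0)"
abbreviation "uB \<equiv> B.uu (N 0)"

lemma N0_even: "N 0 (- t) = N 0 t"
  by (simp add: N_def Let_def A.sym\<Gamma> B.sym\<Gamma> inner_complex_def left_diff_distrib)

lemma N0_zero: "N 0 0 = 0" by (simp add: N_def Let_def A.\<Gamma>0 B.\<Gamma>0)

lemma uA_derivs: "(uA has_real_derivative (A.bb (A.psi x))\<^sup>2 * (N 1 (A.psi x) - A.pp (A.psi x) * N 0 (A.psi x) / 3)) (at x)"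
  "((\<lambda>x. (A.bb (A.psi x))\<^sup>2 * (N 1 (A.psi x) - A.pp (A.psi x) * N 0 (A.psi x) / 3)) has_real_derivative EA (A.psi x)) (at x)"
  by (rule A.d_uu[OF d_N0], rule A.d2_uu[OF d_N0 d_N1])

lemma uB_derivs: "(uB has_real_derivative (B.bb (B.psi x))\<^sup>2 * (N 1 (B.psi x) - B.pp (B.psi x) * N 0 (B.psi x) / 3)) (at x)"
  "((\<lambda>x. (B.bb (B.psi x))\<^sup>2 * (N 1 (B.psi x) - B.pp (B.psi x) * N 0 (B.psi x) / 3)) has_real_derivative EB (B.psi x)) (at x)"
  by (rule B.d_uu[OF d_N0], rule B.d2_uu[OF d_N0 d_N1])

lemma u_per: "uA (x + 1) = uA x" "uB (x + 1) = uB x"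
  by (simp_all add: A.uu_def B.uu_def A.psi_per B.psi_per A.per_bb B.per_bb N_per0)

lemma u_even: "uA (- x) = uA x" "uB (- x) = uB x"
  by (rule A.uu_even, rule N0_even, rule B.uu_even, rule N0_even)

lemma d_primitive: "((\<lambda>t. w t - s t - N 1 t) has_real_derivative N 0 t) (at t)"
  using DERIV_diff[OF DERIV_diff[OF B.ds A.ds] d_N1, of t] by (simp add: N_rec)

text \<open>In the Lazutkin coordinate \<open>uA\<close> is the derivative of the transported
  primitive of \<open>N 0\<close>, which is periodic because the perimeters agree.\<close>

lemma u_mean: "integral {0..1} uA = 0" "integral {0..1} uB = 0"
proof -
  let ?P = "\<lambda>t. w t - s t - N 1 t"
  have P: "?P (2 * pi) = ?P 0" using A.pers[of 0] B.pers[of 0] N_per0(2)[of 0] by simp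
  have "((\<lambda>x. ?P (A.psi x)) has_real_derivative uA x) (at x)" for x
    using DERIV_chain2[OF d_primitive A.d_psi, of x] by (simp add: A.uu_def mult.commute)
  then have "(uA has_integral (?P (A.psi 1) - ?P (A.psi 0))) {0..1}"
    by (intro fundamental_theorem_of_calculus)
       (auto simp: has_real_derivative_iff_has_vector_derivative has_vector_derivative_at_within)
  then show "integral {0..1} uA = 0" using P by (simp add: A.psi_01 integral_unique)
  have "((\<lambda>x. ?P (B.psi x)) has_real_derivative uB x) (at x)" for x
    using DERIV_chain2[OF d_primitive B.d_psi, of x] by (simp add: B.uu_def mult.commute)
  then have "(uB has_integral (?P (B.psi 1) - ?P (B.psi 0))) {0..1}"
    by (intro fundamental_theorem_of_calculus)
       (auto simp: has_real_derivative_iff_has_vector_derivative has_vector_derivative_at_within)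
  then show "integral {0..1} uB = 0" using P by (simp add: B.psi_01 integral_unique)
qed

lemma EA_bound: "\<bar>EA t\<bar> \<le> 344 * (3 * aa 2)"
proof -
  have "\<bar>A.KK ^ 3 / \<rho> t\<bar> \<le> 344" by (rule order_trans[OF A.div_rho_bound[of _ 343]]) (use A.KK_cube in auto)
  then show ?thesis unfolding E_eq by (intro abs_mult_le QA_bound)
qed

lemma E_cont: "continuous_on UNIV (\<lambda>x. EA (A.psi x))" "continuous_on UNIV (\<lambda>x. EB (B.psi x))"
proof -
  have c: "continuous_on UNIV f" if "\<And>t. (f has_real_derivative f' t) (at t)" for f f' :: "real \<Rightarrow> real"
    by (intro continuous_at_imp_continuous_on ballI DERIV_isCont[OF that])
  have n2: "continuous_on UNIV (N 2)" by (rule c[OF d_N]) simp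
  have "continuous_on UNIV EA" unfolding A.EE_def[abs_def]
    by (intro continuous_intros c[OF A.d\<rho>] c[OF A.d_pp] c[OF A.d_pp1] c[OF d_N0] c[OF d_N1] n2) (use A.rho_pos in \<open>auto simp: less_imp_neq[THEN not_sym]\<close>)
  then show "continuous_on UNIV (\<lambda>x. EA (A.psi x))" by (rule continuous_on_compose2[OF _ c[OF A.d_psi]]) auto
  have "continuous_on UNIV EB" unfolding B.EE_def[abs_def]
    by (intro continuous_intros c[OF B.d\<rho>] c[OF B.d_pp] c[OF B.d_pp1] c[OF d_N0] c[OF d_N1] n2) (use B.rho_pos in \<open>auto simp: less_imp_neq[THEN not_sym]\<close>)
  then show "continuous_on UNIV (\<lambda>x. EB (B.psi x))" by (rule continuous_on_compose2[OF _ c[OF B.d_psi]]) auto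
qed

definition cA where "cA = cos_coeff_of uA"
definition cB where "cB = cos_coeff_of uB"
definition DD where "DD = 10 ^ 11 * (aa 0 * aa 5)"

lemma DD: "DD \<ge> 0" using nonnegs by (simp add: DD_def)

lemma EB_bound: "\<bar>EB (B.psi t)\<bar> \<le> 344 * (3 * aa 2) + DD"
  using second_deriv_diff[of t] EA_bound[of "A.psi t"] unfolding DD_def by linarith

lemma cA_bound: "\<bar>cA j\<bar> \<le> (344 * (3 * aa 2)) / (real j)\<^sup>2"
  unfolding cA_def by (rule cos_coeff_of_bound[OF uA_derivs E_cont(1) u_per(1) u_mean(1) EA_bound])

lemma uA_series: "uA x = cosum cA x"
  unfolding cA_def by (rule cosine_series[OF uA_derivs E_cont(1) u_per(1) u_even(1) u_mean(1) EA_bound])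

lemma uB_series: "uB x = cosum cB x"
  unfolding cB_def by (rule cosine_series[OF uB_derivs E_cont(2) u_per(2) u_even(2) u_mean(2) EB_bound])

text \<open>The coefficient bound is applied to \<open>uB - uA\<close> itself, whose second
  derivative is quadratically small; the two separate bounds would be only linear.\<close>

lemma c_diff: "\<bar>cB j - cA j\<bar> \<le> DD / (real j)\<^sup>2"
proof -
  have c: "continuous_on UNIV f" if "\<And>t. (f has_real_derivative f' t) (at t)" for f f' :: "real \<Rightarrow> real"
    by (intro continuous_at_imp_continuous_on ballI DERIV_isCont[OF that])
  have cc: "continuous_on UNIV uA" "continuous_on UNIV uB" by (rule c[OF uA_derivs(1)], rule c[OF uB_derivs(1)])
  have "\<bar>cos_coeff_of (\<lambda>x. uB x - uA x) j\<bar> \<le> DD / (real j)\<^sup>2"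
  proof (rule cos_coeff_of_bound)
    show "continuous_on UNIV (\<lambda>x. EB (B.psi x) - EA (A.psi x))" by (intro continuous_intros E_cont)
    show "integral {0..1} (\<lambda>x. uB x - uA x) = 0"
      using u_mean by (subst integral_diff) (auto intro!: integrable_continuous_real continuous_on_subset[OF cc(1)] continuous_on_subset[OF cc(2)])
    show "\<bar>EB (B.psi x) - EA (A.psi x)\<bar> \<le> DD" for x unfolding DD_def by (rule second_deriv_diff)
  qed (rule DERIV_diff[OF uB_derivs(1) uA_derivs(1)] DERIV_diff[OF uB_derivs(2) uA_derivs(2)] | simp add: u_per)+
  then show ?thesis by (simp add: cos_coeff_of_diff[OF cc(2,1)] cA_def cB_def)
qed

lemma N0_from_uA: "N 0 t = uA (A.XX t) * (A.cr t / A.KK)"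
  using A.cr_pos[of t] A.KK_bounds(3) by (simp add: A.uu_def A.psi(1) A.bb_def)

lemma N0_from_uB: "N 0 t = uB (B.XX t) * (B.cr t / B.KK)"
  using B.cr_pos[of t] B.KK_bounds(3) by (simp add: B.uu_def B.psi(1) B.bb_def)

text \<open>\<open>N 0\<close> is \<open>uA\<close> at the Lazutkin coordinate times the density
  \<open>cr / KK\<close>, and \<open>2 * sin (\<phi> k)\<close> times this density is the weight
  that \<open>orbit_estimates\<close> compares with the circle. Dividing by the circle value
  \<open>l\<close> leaves a weighted Riemann sum for \<open>riemann_row\<close>.\<close>

lemma orbit_row_A:
  assumes o: "A.orbit q \<theta> \<phi>" and c: "\<And>j. \<bar>cA j\<bar> \<le> M / (real j)\<^sup>2"
  defines "l \<equiv> real q * sin (pi / real q) / pi"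
  shows "\<bar>(\<Sum>k<q. 2 * sin (\<phi> k) * N 0 (\<theta> k)) / l - (\<Sum>k<q. uA (real k / real q)) / real q\<bar> \<le> 200 * sqrt (1000 * \<epsilon>) * M / (real q)\<^sup>2" "l > 0"
proof -
  have q: "q \<ge> 2" and \<theta>: "\<theta> 0 = 0" "\<theta> q = 2 * pi" using o by (auto simp: A.orbit_def)
  have "sin (pi / real q) > 0" using q by (intro sin_gt_zero) (auto simp: field_simps)
  then show l: "l > 0" using q by (simp add: l_def)
  define x where "x k = A.XX (\<theta> k)" for k
  define v where "v k = 2 * real q * sin (\<phi> k) * (A.cr (\<theta> k) / A.KK) / l" for k
  have "\<bar>(\<Sum>k<q. v k * cosum cA (x k)) / real q - (\<Sum>k<q. cosum cA (real k / real q)) / real q\<bar> \<le> 200 * sqrt (1000 * \<epsilon>) * M / (real q)\<^sup>2"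
  proof (rule riemann_row[OF c])
    show "q \<ge> 1" "0 < 1000 * \<epsilon>" "1000 * \<epsilon> \<le> 1" using q A.eps by auto
    show "x 0 = 0" "x q = 1" by (simp_all add: x_def \<theta> A.XX_0 A.XX_2pi)
    fix k assume k: "k < q"
    show "\<bar>x (Suc k) - x k - 1 / real q\<bar> \<le> 1000 * \<epsilon> / real q ^ 3" unfolding x_def by (rule A.orbit_estimates(1)[OF o k])
    show "\<bar>v k - 1\<bar> \<le> 1000 * \<epsilon> / (real q)\<^sup>2" unfolding v_def l_def by (rule A.orbit_estimates(2)[OF o k])
  qed
  moreover have "(\<Sum>k<q. v k * cosum cA (x k)) / real q = (\<Sum>k<q. 2 * sin (\<phi> k) * N 0 (\<theta> k)) / l"
    unfolding sum_divide_distrib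
  proof (intro sum.cong refl)
    fix k
    show "v k * cosum cA (x k) / real q = 2 * sin (\<phi> k) * N 0 (\<theta> k) / l"
      using q l by (simp add: v_def x_def uA_series[symmetric] N0_from_uA[of "\<theta> k"])
  qed
  ultimately show "\<bar>(\<Sum>k<q. 2 * sin (\<phi> k) * N 0 (\<theta> k)) / l - (\<Sum>k<q. uA (real k / real q)) / real q\<bar> \<le> 200 * sqrt (1000 * \<epsilon>) * M / (real q)\<^sup>2"
    by (simp add: uA_series)
qed

lemma orbit_row_B:
  assumes o: "B.orbit q \<theta> \<phi>" and c: "\<And>j. \<bar>cB j\<bar> \<le> M / (real j)\<^sup>2"
  defines "l \<equiv> real q * sin (pi / real q) / pi"
  shows "\<bar>(\<Sum>k<q. 2 * sin (\<phi> k) * N 0 (\<theta> k)) / l - (\<Sum>k<q. uB (real k / real q)) / real q\<bar> \<le> 200 * sqrt (1000 * \<epsilon>) * M / (real q)\<^sup>2" "l > 0"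
proof -
  have q: "q \<ge> 2" and \<theta>: "\<theta> 0 = 0" "\<theta> q = 2 * pi" using o by (auto simp: B.orbit_def)
  have "sin (pi / real q) > 0" using q by (intro sin_gt_zero) (auto simp: field_simps)
  then show l: "l > 0" using q by (simp add: l_def)
  define x where "x k = B.XX (\<theta> k)" for k
  define v where "v k = 2 * real q * sin (\<phi> k) * (B.cr (\<theta> k) / B.KK) / l" for k
  have "\<bar>(\<Sum>k<q. v k * cosum cB (x k)) / real q - (\<Sum>k<q. cosum cB (real k / real q)) / real q\<bar> \<le> 200 * sqrt (1000 * \<epsilon>) * M / (real q)\<^sup>2"
  proof (rule riemann_row[OF c])
    show "q \<ge> 1" "0 < 1000 * \<epsilon>" "1000 * \<epsilon> \<le> 1" using q A.eps by auto
    show "x 0 = 0" "x q = 1" by (simp_all add: x_def \<theta> B.XX_0 B.XX_2pi)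
    fix k assume k: "k < q"
    show "\<bar>x (Suc k) - x k - 1 / real q\<bar> \<le> 1000 * \<epsilon> / real q ^ 3" unfolding x_def by (rule B.orbit_estimates(1)[OF o k])
    show "\<bar>v k - 1\<bar> \<le> 1000 * \<epsilon> / (real q)\<^sup>2" unfolding v_def l_def by (rule B.orbit_estimates(2)[OF o k])
  qed
  moreover have "(\<Sum>k<q. v k * cosum cB (x k)) / real q = (\<Sum>k<q. 2 * sin (\<phi> k) * N 0 (\<theta> k)) / l"
    unfolding sum_divide_distrib
  proof (intro sum.cong refl)
    fix k
    show "v k * cosum cB (x k) / real q = 2 * sin (\<phi> k) * N 0 (\<theta> k) / l"
      using q l by (simp add: v_def x_def uB_series[symmetric] N0_from_uB[of "\<theta> k"])
  qed
  ultimately show "\<bar>(\<Sum>k<q. 2 * sin (\<phi> k) * N 0 (\<theta> k)) / l - (\<Sum>k<q. uB (real k / real q)) / real q\<bar> \<le> 200 * sqrt (1000 * \<epsilon>) * M / (real q)\<^sup>2"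
    by (simp add: uB_series)
qed

text \<open>The two one-sided first-variation inequalities, at the orbits of either curve, squeeze each Riemann sum
  of \<open>uA\<close>.\<close>

theorem equal_max_perims_imp_eq:
  assumes eps: "\<epsilon> \<le> 1 / 10 ^ 20"
    and eq: "\<And>q. q \<ge> 2 \<Longrightarrow> \<exists>\<theta> \<phi> \<theta>' \<phi>'. A.orbit q \<theta> \<phi> \<and> B.orbit q \<theta>' \<phi>' \<and>
        B.perim q \<theta> \<le> A.perim q \<theta> \<and> A.perim q \<theta>' \<le> B.perim q \<theta>'"
  shows "\<Delta> t = \<Gamma> t"
proof -
  have se: "sqrt (1000 * \<epsilon>) \<le> 1 / 10 ^ 8"
  proof (rule real_le_lsqrt)
    show "1000 * \<epsilon> \<le> (1 / 10 ^ 8)\<^sup>2" using eps by (simp add: power_divide)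
  qed (use A.eps in auto)
  have "cA j = 0" for j
  proof (rule vanishing_of_small_rows[OF cA_bound])
    fix M and q :: nat
    assume c: "\<And>j. \<bar>cA j\<bar> \<le> M / (real j)\<^sup>2" and q: "q \<ge> 1"
    have M: "M \<ge> 0" using c[of 1] by simp
    show "\<bar>(\<Sum>k<q. cosum cA (real k / real q)) / real q\<bar> \<le> 1 / 8 * M / (real q)\<^sup>2"
    proof (cases "q = 1")
      \<comment> \<open>No orbit has a single vertex; this row is \<open>uA 0\<close>, which
        vanishes since both curves pass through the origin at angle 0.\<close>
      case True
      have "cosum cA 0 = 0" using uA_series[of 0] N0_zero by (simp add: A.uu_def A.psi_01)
      then show ?thesis using True M by simp
    next
      case False
      then have q2: "q \<ge> 2" using q by simp
      obtain \<theta> \<phi> \<theta>' \<phi>' where oA: "A.orbit q \<theta> \<phi>" and oB: "B.orbit q \<theta>' \<phi>'"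
        and pA: "B.perim q \<theta> \<le> A.perim q \<theta>" and pB: "A.perim q \<theta>' \<le> B.perim q \<theta>'" using eq[OF q2] by blast
      have N0: "N 0 t = inner (\<Delta> t) (cis t) - inner (\<Gamma> t) (cis t)" for t by (simp add: N_def Let_def inner_diff_left)
      have sA: "(\<Sum>k<q. 2 * sin (\<phi> k) * N 0 (\<theta> k)) \<le> 0"
      proof -
        have e: "\<theta> 0 = 0" "\<theta> q = 2 * pi" using oA by (auto simp: A.orbit_def)
        have "(\<Sum>k<q. 2 * sin (\<phi> k) * inner (\<Delta> (\<theta> k)) (cis (\<theta> k))) \<le> B.perim q \<theta>"
          unfolding B.perim_def B.len_def by (rule A.orbit_first_variation(1)[OF oA, of "\<lambda>k. \<Delta> (\<theta> k)"]) (use e B.per\<Gamma>[of 0] in simp)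
        moreover have "(\<Sum>k<q. 2 * sin (\<phi> k) * inner (\<Gamma> (\<theta> k)) (cis (\<theta> k))) = A.perim q \<theta>"
          by (rule A.orbit_first_variation(2)[OF oA, of "\<lambda>k. 0"]) simp
        ultimately show ?thesis using pA by (simp add: N0 right_diff_distrib sum_subtractf)
      qed
      have sB: "(\<Sum>k<q. 2 * sin (\<phi>' k) * N 0 (\<theta>' k)) \<ge> 0"
      proof -
        have e: "\<theta>' 0 = 0" "\<theta>' q = 2 * pi" using oB by (auto simp: B.orbit_def)
        have "(\<Sum>k<q. 2 * sin (\<phi>' k) * inner (\<Gamma> (\<theta>' k)) (cis (\<theta>' k))) \<le> A.perim q \<theta>'"
          unfolding A.perim_def A.len_def by (rule B.orbit_first_variation(1)[OF oB, of "\<lambda>k. \<Gamma> (\<theta>' k)"]) (use e A.per\<Gamma>[of 0] in simp)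
        moreover have "(\<Sum>k<q. 2 * sin (\<phi>' k) * inner (\<Delta> (\<theta>' k)) (cis (\<theta>' k))) = B.perim q \<theta>'"
          by (rule B.orbit_first_variation(2)[OF oB, of "\<lambda>k. 0"]) simp
        ultimately show ?thesis using pB by (simp add: N0 right_diff_distrib sum_subtractf)
      qed
      define Z where "Z = 1 / (real q)\<^sup>2"
      have Z: "Z > 0" using q by (simp add: Z_def)
      define TA TB where "TA = (\<Sum>k<q. uA (real k / real q)) / real q" and "TB = (\<Sum>k<q. uB (real k / real q)) / real q"
      \<comment> \<open>\<open>aa 0\<close> is linear in the coefficient bound \<open>M\<close>, and
        \<open>aa 5\<close> is at most \<open>17 * \<epsilon>\<close>; with
        \<open>\<epsilon>\<close> at most \<open>1 / 10 ^ 20\<close> the factor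
        \<open>10 ^ 11\<close> in \<open>DD\<close> is absorbed, so \<open>DD\<close> becomes a
        small fraction of \<open>M\<close>.\<close>
      have a0: "aa 0 \<le> 2 * M"
      proof (rule aa_least)
        fix t
        have "\<bar>uA (A.XX t)\<bar> \<le> 2 * M" unfolding uA_series by (rule cosum_le[OF c M])
        moreover have "\<bar>A.cr t / A.KK\<bar> \<le> 1" using A.cr_bounds[of t] A.KK_num by (simp add: field_simps)
        ultimately have "\<bar>uA (A.XX t) * (A.cr t / A.KK)\<bar> \<le> 2 * M * 1" by (rule abs_mult_le)
        then show "\<bar>N 0 t\<bar> \<le> 2 * M" by (simp add: N0_from_uA[of t])
      qed
      have a5: "aa 5 \<le> 17 * (1 / 10 ^ 20)" 
      proof (rule aa_least)
        fix t
        have "17 * \<epsilon> \<le> 17 * (1 / 10 ^ 20)" using eps by (intro mult_left_mono) auto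
        then show "\<bar>N 5 t\<bar> \<le> 17 * (1 / 10 ^ 20)" using N_bound[of 5 t] by linarith
      qed
      have "aa 0 * aa 5 \<le> (2 * M) * (17 * (1 / 10 ^ 20))" using a0 a5 nonnegs M by (intro mult_mono) auto
      then have DM: "DD \<le> M / 100" using M unfolding DD_def by simp
      have cB: "\<bar>cB j\<bar> \<le> (M + DD) / (real j)\<^sup>2" for j
        using c[of j] c_diff[of j] by (simp add: add_divide_distrib) 
      have f: "200 * sqrt (1000 * \<epsilon>) * M / (real q)\<^sup>2 \<le> 1/100 * M * Z" "200 * sqrt (1000 * \<epsilon>) * (M + DD) / (real q)\<^sup>2 \<le> 1/50 * M * Z"
      proof -
        have s1: "200 * sqrt (1000 * \<epsilon>) \<le> 1/100" using se by simp
        have "200 * sqrt (1000 * \<epsilon>) * M * Z \<le> 1/100 * M * Z" using s1 M Z by (intro mult_right_mono) auto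
        then show "200 * sqrt (1000 * \<epsilon>) * M / (real q)\<^sup>2 \<le> 1/100 * M * Z" by (simp add: Z_def)
        have "200 * sqrt (1000 * \<epsilon>) * (M + DD) \<le> 1/100 * (2 * M)" using s1 M DM DD A.eps by (intro mult_mono) auto
        then have "200 * sqrt (1000 * \<epsilon>) * (M + DD) * Z \<le> 1/50 * M * Z" using Z by (intro mult_right_mono) auto
        then show "200 * sqrt (1000 * \<epsilon>) * (M + DD) / (real q)\<^sup>2 \<le> 1/50 * M * Z" by (simp add: Z_def)
      qed
      note rA = orbit_row_A[OF oA c, folded TA_def] and rB = orbit_row_B[OF oB cB, folded TB_def]
      have up: "TA \<le> 1/100 * M * Z"
      proof -
        have "(\<Sum>k<q. 2 * sin (\<phi> k) * N 0 (\<theta> k)) / (real q * sin (pi / real q) / pi) \<le> 0" using sA rA(2) by (intro divide_nonpos_pos) auto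
        then show ?thesis using rA(1) f(1) by linarith
      qed
      have lo: "TB \<ge> - (1/50 * M * Z)"
      proof -
        have "(\<Sum>k<q. 2 * sin (\<phi>' k) * N 0 (\<theta>' k)) / (real q * sin (pi / real q) / pi) \<ge> 0" using sB rB(2) by (intro divide_nonneg_pos) auto
        then show ?thesis using rB(1) f(2) by linarith
      qed
      have df: "\<bar>TB - TA\<bar> \<le> 1/50 * M * Z"
      proof -
        have cs: "cosum (\<lambda>j. cB j - cA j) x = uB x - uA x" for x
        proof -
          have "(\<lambda>j. cB j * cos (2 * pi * real j * x) - cA j * cos (2 * pi * real j * x)) sums (cosum cB x - cosum cA x)"
            by (intro sums_diff cosum_sums[OF cB] cosum_sums[OF c])
          then have "(\<lambda>j. (cB j - cA j) * cos (2 * pi * real j * x)) sums (uB x - uA x)"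
            by (simp add: left_diff_distrib uA_series uB_series)
          then show ?thesis unfolding cosum_def by (simp add: sums_iff)
        qed
        have "\<bar>(\<Sum>k<q. uB (real k / real q) - uA (real k / real q)) / real q - (cB q - cA q)\<bar> \<le> 3 / 4 * DD / (real q)\<^sup>2"
          using riemann_sum_cosum[OF c_diff q] by (simp add: cs)
        moreover have "(\<Sum>k<q. uB (real k / real q) - uA (real k / real q)) / real q = TB - TA"
          by (simp add: TA_def TB_def sum_subtractf diff_divide_distrib)
        ultimately have "\<bar>TB - TA\<bar> \<le> 3 / 4 * DD / (real q)\<^sup>2 + DD / (real q)\<^sup>2" using c_diff[of q] by linarith
        also have "\<dots> = 7/4 * (DD * Z)" by (simp add: Z_def)
        also have "\<dots> \<le> 2 * DD * Z" using mult_nonneg_nonneg[OF DD, of Z] Z by linarith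
        also have "\<dots> \<le> 2 * (M / 100) * Z" using DM Z by (intro mult_right_mono) auto
        finally show ?thesis by simp
      qed
      \<comment> \<open>The orbit of the first curve bounds \<open>TA\<close> from above and that of
        the second bounds \<open>TB\<close> from below; \<open>df\<close> carries the lower bound
        over to \<open>TA\<close>.\<close>
      have "0 \<le> M * Z" using M Z by simp
      then have "\<bar>TA\<bar> \<le> 1/8 * M * Z" using up lo df by linarith
      then show ?thesis by (simp add: TA_def Z_def uA_series)
    qed
  qed
  then have "uA x = 0" for x unfolding uA_series cosum_def by simp
  \<comment> \<open>The support functions agree, hence so do their derivatives; the difference of
    the curves has exactly \<open>N 0\<close> and \<open>N 1\<close> as its normal and tangential
    components.\<close>
  then have N0: "N 0 = (\<lambda>t. 0)" using N0_from_uA by auto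
  have "N 1 t = 0" for t using d_N0[of t] unfolding N0 using DERIV_unique[OF DERIV_const[of 0]] by metis
  then have "inner (\<Delta> t - \<Gamma> t) (cis t) = 0" "inner (\<Delta> t - \<Gamma> t) (\<i> * cis t) = 0"
    using fun_cong[OF N0, of t] by (simp_all add: N_def Let_def)
  moreover define z where "z = \<Delta> t - \<Gamma> t"
  ultimately have 1: "Re z * cos t + Im z * sin t = 0" "Im z * cos t - Re z * sin t = 0" by (auto simp: inner_complex_def)
  have "Re z = (Re z * cos t + Im z * sin t) * cos t - (Im z * cos t - Re z * sin t) * sin t"
    "Im z = (Re z * cos t + Im z * sin t) * sin t + (Im z * cos t - Re z * sin t) * cos t"
    using sin_cos_squared_add[of t] by (algebra)+
  then have "z = 0" unfolding 1 by (simp add: complex_eq_iff)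
  then show ?thesis by (simp add: z_def)
qed

end

subsection \<open>Lengths of periodic orbits form a null set\<close>

text \<open>The trapezoidal rule for \<open>f1\<close>: with slopes at both ends the error is of
  third order, whereas a first-order expansion at one end would leave a quadratic term.
  \<open>g t\<close> is the error on the interval from 0 to \<open>t\<close>.\<close>

lemma trapezoid_cubic:
  fixes f f1 f2 f3 :: "real \<Rightarrow> real"
  assumes d: "\<And>t. 0 \<le> t \<Longrightarrow> t \<le> 1 \<Longrightarrow> (f has_real_derivative f1 t) (at t)"
    and d1: "\<And>t. 0 \<le> t \<Longrightarrow> t \<le> 1 \<Longrightarrow> (f1 has_real_derivative f2 t) (at t)"
    and d2: "\<And>t. 0 \<le> t \<Longrightarrow> t \<le> 1 \<Longrightarrow> (f2 has_real_derivative f3 t) (at t)"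
    and M: "\<And>t. 0 \<le> t \<Longrightarrow> t \<le> 1 \<Longrightarrow> \<bar>f3 t\<bar> \<le> M"
  shows "\<bar>f 1 - f 0 - (f1 0 + f1 1) / 2\<bar> \<le> M"
proof -
  have M0: "M \<ge> 0" using M[of 0] by simp
  define g where "g t = f t - f 0 - t / 2 * (f1 0 + f1 t)" for t
  define g1 where "g1 t = (f1 t - f1 0) / 2 - t / 2 * f2 t" for t
  have dg: "(g has_real_derivative g1 t) (at t)" if "0 \<le> t" "t \<le> 1" for t
    unfolding g_def[abs_def] g1_def
    by (rule derivative_eq_intros d[OF that] d1[OF that] refl | simp)+ (simp add: field_simps)
  have dg1: "(g1 has_real_derivative (- t / 2 * f3 t)) (at t)" if "0 \<le> t" "t \<le> 1" for t
    unfolding g1_def[abs_def]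
    by (rule derivative_eq_intros d1[OF that] d2[OF that] refl | simp)+
  have g1: "\<bar>g1 t\<bar> \<le> M * t" if t: "0 \<le> t" "t \<le> 1" for t
  proof (rule deriv_abs_bound[OF t(1), where g = "\<lambda>t. M * t"])
    fix x assume x: "0 \<le> x" "x \<le> t"
    then have x1: "x \<le> 1" using t by simp
    show "(g1 has_real_derivative (- x / 2 * f3 x)) (at x)" by (rule dg1[OF x(1) x1])
    show "((\<lambda>t. M * t) has_real_derivative M) (at x)" by (rule derivative_eq_intros refl | simp)+
    have "\<bar>- x / 2\<bar> * \<bar>f3 x\<bar> \<le> 1 * M" using x x1 M[OF x(1) x1] by (intro mult_mono) auto
    then show "\<bar>- x / 2 * f3 x\<bar> \<le> M" by (simp add: abs_mult)
  qed (simp_all add: g1_def)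
  have "\<bar>g 1\<bar> \<le> M * 1"
  proof (rule deriv_abs_bound[where f = g and f' = g1 and g = "\<lambda>t. M * t"])
    fix x :: real assume x: "0 \<le> x" "x \<le> 1"
    show "(g has_real_derivative g1 x) (at x)" by (rule dg[OF x])
    show "((\<lambda>t. M * t) has_real_derivative M) (at x)" by (rule derivative_eq_intros refl | simp)+
    show "\<bar>g1 x\<bar> \<le> M" using g1[OF x] mult_left_mono[OF x(2) M0] by simp
  qed (simp_all add: g_def)
  then show ?thesis by (simp add: g_def)
qed

text \<open>Sard's argument on a two-parameter set of arbitrary shape: of order \<open>N^2\<close>
  cells of side \<open>1 / N\<close>, each with image in an interval of length
  \<open>2 * K / N^3\<close>.\<close>

lemma negligible_cubic_image:
  fixes P :: "'o \<Rightarrow> bool" and x y val :: "'o \<Rightarrow> real"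
  assumes R: "\<And>u. P u \<Longrightarrow> 0 \<le> x u \<and> x u \<le> R \<and> 0 \<le> y u \<and> y u \<le> R" and R0: "R \<ge> 0"
    and K: "\<And>u v r. P u \<Longrightarrow> P v \<Longrightarrow> 0 < r \<Longrightarrow> r \<le> 1 \<Longrightarrow> \<bar>x u - x v\<bar> \<le> r \<Longrightarrow> \<bar>y u - y v\<bar> \<le> r \<Longrightarrow> \<bar>val u - val v\<bar> \<le> K * r ^ 3"
    and K0: "K \<ge> 0"
  shows "negligible (val ` {u. P u})"
  unfolding negligible_outer_le
proof (intro allI impI)
  fix e :: real assume e: "e > 0"
  define C where "C = 2 * K * (R + 2)\<^sup>2"
  have C0: "C \<ge> 0" using K0 by (simp add: C_def)
  obtain N :: nat where N: "real N > C / e" "N \<ge> 1"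
  proof -
    obtain n :: nat where "C / e < real n" using reals_Archimedean2 by blast
    then show thesis using that[of "Suc n"] by simp
  qed
  define M where "M = nat \<lceil>R * real N\<rceil>"
  define cell where "cell u = (nat \<lfloor>x u * real N\<rfloor>, nat \<lfloor>y u * real N\<rfloor>)" for u
  \<comment> \<open>For an empty cell this is an arbitrary object; it only adds one more short
    interval to \<open>T\<close>.\<close>
  define rep where "rep ij = (SOME u. P u \<and> cell u = ij)" for ij
  define h where "h = K * (1 / real N) ^ 3"
  have h0: "h \<ge> 0" using K0 by (simp add: h_def)
  define T where "T = (\<Union>ij\<in>{..M} \<times> {..M}. {val (rep ij) - h .. val (rep ij) + h})"
  have Np: "real N > 0" using N by simp
  have cellM: "cell u \<in> {..M} \<times> {..M}" if "P u" for u
  proof -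
    have "x u * real N \<le> R * real N" "y u * real N \<le> R * real N" using R[OF that] by (auto intro!: mult_right_mono)
    then have "\<lfloor>x u * real N\<rfloor> \<le> \<lceil>R * real N\<rceil>" "\<lfloor>y u * real N\<rfloor> \<le> \<lceil>R * real N\<rceil>" by linarith+
    then show ?thesis by (auto simp: cell_def M_def nat_mono)
  qed
  have sub: "val ` {u. P u} \<subseteq> T"
  proof
    fix z assume "z \<in> val ` {u. P u}"
    then obtain u where u: "P u" "z = val u" by auto
    define v where "v = rep (cell u)"
    have v: "P v" "cell v = cell u" unfolding v_def rep_def using someI[of "\<lambda>w. P w \<and> cell w = cell u" u] u by auto
    have close: "\<bar>p - p'\<bar> \<le> 1 / real N" if "nat \<lfloor>p * real N\<rfloor> = nat \<lfloor>p' * real N\<rfloor>" "0 \<le> p" "0 \<le> p'" for p p'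
    proof -
      have "0 \<le> p * real N" "0 \<le> p' * real N" using that by auto
      then have "\<lfloor>p * real N\<rfloor> = \<lfloor>p' * real N\<rfloor>" using that(1) by (metis eq_nat_nat_iff zero_le_floor)
      then have "\<bar>p * real N - p' * real N\<bar> \<le> 1" by linarith
      then have "\<bar>p - p'\<bar> * real N \<le> 1" by (simp add: left_diff_distrib[symmetric] abs_mult)
      then show ?thesis using Np by (simp add: field_simps)
    qed
    have "\<bar>val u - val v\<bar> \<le> h" unfolding h_def
    proof (rule K[OF u(1) v(1)])
      show "\<bar>x u - x v\<bar> \<le> 1 / real N" using close[of "x u" "x v"] v(2) R[OF u(1)] R[OF v(1)] by (simp add: cell_def)
      show "\<bar>y u - y v\<bar> \<le> 1 / real N" using close[of "y u" "y v"] v(2) R[OF u(1)] R[OF v(1)] by (simp add: cell_def)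
    qed (use N in auto)
    then have "z \<in> {val v - h .. val v + h}" by (auto simp: u abs_le_iff)
    then show "z \<in> T" unfolding T_def v_def by (rule UN_I[OF cellM[OF u(1)]])
  qed
  have Tm: "T \<in> lmeasurable" unfolding T_def by (intro fmeasurable.finite_UN) auto
  have "measure lebesgue T \<le> (\<Sum>ij\<in>{..M} \<times> {..M}. measure lebesgue {val (rep ij) - h .. val (rep ij) + h})"
    unfolding T_def by (intro measure_UNION_le) auto
  also have "\<dots> = real (Suc M) * real (Suc M) * (2 * h)" using h0 by (simp add: algebra_simps)
  also have "\<dots> \<le> (R + 2) * real N * ((R + 2) * real N) * (2 * h)"
  proof -
    have "real M \<le> R * real N + 1" unfolding M_def using R0 by (simp add: mult_nonneg_nonneg)
    moreover have "2 \<le> 2 * real N" using N by simp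
    ultimately have "real (Suc M) \<le> (R + 2) * real N" by (simp add: distrib_right)
    then show ?thesis using h0 R0 by (intro mult_mono) auto
  qed
  also have "\<dots> = C / real N" using Np by (simp add: C_def h_def field_simps power2_eq_square power3_eq_cube)
  also have "\<dots> \<le> e" using N(1) e Np C0 by (simp add: field_simps)
  finally show "\<exists>T. val ` {u. P u} \<subseteq> T \<and> T \<in> lmeasurable \<and> measure lebesgue T \<le> e" using sub Tm by blast
qed

section \<open>Third-order expansion of chord lengths\<close>

context billiard_curve
begin

definition G1 where "G1 t = of_real (\<rho> t) * (\<i> * cis t)"
definition G2 where "G2 t = of_real (\<rho>1 t) * (\<i> * cis t) - of_real (\<rho> t) * cis t"
definition G3 where "G3 t = of_real (\<rho>2 t) * (\<i> * cis t) - 2 * of_real (\<rho>1 t) * cis t - of_real (\<rho> t) * (\<i> * cis t)"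

lemma has_vd_cis: "(cis has_vector_derivative \<i> * cis t) (at t)"
  unfolding cis_conv_exp[abs_def]
  by (rule has_vector_derivative_eq_rhs, rule has_vector_derivative_real_field[where f = "\<lambda>z. exp (\<i> * z)"])
     (auto intro!: derivative_eq_intros)

lemma has_vd_of_real_mult:
  fixes g :: "real \<Rightarrow> complex"
  assumes "(f has_real_derivative f') (at t)" "(g has_vector_derivative g') (at t)"
  shows "((\<lambda>t. of_real (f t) * g t) has_vector_derivative (of_real (f t) * g' + of_real f' * g t)) (at t)"
  by (rule has_vector_derivative_mult[OF has_vector_derivative_of_real assms(2)])
     (use assms(1) in \<open>simp add: has_real_derivative_iff_has_vector_derivative\<close>)

lemma d_G0: "(\<Gamma> has_vector_derivative G1 t) (at t)" using d\<Gamma> by (simp add: G1_def)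

lemma d_G1: "(G1 has_vector_derivative G2 t) (at t)"
  unfolding G1_def[abs_def]
  by (rule has_vector_derivative_eq_rhs[OF has_vd_of_real_mult[OF d\<rho> has_vector_derivative_mult_right[OF has_vd_cis]]])
     (simp add: G2_def algebra_simps)

lemma d_G2: "(G2 has_vector_derivative G3 t) (at t)"
  unfolding G2_def[abs_def]
  by (rule has_vector_derivative_eq_rhs[OF has_vector_derivative_diff[OF
        has_vd_of_real_mult[OF d\<rho>1 has_vector_derivative_mult_right[OF has_vd_cis]] has_vd_of_real_mult[OF d\<rho> has_vd_cis]]])
     (simp add: G3_def algebra_simps)

lemma G_bounds: "norm (G1 t) \<le> 2" "norm (G2 t) \<le> 2" "norm (G3 t) \<le> 2"
proof -
  have r: "\<bar>\<rho> t\<bar> \<le> 1001/1000" "\<bar>\<rho>1 t\<bar> \<le> 1/1000" "\<bar>\<rho>2 t\<bar> \<le> 1/1000" using rho_num[of t] b\<rho>1[of t] b\<rho>2[of t] eps by auto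
  show "norm (G1 t) \<le> 2" using r by (simp add: G1_def norm_mult)
  have "norm (G2 t) \<le> \<bar>\<rho>1 t\<bar> + \<bar>\<rho> t\<bar>" unfolding G2_def by (rule order_trans[OF norm_triangle_ineq4]) (simp add: norm_mult)
  then show "norm (G2 t) \<le> 2" using r by linarith
  have "norm (G3 t) \<le> (\<bar>\<rho>2 t\<bar> + 2 * \<bar>\<rho>1 t\<bar>) + \<bar>\<rho> t\<bar>"
    unfolding G3_def by (rule order_trans[OF norm_triangle_ineq4], rule add_mono, rule order_trans[OF norm_triangle_ineq4]) (simp_all add: norm_mult)
  then show "norm (G3 t) \<le> 2" using r by linarith
qed

text \<open>Angle pairs whose chord does not degenerate: on this set heights and lengths are at
  least \<open>cgap \<delta>\<close>, which gives uniform constants.\<close>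

definition gapset :: "real \<Rightarrow> (real \<times> real) set" where
  "gapset \<delta> = {(a, b). \<delta> \<le> b - a \<and> b - a \<le> 2 * pi - \<delta>}"

definition cgap :: "real \<Rightarrow> real" where "cgap \<delta> = (1 - cos \<delta>) / 2"

lemma cgap: assumes "0 < \<delta>" "\<delta> \<le> 1" shows "0 < cgap \<delta>" "cgap \<delta> \<le> 1"
  using cos_lt_one[of \<delta>] cos_ge_minus_one[of \<delta>] assms pi_gt3 by (auto simp: cgap_def)

lemma gap_heights:
  assumes \<delta>: "0 < \<delta>" "\<delta> \<le> 1" and g: "(a, b) \<in> gapset \<delta>"
  shows "cgap \<delta> \<le> height a b" "cgap \<delta> \<le> height b a" "a < b" "b < a + 2 * pi"
    "cgap \<delta> \<le> len a b" "len a b \<le> 7"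
proof -
  show ab: "a < b" "b < a + 2 * pi" using g \<delta> by (auto simp: gapset_def)
  have "cos (b - a) \<le> cos \<delta>"
  proof (cases "b - a \<le> pi")
    case True then show ?thesis using g \<delta> by (intro cos_monotone_0_pi_le) (auto simp: gapset_def)
  next
    case False
    have "cos (2 * pi - (b - a)) \<le> cos \<delta>" using g \<delta> False by (intro cos_monotone_0_pi_le) (auto simp: gapset_def)
    then show ?thesis by (simp add: cos_diff)
  qed
  then have "(1/2) * (1 - cos \<delta>) \<le> (1 - \<epsilon>) * (1 - cos (b - a))" using eps by (intro mult_mono) auto
  moreover have "cos (a - b) = cos (b - a)" by (metis cos_minus minus_diff_eq)
  ultimately show h: "cgap \<delta> \<le> height a b" "cgap \<delta> \<le> height b a"
    using height_bounds(1)[of b a] height_bounds(1)[of a b] by (auto simp: cgap_def)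
  have "height a b = len a b * sin (chang a b - a)" using chord_polar(7)[OF ab] by simp
  also have "\<dots> \<le> len a b * 1" using chord_polar(2)[OF ab] by (intro mult_left_mono) auto
  finally show "cgap \<delta> \<le> len a b" using h by simp
  have "norm (\<Gamma> b - \<Gamma> a) \<le> (1001/1000) * norm (b - a)"
  proof (rule differentiable_bound[of UNIV _ "\<lambda>t h. h *\<^sub>R G1 t"])
    fix t show "(\<Gamma> has_derivative (\<lambda>h. h *\<^sub>R G1 t)) (at t within UNIV)" using d_G0[of t] by (simp add: has_vector_derivative_def)
    have "norm (G1 t) \<le> 1001/1000" using rho_num[of t] rho_pos[of t] by (simp add: G1_def norm_mult)
    then have "\<bar>x\<bar> * norm (G1 t) \<le> \<bar>x\<bar> * (1001/1000)" for x by (intro mult_left_mono) auto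
    then show "onorm (\<lambda>h. h *\<^sub>R G1 t) \<le> 1001/1000" by (intro onorm_le) (simp add: mult.commute)
  qed auto
  also have "\<dots> \<le> (1001/1000) * (2 * pi)" using ab by (intro mult_left_mono) auto
  also have "\<dots> \<le> 7" using pi_approx by simp
  finally show "len a b \<le> 7" by (simp add: len_def)
qed

end

context billiard_curve
begin

text \<open>\<open>pa\<close> and \<open>pb\<close> are the partial derivatives of
  \<open>len\<close> in its first and second argument, in a form that can be differentiated further
  along a segment of angle pairs.\<close>

definition pa where "pa a b = - inner (G1 a) (\<Gamma> b - \<Gamma> a) / len a b"
definition pb where "pb a b = inner (G1 b) (\<Gamma> b - \<Gamma> a) / len a b"

lemma pa_pb_cos:
  assumes "a < b" "b < a + 2 * pi"
  shows "pa a b = - (\<rho> a * cos (chang a b - a))" "pb a b = \<rho> b * cos (b - chang a b)"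
proof -
  have l: "len a b \<noteq> 0" using chord_polar(2)[OF assms] by simp
  have i: "inner (G1 t) (of_real r * (\<i> * cis u)) = \<rho> t * r * cos (t - u)" for t r u
    by (simp add: G1_def inner_complex_def cos_diff algebra_simps)
  have "cos (a - chang a b) = cos (chang a b - a)" by (metis cos_minus minus_diff_eq)
  then show "pa a b = - (\<rho> a * cos (chang a b - a))" "pb a b = \<rho> b * cos (b - chang a b)"
    unfolding pa_def pb_def chord_polar(1)[OF assms] i using l by simp_all
qed

lemma vd_affine:
  fixes F F' :: "real \<Rightarrow> complex"
  assumes "\<And>t. (F has_vector_derivative F' t) (at t)"
  shows "((\<lambda>t. F (a + t * \<alpha>)) has_vector_derivative of_real \<alpha> * F' (a + t * \<alpha>)) (at t)"
proof -
  have "((\<lambda>t. a + t * \<alpha>) has_vector_derivative \<alpha>) (at t)"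
    unfolding has_real_derivative_iff_has_vector_derivative[symmetric] by (auto intro!: derivative_eq_intros)
  from vector_diff_chain_at[OF this assms] show ?thesis by (simp add: o_def scaleR_conv_of_real)
qed

lemma has_real_derivative_inner:
  fixes f g :: "real \<Rightarrow> complex"
  assumes "(f has_vector_derivative f') (at t)" "(g has_vector_derivative g') (at t)"
  shows "((\<lambda>t. inner (f t) (g t)) has_real_derivative (inner (f t) g' + inner f' (g t))) (at t)"
  unfolding has_real_derivative_iff_has_vector_derivative
  by (rule bounded_bilinear.has_vector_derivative[OF bounded_bilinear_inner assms])

lemma has_real_derivative_norm:
  fixes f :: "real \<Rightarrow> complex"
  assumes "(f has_vector_derivative f') (at t)" "f t \<noteq> 0"
  shows "((\<lambda>t. norm (f t)) has_real_derivative (inner (f t) f' / norm (f t))) (at t)"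
proof -
  have "((\<lambda>t. norm (f t)) has_derivative (\<lambda>h. inner (h *\<^sub>R f') (sgn (f t)))) (at t)"
    using has_derivative_compose[OF assms(1)[unfolded has_vector_derivative_def] has_derivative_norm[OF assms(2)]] .
  then show ?thesis unfolding has_field_derivative_def
    by (rule has_derivative_eq_rhs) (simp add: fun_eq_iff sgn_div_norm inner_commute divide_inverse)
qed

context
  fixes a b a' b' \<delta> :: real
  assumes \<delta>: "0 < \<delta>" "\<delta> \<le> 1" and g: "(a, b) \<in> gapset \<delta>" "(a', b') \<in> gapset \<delta>"
begin

text \<open>The chord vector along the straight segment between the two angle pairs; the segment
  stays in \<open>gapset \<delta>\<close> because this set is convex, see \<open>line_gap\<close>.
  The next three functions are its derivatives in \<open>t\<close>.\<close>

definition lV where "lV t = \<Gamma> (b + t * (b' - b)) - \<Gamma> (a + t * (a' - a))"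
definition lV1 where "lV1 t = of_real (b' - b) * G1 (b + t * (b' - b)) - of_real (a' - a) * G1 (a + t * (a' - a))"
definition lV2 where "lV2 t = of_real ((b' - b)\<^sup>2) * G2 (b + t * (b' - b)) - of_real ((a' - a)\<^sup>2) * G2 (a + t * (a' - a))"
definition lV3 where "lV3 t = of_real ((b' - b) ^ 3) * G3 (b + t * (b' - b)) - of_real ((a' - a) ^ 3) * G3 (a + t * (a' - a))"

lemma d_lV: "(lV has_vector_derivative lV1 t) (at t)" "(lV1 has_vector_derivative lV2 t) (at t)" "(lV2 has_vector_derivative lV3 t) (at t)"
proof -
  show "(lV has_vector_derivative lV1 t) (at t)" unfolding lV_def[abs_def] lV1_def
    by (intro has_vector_derivative_diff vd_affine d_G0)
  have "(lV1 has_vector_derivative (of_real (b' - b) * (of_real (b' - b) * G2 (b + t * (b' - b))) - of_real (a' - a) * (of_real (a' - a) * G2 (a + t * (a' - a))))) (at t)"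
    unfolding lV1_def[abs_def] by (intro has_vector_derivative_diff has_vector_derivative_mult_right vd_affine d_G1)
  then show "(lV1 has_vector_derivative lV2 t) (at t)" by (simp add: lV2_def power2_eq_square mult.assoc)
  have "(lV2 has_vector_derivative (of_real ((b' - b)\<^sup>2) * (of_real (b' - b) * G3 (b + t * (b' - b))) - of_real ((a' - a)\<^sup>2) * (of_real (a' - a) * G3 (a + t * (a' - a))))) (at t)"
    unfolding lV2_def[abs_def] by (intro has_vector_derivative_diff has_vector_derivative_mult_right vd_affine d_G2)
  then show "(lV2 has_vector_derivative lV3 t) (at t)" by (simp add: lV3_def power2_eq_square power3_eq_cube mult.assoc)
qed

lemma lV_bounds:
  assumes r: "\<bar>a' - a\<bar> \<le> r" "\<bar>b' - b\<bar> \<le> r"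
  shows "norm (lV1 t) \<le> 4 * r" "norm (lV2 t) \<le> 4 * r\<^sup>2" "norm (lV3 t) \<le> 4 * r ^ 3"
proof -
  have r0: "r \<ge> 0" using r by linarith
  have key: "norm (of_real x * u - of_real y * v) \<le> 4 * z" if "\<bar>x\<bar> \<le> z" "\<bar>y\<bar> \<le> z" "norm u \<le> 2" "norm v \<le> 2" for x y z and u v :: complex
  proof -
    have "norm (of_real x * u - of_real y * v) \<le> \<bar>x\<bar> * norm u + \<bar>y\<bar> * norm v"
      by (rule order_trans[OF norm_triangle_ineq4]) (simp add: norm_mult)
    also have "\<dots> \<le> z * 2 + z * 2" using that by (intro add_mono mult_mono) auto
    finally show ?thesis by simp
  qed
  show "norm (lV1 t) \<le> 4 * r" unfolding lV1_def by (intro key r G_bounds)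
  have p: "\<bar>(a' - a) ^ n\<bar> \<le> r ^ n" "\<bar>(b' - b) ^ n\<bar> \<le> r ^ n" for n unfolding power_abs by (intro power_mono r abs_ge_zero)+
  show "norm (lV2 t) \<le> 4 * r\<^sup>2" unfolding lV2_def by (intro key p G_bounds)
  show "norm (lV3 t) \<le> 4 * r ^ 3" unfolding lV3_def by (intro key p G_bounds)
qed

lemma line_gap: assumes "0 \<le> t" "t \<le> 1" shows "(a + t * (a' - a), b + t * (b' - b)) \<in> gapset \<delta>"
proof -
  have e: "b + t * (b' - b) - (a + t * (a' - a)) = (1 - t) * (b - a) + t * (b' - a')" by (simp add: algebra_simps)
  have "(1 - t) * \<delta> + t * \<delta> \<le> (1 - t) * (b - a) + t * (b' - a')" using g assms by (intro add_mono mult_left_mono) (auto simp: gapset_def)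
  moreover have "(1 - t) * (b - a) + t * (b' - a') \<le> (1 - t) * (2 * pi - \<delta>) + t * (2 * pi - \<delta>)" using g assms by (intro add_mono mult_left_mono) (auto simp: gapset_def)
  ultimately show ?thesis unfolding gapset_def by (simp add: e left_diff_distrib algebra_simps)
qed

lemma lV_norm: assumes "0 \<le> t" "t \<le> 1" shows "cgap \<delta> \<le> norm (lV t)" "norm (lV t) \<le> 7" "lV t \<noteq> 0"
proof -
  show 1: "cgap \<delta> \<le> norm (lV t)" "norm (lV t) \<le> 7"
    using gap_heights(5,6)[OF \<delta> line_gap[OF assms]] by (simp_all add: len_def lV_def)
  show "lV t \<noteq> 0" using 1(1) cgap(1)[OF \<delta>] by auto
qed

text \<open>\<open>trapezoid_cubic\<close> for the chord length along the segment: the end slopes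
  are combinations of \<open>pa\<close> and \<open>pb\<close>, and the third derivative is cubic in
  the displacement, with two divisions by the length on top of the scale-free part.\<close>

lemma len_trapezoid:
  assumes r: "\<bar>a' - a\<bar> \<le> r" "\<bar>b' - b\<bar> \<le> r"
  shows "\<bar>len a' b' - len a b - ((pa a b + pa a' b') * (a' - a) + (pb a b + pb a' b') * (b' - b)) / 2\<bar> \<le> (3000 / (cgap \<delta>)\<^sup>2) * r ^ 3"
proof -
  define c where "c = cgap \<delta>"
  have c: "0 < c" "c \<le> 1" using cgap[OF \<delta>] by (auto simp: c_def)
  have r0: "r \<ge> 0" using r by linarith
  define f where "f t = norm (lV t)" for t
  define f1 where "f1 t = inner (lV t) (lV1 t) / f t" for t
  \<comment> \<open>From \<open>f * f1 = inner lV lV1\<close>: differentiating gives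
    \<open>f * f2 + f1^2 = P1\<close> and \<open>f * f3 + 3 * f1 * f2 = P2\<close>, which are solved
    for \<open>f2\<close> and \<open>f3\<close>.\<close>
  define P1 where "P1 t = inner (lV t) (lV2 t) + inner (lV1 t) (lV1 t)" for t
  define f2 where "f2 t = (P1 t - (f1 t)\<^sup>2) / f t" for t
  define P2 where "P2 t = (inner (lV t) (lV3 t) + inner (lV1 t) (lV2 t)) + (inner (lV1 t) (lV2 t) + inner (lV2 t) (lV1 t))" for t
  define f3 where "f3 t = (P2 t - 3 * f1 t * f2 t) / f t" for t
  note nb = lV_norm[folded c_def]
  have fp: "f t > 0" "c \<le> f t" "f t \<le> 7" if "0 \<le> t" "t \<le> 1" for t using nb[OF that] c by (auto simp: f_def)
  have df: "(f has_real_derivative f1 t) (at t)" if "0 \<le> t" "t \<le> 1" for t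
    unfolding f_def[abs_def] f1_def by (rule has_real_derivative_norm[OF d_lV(1) nb(3)[OF that]])
  have dP0: "((\<lambda>t. inner (lV t) (lV1 t)) has_real_derivative P1 t) (at t)" for t
    unfolding P1_def by (rule has_real_derivative_inner[OF d_lV(1,2)])
  have dP1: "(P1 has_real_derivative P2 t) (at t)" for t
    unfolding P1_def[abs_def] P2_def
    by (intro DERIV_add has_real_derivative_inner d_lV)
  have df1: "(f1 has_real_derivative f2 t) (at t)" if t: "0 \<le> t" "t \<le> 1" for t
  proof -
    have "(f1 has_real_derivative (P1 t * f t - inner (lV t) (lV1 t) * f1 t) / (f t * f t)) (at t)"
      unfolding f1_def[abs_def] by (rule DERIV_divide[OF dP0 df[OF t, unfolded f1_def]]) (use fp(1)[OF t] in simp)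
    moreover have "(P1 t * f t - inner (lV t) (lV1 t) * f1 t) / (f t * f t) = f2 t"
      using fp(1)[OF t] by (simp add: f2_def f1_def field_simps power2_eq_square)
    ultimately show ?thesis by simp
  qed
  have df2: "(f2 has_real_derivative f3 t) (at t)" if t: "0 \<le> t" "t \<le> 1" for t
  proof -
    have sq: "((\<lambda>t. (f1 t)\<^sup>2) has_real_derivative (2 * (f2 t * f1 t))) (at t)"
      using DERIV_power[OF df1[OF t], of 2] by simp
    have "(f2 has_real_derivative ((P2 t - 2 * (f2 t * f1 t)) * f t - (P1 t - (f1 t)\<^sup>2) * f1 t) / (f t * f t)) (at t)"
      unfolding f2_def[abs_def]
      by (rule DERIV_divide[OF DERIV_diff[OF dP1 sq[unfolded f2_def]] df[OF t]]) (use fp(1)[OF t] in simp)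
    moreover have "((P2 t - 2 * (f2 t * f1 t)) * f t - (P1 t - (f1 t)\<^sup>2) * f1 t) / (f t * f t) = f3 t"
    proof -
      have "P1 t - (f1 t)\<^sup>2 = f2 t * f t" using fp(1)[OF t] by (simp add: f2_def)
      then show ?thesis using fp(1)[OF t] by (simp add: f3_def field_simps)
    qed
    ultimately show ?thesis by simp
  qed
  have ib: "\<bar>inner u v\<bar> \<le> x * y" if "norm u \<le> x" "norm v \<le> y" for u v :: complex and x y
    by (rule order_trans[OF Cauchy_Schwarz_ineq2]) (intro mult_mono that order_trans[OF norm_ge_zero that(1)] norm_ge_zero)
  have b3: "\<bar>f3 t\<bar> \<le> (3000 / c\<^sup>2) * r ^ 3" if t: "0 \<le> t" "t \<le> 1" for t
  proof -
    note lb = lV_bounds[OF r, of t]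
    have nV: "norm (lV t) \<le> 7" using nb(2)[OF t] .
    have f1b: "\<bar>f1 t\<bar> \<le> 4 * r"
    proof -
      have "\<bar>inner (lV t) (lV1 t)\<bar> \<le> f t * (4 * r)" unfolding f_def by (intro ib lb order_refl)
      then show ?thesis using fp(1)[OF t] by (simp add: f1_def abs_divide field_simps)
    qed
    have P1b: "\<bar>P1 t\<bar> \<le> 44 * r\<^sup>2"
    proof -
      have "\<bar>inner (lV t) (lV2 t)\<bar> \<le> 7 * (4 * r\<^sup>2)" "\<bar>inner (lV1 t) (lV1 t)\<bar> \<le> (4 * r) * (4 * r)" by (intro ib nV lb)+
      moreover have "(4 * r) * (4 * r) = 16 * r\<^sup>2" by (simp add: power2_eq_square)
      moreover have "\<bar>x + y\<bar> \<le> 44 * R" if "\<bar>x\<bar> \<le> 7 * (4 * R)" "\<bar>y\<bar> \<le> 16 * R" for x y R :: real using that by linarith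
      ultimately show ?thesis unfolding P1_def by metis
    qed
    have f1s: "(f1 t)\<^sup>2 \<le> 16 * r\<^sup>2" using power_mono[OF f1b, of 2] by (simp add: power_mult_distrib)
    have f2b: "\<bar>f2 t\<bar> \<le> 60 * r\<^sup>2 / c"
    proof -
      have "\<bar>P1 t - (f1 t)\<^sup>2\<bar> \<le> 60 * r\<^sup>2" using P1b f1s zero_le_power2[of "f1 t"] by linarith
      then have "\<bar>P1 t - (f1 t)\<^sup>2\<bar> / f t \<le> 60 * r\<^sup>2 / c" by (rule frac_le[rotated]) (use c fp[OF t] in auto)
      then show ?thesis using fp(1)[OF t] by (simp add: f2_def abs_divide)
    qed
    have P2b: "\<bar>P2 t\<bar> \<le> 76 * r ^ 3"
    proof -
      have "\<bar>inner (lV t) (lV3 t)\<bar> \<le> 7 * (4 * r ^ 3)" "\<bar>inner (lV1 t) (lV2 t)\<bar> \<le> (4 * r) * (4 * r\<^sup>2)" "\<bar>inner (lV2 t) (lV1 t)\<bar> \<le> (4 * r\<^sup>2) * (4 * r)" by (intro ib nV lb)+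
      moreover have "(4 * r) * (4 * r\<^sup>2) = 16 * r ^ 3" "(4 * r\<^sup>2) * (4 * r) = 16 * r ^ 3" by (simp_all add: power2_eq_square power3_eq_cube)
      moreover have "\<bar>(x + y) + (z + u)\<bar> \<le> 76 * R" if "\<bar>x\<bar> \<le> 7 * (4 * R)" "\<bar>y\<bar> \<le> 16 * R" "\<bar>z\<bar> \<le> 16 * R" "\<bar>u\<bar> \<le> 16 * R" for x y z u R :: real
        using that by linarith
      ultimately show ?thesis unfolding P2_def by metis
    qed
    have "\<bar>f1 t * f2 t\<bar> \<le> (4 * r) * (60 * r\<^sup>2 / c)" unfolding abs_mult using f1b f2b r0 by (intro mult_mono) auto
    then have pr: "\<bar>3 * f1 t * f2 t\<bar> \<le> 720 * r ^ 3 / c" by (simp add: abs_mult power2_eq_square power3_eq_cube)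
    have "76 * r ^ 3 \<le> 76 * r ^ 3 / c" using c r0 by (simp add: field_simps mult_left_le_one_le mult_left_le)
    moreover have "76 * r ^ 3 / c + 720 * r ^ 3 / c = 796 * r ^ 3 / c" by (simp add: add_divide_distrib[symmetric])
    ultimately have "\<bar>P2 t - 3 * f1 t * f2 t\<bar> \<le> 796 * r ^ 3 / c" using P2b pr by linarith
    then have "\<bar>P2 t - 3 * f1 t * f2 t\<bar> / f t \<le> (796 * r ^ 3 / c) / c" by (rule frac_le[rotated]) (use c r0 fp[OF t] in auto)
    also have "\<dots> = (796 / c\<^sup>2) * r ^ 3" by (simp add: power2_eq_square)
    also have "\<dots> \<le> (3000 / c\<^sup>2) * r ^ 3" using c r0 by (intro mult_right_mono divide_right_mono) auto
    finally show ?thesis using fp(1)[OF t] by (simp add: f3_def abs_divide)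
  qed
  have gen: "inner W (of_real y * B - of_real x * A) / n = - inner A W / n * x + inner B W / n * y" for W A B :: complex and x y n
  proof -
    have "inner W (of_real y * B - of_real x * A) = y * inner B W - x * inner A W"
      by (simp add: inner_diff_right inner_commute[of W] inner_of_real_mult)
    then show ?thesis by (simp add: diff_divide_distrib mult.commute)
  qed
  have "\<bar>f 1 - f 0 - (f1 0 + f1 1) / 2\<bar> \<le> (3000 / c\<^sup>2) * r ^ 3"
    by (rule trapezoid_cubic[OF df df1 df2 b3])
  moreover have "f 1 = len a' b'" "f 0 = len a b" by (simp_all add: f_def lV_def len_def)
  moreover have "f1 0 = pa a b * (a' - a) + pb a b * (b' - b)" "f1 1 = pa a' b' * (a' - a) + pb a' b' * (b' - b)"
    unfolding f1_def f_def lV_def lV1_def pa_def pb_def len_def gen by simp_all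
  ultimately show ?thesis by (simp add: c_def algebra_simps add_divide_distrib diff_divide_distrib)
qed

text \<open>Up to sign both are inner products of \<open>G1\<close> at one end with the normalised
  chord, so a single estimate along the segment serves for both.\<close>

lemma pa_pb_lipschitz:
  assumes r: "\<bar>a' - a\<bar> \<le> r" "\<bar>b' - b\<bar> \<le> r"
  shows "\<bar>pa a' b' - pa a b\<bar> \<le> 20 / cgap \<delta> * r" "\<bar>pb a' b' - pb a b\<bar> \<le> 20 / cgap \<delta> * r"
proof -
  define c where "c = cgap \<delta>"
  have c: "0 < c" "c \<le> 1" using cgap[OF \<delta>] by (auto simp: c_def)
  have r0: "r \<ge> 0" using r by linarith
  note nb = lV_norm[folded c_def]
  have gen: "\<bar>inner (H 1) (lV 1) / norm (lV 1) - inner (H 0) (lV 0) / norm (lV 0)\<bar> \<le> 20 / c * r"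
    if H: "\<And>t. (H has_vector_derivative H' t) (at t)" and Hb: "\<And>t. norm (H t) \<le> 2" "\<And>t. norm (H' t) \<le> 2 * r" for H H' :: "real \<Rightarrow> complex"
  proof -
    define h where "h t = inner (H t) (lV t) / norm (lV t)" for t
    define h' where "h' t = ((inner (H t) (lV1 t) + inner (H' t) (lV t)) * norm (lV t) - inner (H t) (lV t) * (inner (lV t) (lV1 t) / norm (lV t))) / (norm (lV t) * norm (lV t))" for t
    have dh: "(h has_real_derivative h' t) (at t)" if "0 \<le> t" "t \<le> 1" for t
      unfolding h_def[abs_def] h'_def
      by (rule DERIV_divide[OF has_real_derivative_inner[OF H d_lV(1)] has_real_derivative_norm[OF d_lV(1) nb(3)[OF that]]]) (use nb(3)[OF that] in simp)
    have b: "\<bar>h' t\<bar> \<le> 20 / c * r" if t: "0 \<le> t" "t \<le> 1" for t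
    proof -
      define n where "n = norm (lV t)"
      have n: "n > 0" "c \<le> n" using nb(1,3)[OF t] by (auto simp: n_def)
      have CS: "\<bar>inner u v\<bar> \<le> norm u * norm v" for u v :: complex by (rule Cauchy_Schwarz_ineq2)
      have 1: "\<bar>inner (H t) (lV1 t)\<bar> \<le> 2 * (4 * r)" by (rule order_trans[OF CS]) (intro mult_mono Hb lV_bounds(1)[OF r]; simp)
      have 2: "\<bar>inner (H' t) (lV t)\<bar> \<le> (2 * r) * n" by (rule order_trans[OF CS]) (unfold n_def, intro mult_right_mono Hb norm_ge_zero)
      have 3: "\<bar>inner (H t) (lV t)\<bar> \<le> 2 * n" by (rule order_trans[OF CS]) (unfold n_def, intro mult_right_mono Hb norm_ge_zero)
      have 4: "\<bar>inner (lV t) (lV1 t)\<bar> \<le> n * (4 * r)" by (rule order_trans[OF CS]) (unfold n_def, intro mult_left_mono lV_bounds(1)[OF r] norm_ge_zero)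
      have h'eq: "h' t = (inner (H t) (lV1 t) + inner (H' t) (lV t)) / n - inner (H t) (lV t) / n * (inner (lV t) (lV1 t) / n) / n"
        using n by (simp add: h'_def n_def[symmetric] field_simps)
      have "\<bar>(inner (H t) (lV1 t) + inner (H' t) (lV t)) / n\<bar> \<le> 8 * r / c + 2 * r"
      proof -
        have "\<bar>inner (H t) (lV1 t) / n\<bar> \<le> 8 * r / c" unfolding abs_divide using 1 n c r0 by (intro frac_le) auto
        moreover have "\<bar>inner (H' t) (lV t) / n\<bar> \<le> 2 * r" using 2 n by (simp add: abs_divide field_simps)
        ultimately show ?thesis unfolding add_divide_distrib by linarith
      qed
      moreover have "\<bar>inner (H t) (lV t) / n * (inner (lV t) (lV1 t) / n) / n\<bar> \<le> 8 * r / c"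
      proof -
        have "\<bar>inner (H t) (lV t) / n\<bar> \<le> 2" "\<bar>inner (lV t) (lV1 t) / n\<bar> \<le> 4 * r" using 3 4 n by (simp_all add: abs_divide field_simps)
        then have "\<bar>inner (H t) (lV t) / n * (inner (lV t) (lV1 t) / n)\<bar> \<le> 2 * (4 * r)" unfolding abs_mult by (intro mult_mono) auto
        then have "\<bar>inner (H t) (lV t) / n * (inner (lV t) (lV1 t) / n)\<bar> / \<bar>n\<bar> \<le> 8 * r / c" by (intro frac_le[rotated]) (use n c r0 in auto)
        then show ?thesis by (simp only: abs_divide)
      qed
      moreover have "2 * r \<le> 2 * r / c" using c mult_right_mono[OF c(2) r0] by (simp add: field_simps)
      moreover have "8 * r / c + 2 * r / c + 8 * r / c = 18 * r / c" by (simp add: add_divide_distrib[symmetric])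
      moreover have "\<bar>X - Y\<bar> \<le> 18 * r / c" if "\<bar>X\<bar> \<le> 8 * r / c + 2 * r" "\<bar>Y\<bar> \<le> 8 * r / c" "2 * r \<le> 2 * r / c"
          "8 * r / c + 2 * r / c + 8 * r / c = 18 * r / c" for X Y
        using that by linarith
      ultimately have "\<bar>h' t\<bar> \<le> 18 * r / c" unfolding h'eq by blast
      also have "\<dots> \<le> 20 / c * r" using c r0 by (simp add: divide_right_mono)
      finally show ?thesis .
    qed
    have "\<bar>h 1 - h 0\<bar> \<le> 20 / c * r * 1"
    proof (rule deriv_abs_bound[where f = "\<lambda>t. h t - h 0" and g = "\<lambda>t. 20 / c * r * t"])
      fix t :: real assume t: "0 \<le> t" "t \<le> 1"
      show "((\<lambda>t. h t - h 0) has_real_derivative h' t) (at t)" using DERIV_diff[OF dh[OF t] DERIV_const[of "h 0"]] by simp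
      show "((\<lambda>t. 20 / c * r * t) has_real_derivative (20 / c * r)) (at t)" by (rule derivative_eq_intros refl | simp)+
      show "\<bar>h' t\<bar> \<le> 20 / c * r" by (rule b[OF t])
    qed simp_all
    then show ?thesis by (simp add: h_def)
  qed
  have nm: "norm (of_real x * G2 t) \<le> 2 * r" if "\<bar>x\<bar> \<le> r" for x t
    using mult_mono[OF that G_bounds(2)[of t]] r0 by (simp add: norm_mult)
  have "\<bar>inner (G1 (a + 1 * (a' - a))) (lV 1) / norm (lV 1) - inner (G1 (a + 0 * (a' - a))) (lV 0) / norm (lV 0)\<bar> \<le> 20 / c * r"
    by (rule gen[OF vd_affine[OF d_G1]]) (intro G_bounds nm r)+
  then show "\<bar>pa a' b' - pa a b\<bar> \<le> 20 / cgap \<delta> * r"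
    by (simp add: pa_def lV_def len_def c_def abs_minus_commute)
  have "\<bar>inner (G1 (b + 1 * (b' - b))) (lV 1) / norm (lV 1) - inner (G1 (b + 0 * (b' - b))) (lV 0) / norm (lV 0)\<bar> \<le> 20 / c * r"
    by (rule gen[OF vd_affine[OF d_G1]]) (intro G_bounds nm r)+
  then show "\<bar>pb a' b' - pb a b\<bar> \<le> 20 / cgap \<delta> * r" by (simp add: pb_def lV_def len_def c_def)
qed

end

end

section \<open>The twist property and lengths of periodic orbits\<close>

lemma periodic_int:
  fixes f :: "real \<Rightarrow> 'a"
  assumes "\<And>t. f (t + p) = f t"
  shows "f (t + p * of_int k) = f t"
proof (induction k rule: int_induct[where k = 0])
  case (step1 i)
  have "t + p * of_int (i + 1) = (t + p * of_int i) + p" by (simp add: algebra_simps)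
  then show ?case using step1 assms by metis
next
  case (step2 i)
  have "t + p * of_int i = (t + p * of_int (i - 1)) + p" by (simp add: algebra_simps)
  then show ?case using step2 assms by metis
qed simp

context billiard_curve
begin

text \<open>The mixed second derivative of \<open>len\<close>. Its positivity is the twist property
  of the billiard map; written with heights it can be bounded below on
  \<open>gapset \<delta>\<close>.\<close>

lemma d_pa:
  assumes "a < x" "x < a + 2 * pi"
  shows "((\<lambda>x. pa a x) has_real_derivative \<rho> a * \<rho> x * height a x * height x a / len a x ^ 3) (at x)"
proof -
  define \<omega> where "\<omega> = chang a x"
  define l where "l = len a x"
  have l: "l > 0" using chord_polar(2)[OF assms] by (simp add: l_def)
  have V: "\<Gamma> x - \<Gamma> a = of_real l * (\<i> * cis \<omega>)" using chord_polar(1)[OF assms] by (simp add: l_def \<omega>_def)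
  have i: "inner (G1 t) (of_real r * (\<i> * cis u)) = \<rho> t * r * cos (t - u)" for t r u
    by (simp add: G1_def inner_complex_def cos_diff algebra_simps)
  have dV: "((\<lambda>x. \<Gamma> x - \<Gamma> a) has_vector_derivative G1 x) (at x)"
    using has_vector_derivative_diff[OF d_G0[of x] has_vector_derivative_const[of "\<Gamma> a"]] by simp
  have dn: "((\<lambda>x. - inner (G1 a) (\<Gamma> x - \<Gamma> a)) has_real_derivative (- inner (G1 a) (G1 x))) (at x)"
    using DERIV_minus[OF has_real_derivative_inner[OF has_vector_derivative_const[of "G1 a"] dV]] by simp
  have "((\<lambda>x. pa a x) has_real_derivative ((- inner (G1 a) (G1 x)) * l - (- inner (G1 a) (\<Gamma> x - \<Gamma> a)) * (\<rho> x * cos (x - \<omega>))) / (l * l)) (at x)"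
    unfolding pa_def[abs_def] l_def \<omega>_def by (rule DERIV_divide[OF dn d_len_right[OF assms]]) (use l in \<open>simp add: l_def\<close>)
  moreover have "((- inner (G1 a) (G1 x)) * l - (- inner (G1 a) (\<Gamma> x - \<Gamma> a)) * (\<rho> x * cos (x - \<omega>))) / (l * l)
      = \<rho> a * \<rho> x * height a x * height x a / l ^ 3"
  proof -
    have 1: "inner (G1 a) (G1 x) = \<rho> a * \<rho> x * cos (a - x)" using i[of a "\<rho> x" x] by (simp add: G1_def)
    have 2: "inner (G1 a) (\<Gamma> x - \<Gamma> a) = \<rho> a * l * cos (a - \<omega>)" unfolding V by (rule i)
    have 3: "height a x = l * sin (\<omega> - a)" "height x a = l * sin (x - \<omega>)" using chord_polar(7,8)[OF assms] by (simp_all add: l_def \<omega>_def)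
    have "cos (a - x) = cos ((a - \<omega>) - (x - \<omega>))" by simp
    also have "\<dots> = cos (a - \<omega>) * cos (x - \<omega>) + sin (a - \<omega>) * sin (x - \<omega>)" by (rule cos_diff)
    also have "sin (a - \<omega>) = - sin (\<omega> - a)" by (metis minus_diff_eq sin_minus)
    finally have 4: "cos (a - x) = cos (a - \<omega>) * cos (x - \<omega>) - sin (\<omega> - a) * sin (x - \<omega>)" by simp
    show ?thesis unfolding 1 2 3 4 using l by (simp add: field_simps power3_eq_cube)
  qed
  ultimately show ?thesis by (simp add: l_def)
qed

text \<open>The twist property integrated: given the first angle, the second is a Lipschitz function
  of \<open>pa\<close>, so two consecutive angles of an orbit determine the next one with
  control.\<close>

lemma pa_slope:
  assumes \<delta>: "0 < \<delta>" "\<delta> \<le> 1" and g: "(a, b) \<in> gapset \<delta>" "(a, b') \<in> gapset \<delta>"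
  shows "(cgap \<delta>)\<^sup>2 / 400 * \<bar>b' - b\<bar> \<le> \<bar>pa a b' - pa a b\<bar>"
proof -
  define k where "k = (cgap \<delta>)\<^sup>2 / 400"
  have main: "k * (y - x) \<le> pa a y - pa a x" if xy: "x \<le> y" "(a, x) \<in> gapset \<delta>" "(a, y) \<in> gapset \<delta>" for x y
  proof -
    have "pa a x - k * x \<le> pa a y - k * y"
    proof (rule DERIV_nonneg_imp_nondecreasing[OF xy(1), where f = "\<lambda>t. pa a t - k * t"])
      fix t assume t: "x \<le> t" "t \<le> y"
      have gt: "(a, t) \<in> gapset \<delta>" using t xy by (auto simp: gapset_def)
      note gh = gap_heights[OF \<delta> gt]
      define D where "D = \<rho> a * \<rho> t * height a t * height t a / len a t ^ 3"
      have "((\<lambda>t. pa a t - k * t) has_real_derivative (D - k)) (at t)"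
        using DERIV_diff[OF d_pa[OF gh(3,4)] DERIV_cmult_Id[of k]] by (simp add: D_def)
      moreover have "k \<le> D"
      proof -
        have c0: "cgap \<delta> > 0" by (rule cgap[OF \<delta>])
        have "(999/1000) * (999/1000) * cgap \<delta> * cgap \<delta> \<le> \<rho> a * \<rho> t * height a t * height t a"
          using rho_num[of a] rho_num[of t] gh c0 by (intro mult_mono) (auto intro!: mult_nonneg_nonneg)
        moreover have "len a t ^ 3 \<le> 7 ^ 3" "len a t ^ 3 > 0" using gh c0 power_mono[OF gh(6), of 3] by (auto intro!: zero_less_power)
        ultimately have "(999/1000) * (999/1000) * cgap \<delta> * cgap \<delta> / 7 ^ 3 \<le> D"
          unfolding D_def using c0 gh(1,2) rho_pos[of a] rho_pos[of t] by (intro frac_le) (auto intro!: mult_nonneg_nonneg)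
        moreover have "k \<le> (999/1000) * (999/1000) * cgap \<delta> * cgap \<delta> / 7 ^ 3"
          using mult_pos_pos[OF c0 c0] by (simp add: k_def power2_eq_square)
        ultimately show ?thesis by linarith
      qed
      ultimately show "\<exists>z. ((\<lambda>t. pa a t - k * t) has_real_derivative z) (at t) \<and> 0 \<le> z" by (intro exI[of _ "D - k"]) simp
    qed
    then show ?thesis by (simp add: algebra_simps)
  qed
  show ?thesis unfolding k_def[symmetric]
    using main[of b b'] main[of b' b] g by (cases "b \<le> b'") (auto simp: abs_minus_commute)
qed

text \<open>The last clause says that the total length is critical in each angle, which is the
  reflection law; \<open>w\<close> is the winding number, and the gap condition keeps consecutive
  vertices apart uniformly.\<close>

definition periodic_orbit :: "nat \<Rightarrow> int \<Rightarrow> real \<Rightarrow> (nat \<Rightarrow> real) \<Rightarrow> bool" where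
  "periodic_orbit q w \<delta> \<theta> \<longleftrightarrow> (\<forall>i. (\<theta> i, \<theta> (Suc i)) \<in> gapset \<delta>) \<and> (\<forall>i. \<theta> (i + q) = \<theta> i + 2 * pi * of_int w)
     \<and> (\<forall>i. pb (\<theta> i) (\<theta> (Suc i)) + pa (\<theta> (Suc i)) (\<theta> (Suc (Suc i))) = 0)"

text \<open>One step of the billiard map multiplies distances by at most \<open>L\<close>:
  \<open>pa\<close> and \<open>pb\<close> vary by \<open>20 / cgap \<delta>\<close> times the
  displacement, and the inverse twist costs \<open>400\<close> over the square of
  \<open>cgap \<delta>\<close>.\<close>

lemma orbit_lipschitz:
  assumes \<delta>: "0 < \<delta>" "\<delta> \<le> 1" and o: "periodic_orbit q w \<delta> \<theta>" "periodic_orbit q w \<delta> \<theta>'"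
    and r: "\<bar>\<theta>' 0 - \<theta> 0\<bar> \<le> r" "\<bar>\<theta>' 1 - \<theta> 1\<bar> \<le> r"
  defines "L \<equiv> 16000 / cgap \<delta> ^ 3 + 1"
  shows "\<bar>\<theta>' i - \<theta> i\<bar> \<le> L ^ i * r"
proof -
  define c where "c = cgap \<delta>"
  have c: "0 < c" "c \<le> 1" using cgap[OF \<delta>] by (auto simp: c_def)
  have L: "L \<ge> 1" using c by (simp add: L_def c_def)
  have r0: "r \<ge> 0" using r by linarith
  define \<alpha> where "\<alpha> i = \<theta>' i - \<theta> i" for i
  have gp: "(\<theta> i, \<theta> (Suc i)) \<in> gapset \<delta>" "(\<theta>' i, \<theta>' (Suc i)) \<in> gapset \<delta>" for i using o by (auto simp: periodic_orbit_def)
  have rf: "pb (\<theta> i) (\<theta> (Suc i)) = - pa (\<theta> (Suc i)) (\<theta> (Suc (Suc i)))" "pb (\<theta>' i) (\<theta>' (Suc i)) = - pa (\<theta>' (Suc i)) (\<theta>' (Suc (Suc i)))" for i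
    using o unfolding periodic_orbit_def by (simp_all add: eq_neg_iff_add_eq_0)
  have step: "\<bar>\<alpha> (Suc (Suc i))\<bar> \<le> L * R" if R: "\<bar>\<alpha> i\<bar> \<le> R" "\<bar>\<alpha> (Suc i)\<bar> \<le> R" for i R
  proof -
    have R0: "R \<ge> 0" using R by linarith
    have e1: "\<bar>pb (\<theta>' i) (\<theta>' (Suc i)) - pb (\<theta> i) (\<theta> (Suc i))\<bar> \<le> 20 / c * R"
      unfolding c_def by (rule pa_pb_lipschitz(2)[OF \<delta> gp]) (use R in \<open>auto simp: \<alpha>_def\<close>)
    \<comment> \<open>Translating the next chord so that it starts at
      \<open>\<theta> (Suc i)\<close> makes \<open>pa_slope\<close> applicable, which needs a common
      first argument; translation preserves the gap.\<close>
    define x where "x = \<theta>' (Suc (Suc i)) - \<alpha> (Suc i)"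
    have gx: "(\<theta> (Suc i), x) \<in> gapset \<delta>" using gp(2)[of "Suc i"] by (simp add: gapset_def x_def \<alpha>_def)
    have e2: "\<bar>pa (\<theta>' (Suc i)) (\<theta>' (Suc (Suc i))) - pa (\<theta> (Suc i)) x\<bar> \<le> 20 / c * R"
      unfolding c_def by (rule pa_pb_lipschitz(1)[OF \<delta> gx gp(2)]) (use R in \<open>auto simp: \<alpha>_def x_def\<close>)
    have "\<bar>pa (\<theta> (Suc i)) x - pa (\<theta> (Suc i)) (\<theta> (Suc (Suc i)))\<bar> \<le> 40 / c * R"
    proof -
      have "20 / c * R + 20 / c * R = 40 / c * R" by (simp add: add_divide_distrib[symmetric] distrib_right[symmetric])
      then show ?thesis using e1 e2 unfolding rf by linarith
    qed
    then have "c\<^sup>2 / 400 * \<bar>x - \<theta> (Suc (Suc i))\<bar> \<le> 40 / c * R"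
      using pa_slope[OF \<delta> gp(1)[of "Suc i"] gx] by (simp add: c_def)
    then have "\<bar>x - \<theta> (Suc (Suc i))\<bar> \<le> 16000 / c ^ 3 * R"
      using c by (simp add: field_simps power2_eq_square power3_eq_cube)
    moreover have "\<alpha> (Suc (Suc i)) = (x - \<theta> (Suc (Suc i))) + \<alpha> (Suc i)" by (simp add: x_def \<alpha>_def)
    moreover have "L * R = 16000 / c ^ 3 * R + R" by (simp add: L_def c_def distrib_right)
    ultimately show ?thesis using R by linarith
  qed
  have "\<bar>\<alpha> i\<bar> \<le> L ^ i * r \<and> \<bar>\<alpha> (Suc i)\<bar> \<le> L ^ i * r"
  proof (induction i)
    case 0 then show ?case using r by (simp add: \<alpha>_def)
  next
    case (Suc i)
    have "L ^ i * r \<le> L * (L ^ i * r)" using mult_right_mono[OF L, of "L ^ i * r"] L r0 by simp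
    then show ?case using Suc step[of i "L ^ i * r"] by (auto simp: mult.assoc)
  qed
  then show ?thesis by (simp add: \<alpha>_def)
qed

text \<open>In the trapezoidal formula each vertex receives linear terms from its two sides;
  criticality of both orbits makes them cancel in pairs, and periodicity closes the sum. Only the
  cubic errors remain, and \<open>orbit_lipschitz\<close> bounds them by the distance of the first
  two angles.\<close>

lemma orbit_length_cubic:
  assumes \<delta>: "0 < \<delta>" "\<delta> \<le> 1" and o: "periodic_orbit q w \<delta> \<theta>" "periodic_orbit q w \<delta> \<theta>'"
    and r: "\<bar>\<theta>' 0 - \<theta> 0\<bar> \<le> r" "\<bar>\<theta>' 1 - \<theta> 1\<bar> \<le> r"
  defines "L \<equiv> 16000 / cgap \<delta> ^ 3 + 1"
  shows "\<bar>(\<Sum>i<q. len (\<theta>' i) (\<theta>' (Suc i))) - (\<Sum>i<q. len (\<theta> i) (\<theta> (Suc i)))\<bar> \<le> (real q * (3000 / (cgap \<delta>)\<^sup>2) * (L ^ q) ^ 3) * r ^ 3"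
proof -
  have L: "L \<ge> 1" using cgap[OF \<delta>] by (simp add: L_def)
  have r0: "r \<ge> 0" using r by linarith
  define \<alpha> where "\<alpha> i = \<theta>' i - \<theta> i" for i
  define R where "R = L ^ q * r"
  have gp: "(\<theta> i, \<theta> (Suc i)) \<in> gapset \<delta>" "(\<theta>' i, \<theta>' (Suc i)) \<in> gapset \<delta>" for i using o by (auto simp: periodic_orbit_def)
  have rf: "pb (\<theta> i) (\<theta> (Suc i)) = - pa (\<theta> (Suc i)) (\<theta> (Suc (Suc i)))" "pb (\<theta>' i) (\<theta>' (Suc i)) = - pa (\<theta>' (Suc i)) (\<theta>' (Suc (Suc i)))" for i
    using o unfolding periodic_orbit_def by (simp_all add: eq_neg_iff_add_eq_0)
  have pr: "\<theta> (i + q) = \<theta> i + 2 * pi * of_int w" "\<theta>' (i + q) = \<theta>' i + 2 * pi * of_int w" for i using o by (auto simp: periodic_orbit_def)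
  have aR: "\<bar>\<alpha> i\<bar> \<le> R" if "i \<le> q" for i
  proof -
    have "\<bar>\<alpha> i\<bar> \<le> L ^ i * r" unfolding \<alpha>_def L_def by (rule orbit_lipschitz[OF \<delta> o r])
    also have "\<dots> \<le> R" unfolding R_def using L r0 that by (intro mult_right_mono power_increasing) auto
    finally show ?thesis .
  qed
  define X where "X i = (pa (\<theta> i) (\<theta> (Suc i)) + pa (\<theta>' i) (\<theta>' (Suc i))) * \<alpha> i" for i
  have edge: "\<bar>len (\<theta>' i) (\<theta>' (Suc i)) - len (\<theta> i) (\<theta> (Suc i)) - (X i - X (Suc i)) / 2\<bar> \<le> 3000 / (cgap \<delta>)\<^sup>2 * R ^ 3" if "i < q" for i
  proof -
    have "\<bar>len (\<theta>' i) (\<theta>' (Suc i)) - len (\<theta> i) (\<theta> (Suc i)) - ((pa (\<theta> i) (\<theta> (Suc i)) + pa (\<theta>' i) (\<theta>' (Suc i))) * (\<theta>' i - \<theta> i)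
       + (pb (\<theta> i) (\<theta> (Suc i)) + pb (\<theta>' i) (\<theta>' (Suc i))) * (\<theta>' (Suc i) - \<theta> (Suc i))) / 2\<bar> \<le> 3000 / (cgap \<delta>)\<^sup>2 * R ^ 3"
      by (rule len_trapezoid[OF \<delta> gp]) (use aR[of i] aR[of "Suc i"] that in \<open>auto simp: \<alpha>_def\<close>)
    then show ?thesis unfolding rf X_def \<alpha>_def by (simp add: algebra_simps)
  qed
  have G1p: "G1 (t + 2 * pi * of_int k) = G1 t" for t k
    by (rule periodic_int) (simp add: G1_def per\<rho> complex_eq_iff)
  have pap: "pa (a + 2 * pi * of_int w) (b + 2 * pi * of_int w) = pa a b" for a b
    by (simp add: pa_def len_def G1p Gamma_int)
  have Xq: "X q = X 0" using pr[of 0] pr[of 1] by (simp add: X_def \<alpha>_def pap)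
  have tel: "(\<Sum>i<q. (X i - X (Suc i)) / 2) = 0"
  proof -
    have "(\<Sum>i<q. X (Suc i) - X i) = X q - X 0" by (rule sum_lessThan_telescope)
    then have "(\<Sum>i<q. X i - X (Suc i)) = 0" using Xq by (simp add: sum_subtractf)
    then show ?thesis by (simp add: sum_divide_distrib[symmetric])
  qed
  have "(\<Sum>i<q. len (\<theta>' i) (\<theta>' (Suc i))) - (\<Sum>i<q. len (\<theta> i) (\<theta> (Suc i))) =
    (\<Sum>i<q. len (\<theta>' i) (\<theta>' (Suc i)) - len (\<theta> i) (\<theta> (Suc i)) - (X i - X (Suc i)) / 2)"
    using tel by (simp add: sum_subtractf)
  also have "\<bar>\<dots>\<bar> \<le> (\<Sum>i<q. 3000 / (cgap \<delta>)\<^sup>2 * R ^ 3)"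
    by (rule order_trans[OF sum_abs]) (intro sum_mono edge, simp)
  also have "\<dots> = (real q * (3000 / (cgap \<delta>)\<^sup>2) * (L ^ q) ^ 3) * r ^ 3" by (simp add: R_def power_mult_distrib)
  finally show ?thesis .
qed

theorem negligible_periodic_lengths:
  "negligible {l. \<exists>q w \<theta>. q \<ge> 1 \<and> (\<forall>i. \<theta> i < \<theta> (Suc i) \<and> \<theta> (Suc i) < \<theta> i + 2 * pi) \<and>
      (\<forall>i. \<theta> (i + q) = \<theta> i + 2 * pi * of_int w) \<and>
      (\<forall>i. pb (\<theta> i) (\<theta> (Suc i)) + pa (\<theta> (Suc i)) (\<theta> (Suc (Suc i))) = 0) \<and>
      l = (\<Sum>i<q. len (\<theta> i) (\<theta> (Suc i)))}" (is "negligible ?S")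
proof -
  define val where "val q \<theta> = (\<Sum>i<q. len (\<theta> i) (\<theta> (Suc i)))" for q and \<theta> :: "nat \<Rightarrow> real"
  \<comment> \<open>Countably many pieces, indexed by the period, the winding number and a lower
    bound \<open>1 / (n + 1)\<close> for the gaps, with the first angle moved into one
    period.\<close>
  define B where "B = (\<lambda>(q, w, n). val q ` {\<theta>. periodic_orbit q w (1 / real (Suc n)) \<theta> \<and> 0 \<le> \<theta> 0 \<and> \<theta> 0 \<le> 2 * pi})"
  have neg: "negligible (B z)" for z
  proof -
    obtain q w n where z: "z = (q, w, n)" by (metis prod_cases3)
    define \<delta> where "\<delta> = 1 / real (Suc n)"
    have \<delta>: "0 < \<delta>" "\<delta> \<le> 1" by (auto simp: \<delta>_def)
    define L where "L = 16000 / cgap \<delta> ^ 3 + 1"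
    have L: "L \<ge> 0" using cgap[OF \<delta>] by (simp add: L_def)
    have "negligible (val q ` {\<theta>. periodic_orbit q w \<delta> \<theta> \<and> 0 \<le> \<theta> 0 \<and> \<theta> 0 \<le> 2 * pi})"
    proof (rule negligible_cubic_image[where x = "\<lambda>\<theta>. \<theta> 0" and y = "\<lambda>\<theta>. \<theta> 1" and R = "4 * pi" and K = "real q * (3000 / (cgap \<delta>)\<^sup>2) * (L ^ q) ^ 3"])
      fix \<theta> assume p: "periodic_orbit q w \<delta> \<theta> \<and> 0 \<le> \<theta> 0 \<and> \<theta> 0 \<le> 2 * pi"
      then have "(\<theta> 0, \<theta> (Suc 0)) \<in> gapset \<delta>" by (simp add: periodic_orbit_def)
      then show "0 \<le> \<theta> 0 \<and> \<theta> 0 \<le> 4 * pi \<and> 0 \<le> \<theta> 1 \<and> \<theta> 1 \<le> 4 * pi" using p \<delta> pi_gt_zero by (auto simp: gapset_def)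
    next
      fix \<theta> \<theta>' r assume "periodic_orbit q w \<delta> \<theta> \<and> 0 \<le> \<theta> 0 \<and> \<theta> 0 \<le> 2 * pi" "periodic_orbit q w \<delta> \<theta>' \<and> 0 \<le> \<theta>' 0 \<and> \<theta>' 0 \<le> 2 * pi"
        "\<bar>\<theta> 0 - \<theta>' 0\<bar> \<le> r" "\<bar>\<theta> 1 - \<theta>' 1\<bar> \<le> r"
      then show "\<bar>val q \<theta> - val q \<theta>'\<bar> \<le> real q * (3000 / (cgap \<delta>)\<^sup>2) * (L ^ q) ^ 3 * r ^ 3"
        unfolding val_def L_def by (intro orbit_length_cubic[OF \<delta>]) auto
    qed (use L in auto)
    then show ?thesis by (simp add: B_def z \<delta>_def)
  qed
  have "?S \<subseteq> (\<Union>z. B z)"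
  proof
    fix l assume "l \<in> ?S"
    then obtain q w \<theta> where q: "q \<ge> 1" and gap: "\<And>i. \<theta> i < \<theta> (Suc i)" "\<And>i. \<theta> (Suc i) < \<theta> i + 2 * pi"
      and per: "\<And>i. \<theta> (i + q) = \<theta> i + 2 * pi * of_int w"
      and rf: "\<And>i. pb (\<theta> i) (\<theta> (Suc i)) + pa (\<theta> (Suc i)) (\<theta> (Suc (Suc i))) = 0" and l: "l = val q \<theta>"
      by (auto simp: val_def)
    define G where "G i = \<theta> (Suc i) - \<theta> i" for i
    have Gper: "G (i + q) = G i" for i using per[of i] per[of "Suc i"] by (simp add: G_def)
    have Gmod: "G i = G (i mod q)" for i
    proof -
      have "G (j + k * q) = G j" for j k by (induction k) (use Gper in \<open>auto simp: add.assoc[symmetric] add.commute\<close>, metis Gper add.assoc add.commute)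
      then show ?thesis by (metis mod_div_decomp add.commute)
    qed
    \<comment> \<open>The gaps are periodic in \<open>i\<close>, so finitely many values decide and
      some \<open>1 / (n + 1)\<close> lies below all of them.\<close>
    define m where "m = Min ((\<lambda>i. min (G i) (2 * pi - G i)) ` {..<q})"
    have fin: "finite ((\<lambda>i. min (G i) (2 * pi - G i)) ` {..<q})" "(\<lambda>i. min (G i) (2 * pi - G i)) ` {..<q} \<noteq> {}" using q by (auto simp: lessThan_empty_iff)
    have m0: "m > 0" unfolding m_def using fin gap by (subst Min_gr_iff) (auto simp: G_def less_diff_eq diff_less_eq add.commute)
    have mle: "m \<le> G i" "m \<le> 2 * pi - G i" for i
    proof -
      have "m \<le> min (G (i mod q)) (2 * pi - G (i mod q))" unfolding m_def using fin q by (intro Min_le) auto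
      then show "m \<le> G i" "m \<le> 2 * pi - G i" using Gmod[of i] by auto
    qed
    obtain n :: nat where n: "1 / real (Suc n) < m" using m0 by (metis nat_approx_posE)
    obtain k where k: "0 \<le> \<theta> 0 + 2 * pi * of_int k" "\<theta> 0 + 2 * pi * of_int k < 0 + 2 * pi" by (rule angle_reduce)
    define \<theta>' where "\<theta>' i = \<theta> i + 2 * pi * of_int k" for i
    have G1p: "G1 (t + 2 * pi * of_int k) = G1 t" for t
      by (rule periodic_int) (simp add: G1_def per\<rho> complex_eq_iff)
    have inv: "pa (\<theta>' i) (\<theta>' j) = pa (\<theta> i) (\<theta> j)" "pb (\<theta>' i) (\<theta>' j) = pb (\<theta> i) (\<theta> j)" "len (\<theta>' i) (\<theta>' j) = len (\<theta> i) (\<theta> j)" for i j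
      by (simp_all add: \<theta>'_def pa_def pb_def len_def G1p Gamma_int)
    have "periodic_orbit q w (1 / real (Suc n)) \<theta>'"
      unfolding periodic_orbit_def
    proof (intro conjI allI)
      fix i
      show "(\<theta>' i, \<theta>' (Suc i)) \<in> gapset (1 / real (Suc n))" using mle[of i] n unfolding gapset_def \<theta>'_def G_def by simp
      show "\<theta>' (i + q) = \<theta>' i + 2 * pi * of_int w" using per[of i] by (simp add: \<theta>'_def)
      show "pb (\<theta>' i) (\<theta>' (Suc i)) + pa (\<theta>' (Suc i)) (\<theta>' (Suc (Suc i))) = 0" using rf[of i] by (simp add: inv)
    qed
    moreover have "l = val q \<theta>'" by (simp add: l val_def inv)
    ultimately have "l \<in> B (q, w, n)" using k by (auto simp: B_def \<theta>'_def)
    then show "l \<in> (\<Union>z. B z)" by blast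
  qed
  moreover have "negligible (\<Union>z. B z)"
    by (rule negligible_countable_Union) (use neg in auto)
  ultimately show ?thesis using negligible_subset by blast
qed

end

subsection \<open>Curves from nearly circular domains\<close>

text \<open>\<open>T j\<close> is the \<open>j\<close>-th derivative of the unit tangent of
  \<open>G\<close>, compared with that of a circle. The tangent angle becomes the parameter; its
  derivative is the curvature \<open>\<kappa>\<close>, near 1, so it can be inverted, and
  \<open>\<rho>\<close> is \<open>1 / \<kappa>\<close> at the inverse. The curve is negated because
  the marked point of a normalised domain has outward normal \<open>-1\<close>: after the sign
  change its normal angle is 0.\<close>

lemma curve_from_tangent:
  fixes T :: "nat \<Rightarrow> real \<Rightarrow> complex" and G :: "real \<Rightarrow> complex"
  assumes dG: "\<And>x. (G has_vector_derivative T 0 x) (at x)"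
    and dT: "\<And>j x. j \<le> 3 \<Longrightarrow> (T j has_vector_derivative T (Suc j) x) (at x)"
    and n1: "\<And>x. norm (T 0 x) = 1" and perG: "\<And>x. G (x + 2 * pi) = G x"
    and close: "\<And>j x. j \<le> 4 \<Longrightarrow> norm (T j x - \<i> ^ j * T 0 0 * cis x) \<le> \<delta>"
    and \<delta>: "0 < \<delta>" "\<delta> \<le> 1 / 10 ^ 6" and eps: "100 * \<delta> \<le> \<epsilon>" "\<epsilon> \<le> 1 / 1000"
  shows "\<exists>\<rho> \<rho>1 \<rho>2 \<rho>3 \<Gamma> s. billiard_curve \<rho> \<rho>1 \<rho>2 \<rho>3 \<Gamma> s \<epsilon> \<and> range \<Gamma> = range (\<lambda>x. - G x)"
proof -
  define w where "w = T 0 0"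
  have nw: "norm w = 1" using n1 by (simp add: w_def)
  have w0: "w \<noteq> 0" using nw by auto
  have perT: "T 0 (x + 2 * pi) = T 0 x" for x
  proof -
    have "((\<lambda>x. x + 2 * pi) has_vector_derivative 1) (at x)"
      unfolding has_real_derivative_iff_has_vector_derivative[symmetric] by (auto intro!: derivative_eq_intros)
    from vector_diff_chain_at[OF this dG] have "((\<lambda>x. G (x + 2 * pi)) has_vector_derivative T 0 (x + 2 * pi)) (at x)" by (simp add: o_def)
    then show ?thesis using dG[of x] vector_derivative_unique_at by (simp add: perG) blast
  qed
  \<comment> \<open>For a circle \<open>pr a b\<close> is constant. The curvature and its
    derivatives are imaginary parts of such products, \<open>pr a a\<close> being real, so their
    closeness to constants can be read off.\<close>
  define pr where "pr a b x = T a x * cnj (T b x)" for a b x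
  have dpr: "((\<lambda>x. Im (pr a b x)) has_real_derivative Im (pr (Suc a) b x + pr a (Suc b) x)) (at x)" if "a \<le> 3" "b \<le> 3" for a b x
  proof -
    have "((\<lambda>x. cnj (T b x)) has_vector_derivative cnj (T (Suc b) x)) (at x)"
      using bounded_linear.has_vector_derivative[OF bounded_linear_cnj dT[OF that(2)]] .
    from bounded_linear.has_vector_derivative[OF bounded_linear_Im has_vector_derivative_mult[OF dT[OF that(1)] this]]
    show ?thesis by (simp add: pr_def has_real_derivative_iff_has_vector_derivative add.commute)
  qed
  have prb: "norm (pr a b x - \<i> ^ a * cnj (\<i> ^ b)) \<le> 3 * \<delta>" if ab: "a \<le> 4" "b \<le> 4" for a b x
  proof -
    define u where "u = w * cis x"
    have u1: "norm u = 1" using nw by (simp add: u_def norm_mult)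
    have u: "norm u = 1" "u * cnj u = 1" using u1 complex_norm_square[of u] by simp_all
    define e f where "e = T a x - \<i> ^ a * u" and "f = T b x - \<i> ^ b * u"
    have ef: "norm e \<le> \<delta>" "norm f \<le> \<delta>" using close[OF ab(1), of x] close[OF ab(2), of x] by (simp_all add: e_def f_def u_def w_def mult.assoc)
    have "pr a b x - \<i> ^ a * cnj (\<i> ^ b) = (\<i> ^ a * u) * cnj f + e * cnj (\<i> ^ b * u) + e * cnj f"
    proof -
      have "pr a b x = (\<i> ^ a * u + e) * cnj (\<i> ^ b * u + f)" by (simp add: pr_def e_def f_def)
      also have "\<dots> = \<i> ^ a * cnj (\<i> ^ b) * (u * cnj u) + ((\<i> ^ a * u) * cnj f + e * cnj (\<i> ^ b * u) + e * cnj f)" by (simp add: algebra_simps)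
      finally show ?thesis using u by simp
    qed
    also have "norm \<dots> \<le> norm f + norm e + norm e * norm f"
      by (rule order_trans[OF norm_triangle_ineq], rule add_mono, rule order_trans[OF norm_triangle_ineq]) (auto simp: norm_mult norm_power u)
    also have "norm e * norm f \<le> \<delta> * 1" using ef \<delta> by (intro mult_mono) auto
    finally show ?thesis using ef by linarith
  qed
  define \<kappa> where "\<kappa> x = Im (pr 1 0 x)" for x
  define \<kappa>1 where "\<kappa>1 x = Im (pr 2 0 x)" for x
  define \<kappa>2 where "\<kappa>2 x = Im (pr 3 0 x) + Im (pr 2 1 x)" for x
  define \<kappa>3 where "\<kappa>3 x = Im (pr 4 0 x) + 2 * Im (pr 3 1 x)" for x
  have real: "Im (pr a a x) = 0" for a x by (simp add: pr_def)
  have d\<kappa>: "(\<kappa> has_real_derivative \<kappa>1 x) (at x)" for x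
    using dpr[of 1 0 x] real[of 1 x] by (simp add: \<kappa>_def[abs_def] \<kappa>1_def eval_nat_numeral)
  have d\<kappa>1: "(\<kappa>1 has_real_derivative \<kappa>2 x) (at x)" for x
    using dpr[of 2 0 x] by (simp add: \<kappa>1_def[abs_def] \<kappa>2_def eval_nat_numeral)
  have d\<kappa>2: "(\<kappa>2 has_real_derivative \<kappa>3 x) (at x)" for x
    using DERIV_add[OF dpr[of 3 0 x] dpr[of 2 1 x]] real[of 2 x] by (simp add: \<kappa>2_def[abs_def] \<kappa>3_def eval_nat_numeral add.commute)
  have imb: "\<bar>Im (pr a b x) - Im (\<i> ^ a * cnj (\<i> ^ b))\<bar> \<le> 3 * \<delta>" if "a \<le> 4" "b \<le> 4" for a b x
    using abs_Im_le_cmod[of "pr a b x - \<i> ^ a * cnj (\<i> ^ b)"] prb[OF that, of x] by simp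
  have b\<kappa>: "\<bar>\<kappa> x - 1\<bar> \<le> 3 * \<delta>" "\<bar>\<kappa>1 x\<bar> \<le> 3 * \<delta>" "\<bar>\<kappa>2 x\<bar> \<le> 6 * \<delta>" "\<bar>\<kappa>3 x\<bar> \<le> 9 * \<delta>" for x
  proof -
    show "\<bar>\<kappa> x - 1\<bar> \<le> 3 * \<delta>" using imb[of 1 0 x] by (simp add: \<kappa>_def)
    show "\<bar>\<kappa>1 x\<bar> \<le> 3 * \<delta>" using imb[of 2 0 x] by (simp add: \<kappa>1_def)
    have i3: "\<i> ^ 3 = - \<i>" by (simp add: power3_eq_cube)
    have i4: "\<i> ^ 4 = 1" by simp
    show "\<bar>\<kappa>2 x\<bar> \<le> 6 * \<delta>" using imb[of 3 0 x] imb[of 2 1 x] by (simp add: \<kappa>2_def i3)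
    show "\<bar>\<kappa>3 x\<bar> \<le> 9 * \<delta>" using imb[of 4 0 x] imb[of 3 1 x] by (simp add: \<kappa>3_def i3 i4)
  qed
  have T1: "T 1 x = \<i> * of_real (\<kappa> x) * T 0 x" for x
  proof -
    have "((\<lambda>x. inner (T 0 x) (T 0 x)) has_real_derivative (2 * Re (pr 1 0 x))) (at x)"
      unfolding has_real_derivative_iff_has_vector_derivative
      by (rule has_vector_derivative_eq_rhs[OF bounded_bilinear.has_vector_derivative[OF bounded_bilinear_inner dT dT]])
         (auto simp: pr_def inner_complex_def)
    moreover have "(\<lambda>x. inner (T 0 x) (T 0 x)) = (\<lambda>x. 1)" using n1 by (simp add: dot_square_norm)
    ultimately have "Re (pr 1 0 x) = 0" using DERIV_unique[OF _ DERIV_const[of 1]] by fastforce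
    then have "pr 1 0 x = \<i> * of_real (\<kappa> x)" by (simp add: complex_eq_iff \<kappa>_def)
    moreover have "pr 1 0 x * T 0 x = T 1 x"
    proof -
      have "cnj (T 0 x) * T 0 x = 1" using n1[of x] complex_norm_square[of "T 0 x"] by (simp add: mult.commute)
      then show ?thesis by (simp add: pr_def mult.assoc)
    qed
    ultimately show ?thesis by simp
  qed
  \<comment> \<open>The tangent relative to that of the circle. It stays near 1, so the principal
    logarithm is smooth along it and provides the angle.\<close>
  define P where "P x = T 0 x * (cnj w * cis (- x))" for x
  have cw: "cnj w * w = 1" using nw complex_norm_square[of w] by (simp add: mult.commute)
  have Pn: "norm (P x) = 1" for x using nw n1 by (simp add: P_def norm_mult)
  have TP: "T 0 x = w * cis x * P x" for x
  proof -
    have "w * cis x * P x = T 0 x * (cnj w * w) * (cis x * cis (- x))" by (simp add: P_def algebra_simps)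
    then show ?thesis by (simp add: cw cis_mult)
  qed
  have Pc: "norm (P x - 1) \<le> \<delta>" for x
  proof -
    have "w * cis x * (P x - 1) = T 0 x - w * cis x" using TP[of x] by (simp add: algebra_simps)
    moreover have "norm (w * cis x * (P x - 1)) = norm (P x - 1)" using nw by (simp add: norm_mult)
    ultimately show ?thesis using close[of 0 x] by (simp add: w_def)
  qed
  have Pnp: "P x \<notin> \<real>\<^sub>\<le>\<^sub>0" for x
  proof -
    have "\<bar>Re (P x) - 1\<bar> \<le> \<delta>" using abs_Re_le_cmod[of "P x - 1"] Pc[of x] by simp
    moreover have "\<delta> < 1" using \<delta>(2) by simp
    ultimately have "Re (P x) > 0" by linarith
    then show ?thesis by (auto simp: complex_nonpos_Reals_iff)
  qed
  have dc: "((\<lambda>x. cis (- x)) has_vector_derivative - (\<i> * cis (- x))) (at x)" for x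
  proof -
    have "((\<lambda>y. exp (- \<i> * complex_of_real y)) has_vector_derivative exp (- \<i> * of_real x) * - \<i>) (at x)"
      by (rule has_vector_derivative_eq_rhs, rule has_vector_derivative_real_field[where f = "\<lambda>z. exp (- \<i> * z)"])
         (auto intro!: derivative_eq_intros)
    then show ?thesis by (simp add: cis_conv_exp mult.commute)
  qed
  have dP: "(P has_vector_derivative \<i> * of_real (\<kappa> x - 1) * P x) (at x)" for x
  proof -
    have "(P has_vector_derivative (T 0 x * (cnj w * - (\<i> * cis (- x))) + T (Suc 0) x * (cnj w * cis (- x)))) (at x)"
      unfolding P_def[abs_def] by (intro has_vector_derivative_mult dT has_vector_derivative_mult_right dc) simp
    then show ?thesis by (rule has_vector_derivative_eq_rhs) (use T1[of x] in \<open>simp add: P_def algebra_simps\<close>)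
  qed
  define \<eta> where "\<eta> x = Im (Ln (P x))" for x
  have d\<eta>: "(\<eta> has_real_derivative (\<kappa> x - 1)) (at x)" for x
  proof -
    have "P x \<noteq> 0" using Pn[of x] by auto
    have "((Ln \<circ> P) has_vector_derivative (\<i> * of_real (\<kappa> x - 1) * P x) * inverse (P x)) (at x)"
      by (rule field_vector_diff_chain_at[OF dP has_field_derivative_Ln[OF Pnp]])
    then have "((\<lambda>x. Ln (P x)) has_vector_derivative \<i> * of_real (\<kappa> x - 1)) (at x)"
      using \<open>P x \<noteq> 0\<close> by (simp add: o_def mult.assoc)
    from bounded_linear.has_vector_derivative[OF bounded_linear_Im this] show ?thesis
      by (simp add: \<eta>_def[abs_def] has_real_derivative_iff_has_vector_derivative)
  qed
  have Pcis: "P x = cis (\<eta> x)" for x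
  proof -
    have "P x \<noteq> 0" using Pn[of x] by auto
    then have "P x = exp (Ln (P x))" by simp
    also have "Ln (P x) = \<i> * of_real (\<eta> x)" using Pn[of x] \<open>P x \<noteq> 0\<close> by (simp add: complex_eq_iff \<eta>_def)
    finally show ?thesis by (simp add: cis_conv_exp)
  qed
  define \<Theta> where "\<Theta> x = x + \<eta> x" for x
  have d\<Theta>: "(\<Theta> has_real_derivative \<kappa> x) (at x)" for x
    using DERIV_add[OF DERIV_ident d\<eta>[of x]] by (simp add: \<Theta>_def[abs_def])
  have per\<Theta>: "\<Theta> (x + 2 * pi) = \<Theta> x + 2 * pi" for x
  proof -
    have "cis (- (x + 2 * pi)) = cis (- x)" using cos_periodic[of x] sin_periodic[of x] cos_minus[of "x + 2 * pi"] sin_minus[of "x + 2 * pi"] by (simp only: complex_eq_iff cis.sel cos_minus sin_minus)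
    then show ?thesis by (simp add: \<Theta>_def \<eta>_def P_def perT)
  qed
  have \<kappa>half: "1/2 \<le> \<kappa> x" for x using b\<kappa>(1)[of x] \<delta> by (auto simp: abs_le_iff)
  obtain S where S: "\<And>x. S (\<Theta> x) = x" "\<And>y. \<Theta> (S y) = y" "\<And>y. (S has_real_derivative inverse (\<kappa> (S y))) (at y)"
    using inverse_diffeo[OF d\<Theta> _ \<kappa>half] by auto
  \<comment> \<open>The shift for which the tangent \<open>w * cis (\<Theta> x)\<close> becomes
    \<open>- \<i> * cis t\<close>, so that \<open>- G\<close> has tangent
    \<open>\<i> * cis t\<close>.\<close>
  define \<beta> where "\<beta> = Arg (\<i> * w)"
  have \<beta>: "\<i> * w = cis \<beta>" unfolding \<beta>_def using cis_Arg[of "\<i> * w"] nw w0 by (simp add: sgn_eq norm_mult)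
  define \<sigma> where "\<sigma> t = S (t - \<beta>)" for t
  have per\<sigma>: "\<sigma> (t + 2 * pi) = \<sigma> t + 2 * pi" for t
  proof -
    have "\<Theta> (S (t - \<beta>) + 2 * pi) = t + 2 * pi - \<beta>" by (simp add: per\<Theta> S(2))
    then show ?thesis using S(1)[of "S (t - \<beta>) + 2 * pi"] by (simp add: \<sigma>_def)
  qed
  define \<rho> where "\<rho> t = inverse (\<kappa> (\<sigma> t))" for t
  have d\<sigma>: "(\<sigma> has_real_derivative \<rho> t) (at t)" for t
  proof -
    have "((\<lambda>t. t - \<beta>) has_real_derivative 1) (at t)" by (auto intro!: derivative_eq_intros)
    from DERIV_chain2[OF S(3) this] show ?thesis by (simp add: \<sigma>_def[abs_def] \<rho>_def)
  qed
  define \<rho>1 where "\<rho>1 t = - (\<kappa>1 (\<sigma> t) * \<rho> t ^ 3)" for t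
  define \<rho>2 where "\<rho>2 t = - (\<kappa>2 (\<sigma> t) * \<rho> t * \<rho> t ^ 3 + 3 * \<rho> t ^ 2 * \<rho>1 t * \<kappa>1 (\<sigma> t))" for t
  define \<rho>3 where "\<rho>3 t = - ((\<kappa>3 (\<sigma> t) * \<rho> t * \<rho> t + \<rho>1 t * \<kappa>2 (\<sigma> t)) * \<rho> t ^ 3 + 3 * \<rho> t ^ 2 * \<rho>1 t * (\<kappa>2 (\<sigma> t) * \<rho> t)
     + ((6 * \<rho> t * \<rho>1 t * \<rho>1 t + \<rho>2 t * (3 * \<rho> t ^ 2)) * \<kappa>1 (\<sigma> t) + \<kappa>2 (\<sigma> t) * \<rho> t * (3 * \<rho> t ^ 2 * \<rho>1 t)))" for t
  have \<kappa>0: "\<kappa> x \<noteq> 0" for x using \<kappa>half[of x] by auto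
  have d\<rho>: "(\<rho> has_real_derivative \<rho>1 t) (at t)" for t
  proof -
    have "((\<lambda>t. \<kappa> (\<sigma> t)) has_real_derivative (\<kappa>1 (\<sigma> t) * \<rho> t)) (at t)" by (rule DERIV_chain2[OF d\<kappa> d\<sigma>])
    from DERIV_inverse'[OF this \<kappa>0] show ?thesis by (simp add: \<rho>_def[abs_def] \<rho>1_def power3_eq_cube mult_ac)
  qed
  have d\<kappa>1': "((\<lambda>t. \<kappa>1 (\<sigma> t)) has_real_derivative (\<kappa>2 (\<sigma> t) * \<rho> t)) (at t)" for t by (rule DERIV_chain2[OF d\<kappa>1 d\<sigma>])
  have d\<kappa>2': "((\<lambda>t. \<kappa>2 (\<sigma> t)) has_real_derivative (\<kappa>3 (\<sigma> t) * \<rho> t)) (at t)" for t by (rule DERIV_chain2[OF d\<kappa>2 d\<sigma>])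
  have dr3: "((\<lambda>t. \<rho> t ^ 3) has_real_derivative (3 * \<rho> t ^ 2 * \<rho>1 t)) (at t)" for t
    using DERIV_power[OF d\<rho>, of 3 t] by (simp add: mult_ac)
  have dr2: "((\<lambda>t. 3 * \<rho> t ^ 2) has_real_derivative (6 * \<rho> t * \<rho>1 t)) (at t)" for t
    using DERIV_cmult[OF DERIV_power[OF d\<rho>, of 2 t], of 3] by (simp add: mult_ac)
  have d\<rho>1: "(\<rho>1 has_real_derivative \<rho>2 t) (at t)" for t
    unfolding \<rho>1_def[abs_def] \<rho>2_def using DERIV_minus[OF DERIV_mult[OF d\<kappa>1' dr3], of t] by (simp only: \<rho>1_def)
  have d\<rho>2: "(\<rho>2 has_real_derivative \<rho>3 t) (at t)" for t
    unfolding \<rho>2_def[abs_def]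
    by (rule DERIV_minus[OF DERIV_add[OF DERIV_mult[OF DERIV_mult[OF d\<kappa>2' d\<rho>] dr3] DERIV_mult[OF DERIV_mult[OF dr2 d\<rho>1] d\<kappa>1']], THEN DERIV_cong])
       (simp add: \<rho>3_def \<rho>2_def algebra_simps)
  have rb: "\<bar>\<rho> t - 1\<bar> \<le> 7 * \<delta>" "\<bar>\<rho> t\<bar> \<le> 101/100" for t
  proof -
    have "\<rho> t - 1 = (1 - \<kappa> (\<sigma> t)) / \<kappa> (\<sigma> t)" using \<kappa>0 by (simp add: \<rho>_def field_simps)
    then have "\<bar>\<rho> t - 1\<bar> = \<bar>1 - \<kappa> (\<sigma> t)\<bar> / \<kappa> (\<sigma> t)" using \<kappa>half[of "\<sigma> t"] by (simp add: abs_divide)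
    also have "\<dots> \<le> 3 * \<delta> / (1/2)" using b\<kappa>(1)[of "\<sigma> t"] \<kappa>half[of "\<sigma> t"] \<delta> by (intro frac_le) auto
    finally show 1: "\<bar>\<rho> t - 1\<bar> \<le> 7 * \<delta>" using \<delta> by simp
    then show "\<bar>\<rho> t\<bar> \<le> 101/100" using \<delta> by (auto simp: abs_le_iff)
  qed
  have ml: "\<bar>x * y\<bar> \<le> a * b" if "\<bar>x\<bar> \<le> a" "\<bar>y\<bar> \<le> b" for x y a b :: real unfolding abs_mult using that by (intro mult_mono) auto
  have r2: "\<bar>\<rho> t ^ 2\<bar> \<le> 11/10" "\<bar>\<rho> t ^ 3\<bar> \<le> 11/10" for t
    unfolding power_abs using power_mono[OF rb(2)[of t], of 2] power_mono[OF rb(2)[of t], of 3] by (auto simp: power_divide)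
  have b1: "\<bar>\<rho>1 t\<bar> \<le> 4 * \<delta>" for t
    using ml[OF b\<kappa>(2)[of "\<sigma> t"] r2(2)[of t]] \<delta> by (simp add: \<rho>1_def)
  have b2: "\<bar>\<rho>2 t\<bar> \<le> 10 * \<delta>" for t
  proof -
    have A: "\<bar>\<kappa>2 (\<sigma> t) * \<rho> t * \<rho> t ^ 3\<bar> \<le> 6 * \<delta> * (101/100) * (11/10)" by (intro ml b\<kappa> rb r2)
    have B: "\<bar>3 * \<rho> t ^ 2 * \<rho>1 t * \<kappa>1 (\<sigma> t)\<bar> \<le> 3 * (11/10) * (1/10) * (3 * \<delta>)"
      using b1[of t] \<delta> by (intro ml b\<kappa> r2) auto
    show ?thesis unfolding \<rho>2_def using A B \<delta> by linarith
  qed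
  \<comment> \<open>The largest of the four bounds; the hypothesis
    \<open>100 * \<delta> \<le> \<epsilon>\<close> leaves room for it.\<close>
  have b3: "\<bar>\<rho>3 t\<bar> \<le> 50 * \<delta>" for t
  proof -
    have s1: "\<bar>\<rho>1 t\<bar> \<le> 1/10" "\<bar>\<rho>2 t\<bar> \<le> 1/10" using b1[of t] b2[of t] \<delta> by auto
    have A1: "\<bar>\<kappa>3 (\<sigma> t) * \<rho> t * \<rho> t\<bar> \<le> 9 * \<delta> * (101/100) * (101/100)" by (intro ml b\<kappa> rb)
    have A2: "\<bar>\<rho>1 t * \<kappa>2 (\<sigma> t)\<bar> \<le> (1/10) * (6 * \<delta>)" by (intro ml b\<kappa> s1)
    have "\<bar>\<kappa>3 (\<sigma> t) * \<rho> t * \<rho> t + \<rho>1 t * \<kappa>2 (\<sigma> t)\<bar> \<le> 11 * \<delta>" using A1 A2 \<delta> by linarith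
    then have A: "\<bar>(\<kappa>3 (\<sigma> t) * \<rho> t * \<rho> t + \<rho>1 t * \<kappa>2 (\<sigma> t)) * \<rho> t ^ 3\<bar> \<le> (11 * \<delta>) * (11/10)" by (intro ml r2)
    have k2: "\<bar>\<kappa>2 (\<sigma> t) * \<rho> t\<bar> \<le> 6 * \<delta> * (101/100)" by (intro ml b\<kappa> rb)
    have q: "\<bar>3 * \<rho> t ^ 2 * \<rho>1 t\<bar> \<le> 3 * (11/10) * (1/10)" by (intro ml r2 s1) auto
    have B: "\<bar>3 * \<rho> t ^ 2 * \<rho>1 t * (\<kappa>2 (\<sigma> t) * \<rho> t)\<bar> \<le> 3 * (11/10) * (1/10) * (6 * \<delta> * (101/100))" by (intro ml[OF q k2])
    have E: "\<bar>\<kappa>2 (\<sigma> t) * \<rho> t * (3 * \<rho> t ^ 2 * \<rho>1 t)\<bar> \<le> (6 * \<delta> * (101/100)) * (3 * (11/10) * (1/10))" by (intro ml[OF k2 q])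
    have C1: "\<bar>6 * \<rho> t * \<rho>1 t * \<rho>1 t\<bar> \<le> 6 * (101/100) * (1/10) * (1/10)" by (intro ml rb s1) auto
    have C2: "\<bar>\<rho>2 t * (3 * \<rho> t ^ 2)\<bar> \<le> (1/10) * (3 * (11/10))" by (intro ml s1 r2) auto
    have "\<bar>6 * \<rho> t * \<rho>1 t * \<rho>1 t + \<rho>2 t * (3 * \<rho> t ^ 2)\<bar> \<le> 1" using C1 C2 by linarith
    then have C: "\<bar>(6 * \<rho> t * \<rho>1 t * \<rho>1 t + \<rho>2 t * (3 * \<rho> t ^ 2)) * \<kappa>1 (\<sigma> t)\<bar> \<le> 1 * (3 * \<delta>)" by (intro ml b\<kappa>)
    have tri: "\<bar>- (x + y + (z + u))\<bar> \<le> \<bar>x\<bar> + \<bar>y\<bar> + \<bar>z\<bar> + \<bar>u\<bar>" for x y z u :: real by linarith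
    show ?thesis unfolding \<rho>3_def by (rule order_trans[OF tri]) (use A B C E \<delta> in linarith)
  qed
  define \<Gamma> where "\<Gamma> t = - G (\<sigma> t)" for t
  have d\<Gamma>: "(\<Gamma> has_vector_derivative of_real (\<rho> t) * (\<i> * cis t)) (at t)" for t
  proof -
    have "((\<lambda>t. G (\<sigma> t)) has_vector_derivative (\<rho> t *\<^sub>R T 0 (\<sigma> t))) (at t)"
      using vector_diff_chain_at[OF d\<sigma>[of t, unfolded has_real_derivative_iff_has_vector_derivative] dG] by (simp add: o_def)
    from has_vector_derivative_minus[OF this]
    have "(\<Gamma> has_vector_derivative - (\<rho> t *\<^sub>R T 0 (\<sigma> t))) (at t)" by (simp add: \<Gamma>_def[abs_def])
    moreover have "T 0 (\<sigma> t) = - (\<i> * cis t)"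
    proof -
      have "T 0 (\<sigma> t) = w * (cis (\<sigma> t) * cis (\<eta> (\<sigma> t)))" using TP[of "\<sigma> t"] Pcis by (simp add: mult.assoc)
      also have "\<dots> = w * cis (\<Theta> (\<sigma> t))" by (simp add: cis_mult \<Theta>_def)
      also have "\<Theta> (\<sigma> t) = t - \<beta>" by (simp add: \<sigma>_def S(2))
      also have "w = - \<i> * cis \<beta>" by (simp flip: \<beta>)
      also have "- \<i> * cis \<beta> * cis (t - \<beta>) = - \<i> * (cis \<beta> * cis (t - \<beta>))" by simp
      also have "cis \<beta> * cis (t - \<beta>) = cis t" by (simp add: cis_mult)
      finally show ?thesis by simp
    qed
    ultimately show ?thesis by (simp add: scaleR_conv_of_real)
  qed
  have "billiard_curve \<rho> \<rho>1 \<rho>2 \<rho>3 \<Gamma> \<sigma> \<epsilon>"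
  proof
    fix t
    show "0 < \<epsilon>" "\<epsilon> \<le> 1 / 1000" using eps \<delta> by auto
    show "\<bar>\<rho> t - 1\<bar> \<le> \<epsilon>" "\<bar>\<rho>1 t\<bar> \<le> \<epsilon>" "\<bar>\<rho>2 t\<bar> \<le> \<epsilon>" "\<bar>\<rho>3 t\<bar> \<le> \<epsilon>"
      using rb(1)[of t] b1[of t] b2[of t] b3[of t] eps \<delta> by linarith+
    show "\<Gamma> (t + 2 * pi) = \<Gamma> t" by (simp add: \<Gamma>_def per\<sigma> perG)
    show "\<rho> (t + 2 * pi) = \<rho> t"
    proof -
      have "T 1 (x + 2 * pi) = T 1 x" for x
      proof -
        have "((\<lambda>x. x + 2 * pi) has_vector_derivative 1) (at x)"
          unfolding has_real_derivative_iff_has_vector_derivative[symmetric] by (auto intro!: derivative_eq_intros)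
        from vector_diff_chain_at[OF this dT[of 0]] have "((\<lambda>x. T 0 (x + 2 * pi)) has_vector_derivative T 1 (x + 2 * pi)) (at x)" by (simp add: o_def)
        then show ?thesis using dT[of 0 x] vector_derivative_unique_at by (simp add: perT) blast
      qed
      then show ?thesis by (simp add: \<rho>_def \<kappa>_def pr_def per\<sigma> perT)
    qed
  qed (rule d\<rho> d\<rho>1 d\<rho>2 d\<Gamma> d\<sigma> per\<sigma>)+
  moreover have "range \<Gamma> = range (\<lambda>x. - G x)"
  proof -
    have "- G x \<in> range \<Gamma>" for x
      by (rule range_eqI[of _ _ "\<Theta> x + \<beta>"]) (simp add: \<Gamma>_def \<sigma>_def S(1))
    then show ?thesis by (auto simp: \<Gamma>_def)
  qed
  ultimately show ?thesis by blast
qed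

section \<open>From nearly circular domains to symmetric curves\<close>

lemma frontier_injective_linear_image:
  fixes f :: "complex \<Rightarrow> complex"
  assumes "linear f" "inj f"
  shows "frontier (f ` S) = f ` frontier S"
  unfolding frontier_def closure_injective_linear_image[OF assms, symmetric] interior_injective_linear_image[OF assms]
  using assms(2) by (simp add: image_set_diff)

lemma frontier_scale: "c > 0 \<Longrightarrow> frontier ((\<lambda>z. complex_of_real c * z) ` S) = (\<lambda>z. complex_of_real c * z) ` frontier S"
  by (rule frontier_injective_linear_image) (auto simp: linear_times inj_on_def)

lemma frontier_cnj: "frontier (cnj ` S) = cnj ` frontier S"
  by (rule frontier_injective_linear_image) (auto simp: bounded_linear_cnj bounded_linear.linear inj_on_def)

context billiard_curve
begin

lemma height_nonpos_imp_eq: assumes "height a b \<le> 0" shows "\<Gamma> b = \<Gamma> a"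
proof -
  obtain k where k: "a \<le> b + 2 * pi * of_int k" "b + 2 * pi * of_int k < a + 2 * pi" by (rule angle_reduce)
  have "height a (b + 2 * pi * of_int k) \<le> 0" using assms by (simp add: height_def Gamma_int)
  then have "\<not> a < b + 2 * pi * of_int k" using height_pos(1) k(2) by fastforce
  then have "a = b + 2 * pi * of_int k" using k by simp
  then show ?thesis using Gamma_int by metis
qed

text \<open>\<open>cnj\<close> maps the support point of direction \<open>cis t\<close> to that of
  direction \<open>cis (- t)\<close>, and support points are unique by
  \<open>height_nonpos_imp_eq\<close>; this gives the symmetry. The origin is then its own mirror
  image, so its angle is 0 or \<open>pi\<close> up to full turns; \<open>pi\<close> is excluded
  because the axis point \<open>- x\<close> would lie beyond the tangent line there.\<close>

lemma sym_curveI: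
  assumes cn: "cnj ` range \<Gamma> = range \<Gamma>" and z: "0 \<in> range \<Gamma>" and x: "of_real (- x) \<in> range \<Gamma>" "x > 0"
  shows "sym_curve \<rho> \<rho>1 \<rho>2 \<rho>3 \<Gamma> s \<epsilon>"
proof -
  have ci: "inner (cnj u) (cnj v) = inner u v" for u v by (simp add: inner_complex_def)
  have sym: "\<Gamma> (- t) = cnj (\<Gamma> t)" for t
  proof -
    have "cnj (\<Gamma> t) \<in> range \<Gamma>" using cn by blast
    then obtain b where b: "cnj (\<Gamma> t) = \<Gamma> b" by blast
    have "\<Gamma> (- t) \<in> cnj ` range \<Gamma>" using cn by blast
    then obtain b' where b': "\<Gamma> (- t) = cnj (\<Gamma> b')" by blast
    have c: "cis (- t) = cnj (cis t)" by (simp add: cis_cnj)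
    have "height (- t) b = inner (\<Gamma> (- t)) (cis (- t)) - inner (\<Gamma> b) (cis (- t))" by (simp add: height_def inner_diff_left)
    also have "\<dots> = inner (\<Gamma> b') (cis t) - inner (\<Gamma> t) (cis t)" unfolding b' b[symmetric] c ci ..
    also have "\<dots> = - height t b'" by (simp add: height_def inner_diff_left)
    also have "\<dots> \<le> 0" using height_nonneg[of t b'] by simp
    finally show ?thesis using height_nonpos_imp_eq[of "- t" b] b by simp
  qed
  have "\<rho> (- t) = \<rho> t" for t
  proof -
    have "((\<lambda>t. - t) has_vector_derivative -1) (at t)"
      unfolding has_real_derivative_iff_has_vector_derivative[symmetric] by (auto intro!: derivative_eq_intros)
    from vector_diff_chain_at[OF this d\<Gamma>]
    have "((\<lambda>t. \<Gamma> (- t)) has_vector_derivative - (of_real (\<rho> (- t)) * (\<i> * cis (- t)))) (at t)" by (simp add: o_def)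
    moreover have "((\<lambda>t. cnj (\<Gamma> t)) has_vector_derivative cnj (of_real (\<rho> t) * (\<i> * cis t))) (at t)"
      using bounded_linear.has_vector_derivative[OF bounded_linear_cnj d\<Gamma>] .
    ultimately have "- (of_real (\<rho> (- t)) * (\<i> * cis (- t))) = cnj (of_real (\<rho> t) * (\<i> * cis t))"
      unfolding sym using vector_derivative_unique_at by blast
    then have "of_real (\<rho> (- t)) * (\<i> * cis (- t)) = of_real (\<rho> t) * (\<i> * cis (- t))" by (simp add: cis_cnj)
    then show ?thesis by simp
  qed
  moreover have "\<Gamma> 0 = 0"
  proof -
    obtain b where b: "\<Gamma> b = 0" using z by (metis rangeE)
    have "\<Gamma> (- b) = \<Gamma> b" using sym[of b] b by simp
    then obtain k where k: "b = - b + 2 * pi * of_int k" using Gamma_eq_imp[of "- b" b] by metis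
    then have bk: "b = pi * of_int k" by simp
    show ?thesis
    proof (cases "even k")
      case True
      then obtain j where "k = 2 * j" by (elim evenE)
      then have "b = 0 + 2 * pi * of_int j" using bk by simp
      then show ?thesis using b Gamma_int[of 0 j] by simp
    next
      case False
      then obtain j where "k = 2 * j + 1" by (elim oddE)
      then have "b = pi + 2 * pi * of_int j" using bk by (simp add: algebra_simps)
      then have p: "\<Gamma> pi = 0" using b Gamma_int[of pi j] by simp
      obtain b' where b': "of_real (- x) = \<Gamma> b'" using x by blast
      have "height pi b' = Re (\<Gamma> b')" by (simp add: height_def p inner_complex_def)
      also have "\<dots> = - x" by (simp flip: b')
      finally show ?thesis using height_nonneg[of pi b'] x by simp
    qed
  qed
  ultimately show ?thesis using sym by (intro sym_curve.intro sym_curve_axioms.intro billiard_curve_axioms) auto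
qed

end

lemma exp_linear_vector_derivative:
  "((\<lambda>s. C * exp (a * complex_of_real s)) has_vector_derivative a * C * exp (a * of_real s)) (at s)"
  by (rule has_vector_derivative_eq_rhs, rule has_vector_derivative_real_field[where f = "\<lambda>z. C * exp (a * z)"])
     (auto intro!: derivative_eq_intros)

lemma tangent_circle_deriv:
  "(tangent_circle g has_vector_derivative vector_derivative g (at 0) * exp (2 * of_real pi * \<i> * of_real s)) (at s)"
proof -
  define w where "w = vector_derivative g (at 0)"
  define a where "a = 2 * complex_of_real pi * \<i>"
  have a0: "a \<noteq> 0" by (simp add: a_def)
  have "((\<lambda>s. g 0 + ((w / a) * exp (a * of_real s) - w / a)) has_vector_derivative 0 + (a * (w / a) * exp (a * of_real s) - 0)) (at s)"
    by (intro has_vector_derivative_add has_vector_derivative_const has_vector_derivative_diff exp_linear_vector_derivative)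
  moreover have "tangent_circle g = (\<lambda>s. g 0 + ((w / a) * exp (a * of_real s) - w / a))"
    unfolding tangent_circle_def[abs_def] w_def[symmetric] a_def[symmetric] by (simp add: right_diff_distrib)
  ultimately show ?thesis using a0 by (simp add: w_def a_def)
qed

lemma tangent_circle_vderiv:
  "vderiv_iter (Suc n) (tangent_circle g) s = (2 * of_real pi * \<i>) ^ n * vector_derivative g (at 0) * exp (2 * of_real pi * \<i> * of_real s)"
proof -
  define w where "w = vector_derivative g (at 0)"
  define a where "a = 2 * complex_of_real pi * \<i>"
  have "vderiv_iter (Suc n) (tangent_circle g) = (\<lambda>s. a ^ n * w * exp (a * of_real s))"
  proof (induction n)
    case 0
    show ?case using vector_derivative_at[OF tangent_circle_deriv[of g]] by (simp add: w_def a_def)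
  next
    case (Suc n)
    have "vderiv_iter (Suc (Suc n)) (tangent_circle g) = (\<lambda>s. vector_derivative (\<lambda>s. a ^ n * w * exp (a * of_real s)) (at s))"
      using Suc by simp
    also have "\<dots> = (\<lambda>s. a ^ Suc n * w * exp (a * of_real s))"
      using vector_derivative_at[OF exp_linear_vector_derivative[of "a ^ n * w" a]] by (simp add: mult.assoc)
    finally show ?case .
  qed
  then show ?thesis by (simp add: w_def a_def)
qed

lemma domain_curve:
  assumes S: "S_delta 8 \<delta> \<Omega>" and cn: "cnj ` \<Omega> = \<Omega>" and z: "0 \<in> frontier \<Omega>"
    and x: "complex_of_real x \<in> frontier \<Omega>" "x > 0"
    and \<delta>: "0 < \<delta>" "\<delta> \<le> 1 / 10 ^ 6" and eps: "100 * \<delta> \<le> \<epsilon>" "\<epsilon> \<le> 1 / 1000"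
  shows "\<exists>\<rho> \<rho>1 \<rho>2 \<rho>3 \<Gamma> s r. sym_curve \<rho> \<rho>1 \<rho>2 \<rho>3 \<Gamma> s \<epsilon> \<and> r > 0 \<and> frontier \<Omega> = range (\<lambda>t. - (of_real r * \<Gamma> t))"
proof -
  obtain c g where c: "c > 0" and bp: "boundary_param 9 ((\<lambda>z. of_real c * z) ` \<Omega>) g"
    and unit: "\<And>s. norm (vector_derivative g (at s)) = 1"
    and cl: "\<And>j s. j \<le> 9 \<Longrightarrow> norm (vderiv_iter j (\<lambda>s. g s - tangent_circle g s) s) \<le> \<delta>"
    using S by (auto simp: S_delta_def delta_close_def)
  have ck: "Ck 9 g" and per: "\<And>x. g (x + 1) = g x" and im: "g ` {0..1} = frontier ((\<lambda>z. of_real c * z) ` \<Omega>)"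
    using bp by (auto simp: boundary_param_def)
  define D where "D j = vderiv_iter j g" for j
  have dD: "(D j has_vector_derivative D (Suc j) s) (at s)" if "j < 9" for j s
    using ck that by (auto simp: Ck_def D_def vector_derivative_works[symmetric])
  define C where "C j = vderiv_iter j (tangent_circle g)" for j
  define w where "w = vector_derivative g (at 0)"
  have CS: "C (Suc n) s = (2 * of_real pi * \<i>) ^ n * w * exp (2 * of_real pi * \<i> * of_real s)" for n s
    unfolding C_def w_def by (rule tangent_circle_vderiv)
  have dC: "(C j has_vector_derivative C (Suc j) s) (at s)" for j s
  proof (cases j)
    case 0
    have "(tangent_circle g has_vector_derivative w * exp (2 * of_real pi * \<i> * of_real s)) (at s)"
      unfolding w_def by (rule tangent_circle_deriv)
    then show ?thesis using CS[of 0 s] 0 by (simp add: C_def)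
  next
    case (Suc n)
    have e: "C (Suc n) = (\<lambda>s. (2 * of_real pi * \<i>) ^ n * w * exp (2 * of_real pi * \<i> * of_real s))" using CS by auto
    have "((\<lambda>s. (2 * of_real pi * \<i>) ^ n * w * exp (2 * of_real pi * \<i> * of_real s)) has_vector_derivative C (Suc (Suc n)) s) (at s)"
      using exp_linear_vector_derivative[of "(2 * of_real pi * \<i>) ^ n * w" "2 * of_real pi * \<i>" s] unfolding CS by (simp add: mult.assoc)
    then show ?thesis using e Suc by simp
  qed
  have diff: "vderiv_iter j (\<lambda>s. g s - tangent_circle g s) = (\<lambda>s. D j s - C j s)" if "j \<le> 9" for j
    using that
  proof (induction j)
    case 0 then show ?case by (simp add: D_def C_def)
  next
    case (Suc j)
    have "((\<lambda>s. D j s - C j s) has_vector_derivative D (Suc j) s - C (Suc j) s) (at s)" for s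
      by (intro has_vector_derivative_diff dD dC) (use Suc in simp)
    from vector_derivative_at[OF this] show ?case using Suc by simp
  qed
  have D1: "D 1 s = vector_derivative g (at s)" for s by (simp add: D_def)
  \<comment> \<open>Rescaling from perimeter 1 to \<open>2 * pi\<close> keeps unit speed; the
    \<open>j\<close>-th derivative of the tangent is divided by \<open>(2 * pi) ^ j\<close>, so
    closeness to the circle is not lost.\<close>
  define G where "G y = of_real (2 * pi) * g (y / (2 * pi))" for y
  define T where "T j y = D (Suc j) (y / (2 * pi)) / of_real ((2 * pi) ^ j)" for j y
  have dq: "((\<lambda>y. y / (2 * pi)) has_vector_derivative (1 / (2 * pi))) (at y)" for y
    unfolding has_real_derivative_iff_has_vector_derivative[symmetric] by (auto intro!: derivative_eq_intros)
  have dG: "(G has_vector_derivative T 0 y) (at y)" for y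
  proof -
    have "((\<lambda>y. D 0 (y / (2 * pi))) has_vector_derivative (1 / (2 * pi)) *\<^sub>R D 1 (y / (2 * pi))) (at y)"
      using vector_diff_chain_at[OF dq dD[of 0]] by (simp add: o_def)
    from has_vector_derivative_mult_right[OF this, of "of_real (2 * pi)"]
    show ?thesis by (simp add: G_def[abs_def] T_def D_def scaleR_conv_of_real)
  qed
  have dT: "(T j has_vector_derivative T (Suc j) y) (at y)" if "j \<le> 3" for j y
  proof -
    have "((\<lambda>y. D (Suc j) (y / (2 * pi))) has_vector_derivative (1 / (2 * pi)) *\<^sub>R D (Suc (Suc j)) (y / (2 * pi))) (at y)"
      using vector_diff_chain_at[OF dq dD[of "Suc j"]] that by (simp add: o_def)
    from has_vector_derivative_mult_right[OF this, of "inverse (of_real ((2 * pi) ^ j))"]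
    show ?thesis by (simp add: T_def[abs_def] scaleR_conv_of_real field_simps)
  qed
  have T00: "T 0 0 = w" by (simp add: T_def D_def w_def)
  have close: "norm (T j y - \<i> ^ j * T 0 0 * cis y) \<le> \<delta>" if "j \<le> 4" for j y
  proof -
    define s where "s = y / (2 * pi)"
    have "norm (D (Suc j) s - C (Suc j) s) \<le> \<delta>" using cl[of "Suc j" s] diff[of "Suc j"] that by (simp del: vderiv_iter.simps)
    moreover have "C (Suc j) s = of_real ((2 * pi) ^ j) * (\<i> ^ j * w * cis y)"
      unfolding CS by (simp add: s_def cis_conv_exp power_mult_distrib mult_ac)
    moreover have "T j y = D (Suc j) s / of_real ((2 * pi) ^ j)" by (simp add: T_def s_def)
    ultimately have "norm (of_real ((2 * pi) ^ j) * (T j y - \<i> ^ j * w * cis y)) \<le> \<delta>" by (simp add: right_diff_distrib)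
    then have n: "(2 * pi) ^ j * norm (T j y - \<i> ^ j * w * cis y) \<le> \<delta>" by (simp add: norm_mult norm_power)
    have "1 \<le> (2 * pi) ^ j" using pi_gt3 by (intro one_le_power) simp
    then have "1 * norm (T j y - \<i> ^ j * w * cis y) \<le> (2 * pi) ^ j * norm (T j y - \<i> ^ j * w * cis y)" by (intro mult_right_mono) auto
    then show ?thesis using n T00 by simp
  qed
  have n1: "norm (T 0 y) = 1" for y using unit by (simp add: T_def D_def)
  have perG: "G (y + 2 * pi) = G y" for y using per[of "y / (2 * pi)"] by (simp add: G_def add_divide_distrib)
  obtain \<rho> \<rho>1 \<rho>2 \<rho>3 \<Gamma> s where bc: "billiard_curve \<rho> \<rho>1 \<rho>2 \<rho>3 \<Gamma> s \<epsilon>" and rg: "range \<Gamma> = range (\<lambda>x. - G x)"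
    using curve_from_tangent[where T = T, OF dG dT n1 perG close \<delta> eps] by blast
  have rgg: "range g = g ` {0..1}"
  proof -
    have pk: "g (x + 1 * of_int k) = g x" for x k
    proof (induction k rule: int_induct[where k = 0])
      case (step1 i) then show ?case using per[of "x + 1 * of_int i"] by (simp add: add.assoc)
    next
      case (step2 i) then show ?case using per[of "x + 1 * of_int (i - 1)"] by (simp add: add.assoc)
    qed simp
    have "g x = g (frac x)" for x using pk[of "frac x" "\<lfloor>x\<rfloor>"] by (simp add: frac_def)
    moreover have "frac x \<in> {0..1}" for x :: real by (simp add: frac_lt_1 less_imp_le)
    ultimately show ?thesis by (metis (no_types, opaque_lifting) image_eqI image_subset_iff rangeI subset_antisym subset_UNIV image_mono)
  qed
  have frg: "range g = (\<lambda>z. of_real c * z) ` frontier \<Omega>" using im rgg frontier_scale[OF c] by simp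
  \<comment> \<open>Undoes both scalings, by \<open>c\<close> and by \<open>2 * pi\<close>.\<close>
  define R where "R = 1 / (2 * pi * c)"
  have R: "R > 0" using c by (simp add: R_def)
  have RG: "range \<Gamma> = (\<lambda>z. - (of_real (2 * pi * c) * z)) ` frontier \<Omega>"
  proof -
    have "range (\<lambda>x. - G x) = (\<lambda>z. - (of_real (2 * pi) * z)) ` range g"
    proof -
      have "range (\<lambda>x::real. x / (2 * pi)) = UNIV"
        by (rule surjI[of _ "\<lambda>x. x * (2 * pi)"]) simp
      then have "range (\<lambda>x. g (x / (2 * pi))) = range g" by (metis image_image)
      moreover have "range (\<lambda>x. - G x) = (\<lambda>z. - (of_real (2 * pi) * z)) ` range (\<lambda>x. g (x / (2 * pi)))"
        by (simp add: G_def image_image)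
      ultimately show ?thesis by (simp only:)
    qed
    then show ?thesis by (simp add: rg frg image_image mult.assoc)
  qed
  interpret billiard_curve \<rho> \<rho>1 \<rho>2 \<rho>3 \<Gamma> s \<epsilon> by (rule bc)
  have "sym_curve \<rho> \<rho>1 \<rho>2 \<rho>3 \<Gamma> s \<epsilon>"
  proof (rule sym_curveI[where x = "2 * pi * c * x"])
    have "cnj ` frontier \<Omega> = frontier \<Omega>" using frontier_cnj[of \<Omega>] cn by simp
    then show "cnj ` range \<Gamma> = range \<Gamma>" unfolding RG image_image by (metis (no_types, lifting) complex_cnj_complex_of_real complex_cnj_minus complex_cnj_mult image_cong image_image)
    show "0 \<in> range \<Gamma>" unfolding RG using z by (intro image_eqI[of _ _ 0]) auto
    show "of_real (- (2 * pi * c * x)) \<in> range \<Gamma>" unfolding RG using x by (intro image_eqI[of _ _ "of_real x"]) auto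
    show "2 * pi * c * x > 0" using c x by simp
  qed
  moreover have "frontier \<Omega> = range (\<lambda>t. - (of_real R * \<Gamma> t))"
  proof -
    have "range (\<lambda>t. - (of_real R * \<Gamma> t)) = (\<lambda>z. - (of_real R * z)) ` range \<Gamma>" by (simp add: image_image)
    also have "\<dots> = (\<lambda>z. z) ` frontier \<Omega>" unfolding RG image_image using c by (intro image_cong refl) (simp add: R_def)
    finally show ?thesis by simp
  qed
  ultimately show ?thesis using R by blast
qed

subsection \<open>Spectra and isospectral families\<close>

context billiard_curve
begin

text \<open>Projection on the direction of the chord: \<open>s\<close> grows at least as fast as any
  component of \<open>\<Gamma>\<close>.\<close>

lemma len_le_arc: assumes "a \<le> b" shows "len a b \<le> s b - s a"
proof -
  define u where "u = sgn (\<Gamma> b - \<Gamma> a)"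
  have nu: "norm u \<le> 1" by (simp add: u_def norm_sgn)
  have "s a - inner (\<Gamma> a) u \<le> s b - inner (\<Gamma> b) u"
  proof (rule DERIV_nonneg_imp_nondecreasing[OF assms, where f = "\<lambda>t. s t - inner (\<Gamma> t) u"])
    fix t
    have "((\<lambda>t. s t - inner (\<Gamma> t) u) has_real_derivative \<rho> t - \<rho> t * inner (\<i> * cis t) u) (at t)"
      by (intro DERIV_diff ds d_inner_Gamma)
    moreover have "\<rho> t * inner (\<i> * cis t) u \<le> \<rho> t * 1"
    proof (rule mult_left_mono)
      have "inner (\<i> * cis t) u \<le> norm (\<i> * cis t) * norm u" by (rule norm_cauchy_schwarz)
      then show "inner (\<i> * cis t) u \<le> 1" using nu by (simp add: norm_mult)
    qed (use rho_pos[of t] in simp)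
    ultimately show "\<exists>y. ((\<lambda>t. s t - inner (\<Gamma> t) u) has_real_derivative y) (at t) \<and> 0 \<le> y" by auto
  qed
  moreover have "inner (\<Gamma> b - \<Gamma> a) u = len a b"
    by (cases "\<Gamma> b = \<Gamma> a") (auto simp: u_def len_def sgn_div_norm dot_square_norm power2_eq_square)
  ultimately show ?thesis by (simp add: inner_diff_left)
qed

lemma CC_le_len: "CC ((a + b) / 2) ((b - a) / 2) \<le> len a b"
proof -
  have "CC ((a + b) / 2) ((b - a) / 2) \<le> norm (midchord ((a + b) / 2) ((b - a) / 2))"
    unfolding CC_def by (rule complex_Re_le_cmod)
  also have "\<dots> = len a b"
  proof -
    have "(a + b) / 2 + (b - a) / 2 = b" "(a + b) / 2 - (b - a) / 2 = a" by (simp_all add: field_simps)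
    then show ?thesis by (simp add: midchord_def len_def norm_mult)
  qed
  finally show ?thesis .
qed

text \<open>Projection on the tangent direction at \<open>m\<close>: along the arc the tangent makes
  an angle of at most \<open>d\<close> with it.\<close>

lemma len_ge_arc: assumes "0 \<le> d" "d \<le> pi / 2" shows "cos d * (s (m + d) - s (m - d)) \<le> len (m - d) (m + d)"
proof -
  have "CC m 0 - cos d * (s (m + 0) - s (m - 0)) \<le> CC m d - cos d * (s (m + d) - s (m - d))"
  proof (rule DERIV_nonneg_imp_nondecreasing[OF assms(1), where f = "\<lambda>t. CC m t - cos d * (s (m + t) - s (m - t))"])
    fix t assume t: "0 \<le> t" "t \<le> d"
    have 1: "((\<lambda>t. s (m + t)) has_real_derivative \<rho> (m + t) * 1) (at t)"
      by (rule DERIV_chain2[OF ds]) (auto intro!: derivative_eq_intros)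
    have 2: "((\<lambda>t. s (m - t)) has_real_derivative \<rho> (m - t) * (-1)) (at t)"
      by (rule DERIV_chain2[OF ds]) (auto intro!: derivative_eq_intros)
    have "((\<lambda>t. CC m t - cos d * (s (m + t) - s (m - t))) has_real_derivative
       (\<rho> (m + t) + \<rho> (m - t)) * cos t - cos d * (\<rho> (m + t) * 1 - \<rho> (m - t) * (-1))) (at t)"
      by (intro DERIV_diff DERIV_cmult d_CC 1 2)
    moreover have "(\<rho> (m + t) + \<rho> (m - t)) * cos d \<le> (\<rho> (m + t) + \<rho> (m - t)) * cos t"
    proof (rule mult_left_mono)
      show "cos d \<le> cos t" using t assms pi_gt_zero by (intro cos_monotone_0_pi_le) linarith+
      show "0 \<le> \<rho> (m + t) + \<rho> (m - t)" using rho_pos[of "m + t"] rho_pos[of "m - t"] by linarith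
    qed
    ultimately show "\<exists>y. ((\<lambda>t. CC m t - cos d * (s (m + t) - s (m - t))) has_real_derivative y) (at t) \<and> 0 \<le> y"
      by (intro exI conjI) (assumption, simp add: algebra_simps)
  qed
  then have "cos d * (s (m + d) - s (m - d)) \<le> CC m d" by (simp add: CC_0)
  also have "\<dots> \<le> len (m - d) (m + d)" using CC_le_len[of "m - d" "m + d"] by simp
  finally show ?thesis .
qed

text \<open>The curve leaves its tangent quadratically; this later shows that a point moving on the
  boundary has no normal velocity.\<close>

lemma height_le_len_sq: "height a b \<le> 2 * (len a b)\<^sup>2"
proof -
  obtain k where k: "a \<le> b + 2 * pi * of_int k" "b + 2 * pi * of_int k < a + 2 * pi" by (rule angle_reduce)
  define c where "c = b + 2 * pi * of_int k"
  define d where "d = (c - a) / 2"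
  have ac: "a \<le> c" "c < a + 2 * pi" using k by (simp_all add: c_def)
  then have d: "0 \<le> d" "d \<le> pi" by (simp_all add: d_def)
  have G: "\<Gamma> c = \<Gamma> b" by (simp add: c_def Gamma_int)
  have dl: "2 * (1 - \<epsilon>) * sin d \<le> len a c" using CC_ge[OF d, of "(a + c) / 2"] CC_le_len[of a c] by (simp add: d_def)
  have "height a c \<le> (1 + \<epsilon>) * (1 - cos (c - a))" using height_bounds_aux(2)[of a c] ac by simp
  also have "c - a = 2 * d" by (simp add: d_def)
  also have "1 - cos (2 * d) = 2 * (sin d)\<^sup>2" by (simp add: cos_double_sin)
  finally have "height a c \<le> (1 + \<epsilon>) * (2 * (sin d)\<^sup>2)" .
  moreover have "(2 * (1 - \<epsilon>) * sin d)\<^sup>2 \<le> (len a c)\<^sup>2"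
    using dl sin_ge_zero[OF d] eps by (intro power_mono) auto
  moreover have "(2 * (sin d)\<^sup>2) \<le> (2 * (1 - \<epsilon>) * sin d)\<^sup>2"
  proof -
    have "(3/2)\<^sup>2 \<le> (2 * (1 - \<epsilon>))\<^sup>2" using eps by (intro power_mono) auto
    then have "2 \<le> (2 * (1 - \<epsilon>))\<^sup>2" by (simp add: power2_eq_square)
    then have "2 * (sin d)\<^sup>2 \<le> (2 * (1 - \<epsilon>))\<^sup>2 * (sin d)\<^sup>2" by (intro mult_right_mono) auto
    then show ?thesis by (simp add: power_mult_distrib)
  qed
  moreover have "(1 + \<epsilon>) * (2 * (sin d)\<^sup>2) \<le> 2 * (2 * (sin d)\<^sup>2)" using eps by (intro mult_right_mono) auto
  ultimately have "height a c \<le> 2 * (len a c)\<^sup>2" by linarith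
  then show ?thesis by (simp add: height_def len_def G)
qed

end

context sym_curve
begin

lemma perim_le: assumes "\<And>k. k < q \<Longrightarrow> \<theta> k \<le> \<theta> (Suc k)" "\<theta> 0 = 0" "\<theta> q = 2 * pi" shows "perim q \<theta> \<le> 2 * pi"
proof -
  have "perim q \<theta> \<le> (\<Sum>k<q. s (\<theta> (Suc k)) - s (\<theta> k))" unfolding perim_def using assms(1) by (intro sum_mono len_le_arc) auto
  also have "\<dots> = s (\<theta> q) - s (\<theta> 0)" by (rule sum_lessThan_telescope)
  also have "\<dots> = 2 * pi" using pers[of 0] by (simp add: assms)
  finally show ?thesis .
qed

text \<open>Equidistant normal angles give a lower bound through \<open>len_ge_arc\<close>; with
  \<open>perim_le\<close> it squeezes \<open>maxper q\<close> to the perimeter.\<close>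

lemma regular_chain:
  assumes q: "q \<ge> 2"
  obtains h where "h \<in> half_chains q" "cos (pi / real q) * (2 * pi) \<le> perim q (full_chain q h)"
proof -
  define h where "h k = (if k \<le> (q - 1) div 2 then 2 * pi * real k / real q else 0)" for k :: nat
  have 1: "h \<in> half_chains q"
  proof -
    have "2 * real ((q - 1) div 2) \<le> real q" by linarith
    then have "2 * pi * real ((q - 1) div 2) / real q \<le> pi" using q by (simp add: field_simps)
    then show ?thesis by (auto simp: half_chains_def Let_def h_def divide_right_mono)
  qed
  have f: "full_chain q h k = 2 * pi * real k / real q" if "k \<le> q" for k
  proof -
    have "2 * k < q \<Longrightarrow> k \<le> (q - 1) div 2" "2 * k > q \<Longrightarrow> q - k \<le> (q - 1) div 2" using q by linarith+
    moreover have "2 * pi * real k / real q = pi" if "2 * k = q" using that q by auto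
    ultimately show ?thesis using that q by (auto simp: full_chain_def h_def of_nat_diff field_simps)
  qed
  define d where "d = pi / real q"
  have d: "0 \<le> d" "d \<le> pi / 2" using q by (auto simp: d_def field_simps)
  have "cos d * (2 * pi) = cos d * (s (2 * pi * real q / real q) - s (2 * pi * real 0 / real q))"
    using q pers[of 0] by simp
  also have "\<dots> = cos d * (\<Sum>k<q. s (2 * pi * real (Suc k) / real q) - s (2 * pi * real k / real q))"
    by (subst sum_lessThan_telescope) simp
  also have "\<dots> = (\<Sum>k<q. cos d * (s (2 * pi * real (Suc k) / real q) - s (2 * pi * real k / real q)))" by (rule sum_distrib_left)
  also have "\<dots> \<le> (\<Sum>k<q. len (2 * pi * real k / real q) (2 * pi * real (Suc k) / real q))"
  proof (rule sum_mono)
    fix k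
    define m where "m = 2 * pi * real k / real q + d"
    have "m - d = 2 * pi * real k / real q" "m + d = 2 * pi * real (Suc k) / real q"
      using q by (simp_all add: m_def d_def field_simps)
    then show "cos d * (s (2 * pi * real (Suc k) / real q) - s (2 * pi * real k / real q)) \<le> len (2 * pi * real k / real q) (2 * pi * real (Suc k) / real q)"
      using len_ge_arc[OF d, of m] by simp
  qed
  also have "\<dots> = perim q (full_chain q h)" unfolding perim_def by (intro sum.cong refl) (simp add: f)
  finally show thesis using that 1 by (simp add: d_def)
qed

definition maxper :: "nat \<Rightarrow> real" where
  "maxper q = Sup ((\<lambda>h. perim q (full_chain q h)) ` half_chains q)"

lemma maxper:
  assumes "q \<ge> 2"
  obtains h \<phi> where "h \<in> half_chains q" "orbit q (full_chain q h) \<phi>" "perim q (full_chain q h) = maxper q"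
    "\<And>h'. h' \<in> half_chains q \<Longrightarrow> perim q (full_chain q h') \<le> maxper q"
proof -
  obtain h \<phi> where h: "h \<in> half_chains q" "orbit q (full_chain q h) \<phi>"
    "\<And>h'. h' \<in> half_chains q \<Longrightarrow> perim q (full_chain q h') \<le> perim q (full_chain q h)"
    using ex_max_orbit[OF assms] by blast
  have "maxper q = perim q (full_chain q h)" unfolding maxper_def by (rule cSup_eq_maximum) (use h in auto)
  then show thesis using that h by metis
qed

lemma maxper_bounds: assumes "q \<ge> 2" shows "cos (pi / real q) * (2 * pi) \<le> maxper q" "maxper q \<le> 2 * pi"
proof -
  obtain h \<phi> where h: "orbit q (full_chain q h) \<phi>" "perim q (full_chain q h) = maxper q"
    "\<And>h'. h' \<in> half_chains q \<Longrightarrow> perim q (full_chain q h') \<le> maxper q" using maxper[OF assms] by blast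
  obtain h' where "h' \<in> half_chains q" "cos (pi / real q) * (2 * pi) \<le> perim q (full_chain q h')" by (rule regular_chain[OF assms])
  then show "cos (pi / real q) * (2 * pi) \<le> maxper q" using h(3) by fastforce
  show "maxper q \<le> 2 * pi" unfolding h(2)[symmetric] using h(1) by (intro perim_le) (auto simp: orbit_def less_imp_le)
qed

lemma maxper_tendsto: "maxper \<longlonglongrightarrow> 2 * pi"
proof (rule tendsto_sandwich[where f = "\<lambda>q. cos (pi / real q) * (2 * pi)" and h = "\<lambda>_. 2 * pi"])
  show "\<forall>\<^sub>F q in sequentially. cos (pi / real q) * (2 * pi) \<le> maxper q" "\<forall>\<^sub>F q in sequentially. maxper q \<le> 2 * pi"
    by (rule eventually_mono[OF eventually_ge_at_top[of 2]], erule maxper_bounds)+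
  have "(\<lambda>q. cos (pi / real q) * (2 * pi)) \<longlonglongrightarrow> cos 0 * (2 * pi)"
    by (intro tendsto_intros tendsto_divide_0[OF tendsto_const] filterlim_at_top_imp_at_infinity filterlim_real_sequentially)
  then show "(\<lambda>q. cos (pi / real q) * (2 * pi)) \<longlonglongrightarrow> 2 * pi" by simp
qed simp

text \<open>The longest orbit of one curve is tested on the other: by the first variation each
  vertex costs at most \<open>2 * \<eta>\<close>. Only the scaled support functions enter, so this
  gives continuity along a family although curves and scales are chosen separately for each
  \<open>\<tau>\<close>.\<close>

lemma maxper_diff_le:
  assumes B: "sym_curve \<sigma> \<sigma>1 \<sigma>2 \<sigma>3 \<Delta> w \<epsilon>'" and q: "q \<ge> 2" and r: "r' \<ge> 0"
    and \<eta>: "\<And>t. \<bar>r' * inner (\<Delta> t) (cis t) - r * inner (\<Gamma> t) (cis t)\<bar> \<le> \<eta>"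
  shows "r * maxper q - 2 * real q * \<eta> \<le> r' * sym_curve.maxper \<Delta> q"
proof -
  interpret B: sym_curve \<sigma> \<sigma>1 \<sigma>2 \<sigma>3 \<Delta> w \<epsilon>' by (rule B)
  obtain h \<phi> where h: "h \<in> half_chains q" "orbit q (full_chain q h) \<phi>" "perim q (full_chain q h) = maxper q" using maxper[OF q] by blast
  define \<theta> where "\<theta> = full_chain q h"
  have o: "orbit q \<theta> \<phi>" using h by (simp add: \<theta>_def)
  have cl: "of_real r' * \<Delta> (\<theta> q) = of_real r' * \<Delta> (\<theta> 0)" using o B.per\<Gamma>[of 0] by (simp add: orbit_def)
  have "(\<Sum>k<q. 2 * sin (\<phi> k) * inner (of_real r' * \<Delta> (\<theta> k)) (cis (\<theta> k))) \<le> (\<Sum>k<q. norm (of_real r' * \<Delta> (\<theta> (Suc k)) - of_real r' * \<Delta> (\<theta> k)))"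
    by (rule orbit_first_variation(1)[OF o cl])
  also have "\<dots> = r' * B.perim q \<theta>"
    using r by (simp add: B.perim_def B.len_def sum_distrib_left norm_mult flip: right_diff_distrib)
  also have "B.perim q \<theta> \<le> B.maxper q"
  proof -
    obtain h0 \<phi>0 where "\<And>h'. h' \<in> half_chains q \<Longrightarrow> B.perim q (full_chain q h') \<le> B.maxper q" using B.maxper[OF q] by blast
    then show ?thesis using h(1) by (simp add: \<theta>_def)
  qed
  finally have 1: "(\<Sum>k<q. 2 * sin (\<phi> k) * inner (of_real r' * \<Delta> (\<theta> k)) (cis (\<theta> k))) \<le> r' * B.maxper q" using r by (simp add: mult_left_mono)
  have "r * maxper q - 2 * real q * \<eta> = r * (\<Sum>k<q. 2 * sin (\<phi> k) * inner (\<Gamma> (\<theta> k)) (cis (\<theta> k))) - (\<Sum>k<q. 2 * \<eta>)"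
    using orbit_first_variation(2)[OF o, of "\<lambda>_. 0"] h(3) by (simp add: \<theta>_def)
  also have "\<dots> = (\<Sum>k<q. 2 * sin (\<phi> k) * (r * inner (\<Gamma> (\<theta> k)) (cis (\<theta> k))) - 2 * \<eta>)"
    by (simp add: sum_subtractf sum_distrib_left mult_ac)
  also have "\<dots> \<le> (\<Sum>k<q. 2 * sin (\<phi> k) * inner (of_real r' * \<Delta> (\<theta> k)) (cis (\<theta> k)))"
  proof (rule sum_mono)
    fix k
    define x where "x = r' * inner (\<Delta> (\<theta> k)) (cis (\<theta> k)) - r * inner (\<Gamma> (\<theta> k)) (cis (\<theta> k))"
    have "\<bar>sin (\<phi> k)\<bar> * \<bar>x\<bar> \<le> 1 * \<eta>" using \<eta>[of "\<theta> k"] by (intro mult_mono) (auto simp: x_def)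
    then have "- \<eta> \<le> sin (\<phi> k) * x" by (simp add: abs_mult[symmetric])
    then show "2 * sin (\<phi> k) * (r * inner (\<Gamma> (\<theta> k)) (cis (\<theta> k))) - 2 * \<eta> \<le> 2 * sin (\<phi> k) * inner (of_real r' * \<Delta> (\<theta> k)) (cis (\<theta> k))"
      by (simp add: x_def inner_of_real_mult algebra_simps)
  qed
  finally show ?thesis using 1 by linarith
qed

end

section \<open>Geodesics and length spectrum of a domain\<close>

lemma reflection_law_iff:
  assumes "c \<noteq> 0" "l > 0" "m > 0"
    and t: "t = of_real c * (\<i> * cis b)" and u: "u = of_real l * (\<i> * cis \<alpha>)" and w: "w = - (of_real m * (\<i> * cis \<beta>))"
  shows "inner u t * norm w = - (inner w t * norm u) \<longleftrightarrow> cos (\<alpha> - b) = cos (\<beta> - b)"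
proof -
  have i: "inner (of_real x * (\<i> * cis a)) (of_real y * (\<i> * cis b)) = x * y * cos (a - b)" for x y a
    by (simp add: inner_complex_def cos_diff algebra_simps)
  have "inner u t = l * c * cos (\<alpha> - b)" unfolding t u by (rule i)
  moreover have "inner w t = - (m * c * cos (\<beta> - b))" unfolding t w inner_minus_left i ..
  moreover have "norm u = l" "norm w = m" using assms by (simp_all add: u w norm_mult)
  ultimately have "inner u t * norm w = - (inner w t * norm u) \<longleftrightarrow> (l * c * m) * cos (\<alpha> - b) = (l * c * m) * cos (\<beta> - b)"
    by (simp add: mult_ac)
  then show ?thesis using assms by simp
qed

lemma orthogonal_cis:
  assumes "inner z (cis t) = 0" shows "z = of_real (inner z (\<i> * cis t)) * (\<i> * cis t)"
proof -
  have e: "inner z (cis t) = Re (z * cnj (cis t))" "inner z (\<i> * cis t) = Im (z * cnj (cis t))"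
    by (simp_all add: inner_complex_def)
  have "z * cnj (cis t) = \<i> * of_real (inner z (\<i> * cis t))" using assms e by (simp add: complex_eq_iff)
  then have "z * (cnj (cis t) * cis t) = \<i> * of_real (inner z (\<i> * cis t)) * cis t" by (simp only: mult.assoc[symmetric])
  moreover have "cnj (cis t) * cis t = 1" by (simp add: cis_cnj cis_mult)
  ultimately have "z * 1 = \<i> * of_real (inner z (\<i> * cis t)) * cis t" by (simp only:)
  then show ?thesis by (simp only: mult_1_right) (simp only: mult_ac)
qed

lemma boundary_param_range: assumes "boundary_param k \<Omega> g" shows "g x \<in> frontier \<Omega>"
proof -
  have per: "\<And>x. g (x + 1) = g x" and im: "g ` {0..1} = frontier \<Omega>" using assms by (auto simp: boundary_param_def)
  have pk: "g (x + of_int k) = g x" for x k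
  proof (induction k rule: int_induct[where k = 0])
    case (step1 i) then show ?case using per[of "x + of_int i"] by (simp add: add.assoc)
  next
    case (step2 i) then show ?case using per[of "x + of_int (i - 1)"] by (simp add: add.assoc)
  qed simp
  have "g x = g (frac x)" using pk[of "frac x" "\<lfloor>x\<rfloor>"] by (simp add: frac_def)
  moreover have "frac x \<in> {0..1}" by (simp add: frac_lt_1 less_imp_le)
  ultimately show ?thesis using im by (metis imageI)
qed

text \<open>The sign places the marked point, whose outward normal is \<open>-1\<close>, at normal
  angle 0 of \<open>\<Gamma>\<close>; the outward normal of the domain at \<open>pt t\<close> is
  \<open>- cis t\<close>.\<close>

locale boundary_curve = sym_curve +
  fixes \<Omega> :: "complex set" and R :: real
  assumes op: "open \<Omega>" and bd: "bounded \<Omega>" and R: "R > 0"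
    and fr: "frontier \<Omega> = range (\<lambda>t. - (of_real R * \<Gamma> t))"
begin

abbreviation pt where "pt t \<equiv> - (of_real R * \<Gamma> t)"

lemma inner_pt: "inner (pt b - pt a) (cis a) = R * height a b"
  by (simp add: height_def inner_diff_left inner_of_real_mult algebra_simps)

lemma inner_pt_min: "inner (pt a) (cis a) \<le> inner (pt b) (cis a)"
proof -
  have "0 \<le> inner (pt b - pt a) (cis a)" unfolding inner_pt using height_nonneg R by simp
  then show ?thesis by (simp only: inner_diff_left)
qed

text \<open>On the compact closure the linear functional attains its minimum, but not at a point of
  the open set, hence on the frontier, where \<open>pt t\<close> is minimal.\<close>

lemma support: assumes "z \<in> \<Omega>" shows "inner (z - pt t) (- cis t) < 0"
proof -
  have dec: "\<exists>y\<in>\<Omega>. inner y (cis t) < inner x (cis t)" if "x \<in> \<Omega>" for x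
  proof -
    obtain e where e: "e > 0" "ball x e \<subseteq> \<Omega>" using op \<open>x \<in> \<Omega>\<close> unfolding open_contains_ball by blast
    define y where "y = x - of_real (e / 2) * cis t"
    have "y \<in> \<Omega>" using e by (intro subsetD[OF e(2)]) (simp add: y_def dist_norm norm_mult)
    moreover have "inner y (cis t) = inner x (cis t) - e / 2"
      by (simp add: y_def inner_diff_left inner_of_real_mult inner_cis del: of_real_divide)
    ultimately show ?thesis using e by (intro bexI[of _ y]) auto
  qed
  have "compact (closure \<Omega>)" using bd by (simp add: compact_closure)
  moreover have "closure \<Omega> \<noteq> {}" using assms closure_subset by blast
  ultimately obtain m where m: "m \<in> closure \<Omega>" "\<And>y. y \<in> closure \<Omega> \<Longrightarrow> inner m (cis t) \<le> inner y (cis t)"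
    using continuous_attains_inf[of "closure \<Omega>" "\<lambda>z. inner z (cis t)"] continuous_on_inner[OF continuous_on_id continuous_on_const] by blast
  have "m \<notin> \<Omega>" using dec m(2) closure_subset by (meson in_mono not_less)
  then have "m \<in> frontier \<Omega>" using m(1) op by (simp add: frontier_def interior_open)
  then obtain b where "m = pt b" using fr by blast
  then have "inner (pt t) (cis t) \<le> inner m (cis t)" using inner_pt_min by simp
  moreover obtain y where y: "y \<in> \<Omega>" "inner y (cis t) < inner z (cis t)" using dec[OF assms] by blast
  moreover have "inner m (cis t) \<le> inner y (cis t)" using m(2) y(1) closure_subset by blast
  ultimately show ?thesis by (simp only: inner_diff_left inner_minus_right)
qed

lemma interior_nonempty: "\<Omega> \<noteq> {}"
  using fr by auto

text \<open>Uniqueness: for any candidate \<open>N\<close> the component of \<open>\<Gamma>\<close>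
  along \<open>N\<close> is minimal at \<open>t\<close>, so \<open>N\<close> is orthogonal to the
  tangent; an interior point decides the sign.\<close>

lemma outward_normal_pt: "outward_normal \<Omega> (pt t) = - cis t"
  unfolding outward_normal_def
proof (rule the_equality)
  show "norm (- cis t) = 1 \<and> (\<forall>z\<in>\<Omega>. inner (z - pt t) (- cis t) < 0)" using support by simp
next
  fix N assume N: "norm N = 1 \<and> (\<forall>z\<in>\<Omega>. inner (z - pt t) N < 0)"
  have cl: "inner (z - pt t) N \<le> 0" if "z \<in> closure \<Omega>" for z
  proof -
    have "closed {z. inner (z - pt t) N \<le> 0}" by (intro closed_Collect_le continuous_intros)
    moreover have "\<Omega> \<subseteq> {z. inner (z - pt t) N \<le> 0}" using N less_imp_le by blast
    ultimately have "closure \<Omega> \<subseteq> {z. inner (z - pt t) N \<le> 0}" by (rule closure_minimal[rotated])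
    then show ?thesis using that by blast
  qed
  have mn: "inner (\<Gamma> t) N \<le> inner (\<Gamma> x) N" for x
  proof -
    have "pt x \<in> closure \<Omega>" using fr by (auto simp: frontier_def)
    from cl[OF this] have "R * inner (\<Gamma> t) N \<le> R * inner (\<Gamma> x) N"
      by (simp add: inner_diff_left inner_of_real_mult inner_add_left)
    then show ?thesis using R by simp
  qed
  have "\<rho> t * inner (\<i> * cis t) N = 0" by (rule DERIV_local_min[OF d_inner_Gamma[of N t], of 1]) (use mn in auto)
  then have "inner (\<i> * cis t) N = 0" using rho_pos[of t] by simp
  moreover have "cis (t - pi / 2) * \<i> = cis t" by (simp add: complex_eq_iff cos_diff sin_diff)
  ultimately have "inner N (cis (t + pi / 2)) = 0" by (simp add: inner_complex_def cos_add sin_add algebra_simps)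
  from orthogonal_cis[OF this] obtain c where c: "N = of_real c * (\<i> * cis (t + pi / 2))" by blast
  moreover have "\<i> * cis (t + pi / 2) = - cis t" by (simp add: complex_eq_iff cos_add sin_add)
  ultimately have Nc: "N = - (of_real c * cis t)" by simp
  then have "\<bar>c\<bar> = 1" using N by (simp add: norm_mult)
  obtain z where z: "z \<in> \<Omega>" using interior_nonempty by blast
  have "inner (z - pt t) N = c * inner (z - pt t) (- cis t)"
    using inner_of_real_mult[of c "cis t" "z - pt t"] by (simp only: Nc inner_minus_right inner_commute[of "z - pt t"] mult_minus_right)
  moreover have "inner (z - pt t) N < 0" using N z by blast
  ultimately have "c > 0" using support[OF z, of t] by (metis less_asym mult_less_0_iff)
  then show "N = - cis t" using Nc \<open>\<bar>c\<bar> = 1\<close> by simp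
qed

text \<open>The boundary parameterization in the reflection law is arbitrary. At \<open>pt t\<close>
  the component along \<open>cis t\<close> is minimal, so the velocity is tangential;
  \<open>c\<close> may have either sign.\<close>

lemma tangent_direction:
  assumes g: "boundary_param 1 \<Omega> g" and \<xi>: "g \<xi> = pt t"
  obtains c where "c \<noteq> 0" "vector_derivative g (at \<xi>) = of_real c * (\<i> * cis t)"
proof -
  define D where "D = vector_derivative g (at \<xi>)"
  have "g differentiable (at \<xi>)" using g by (auto simp: boundary_param_def Ck_def)
  then have "(g has_vector_derivative D) (at \<xi>)" unfolding D_def using vector_derivative_works by blast
  from bounded_linear.has_vector_derivative[OF bounded_linear_inner_left this, of "cis t"]
  have "((\<lambda>x. inner (g x) (cis t)) has_real_derivative inner D (cis t)) (at \<xi>)"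
    by (simp add: has_real_derivative_iff_has_vector_derivative)
  moreover have "inner (g \<xi>) (cis t) \<le> inner (g x) (cis t)" for x
  proof -
    obtain b where "g x = pt b" using boundary_param_range[OF g, of x] fr by blast
    then show ?thesis using inner_pt_min[of t b] \<xi> by simp
  qed
  ultimately have "inner D (cis t) = 0" by (intro DERIV_local_min[of _ _ \<xi> 1]) auto
  then have "D = of_real (inner D (\<i> * cis t)) * (\<i> * cis t)" by (rule orthogonal_cis)
  moreover have "D \<noteq> 0" using g by (simp add: D_def boundary_param_def)
  ultimately show thesis using that[of "inner D (\<i> * cis t)"] unfolding D_def[symmetric] by (metis mult_zero_left of_real_0)
qed

lemma maxper_in_spectrum:
  assumes g: "boundary_param 1 \<Omega> g" and q: "q \<ge> 2"
  shows "R * maxper q \<in> length_spectrum \<Omega>"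
proof -
  obtain h \<phi> where h: "orbit q (full_chain q h) \<phi>" "perim q (full_chain q h) = maxper q" using maxper[OF q] by blast
  define \<theta> where "\<theta> = full_chain q h"
  have o: "orbit q \<theta> \<phi>" and pm: "perim q \<theta> = maxper q" using h by (simp_all add: \<theta>_def)
  have o0: "\<theta> 0 = 0" "\<theta> q = 2 * pi" "\<phi> q = \<phi> 0" using o by (auto simp: orbit_def)
  have ok: "\<theta> k < \<theta> (Suc k)" "\<theta> (Suc k) < \<theta> k + 2 * pi" "chang (\<theta> k) (\<theta> (Suc k)) - \<theta> k = \<phi> k"
    "\<theta> (Suc k) - chang (\<theta> k) (\<theta> (Suc k)) = \<phi> (Suc k)" if "k < q" for k using o that by (auto simp: orbit_def)
  define p where "p i = pt (\<theta> (i mod q))" for i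
  \<comment> \<open>\<open>\<theta> q\<close> is \<open>2 * pi\<close> while the index
    \<open>q\<close> wraps to \<open>\<theta> 0 = 0\<close>; points, reflection angles and normals
    agree all the same.\<close>
  have wrap: "\<Gamma> (\<theta> (Suc i mod q)) = \<Gamma> (\<theta> (Suc (i mod q)))" "\<phi> (Suc i mod q) = \<phi> (Suc (i mod q))"
    "cis (\<theta> (Suc i mod q)) = cis (\<theta> (Suc (i mod q)))" for i
    using o0 per\<Gamma>[of 0] q by (auto simp: mod_Suc)
  have step: "p (Suc i) - p i = - (of_real (R * len (\<theta> (i mod q)) (\<theta> (Suc (i mod q)))) * (\<i> * cis (chang (\<theta> (i mod q)) (\<theta> (Suc (i mod q))))))"
    and lpos: "len (\<theta> (i mod q)) (\<theta> (Suc (i mod q))) > 0" for i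
  proof -
    have m: "i mod q < q" using q by simp
    have "p (Suc i) - p i = - (of_real R * (\<Gamma> (\<theta> (Suc (i mod q))) - \<Gamma> (\<theta> (i mod q))))"
      by (simp add: p_def wrap algebra_simps)
    then show "p (Suc i) - p i = - (of_real (R * len (\<theta> (i mod q)) (\<theta> (Suc (i mod q)))) * (\<i> * cis (chang (\<theta> (i mod q)) (\<theta> (Suc (i mod q))))))"
      by (simp only: chord_polar(1)[OF ok(1,2)[OF m]]) (simp add: mult.assoc)
    show "len (\<theta> (i mod q)) (\<theta> (Suc (i mod q))) > 0" by (rule chord_polar(2)[OF ok(1,2)[OF m]])
  qed
  have "closed_geodesic \<Omega> q p"
    unfolding closed_geodesic_def
  proof (intro conjI allI exI[of _ g])
    fix i
    show "p (i + q) = p i" by (simp add: p_def)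
    show "p i \<in> frontier \<Omega>" by (auto simp: p_def fr)
    show "p (Suc i) \<noteq> p i" using step[of i] lpos[of i] R by auto
    define j where "j = i mod q"
    define j' where "j' = Suc i mod q"
    have jq: "j < q" "j' < q" using q by (simp_all add: j_def j'_def)
    have "p (Suc i) \<in> g ` {0..1}" using g by (auto simp: boundary_param_def p_def fr)
    then obtain \<xi> where \<xi>: "g \<xi> = p (Suc i)" by auto
    obtain c where c: "c \<noteq> 0" "vector_derivative g (at \<xi>) = of_real c * (\<i> * cis (\<theta> j'))"
      by (rule tangent_direction[OF g, of \<xi> "\<theta> j'"]) (use \<xi> in \<open>auto simp: p_def j'_def\<close>)
    have cc: "cos (chang (\<theta> j) (\<theta> (Suc j)) - \<theta> j') = cos (chang (\<theta> j') (\<theta> (Suc j')) - \<theta> j')"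
    proof -
      have e: "cos (\<theta> j') = cos (\<theta> (Suc j))" "sin (\<theta> j') = sin (\<theta> (Suc j))" using wrap(3)[of i] by (auto simp: complex_eq_iff j_def j'_def)
      have "cos (chang (\<theta> j) (\<theta> (Suc j)) - \<theta> j') = cos (chang (\<theta> j) (\<theta> (Suc j)) - \<theta> (Suc j))" by (simp add: cos_diff e)
      also have "\<dots> = cos (- \<phi> (Suc j))" using ok(4)[OF jq(1)] by (metis minus_diff_eq)
      also have "\<dots> = cos (\<phi> j')" using wrap(2)[of i] by (simp add: j_def j'_def)
      finally show ?thesis using ok(3)[OF jq(2)] by simp
    qed
    show "\<exists>\<xi>. g \<xi> = p (Suc i) \<and> (let t = vector_derivative g (at \<xi>); u = p i - p (Suc i); w = p (Suc (Suc i)) - p (Suc i)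
              in inner u t * norm w = - (inner w t * norm u))"
      unfolding Let_def
    proof (intro exI[of _ \<xi>] conjI \<xi>, rule reflection_law_iff[THEN iffD2, OF c(1) _ _ c(2) _ _ cc])
      show "p i - p (Suc i) = of_real (R * len (\<theta> j) (\<theta> (Suc j))) * (\<i> * cis (chang (\<theta> j) (\<theta> (Suc j))))"
        using step[of i] by (simp add: j_def algebra_simps)
      show "p (Suc (Suc i)) - p (Suc i) = - (of_real (R * len (\<theta> j') (\<theta> (Suc j'))) * (\<i> * cis (chang (\<theta> j') (\<theta> (Suc j')))))"
        using step[of "Suc i"] by (simp add: j'_def)
    qed (use lpos[of i] lpos[of "Suc i"] R in \<open>simp_all add: j_def j'_def\<close>)
  qed (use q g in auto)
  moreover have "geodesic_length q p = R * maxper q"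
  proof -
    have "dist (p i) (p (Suc i)) = R * len (\<theta> i) (\<theta> (Suc i))" if "i < q" for i
      using step[of i] lpos[of i] that R by (simp add: dist_norm norm_minus_commute[of "p i"] norm_mult)
    then show ?thesis by (simp add: geodesic_length_def pm[symmetric] perim_def sum_distrib_left)
  qed
  ultimately have "\<exists>q' p. closed_geodesic \<Omega> q' p \<and> R * maxper q = geodesic_length q' p" by metis
  then have "real 1 * (R * maxper q) \<in> length_spectrum \<Omega>" unfolding length_spectrum_def by blast
  then show ?thesis by simp
qed

text \<open>The angles are lifted one vertex at a time, each into the open full turn after its
  predecessor; distinctness of consecutive vertices keeps them off the ends.\<close>

lemma geodesic_lift:
  assumes "closed_geodesic \<Omega> q p"
  obtains w \<theta> where "\<And>i. \<theta> i < \<theta> (Suc i) \<and> \<theta> (Suc i) < \<theta> i + 2 * pi" "\<And>i. \<theta> (i + q) = \<theta> i + 2 * pi * of_int w"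
    "\<And>i. pb (\<theta> i) (\<theta> (Suc i)) + pa (\<theta> (Suc i)) (\<theta> (Suc (Suc i))) = 0" "\<And>i. p i = pt (\<theta> i)"
proof -
  have q: "q \<ge> 2" and per: "\<And>i. p (i + q) = p i" and pf: "\<And>i. p i \<in> frontier \<Omega>" and pd: "\<And>i. p (Suc i) \<noteq> p i"
    using assms by (auto simp: closed_geodesic_def)
  obtain g where g: "boundary_param 1 \<Omega> g" and refl: "\<And>i. \<exists>\<xi>. g \<xi> = p (Suc i) \<and>
             (let t = vector_derivative g (at \<xi>); u = p i - p (Suc i); w = p (Suc (Suc i)) - p (Suc i)
              in inner u t * norm w = - (inner w t * norm u))"
    using assms by (auto simp: closed_geodesic_def)
  have "\<exists>\<theta>. \<forall>n. p n = pt (\<theta> n) \<and> (\<theta> n < \<theta> (Suc n) \<and> \<theta> (Suc n) < \<theta> n + 2 * pi)"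
  proof (rule dependent_nat_choice)
    show "\<exists>x. p 0 = pt x" using pf[of 0] fr by blast
  next
    fix x n assume x: "p n = pt x"
    obtain b where b: "p (Suc n) = pt b" using pf[of "Suc n"] fr by blast
    obtain k where k: "x \<le> b + 2 * pi * of_int k" "b + 2 * pi * of_int k < x + 2 * pi" by (rule angle_reduce)
    have b': "p (Suc n) = pt (b + 2 * pi * of_int k)" using b by (simp add: Gamma_int)
    then have "x \<noteq> b + 2 * pi * of_int k" using pd[of n] x by metis
    then show "\<exists>y. p (Suc n) = pt y \<and> x < y \<and> y < x + 2 * pi" using b' k by (intro exI[of _ "b + 2 * pi * of_int k"]) auto
  qed
  then obtain \<theta> where \<theta>: "\<And>n. p n = pt (\<theta> n)" "\<And>n. \<theta> n < \<theta> (Suc n)" "\<And>n. \<theta> (Suc n) < \<theta> n + 2 * pi" by blast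
  have "\<exists>k::int. \<theta> (i + q) = \<theta> i + 2 * pi * of_int k" for i
  proof -
    have "\<Gamma> (\<theta> i) = \<Gamma> (\<theta> (i + q))" using per[of i] \<theta>(1)[of i] \<theta>(1)[of "i + q"] R by simp
    then show ?thesis using Gamma_eq_imp by metis
  qed
  then obtain W :: "nat \<Rightarrow> int" where W: "\<And>i. \<theta> (i + q) = \<theta> i + 2 * pi * of_int (W i)" by metis
  \<comment> \<open>Gaps lie strictly between 0 and \<open>2 * pi\<close>, so two gaps that differ
    by a multiple of \<open>2 * pi\<close> are equal, and the winding number does not depend on
    \<open>i\<close>.\<close>
  have WS: "W (Suc i) = W i" for i
  proof -
    define d where "d = W (Suc i) - W i"
    have "2 * pi * of_int d = (\<theta> (Suc (i + q)) - \<theta> (i + q)) - (\<theta> (Suc i) - \<theta> i)"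
      using W[of i] W[of "Suc i"] by (simp add: d_def algebra_simps)
    then have "2 * pi * of_int d < 2 * pi * 1" "2 * pi * (-1) < 2 * pi * of_int d"
      using \<theta>(2,3)[of i] \<theta>(2,3)[of "i + q"] by linarith+
    then have "of_int d < (1::real)" "(-1::real) < of_int d" using mult_less_cancel_left_pos[of "2 * pi"] pi_gt_zero by fastforce+
    then have "d = 0" by linarith
    then show ?thesis by (simp add: d_def)
  qed
  have W0: "W i = W 0" for i by (induction i) (simp_all add: WS)
  show thesis
  proof (rule that[of \<theta> "W 0"])
    fix i
    show "\<theta> i < \<theta> (Suc i) \<and> \<theta> (Suc i) < \<theta> i + 2 * pi" "p i = pt (\<theta> i)" using \<theta> by auto
    show "\<theta> (i + q) = \<theta> i + 2 * pi * of_int (W 0)" using W[of i] W0[of i] by simp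
    obtain \<xi> where \<xi>: "g \<xi> = p (Suc i)" and rl: "inner (p i - p (Suc i)) (vector_derivative g (at \<xi>)) * norm (p (Suc (Suc i)) - p (Suc i))
        = - (inner (p (Suc (Suc i)) - p (Suc i)) (vector_derivative g (at \<xi>)) * norm (p i - p (Suc i)))"
      using refl[of i] unfolding Let_def by blast
    obtain c where c: "c \<noteq> 0" "vector_derivative g (at \<xi>) = of_real c * (\<i> * cis (\<theta> (Suc i)))"
      by (rule tangent_direction[OF g, of \<xi> "\<theta> (Suc i)"]) (use \<xi> \<theta>(1)[of "Suc i"] in auto)
    have st: "p (Suc k) - p k = - (of_real (R * len (\<theta> k) (\<theta> (Suc k))) * (\<i> * cis (chang (\<theta> k) (\<theta> (Suc k)))))" for k
    proof -
      have "p (Suc k) - p k = - (of_real R * (\<Gamma> (\<theta> (Suc k)) - \<Gamma> (\<theta> k)))" by (simp add: \<theta>(1) algebra_simps)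
      then show ?thesis by (simp only: chord_polar(1)[OF \<theta>(2,3)[of k]]) (simp add: mult.assoc)
    qed
    have "cos (chang (\<theta> i) (\<theta> (Suc i)) - \<theta> (Suc i)) = cos (chang (\<theta> (Suc i)) (\<theta> (Suc (Suc i))) - \<theta> (Suc i))"
    proof (rule reflection_law_iff[THEN iffD1, OF c(1) _ _ c(2) _ _ rl])
      show "p i - p (Suc i) = of_real (R * len (\<theta> i) (\<theta> (Suc i))) * (\<i> * cis (chang (\<theta> i) (\<theta> (Suc i))))"
        using st[of i] by (simp add: algebra_simps)
      show "p (Suc (Suc i)) - p (Suc i) = - (of_real (R * len (\<theta> (Suc i)) (\<theta> (Suc (Suc i)))) * (\<i> * cis (chang (\<theta> (Suc i)) (\<theta> (Suc (Suc i))))))"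
        by (rule st)
    qed (use R chord_polar(2)[OF \<theta>(2,3)] in auto)
    then show "pb (\<theta> i) (\<theta> (Suc i)) + pa (\<theta> (Suc i)) (\<theta> (Suc (Suc i))) = 0"
      using pa_pb_cos(2)[OF \<theta>(2,3)[of i]] pa_pb_cos(1)[OF \<theta>(2,3)[of "Suc i"]]
        cos_minus[of "\<theta> (Suc i) - chang (\<theta> i) (\<theta> (Suc i))"] by simp
  qed
qed

text \<open>Integer multiples form a countable union of scaled null sets; the multiples of the
  boundary length are countable.\<close>

lemma negligible_spectrum: "negligible (length_spectrum \<Omega>)"
proof -
  define S where "S = {l. \<exists>q w \<theta>. q \<ge> 1 \<and> (\<forall>i. \<theta> i < \<theta> (Suc i) \<and> \<theta> (Suc i) < \<theta> i + 2 * pi) \<and>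
      (\<forall>i. \<theta> (i + q) = \<theta> i + 2 * pi * of_int w) \<and>
      (\<forall>i. pb (\<theta> i) (\<theta> (Suc i)) + pa (\<theta> (Suc i)) (\<theta> (Suc (Suc i))) = 0) \<and>
      l = (\<Sum>i<q. len (\<theta> i) (\<theta> (Suc i)))}"
  have S: "negligible S" unfolding S_def by (rule negligible_periodic_lengths)
  have sc: "negligible ((\<lambda>l. c * l) ` S)" for c :: real
    by (rule negligible_differentiable_image_negligible) (auto simp: S intro!: derivative_intros)
  have gl: "\<exists>l'\<in>S. l = R * l'" if cg: "closed_geodesic \<Omega> q p" and lq: "l = geodesic_length q p" for q p l
  proof -
    obtain w \<theta> where t: "\<And>i. \<theta> i < \<theta> (Suc i) \<and> \<theta> (Suc i) < \<theta> i + 2 * pi" "\<And>i. \<theta> (i + q) = \<theta> i + 2 * pi * of_int w"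
      "\<And>i. pb (\<theta> i) (\<theta> (Suc i)) + pa (\<theta> (Suc i)) (\<theta> (Suc (Suc i))) = 0" "\<And>i. p i = pt (\<theta> i)"
      by (rule geodesic_lift[OF cg]) (rule that)
    have "(\<Sum>i<q. len (\<theta> i) (\<theta> (Suc i))) \<in> S"
      unfolding S_def mem_Collect_eq
      by (rule exI[of _ q], rule exI[of _ w], rule exI[of _ \<theta>]) (use t(1-3) cg in \<open>simp add: closed_geodesic_def\<close>)
    moreover have "dist (p i) (p (Suc i)) = R * len (\<theta> i) (\<theta> (Suc i))" for i
    proof -
      have "p i - p (Suc i) = of_real R * (\<Gamma> (\<theta> (Suc i)) - \<Gamma> (\<theta> i))" by (simp add: t(4) algebra_simps)
      then show ?thesis using R by (simp add: dist_norm norm_mult len_def)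
    qed
    then have "l = R * (\<Sum>i<q. len (\<theta> i) (\<theta> (Suc i)))" by (simp add: lq geodesic_length_def sum_distrib_left)
    ultimately show ?thesis by blast
  qed
  have "length_spectrum \<Omega> \<subseteq> (\<Union>k::nat. (\<lambda>l. (real k * R) * l) ` S) \<union> range (\<lambda>k::nat. real k * boundary_length \<Omega>)"
  proof
    fix x assume "x \<in> length_spectrum \<Omega>"
    then consider k q p where "x = real k * geodesic_length q p" "closed_geodesic \<Omega> q p" | k where "x = real k * boundary_length \<Omega>"
      by (auto simp: length_spectrum_def)
    then show "x \<in> (\<Union>k::nat. (\<lambda>l. (real k * R) * l) ` S) \<union> range (\<lambda>k::nat. real k * boundary_length \<Omega>)"
    proof cases
      case (1 k q p)
      then obtain l where l: "l \<in> S" "geodesic_length q p = R * l" using gl by blast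
      then have "x = (real k * R) * l" using 1 by simp
      then show ?thesis using l(1) by blast
    qed blast
  qed
  moreover have "negligible (\<Union>k::nat. (\<lambda>l. (real k * R) * l) ` S)" by (rule negligible_countable_Union) (auto intro: sc)
  moreover have "negligible (range (\<lambda>k::nat. real k * boundary_length \<Omega>))" by (simp add: negligible_iff_null_sets null_sets_completionI countable_imp_null_set_lborel)
  ultimately show ?thesis by (meson negligible_Un negligible_subset)
qed

end

section \<open>Isospectral families\<close>

lemma continuous_negligible_range_constant:
  fixes f :: "real \<Rightarrow> real"
  assumes "continuous_on {a..b} f" "negligible (f ` {a..b})" "x \<in> {a..b}" "y \<in> {a..b}"
  shows "f x = f y"
proof (rule ccontr)
  assume ne: "f x \<noteq> f y"
  have "connected (f ` {a..b})" using assms(1) by (rule connected_continuous_image) simp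
  then have sub: "{min (f x) (f y)..max (f x) (f y)} \<subseteq> f ` {a..b}"
    using assms(3,4) by (intro connected_contains_Icc) (auto simp: min_def max_def)
  then have "negligible (cbox (min (f x) (f y)) (max (f x) (f y)))" using assms(2) negligible_subset by auto
  then have "box (min (f x) (f y)) (max (f x) (f y)) = {}" unfolding negligible_interval .
  then show False using ne by (auto simp: min_def max_def split: if_splits)
qed

text \<open>The difference quotient of \<open>f\<close> is dominated by that of \<open>K\<close>
  times the squared displacement, whose derivative at \<open>x\<close> vanishes.\<close>

lemma derivative_zero_of_quadratic_bound:
  fixes f :: "real \<Rightarrow> real" and y :: "real \<Rightarrow> complex"
  assumes x: "x \<in> {a..b}" "a < b" and f: "(f has_real_derivative m) (at x within {a..b})" and fx: "f x = 0"
    and y: "(y has_vector_derivative D) (at x within {a..b})"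
    and b: "\<And>t. t \<in> {a..b} \<Longrightarrow> \<bar>f t\<bar> \<le> K * (norm (y t - y x))\<^sup>2"
  shows "m = 0"
proof -
  have "((\<lambda>t. y t - y x) has_vector_derivative D - 0) (at x within {a..b})" by (intro has_vector_derivative_diff y has_vector_derivative_const)
  then have y': "((\<lambda>t. y t - y x) has_vector_derivative D) (at x within {a..b})" by simp
  from bounded_bilinear.has_vector_derivative[OF bounded_bilinear_inner this this]
  have "((\<lambda>t. inner (y t - y x) (y t - y x)) has_real_derivative 0) (at x within {a..b})"
    by (simp add: has_real_derivative_iff_has_vector_derivative)
  then have "((\<lambda>t. (norm (y t - y x))\<^sup>2) has_real_derivative 0) (at x within {a..b})" by (simp add: dot_square_norm)
  from DERIV_cmult[OF this, of K]
  have "((\<lambda>t. K * (norm (y t - y x))\<^sup>2 / (t - x)) \<longlongrightarrow> 0) (at x within {a..b})" by (simp add: has_field_derivative_iff)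
  then have lim: "((\<lambda>t. \<bar>K * (norm (y t - y x))\<^sup>2 / (t - x)\<bar>) \<longlongrightarrow> 0) (at x within {a..b})" by (rule tendsto_rabs_zero)
  have "((\<lambda>t. f t / (t - x)) \<longlongrightarrow> 0) (at x within {a..b})"
  proof (rule Lim_null_comparison[OF _ lim])
    show "\<forall>\<^sub>F t in at x within {a..b}. norm (f t / (t - x)) \<le> \<bar>K * (norm (y t - y x))\<^sup>2 / (t - x)\<bar>"
      unfolding eventually_at_filter
    proof (rule always_eventually, intro allI impI)
      fix t assume "t \<in> {a..b}"
      then have "\<bar>f t\<bar> \<le> \<bar>K * (norm (y t - y x))\<^sup>2\<bar>" using b[of t] by linarith
      then show "norm (f t / (t - x)) \<le> \<bar>K * (norm (y t - y x))\<^sup>2 / (t - x)\<bar>"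
        unfolding real_norm_def abs_divide by (rule divide_right_mono) simp
    qed
  qed
  moreover have "((\<lambda>t. f t / (t - x)) \<longlongrightarrow> m) (at x within {a..b})" using f fx by (simp add: has_field_derivative_iff)
  moreover have "at x within {a..b} \<noteq> bot" using x by (simp add: at_within_Icc_at trivial_limit_within islimpt_Icc)
  ultimately show ?thesis using tendsto_unique by blast
qed

lemma C1_family_lipschitz:
  assumes "C1_family r \<Omega> \<gamma>"
  obtains M where "M \<ge> 0" "\<And>\<tau> \<tau>' \<xi>. \<tau> \<in> {-1..1} \<Longrightarrow> \<tau>' \<in> {-1..1} \<Longrightarrow> \<xi> \<in> {0..1} \<Longrightarrow> norm (\<gamma> \<tau> \<xi> - \<gamma> \<tau>' \<xi>) \<le> M * \<bar>\<tau> - \<tau>'\<bar>"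
proof -
  have d: "\<And>\<tau> \<xi>. \<tau> \<in> {-1..1} \<Longrightarrow> ((\<lambda>t. \<gamma> t \<xi>) has_vector_derivative dtau \<gamma> \<tau> \<xi>) (at \<tau> within {-1..1})"
    and c: "continuous_on ({-1..1} \<times> UNIV) (\<lambda>(\<tau>, \<xi>). dtau \<gamma> \<tau> \<xi>)"
    using assms by (auto simp: C1_family_def)
  have "compact ((\<lambda>(\<tau>, \<xi>). dtau \<gamma> \<tau> \<xi>) ` ({-1..1} \<times> {0..1}))"
    by (rule compact_continuous_image[OF continuous_on_subset[OF c]]) (auto intro: compact_Times)
  then obtain M where M: "M > 0" "\<And>z. z \<in> (\<lambda>(\<tau>, \<xi>). dtau \<gamma> \<tau> \<xi>) ` ({-1..1} \<times> {0..1}) \<Longrightarrow> norm z \<le> M"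
    using compact_imp_bounded bounded_pos by metis
  have "norm (\<gamma> \<tau> \<xi> - \<gamma> \<tau>' \<xi>) \<le> M * \<bar>\<tau> - \<tau>'\<bar>" if t: "\<tau> \<in> {-1..1}" "\<tau>' \<in> {-1..1}" "\<xi> \<in> {0..1}" for \<tau> \<tau>' \<xi>
  proof -
    have "norm ((\<lambda>t. \<gamma> t \<xi>) \<tau> - (\<lambda>t. \<gamma> t \<xi>) \<tau>') \<le> M * norm (\<tau> - \<tau>')"
    proof (rule differentiable_bound[where S = "{-1..1}" and f' = "\<lambda>x h. h *\<^sub>R dtau \<gamma> x \<xi>"])
      fix x :: real assume x: "x \<in> {-1..1}"
      show "((\<lambda>t. \<gamma> t \<xi>) has_derivative (\<lambda>h. h *\<^sub>R dtau \<gamma> x \<xi>)) (at x within {-1..1})"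
        using d[OF x, of \<xi>] by (simp add: has_vector_derivative_def)
      have "norm (dtau \<gamma> x \<xi>) \<le> M" using x t(3) by (intro M(2)) auto
      then show "onorm (\<lambda>h. h *\<^sub>R dtau \<gamma> x \<xi>) \<le> M"
        by (intro onorm_le) (simp add: mult.commute[of M] mult_left_mono)
    qed (use t in auto)
    then show ?thesis by simp
  qed
  then show thesis using that[of M] M(1) by simp
qed

text \<open>Boundary points with the same parameter are \<open>\<eta>\<close>-close, so the minima
  of a linear functional of norm 1 differ by at most \<open>\<eta>\<close>. The one-sided estimate
  is stated for arbitrary data so that it can be used in both directions.\<close>

lemma support_function_close:
  assumes A: "boundary_curve \<rho> \<rho>1 \<rho>2 \<rho>3 \<Gamma> s \<epsilon> \<Omega> R" and B: "boundary_curve \<sigma> \<sigma>1 \<sigma>2 \<sigma>3 \<Delta> w \<epsilon> \<Omega>' R'"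
    and g: "f ` {0..1} = frontier \<Omega>" "g ` {0..1} = frontier \<Omega>'" and \<eta>: "\<And>\<xi>::real. \<xi> \<in> {0..1} \<Longrightarrow> norm (f \<xi> - g \<xi>) \<le> \<eta>"
  shows "\<bar>R' * inner (\<Delta> t) (cis t) - R * inner (\<Gamma> t) (cis t)\<bar> \<le> \<eta>"
proof -
  have one: "R * inner (\<Gamma> t) (cis t) \<le> R' * inner (\<Delta> t) (cis t) + \<eta>"
    if A: "boundary_curve \<rho> \<rho>1 \<rho>2 \<rho>3 \<Gamma> s \<epsilon> \<Omega> R" and B: "boundary_curve \<sigma> \<sigma>1 \<sigma>2 \<sigma>3 \<Delta> w \<epsilon> \<Omega>' R'"
      and g: "f ` {0..1} = frontier \<Omega>" "g ` {0..1} = frontier \<Omega>'" and \<eta>: "\<And>\<xi>::real. \<xi> \<in> {0..1} \<Longrightarrow> norm (f \<xi> - g \<xi>) \<le> \<eta>"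
    for \<rho> \<rho>1 \<rho>2 \<rho>3 \<Gamma> s \<Omega> R \<sigma> \<sigma>1 \<sigma>2 \<sigma>3 \<Delta> w \<Omega>' R' f g
  proof -
    interpret A: boundary_curve \<rho> \<rho>1 \<rho>2 \<rho>3 \<Gamma> s \<epsilon> \<Omega> R by (rule A)
    interpret B: boundary_curve \<sigma> \<sigma>1 \<sigma>2 \<sigma>3 \<Delta> w \<epsilon> \<Omega>' R' by (rule B)
    have "A.pt t \<in> f ` {0..1}" using g(1) A.fr by blast
    then obtain \<xi> where \<xi>: "\<xi> \<in> {0..1}" "f \<xi> = A.pt t" by auto
    have "g \<xi> \<in> frontier \<Omega>'" using g(2) \<xi>(1) by blast
    then obtain b where b: "g \<xi> = B.pt b" using B.fr by blast
    have "inner (B.pt t) (cis t) \<le> inner (g \<xi>) (cis t)" unfolding b by (rule B.inner_pt_min)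
    moreover have "inner (g \<xi> - f \<xi>) (cis t) \<le> \<eta>"
      using norm_cauchy_schwarz[of "g \<xi> - f \<xi>" "cis t"] \<eta>[OF \<xi>(1)] by (simp add: norm_minus_commute)
    ultimately show ?thesis by (simp add: \<xi>(2) inner_diff_left inner_of_real_mult inner_add_left)
  qed
  from one[OF A B g \<eta>] one[OF B A g(2,1)] \<eta> show ?thesis by (fastforce simp: norm_minus_commute abs_le_iff)
qed

lemma equal_scaled_maxper_imp_eq:
  assumes A: "sym_curve \<rho> \<rho>1 \<rho>2 \<rho>3 \<Gamma> s \<epsilon>" and B: "sym_curve \<sigma> \<sigma>1 \<sigma>2 \<sigma>3 \<Delta> w \<epsilon>" and eps: "\<epsilon> \<le> 1 / 10 ^ 20" and R: "R > 0"
    and eq: "\<And>q. q \<ge> 2 \<Longrightarrow> R * sym_curve.maxper \<Gamma> q = R' * sym_curve.maxper \<Delta> q"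
  shows "R' = R" "\<Delta> = \<Gamma>"
proof -
  interpret two_curves \<rho> \<rho>1 \<rho>2 \<rho>3 \<Gamma> s \<sigma> \<sigma>1 \<sigma>2 \<sigma>3 \<Delta> w \<epsilon> by (intro two_curves.intro A B)
  have LA: "(\<lambda>q. R * A.maxper q) \<longlonglongrightarrow> R * (2 * pi)" by (intro tendsto_intros A.maxper_tendsto)
  have LB: "(\<lambda>q. R' * B.maxper q) \<longlonglongrightarrow> R' * (2 * pi)" by (intro tendsto_intros B.maxper_tendsto)
  have ev: "\<forall>\<^sub>F q in sequentially. R * A.maxper q = R' * B.maxper q"
    by (rule eventually_mono[OF eventually_ge_at_top[of 2]], erule eq)
  have "R' * (2 * pi) = R * (2 * pi)" by (rule LIMSEQ_unique[OF LB tendsto_cong[OF ev, THEN iffD1, OF LA]])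
  then show RR: "R' = R" by simp
  show "\<Delta> = \<Gamma>"
  proof (rule ext, rule equal_max_perims_imp_eq[OF eps])
    fix q :: nat assume q: "q \<ge> 2"
    have m: "A.maxper q = B.maxper q" using eq[OF q] RR R by simp
    obtain h \<phi> where h: "h \<in> half_chains q" "A.orbit q (full_chain q h) \<phi>" "A.perim q (full_chain q h) = A.maxper q"
      "\<And>h'. h' \<in> half_chains q \<Longrightarrow> A.perim q (full_chain q h') \<le> A.maxper q" using A.maxper[OF q] by blast
    obtain h' \<phi>' where h': "h' \<in> half_chains q" "B.orbit q (full_chain q h') \<phi>'" "B.perim q (full_chain q h') = B.maxper q"
      "\<And>h. h \<in> half_chains q \<Longrightarrow> B.perim q (full_chain q h) \<le> B.maxper q" using B.maxper[OF q] by blast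
    \<comment> \<open>The maximiser of one curve is a competitor for the other, and both maxima are
      equal.\<close>
    have "B.perim q (full_chain q h) \<le> A.perim q (full_chain q h)" using h'(4)[OF h(1)] h(3) m by simp
    moreover have "A.perim q (full_chain q h') \<le> B.perim q (full_chain q h')" using h(4)[OF h'(1)] h'(3) m by simp
    ultimately show "\<exists>\<theta> \<phi> \<theta>' \<phi>'. A.orbit q \<theta> \<phi> \<and> B.orbit q \<theta>' \<phi>' \<and> B.perim q \<theta> \<le> A.perim q \<theta> \<and> A.perim q \<theta>' \<le> B.perim q \<theta>'"
      using h(2) h'(2) by blast
  qed
qed

text \<open>On a fixed boundary the distance of the moving point from the tangent line is at most
  quadratic in its displacement, so the normal velocity vanishes; the one-sided derivatives at the
  ends of the interval are included.\<close>

lemma (in boundary_curve) constant_boundary_deformation: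
  assumes d: "\<And>\<tau>. \<tau> \<in> {-1..1} \<Longrightarrow> ((\<lambda>t. \<gamma> t \<xi>) has_vector_derivative dtau \<gamma> \<tau> \<xi>) (at \<tau> within {-1..1})"
    and b: "\<And>\<tau>. \<tau> \<in> {-1..1} \<Longrightarrow> \<gamma> \<tau> \<xi> \<in> frontier \<Omega>" and \<tau>: "\<tau> \<in> {-1..1}"
  shows "inner (dtau \<gamma> \<tau> \<xi>) (outward_normal \<Omega> (\<gamma> \<tau> \<xi>)) = 0"
proof -
  obtain a where a: "\<gamma> \<tau> \<xi> = pt a" using b[OF \<tau>] fr by blast
  have "((\<lambda>t. inner (\<gamma> t \<xi>) (cis a) - inner (pt a) (cis a)) has_real_derivative inner (dtau \<gamma> \<tau> \<xi>) (cis a) - 0) (at \<tau> within {-1..1})"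
    using bounded_linear.has_vector_derivative[OF bounded_linear_inner_left d[OF \<tau>], of "cis a"]
    by (intro DERIV_diff DERIV_const) (simp add: has_real_derivative_iff_has_vector_derivative)
  then have f: "((\<lambda>t. inner (\<gamma> t \<xi> - pt a) (cis a)) has_real_derivative inner (dtau \<gamma> \<tau> \<xi>) (cis a)) (at \<tau> within {-1..1})"
    by (simp only: inner_diff_left diff_zero)
  have "inner (dtau \<gamma> \<tau> \<xi>) (cis a) = 0"
  proof (rule derivative_zero_of_quadratic_bound[OF \<tau> _ f _ d[OF \<tau>]])
    fix t :: real assume "t \<in> {-1..1}"
    then obtain c where c: "\<gamma> t \<xi> = pt c" using b fr by blast
    have "inner (pt c - pt a) (cis a) = R * height a c" by (rule inner_pt)
    moreover have "R * height a c \<le> R * (2 * (len a c)\<^sup>2)" using R by (intro mult_left_mono height_le_len_sq) auto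
    moreover have "norm (pt c - pt a) = R * len a c"
    proof -
      have "pt c - pt a = - (of_real R * (\<Gamma> c - \<Gamma> a))" by (simp add: algebra_simps)
      then show ?thesis using R by (simp only: norm_minus_cancel norm_mult len_def) simp
    qed
    moreover have "(2 / R) * (R * len a c)\<^sup>2 = R * (2 * (len a c)\<^sup>2)" using R by (simp add: power2_eq_square)
    moreover have "R * height a c \<ge> 0" using R height_nonneg by simp
    ultimately show "\<bar>inner (\<gamma> t \<xi> - pt a) (cis a)\<bar> \<le> (2 / R) * (norm (\<gamma> t \<xi> - \<gamma> \<tau> \<xi>))\<^sup>2" unfolding a c by simp
  qed (use a in auto)
  then show ?thesis unfolding a outward_normal_pt by simp
qed

text \<open>What is continuous in \<open>\<tau>\<close> is \<open>L q\<close>, the maximal length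
  for the unscaled domain. Once it is constant for every \<open>q\<close>, all curves and scales
  equal those at \<open>\<tau> = 0\<close>, so one curve describes the frontier of every
  domain.\<close>

lemma isospectral_family_frontier:
  assumes fam: "C1_family 8 \<Omega> \<gamma>" and nrm: "normalized \<Omega> \<gamma>" and iso: "dyn_isospectral \<Omega>"
    and S: "\<And>\<tau>. \<tau> \<in> {-1..1} \<Longrightarrow> S_delta 8 \<delta> (\<Omega> \<tau>)" and \<delta>: "0 < \<delta>" "100 * \<delta> \<le> 1 / 10 ^ 20"
  shows "\<exists>\<rho> \<rho>1 \<rho>2 \<rho>3 \<Gamma> s R. \<forall>\<tau>\<in>{-1..1}. boundary_curve \<rho> \<rho>1 \<rho>2 \<rho>3 \<Gamma> s (1 / 10 ^ 20) (\<Omega> \<tau>) R"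
proof -
  define \<epsilon> :: real where "\<epsilon> = 1 / 10 ^ 20"
  have bp: "boundary_param 9 (\<Omega> \<tau>) (\<gamma> \<tau>)" and dom: "domain_D 8 (\<Omega> \<tau>)" if "\<tau> \<in> {-1..1}" for \<tau>
    using fam that by (auto simp: C1_family_def)
  have im: "\<gamma> \<tau> ` {0..1} = frontier (\<Omega> \<tau>)" if "\<tau> \<in> {-1..1}" for \<tau> using bp[OF that] by (simp add: boundary_param_def)
  have bp1: "boundary_param 1 (\<Omega> \<tau>) (\<gamma> \<tau>)" if "\<tau> \<in> {-1..1}" for \<tau>
  proof -
    have ck: "Ck 9 (\<gamma> \<tau>)" using bp[OF that] by (simp add: boundary_param_def)
    then have "vderiv_iter 1 (\<gamma> \<tau>) differentiable at x" for x unfolding Ck_def by (meson one_less_numeral_iff semiring_norm(77))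
    then have "continuous_on UNIV (vderiv_iter 1 (\<gamma> \<tau>))"
      by (intro continuous_at_imp_continuous_on ballI differentiable_imp_continuous_within) simp
    moreover have "vderiv_iter 0 (\<gamma> \<tau>) differentiable at x" for x using ck unfolding Ck_def by (meson zero_less_numeral)
    ultimately have "Ck 1 (\<gamma> \<tau>)" by (auto simp: Ck_def)
    then show ?thesis using bp[OF that] by (simp add: boundary_param_def)
  qed
  have "\<exists>\<rho> \<rho>1 \<rho>2 \<rho>3 \<Gamma> s R. boundary_curve \<rho> \<rho>1 \<rho>2 \<rho>3 \<Gamma> s \<epsilon> (\<Omega> \<tau>) R" if t: "\<tau> \<in> {-1..1}" for \<tau>
  proof -
    obtain x where x: "x > 0" "complex_of_real x \<in> frontier (\<Omega> \<tau>)" and c: "cnj ` \<Omega> \<tau> = \<Omega> \<tau>" and z: "\<gamma> \<tau> 0 = 0"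
      using nrm t unfolding normalized_def by blast
    have "0 \<in> frontier (\<Omega> \<tau>)" using boundary_param_range[OF bp[OF t], of 0] z by simp
    from domain_curve[OF S[OF t] c this x(2,1) \<delta>(1), of \<epsilon>]
    obtain \<rho> \<rho>1 \<rho>2 \<rho>3 \<Gamma> s R where "sym_curve \<rho> \<rho>1 \<rho>2 \<rho>3 \<Gamma> s \<epsilon>" "R > 0" "frontier (\<Omega> \<tau>) = range (\<lambda>t. - (of_real R * \<Gamma> t))"
      using \<delta>(2) by (auto simp: \<epsilon>_def)
    then have "boundary_curve \<rho> \<rho>1 \<rho>2 \<rho>3 \<Gamma> s \<epsilon> (\<Omega> \<tau>) R"
      using dom[OF t] by (intro boundary_curve.intro boundary_curve_axioms.intro) (auto simp: domain_D_def)
    then show ?thesis by blast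
  qed
  then obtain \<rho> \<rho>1 \<rho>2 \<rho>3 \<Gamma> s R where bc:
    "\<And>\<tau>. \<tau> \<in> {-1..1} \<Longrightarrow> boundary_curve (\<rho> \<tau>) (\<rho>1 \<tau>) (\<rho>2 \<tau>) (\<rho>3 \<tau>) (\<Gamma> \<tau>) (s \<tau>) \<epsilon> (\<Omega> \<tau>) (R \<tau>)" by metis
  have sc: "sym_curve (\<rho> \<tau>) (\<rho>1 \<tau>) (\<rho>2 \<tau>) (\<rho>3 \<tau>) (\<Gamma> \<tau>) (s \<tau>) \<epsilon>" if "\<tau> \<in> {-1..1}" for \<tau>
    using bc[OF that] by (rule boundary_curve.axioms(1))
  have Rp: "R \<tau> > 0" if "\<tau> \<in> {-1..1}" for \<tau> using boundary_curve.R[OF bc[OF that]] .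
  obtain M where M: "M \<ge> 0" "\<And>\<tau> \<tau>' \<xi>. \<tau> \<in> {-1..1} \<Longrightarrow> \<tau>' \<in> {-1..1} \<Longrightarrow> \<xi> \<in> {0..1} \<Longrightarrow> norm (\<gamma> \<tau> \<xi> - \<gamma> \<tau>' \<xi>) \<le> M * \<bar>\<tau> - \<tau>'\<bar>"
    by (rule C1_family_lipschitz[OF fam]) (rule that)
  define L where "L q \<tau> = R \<tau> * sym_curve.maxper (\<Gamma> \<tau>) q" for q \<tau>
  have Lconst: "L q \<tau> = L q 0" if q: "q \<ge> 2" and t: "\<tau> \<in> {-1..1}" for q \<tau>
  proof (rule continuous_negligible_range_constant[of "-1" 1 "L q"])
    have le: "L q \<tau> - 2 * real q * (M * \<bar>\<tau> - \<tau>'\<bar>) \<le> L q \<tau>'" if tt: "\<tau> \<in> {-1..1}" "\<tau>' \<in> {-1..1}" for \<tau> \<tau>'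
      unfolding L_def
      by (rule sym_curve.maxper_diff_le[OF sc[OF tt(1)] sc[OF tt(2)] q less_imp_le[OF Rp[OF tt(2)]]],
          rule support_function_close[OF bc[OF tt(1)] bc[OF tt(2)] im[OF tt(1)] im[OF tt(2)]], rule M(2)[OF tt])
    have "\<bar>L q \<tau> - L q \<tau>'\<bar> \<le> (2 * real q * M) * \<bar>\<tau> - \<tau>'\<bar>" if "\<tau> \<in> {-1..1}" "\<tau>' \<in> {-1..1}" for \<tau> \<tau>'
      using le[OF that] le[OF that(2,1)] by (simp add: abs_minus_commute[of \<tau>'] abs_le_iff mult.assoc)
    then have "(2 * real q * M)-lipschitz_on {-1..1} (L q)" using M(1) by (intro lipschitz_onI) (auto simp: dist_real_def)
    then show "continuous_on {-1..1} (L q)" by (rule lipschitz_on_continuous_on)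
    have "L q \<tau> \<in> length_spectrum (\<Omega> 0)" if tt: "\<tau> \<in> {-1..1}" for \<tau>
    proof -
      have "L q \<tau> \<in> length_spectrum (\<Omega> \<tau>)" unfolding L_def by (rule boundary_curve.maxper_in_spectrum[OF bc[OF tt] bp1[OF tt] q])
      then show ?thesis using iso tt unfolding dyn_isospectral_def by blast
    qed
    moreover have "negligible (length_spectrum (\<Omega> 0))" by (rule boundary_curve.negligible_spectrum[OF bc]) simp
    ultimately show "negligible (L q ` {-1..1})" by (meson image_subsetI negligible_subset)
  qed (use t in auto)
  have eq: "R \<tau> = R 0" "\<Gamma> \<tau> = \<Gamma> 0" if t: "\<tau> \<in> {-1..1}" for \<tau>
  proof -
    have z: "(0::real) \<in> {-1..1}" and e: "\<epsilon> \<le> 1 / 10 ^ 20" by (simp_all add: \<epsilon>_def)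
    have "R 0 * sym_curve.maxper (\<Gamma> 0) q = R \<tau> * sym_curve.maxper (\<Gamma> \<tau>) q" if "q \<ge> 2" for q
      using Lconst[OF that t] by (simp add: L_def)
    from equal_scaled_maxper_imp_eq[OF sc[OF z] sc[OF t] e Rp[OF z] this] show "R \<tau> = R 0" "\<Gamma> \<tau> = \<Gamma> 0" by blast+
  qed
  have "boundary_curve (\<rho> 0) (\<rho>1 0) (\<rho>2 0) (\<rho>3 0) (\<Gamma> 0) (s 0) \<epsilon> (\<Omega> \<tau>) (R 0)" if t: "\<tau> \<in> {-1..1}" for \<tau>
  proof (intro boundary_curve.intro boundary_curve_axioms.intro)
    show "sym_curve (\<rho> 0) (\<rho>1 0) (\<rho>2 0) (\<rho>3 0) (\<Gamma> 0) (s 0) \<epsilon>" by (rule sc) simp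
    show "open (\<Omega> \<tau>)" "bounded (\<Omega> \<tau>)" "0 < R 0" using dom[OF t] Rp[of 0] by (auto simp: domain_D_def)
    show "frontier (\<Omega> \<tau>) = range (\<lambda>t. - (of_real (R 0) * \<Gamma> 0 t))" using boundary_curve.fr[OF bc[OF t]] eq[OF t] by simp
  qed
  then show ?thesis unfolding \<epsilon>_def by blast
qed

theorem theorem3p3:
  shows "\<exists>\<delta>>0. \<forall>(\<Omega> :: real \<Rightarrow> complex set) (\<gamma> :: real \<Rightarrow> real \<Rightarrow> complex).
           C1_family 8 \<Omega> \<gamma> \<and> normalized \<Omega> \<gamma> \<and> dyn_isospectral \<Omega>
           \<and> (\<forall>\<tau>\<in>{-1..1}. S_delta 8 \<delta> (\<Omega> \<tau>))
           \<longrightarrow> (\<forall>\<tau>\<in>{-1..1}. \<forall>\<xi>. deformation \<Omega> \<gamma> \<tau> \<xi> = 0)"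
proof (intro exI[of _ "1 / 10 ^ 22"] conjI allI impI ballI)
  fix \<Omega> :: "real \<Rightarrow> complex set" and \<gamma> :: "real \<Rightarrow> real \<Rightarrow> complex" and \<tau> \<xi> :: real
  assume *: "C1_family 8 \<Omega> \<gamma> \<and> normalized \<Omega> \<gamma> \<and> dyn_isospectral \<Omega> \<and> (\<forall>\<tau>\<in>{-1..1}. S_delta 8 (1 / 10 ^ 22) (\<Omega> \<tau>))"
    and \<tau>: "\<tau> \<in> {-1..1}"
  \<comment> \<open>With \<open>\<delta> = 1 / 10 ^ 22\<close> the value
    \<open>100 * \<delta>\<close> is the \<open>1 / 10 ^ 20\<close> required by
    \<open>equal_max_perims_imp_eq\<close>.\<close>
  have "\<exists>\<rho> \<rho>1 \<rho>2 \<rho>3 \<Gamma> s R. \<forall>\<tau>\<in>{-1..1}. boundary_curve \<rho> \<rho>1 \<rho>2 \<rho>3 \<Gamma> s (1 / 10 ^ 20) (\<Omega> \<tau>) R"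
    by (rule isospectral_family_frontier[of \<Omega> \<gamma> "1 / 10 ^ 22"]) (use * in auto)
  then obtain \<rho> \<rho>1 \<rho>2 \<rho>3 \<Gamma> s R where bc: "\<And>\<tau>. \<tau> \<in> {-1..1} \<Longrightarrow> boundary_curve \<rho> \<rho>1 \<rho>2 \<rho>3 \<Gamma> s (1 / 10 ^ 20) (\<Omega> \<tau>) R"
    by blast
  have fr: "frontier (\<Omega> t) = frontier (\<Omega> \<tau>)" if "t \<in> {-1..1}" for t
    using boundary_curve.fr[OF bc[OF that]] boundary_curve.fr[OF bc[OF \<tau>]] by simp
  have "boundary_param 9 (\<Omega> t) (\<gamma> t)" if "t \<in> {-1..1}" for t using * that by (auto simp: C1_family_def)
  then have "\<gamma> t \<xi> \<in> frontier (\<Omega> \<tau>)" if "t \<in> {-1..1}" for t using boundary_param_range fr that by metis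
  moreover have "((\<lambda>t. \<gamma> t \<xi>) has_vector_derivative dtau \<gamma> t \<xi>) (at t within {-1..1})" if "t \<in> {-1..1}" for t
    using * that by (auto simp: C1_family_def)
  ultimately show "deformation \<Omega> \<gamma> \<tau> \<xi> = 0"
    unfolding deformation_def using boundary_curve.constant_boundary_deformation[OF bc[OF \<tau>]] \<tau> by blast
qed simp

end
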